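(* Let $d\ge 1$, $p>2$ and $s\in(0,1)$ be such that $$q_c := -1+p(1-s) < 1 .$$ Let $\alpha_\varphi\in(0,1]$ and let the obstacle $\varphi: Q_1\to\mathbb{R}$ satisfy $\varphi\in C^{0,1}_x(Q_1)\cap C^{0,\alpha_\varphi}_t(Q_1)$. Let $u$ be a viscosity solution of $$\min\{u-\varphi,\ \partial_t u+(-\Delta_p)^s u\}=0\quad\text{in } Q_1,$$ and assume that $u\in C_{\mathrm{loc}}(-1,0;L^{p-1}_{sp}(\mathbb{R}^d))$. Let $$\alpha=\min\left\{\left(\frac{1}{1-q_c}\right)^-,\ \alpha_\varphi\right\},$$ where $\left(\frac{1}{1-q_c}\right)^-$ denotes an arbitrary fixed number strictly smaller than $\frac{1}{1-q_c}$. Then there exists a constant $C>0$, depending only on $d$, $p$, $s$, $\alpha$, $[\varphi]_{C^{0,1}_x}$ and $[\varphi]_{C^{0,\alpha_\varphi}_t}$, such that $$|u(x,t)-u(y,\tau)|\le C\,\mathcal{M}\left(|x-y|+\mathcal{M}^{(p-2)\alpha}|t-\tau|^{\alpha}\right)$$ for all $(x,t),(y,\tau)\in Q_{1/2}$, where $$\mathcal{M}:=1+\|u\|_{L^\infty(Q_{3/4})}+\sup_{t\in(-(3/4)^2,0]}\|u(\cdot,t)\|_{L^{p-1}_{sp}(\mathbb{R}^d)} .$$ In particular, if $q_c>0$ and $\alpha_\varphi=1$, then $$|u(x,t)-u(y,\tau)|\le C\,\mathcal{M}\left(|x-y|+\mathcal{M}^{p-2}|t-\tau|\right)$$ for all $(x,t),(y,\tau)\in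 Q_{1/2}$.
   Context: Cylinders: $Q_r(x_0,t_0):=B_r(x_0)\times(t_0-r^2,t_0]$ with $B_r(x_0)\subset\mathbb{R}^d$ the open ball, and $Q_r:=Q_r(0,0)=B_r(0)\times(-r^2,0]$. Operator: for each fixed $t$, $(-\Delta_p)^s u(x,t):=\mathrm{P.V.}\int_{\mathbb{R}^d}\frac{|u(x,t)-u(y,t)|^{p-2}(u(x,t)-u(y,t))}{|x-y|^{d+sp}}\,dy$. Tail space: $L^{p-1}_{sp}(\mathbb{R}^d)$ is the set of $w\in L^{p-1}_{\mathrm{loc}}(\mathbb{R}^d)$ with $\|w\|_{L^{p-1}_{sp}(\mathbb{R}^d)}:=\left(\int_{\mathbb{R}^d}\frac{|w(x)|^{p-1}}{1+|x|^{d+sp}}\,dx\right)^{1/(p-1)}<\infty$. Obstacle regularity: $\varphi\in C^{0,1}_x(Q_1)$ means that $[\varphi]_{C^{0,1}_x}$, the supremum of $|\varphi(x,t)-\varphi(y,t)|/|x-y|$ over $(x,t),(y,t)\in Q_1$, $x\ne y$, is finite; $\varphi\in C^{0,\alpha_\varphi}_t(Q_1)$ means that $[\varphi]_{C^{0,\alpha_\varphi}_t}$, the supremum of $|\varphi(x,t)-\varphi(x,\tau)|/|t-\tau|^{\alpha_\varphi}$ over $(x,t),(x,\tau)\in Q_1$, $t\neq\tau$, is finite. Viscosity solutions in $\Omega\times(t_1,t_2]$ (here $\Omega=B_1$, $(t_1,t_2]=(-1,0]$), with $\varphi$ continuous; functions $u$ are defined on $\mathbb{R}^d\times(t_1,t_2]$.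 $C^2(Q_r(x_0,t_0))$ denotes functions that are $C^2$ in space and $C^1$ in time. $u$ is a viscosity subsolution if $u\in \mathrm{USC}(\Omega\times(t_1,t_2])\cap C_{\mathrm{loc}}(t_1,t_2;L^{p-1}_{sp}(\mathbb{R}^d))$ and, whenever $\phi\in C^2(Q_r(x_0,t_0))$ with $Q_r(x_0,t_0)\subset\Omega\times(t_1,t_2]$ touches $u$ from above at $(x_0,t_0)$ in $Q_r(x_0,t_0)$ (i.e. $\phi\ge u$ in $Q_r(x_0,t_0)$ with equality at $(x_0,t_0)$), one has $$\min\{u(x_0,t_0)-\varphi(x_0,t_0),\ \partial_t\phi(x_0,t_0)+(-\Delta_p)^s\phi_r(x_0,t_0)\}\le 0,$$ where $\phi_r=\phi$ in $Q_r(x_0,t_0)$ and $\phi_r=u$ otherwise. A viscosity supersolution is defined similarly (LSC instead of USC, $\phi$ touching $u$ from below, and $\ge 0$ instead of $\le 0$). A viscosity solution is both a viscosity subsolution and a viscosity supersolution. *)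

theory Defs
  imports "HOL-Analysis.Analysis" "HOL-Probability.Essential_Supremum"
begin

text \<open>Space is \<open>real ^ 'd\<close>, so the dimension is \<open>CARD('d)\<close>. Functions of space and time are total
  functions on \<open>(real ^ 'd) \<times> real\<close>; only their values on the sets named below matter.\<close>

definition parab_cyl :: "real \<Rightarrow> real ^ 'd \<Rightarrow> real \<Rightarrow> ((real ^ 'd) \<times> real) set" where
  "parab_cyl r x0 t0 = ball x0 r \<times> {t0 - r\<^sup>2 <.. t0}"

definition q_crit :: "real \<Rightarrow> real \<Rightarrow> real" where
  "q_crit p s = - 1 + p * (1 - s)"


subsection \<open>The operator\<close>

text \<open>The integral with values in the extended reals. The Bochner integral is not used here because
  it returns 0 for functions that are not integrable, whereas a test function may blow up at the
  lateral boundary of its cylinder, making the integral below equal to plus or minus infinity.\<close>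

definition ext_integral :: "'a measure \<Rightarrow> ('a \<Rightarrow> real) \<Rightarrow> ereal" where
  "ext_integral M f =
     enn2ereal (\<integral>\<^sup>+ x. ennreal (f x) \<partial>M) - enn2ereal (\<integral>\<^sup>+ x. ennreal (- f x) \<partial>M)"

definition frac_p_laplacian :: "real \<Rightarrow> real \<Rightarrow> (real ^ 'd \<Rightarrow> real) \<Rightarrow> real ^ 'd \<Rightarrow> ereal" where
  "frac_p_laplacian p s w x =
     Lim (at_right 0) (\<lambda>\<epsilon>. ext_integral (lebesgue_on (- ball x \<epsilon>))
       (\<lambda>y. \<bar>w x - w y\<bar> powr (p - 2) * (w x - w y) / norm (x - y) powr (real CARD('d) + s * p)))"


subsection \<open>The tail space\<close>

definition tail_space :: "real \<Rightarrow> real \<Rightarrow> (real ^ 'd \<Rightarrow> real) set" where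
  "tail_space p s =
     {w. w \<in> borel_measurable lebesgue \<and>
         (\<forall>K. compact K \<longrightarrow> integrable (lebesgue_on K) (\<lambda>x. \<bar>w x\<bar> powr (p - 1))) \<and>
         integrable lebesgue
           (\<lambda>x. \<bar>w x\<bar> powr (p - 1) / (1 + norm x powr (real CARD('d) + s * p)))}"

definition tail_norm :: "real \<Rightarrow> real \<Rightarrow> (real ^ 'd \<Rightarrow> real) \<Rightarrow> real" where
  "tail_norm p s w =
     (LINT x|lebesgue. \<bar>w x\<bar> powr (p - 1) / (1 + norm x powr (real CARD('d) + s * p)))
       powr (1 / (p - 1))"

text \<open>Membership in \<open>C\<^sub>l\<^sub>o\<^sub>c(t1, t2; L)\<close> for \<open>L\<close> the tail space. As usual for the half-open cylinders
  \<open>\<Omega> \<times> (t1, t2]\<close>, ``loc'' refers to the compact subintervals of \<open>(t1, t2]\<close>; in particular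
  \<open>u(\<cdot>, t2)\<close> is in \<open>L\<close>, so that the operator makes sense at the final time.\<close>

definition tail_continuous ::
  "real \<Rightarrow> real \<Rightarrow> real \<Rightarrow> real \<Rightarrow> ((real ^ 'd) \<times> real \<Rightarrow> real) \<Rightarrow> bool" where
  "tail_continuous p s t1 t2 u \<longleftrightarrow>
     (\<forall>t\<in>{t1<..t2}. (\<lambda>x. u (x, t)) \<in> tail_space p s) \<and>
     (\<forall>t\<in>{t1<..t2}. ((\<lambda>\<tau>. tail_norm p s (\<lambda>x. u (x, \<tau>) - u (x, t))) \<longlongrightarrow> 0) (at t within {t1<..t2}))"


subsection \<open>Viscosity solutions of the obstacle problem\<close>

definition usc_on :: "'a::topological_space set \<Rightarrow> ('a \<Rightarrow> real) \<Rightarrow> bool" where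
  "usc_on S u \<longleftrightarrow> (\<forall>z\<in>S. \<forall>c>u z. \<forall>\<^sub>F w in at z within S. u w < c)"

definition lsc_on :: "'a::topological_space set \<Rightarrow> ('a \<Rightarrow> real) \<Rightarrow> bool" where
  "lsc_on S u \<longleftrightarrow> (\<forall>z\<in>S. \<forall>c<u z. \<forall>\<^sub>F w in at z within S. c < u w)"

text \<open>\<open>C\<^sup>2\<close> in space and \<open>C\<^sup>1\<close> in time, with derivatives \<open>G\<close> (spatial gradient), \<open>H\<close> (spatial Hessian)
  and \<open>T\<close> (time derivative) jointly continuous. Spatial slices of \<open>Q\<close> are meant to be open; the
  time derivative is relative to \<open>Q\<close>, hence one-sided at the top of a cylinder.\<close>

definition C2_on :: "((real ^ 'd) \<times> real) set \<Rightarrow> ((real ^ 'd) \<times> real \<Rightarrow> real) \<Rightarrow> bool" where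
  "C2_on Q f \<longleftrightarrow>
     (\<exists>(G :: (real ^ 'd) \<times> real \<Rightarrow> real ^ 'd) (H :: (real ^ 'd) \<times> real \<Rightarrow> real ^ 'd ^ 'd)
        (T :: (real ^ 'd) \<times> real \<Rightarrow> real).
        continuous_on Q G \<and> continuous_on Q H \<and> continuous_on Q T \<and>
        (\<forall>(x, t)\<in>Q.
           ((\<lambda>y. f (y, t)) has_derivative (\<lambda>h. G (x, t) \<bullet> h)) (at x) \<and>
           ((\<lambda>y. G (y, t)) has_derivative (\<lambda>h. H (x, t) *v h)) (at x) \<and>
           ((\<lambda>\<tau>. f (x, \<tau>)) has_real_derivative T (x, t)) (at t within {\<tau>. (x, \<tau>) \<in> Q})))"

text \<open>The value at \<open>(x0, t0)\<close> of \<open>\<partial>\<^sub>t \<phi> + (-\<Delta>\<^sub>p)\<^sup>s \<phi>\<^sub>r\<close>, where \<open>\<phi>\<^sub>r\<close> is \<open>\<phi>\<close> in the cylinder and \<open>u\<close>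
  elsewhere. The time derivative is taken within the cylinder, i.e. from the left.\<close>

definition visc_operator ::
  "real \<Rightarrow> real \<Rightarrow> ((real ^ 'd) \<times> real \<Rightarrow> real) \<Rightarrow> ((real ^ 'd) \<times> real \<Rightarrow> real) \<Rightarrow>
   real \<Rightarrow> real ^ 'd \<Rightarrow> real \<Rightarrow> ereal" where
  "visc_operator p s u \<phi> r x0 t0 =
     ereal (vector_derivative (\<lambda>\<tau>. \<phi> (x0, \<tau>)) (at t0 within {t0 - r\<^sup>2 <.. t0})) +
     frac_p_laplacian p s
       (\<lambda>y. if (y, t0) \<in> parab_cyl r x0 t0 then \<phi> (y, t0) else u (y, t0)) x0"

definition visc_subsolution ::
  "real \<Rightarrow> real \<Rightarrow> ((real ^ 'd) \<times> real \<Rightarrow> real) \<Rightarrow> (real ^ 'd) set \<Rightarrow> real \<Rightarrow> real \<Rightarrow>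
   ((real ^ 'd) \<times> real \<Rightarrow> real) \<Rightarrow> bool" where
  "visc_subsolution p s obst \<Omega> t1 t2 u \<longleftrightarrow>
     usc_on (\<Omega> \<times> {t1<..t2}) u \<and> tail_continuous p s t1 t2 u \<and>
     (\<forall>x0 t0 r \<phi>.
        r > 0 \<and> parab_cyl r x0 t0 \<subseteq> \<Omega> \<times> {t1<..t2} \<and> C2_on (parab_cyl r x0 t0) \<phi> \<and>
        (\<forall>z\<in>parab_cyl r x0 t0. \<phi> z \<ge> u z) \<and> \<phi> (x0, t0) = u (x0, t0)
        \<longrightarrow> min (ereal (u (x0, t0) - obst (x0, t0))) (visc_operator p s u \<phi> r x0 t0) \<le> 0)"

definition visc_supersolution ::
  "real \<Rightarrow> real \<Rightarrow> ((real ^ 'd) \<times> real \<Rightarrow> real) \<Rightarrow> (real ^ 'd) set \<Rightarrow> real \<Rightarrow> real \<Rightarrow>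
   ((real ^ 'd) \<times> real \<Rightarrow> real) \<Rightarrow> bool" where
  "visc_supersolution p s obst \<Omega> t1 t2 u \<longleftrightarrow>
     lsc_on (\<Omega> \<times> {t1<..t2}) u \<and> tail_continuous p s t1 t2 u \<and>
     (\<forall>x0 t0 r \<phi>.
        r > 0 \<and> parab_cyl r x0 t0 \<subseteq> \<Omega> \<times> {t1<..t2} \<and> C2_on (parab_cyl r x0 t0) \<phi> \<and>
        (\<forall>z\<in>parab_cyl r x0 t0. \<phi> z \<le> u z) \<and> \<phi> (x0, t0) = u (x0, t0)
        \<longrightarrow> min (ereal (u (x0, t0) - obst (x0, t0))) (visc_operator p s u \<phi> r x0 t0) \<ge> 0)"

definition visc_solution ::
  "real \<Rightarrow> real \<Rightarrow> ((real ^ 'd) \<times> real \<Rightarrow> real) \<Rightarrow> (real ^ 'd) set \<Rightarrow> real \<Rightarrow> real \<Rightarrow>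
   ((real ^ 'd) \<times> real \<Rightarrow> real) \<Rightarrow> bool" where
  "visc_solution p s obst \<Omega> t1 t2 u \<longleftrightarrow>
     visc_subsolution p s obst \<Omega> t1 t2 u \<and> visc_supersolution p s obst \<Omega> t1 t2 u"


subsection \<open>Regularity of the obstacle\<close>

definition lip_x_quotients ::
  "((real ^ 'd) \<times> real) set \<Rightarrow> ((real ^ 'd) \<times> real \<Rightarrow> real) \<Rightarrow> real set" where
  "lip_x_quotients Q f =
     {\<bar>f (x, t) - f (y, t)\<bar> / norm (x - y) | x y t. (x, t) \<in> Q \<and> (y, t) \<in> Q \<and> x \<noteq> y}"

definition holder_t_quotients ::
  "real \<Rightarrow> ((real ^ 'd) \<times> real) set \<Rightarrow> ((real ^ 'd) \<times> real \<Rightarrow> real) \<Rightarrow> real set" where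
  "holder_t_quotients a Q f =
     {\<bar>f (x, t) - f (x, \<tau>)\<bar> / \<bar>t - \<tau>\<bar> powr a | x t \<tau>. (x, t) \<in> Q \<and> (x, \<tau>) \<in> Q \<and> t \<noteq> \<tau>}"

definition C_lip_x :: "((real ^ 'd) \<times> real) set \<Rightarrow> ((real ^ 'd) \<times> real \<Rightarrow> real) set" where
  "C_lip_x Q = {f. bdd_above (lip_x_quotients Q f)}"

definition lip_x_seminorm ::
  "((real ^ 'd) \<times> real) set \<Rightarrow> ((real ^ 'd) \<times> real \<Rightarrow> real) \<Rightarrow> real" where
  "lip_x_seminorm Q f = Sup (lip_x_quotients Q f)"

definition C_holder_t :: "real \<Rightarrow> ((real ^ 'd) \<times> real) set \<Rightarrow> ((real ^ 'd) \<times> real \<Rightarrow> real) set" where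
  "C_holder_t a Q = {f. bdd_above (holder_t_quotients a Q f)}"

definition holder_t_seminorm ::
  "real \<Rightarrow> ((real ^ 'd) \<times> real) set \<Rightarrow> ((real ^ 'd) \<times> real \<Rightarrow> real) \<Rightarrow> real" where
  "holder_t_seminorm a Q f = Sup (holder_t_quotients a Q f)"


subsection \<open>The size of the solution\<close>

definition Linf_norm :: "'a::euclidean_space set \<Rightarrow> ('a \<Rightarrow> real) \<Rightarrow> real" where
  "Linf_norm S f = real_of_ereal (esssup (lebesgue_on S) (\<lambda>z. ereal \<bar>f z\<bar>))"

text \<open>For a viscosity solution in the unit cylinder both terms are finite: \<open>u\<close> is continuous there
  and \<open>t \<mapsto> u(\<cdot>, t)\<close> is continuous into the tail space on the compact interval \<open>[-(3/4)\<^sup>2, 0]\<close>.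
  So the conversion to real numbers and the supremum of reals lose nothing.\<close>

definition sol_size :: "real \<Rightarrow> real \<Rightarrow> ((real ^ 'd) \<times> real \<Rightarrow> real) \<Rightarrow> real" where
  "sol_size p s u =
     1 + Linf_norm (parab_cyl (3/4) 0 0) u +
     (SUP t\<in>{- (3/4)\<^sup>2 <.. 0}. tail_norm p s (\<lambda>x. u (x, t)))"

end

theory Submission
  imports Defs
begin

text \<open>After division by \<open>M = sol_size p s u\<close> the equation becomes \<open>\<kappa> \<partial>\<^sub>t v + (-\<Delta>\<^sub>p)\<^sup>s v = 0\<close>
  with \<open>\<kappa> = M powr (2 - p) \<le> 1\<close>, and all the estimates are uniform in \<open>\<kappa>\<close>.
  Spatial regularity is obtained by the Ishii--Lions method: double the variables, penalise with
  \<open>L \<omega>(|x - y|)\<close> for a strictly concave modulus \<open>\<omega>\<close>, and compare the two viscosity inequalities at a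
  maximum \<open>(x\<^sub>0, y\<^sub>0)\<close>. With \<open>r = |x\<^sub>0 - y\<^sub>0|\<close>, concavity makes the difference of the nonlocal terms at
  least \<open>c L\<^sup>p\<^sup>-\<^sup>1 r\<^sup>G\<close> on a ball of jumps almost parallel to \<open>x\<^sub>0 - y\<^sub>0\<close>, while every error term is
  \<open>O(r\<^sup>G)\<close> once \<open>u\<close> is known to be Hoelder continuous with a slightly smaller exponent. The hypothesis
  \<open>q_crit p s < 1\<close>, i.e. \<open>p - 2 < s p\<close>, allows this bootstrap to gain a fixed amount per step
  and to reach exponent 1. At a contact point the obstacle controls \<open>u(x\<^sub>0) - u(y\<^sub>0)\<close> directly.
  Time regularity then follows from the barriers \<open>A (r + |x - y|\<^sup>2 / r) + K (t - \<tau>)\<close> with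
  \<open>K\<close> of order \<open>r powr (1 - 1/\<alpha>) / \<kappa>\<close> and \<open>r\<close> of order \<open>((t - \<tau>) / \<kappa>) powr \<alpha>\<close>.\<close>

subsection \<open>Signed powers and radial integrals\<close>

text \<open>Why \<open>p - 2 < q\<close>, with \<open>q = s * p\<close>, is the threshold: at
  distance r the concavity gain has order \<open>r powr (\<theta>' * (p - 1) - q)\<close>, up to a
  small power, while the localisation in time and the tails leave errors of order
  \<open>r powr \<theta>\<close>, again up to a small power. With \<open>\<theta>'\<close> close to
  \<open>\<theta>\<close> the gain wins if \<open>\<theta> * (p - 2) < q\<close>, and
  \<open>\<theta> = 1\<close> is the worst case. Errors from jumps of length about r scale exactly
  like the gain when \<open>\<theta>' = \<theta>\<close>; a small power is won by interpolating
  between two bounds for the difference of the increments, one from the spatial penalty and one from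
  the Hoelder estimate already known. A second difficulty is the principal value. All test functions
  are isotropic quadratics in space; for these the part near the touching point is bounded in terms
  of the gradient, the Hessian and the radius of touching at the fixed time. Hence the two
  inequalities can be compared with the solution itself in all jumps longer than
  \<open>\<delta> = r powr (1 + \<mu>)\<close>.\<close>

definition spow :: "real \<Rightarrow> real \<Rightarrow> real" where
  "spow p a = \<bar>a\<bar> powr (p - 2) * a"

lemma spow_minus [simp]: "spow p (- a) = - spow p a"
  by (simp add: spow_def)

lemma spow_0 [simp]: "spow p 0 = 0"
  by (simp add: spow_def)

lemma spow_nonneg_eq: "0 \<le> a \<Longrightarrow> spow p a = a powr (p - 1)"
  using powr_mult_base[of a "p - 2"] by (simp add: spow_def mult.commute)

lemma abs_spow: "\<bar>spow p a\<bar> = \<bar>a\<bar> powr (p - 1)"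
  using powr_mult_base[of "\<bar>a\<bar>" "p - 2"] by (simp add: spow_def abs_mult mult.commute)

lemma spow_mult: "0 < c \<Longrightarrow> spow p (c * a) = c powr (p - 1) * spow p a"
  using powr_mult_base[of c "p - 2"] by (simp add: spow_def abs_mult powr_mult mult_ac)

lemma spow_mono:
  assumes "2 < p" "a \<le> b"
  shows "spow p a \<le> spow p b"
proof -
  have pos: "spow p x \<le> spow p y" if "0 \<le> x" "x \<le> y" for x y
    using that assms(1) by (simp add: spow_nonneg_eq powr_mono2)
  have sgn: "0 \<le> spow p x" if "0 \<le> x" for x using that by (simp add: spow_def)
  show ?thesis
  proof (cases "0 \<le> a")
    case True
    then show ?thesis using pos assms(2) by simp
  next
    case False
    then show ?thesis
      using pos[of "- b" "- a"] sgn[of b] sgn[of "- a"] assms(2) by (cases "0 \<le> b") auto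
  qed
qed

lemma borel_measurable_spow [measurable]: "spow p \<in> borel_measurable borel"
  unfolding spow_def[abs_def] by measurable

lemma powr_diff_le:
  assumes p: "2 < p" and "0 \<le> b" "b \<le> (a::real)"
  shows "a powr (p - 1) - b powr (p - 1) \<le> (p - 1) * (a - b) * a powr (p - 2)"
proof (cases "b = 0 \<or> a = b")
  case True
  then show ?thesis
  proof
    assume "b = 0"
    have "1 * a powr (p - 1) \<le> (p - 1) * a powr (p - 1)" using p by (intro mult_right_mono) auto
    then show ?thesis using \<open>b = 0\<close> assms powr_mult_base[of a "p - 2"] p by (simp add: mult.assoc)
  qed simp
next
  case False
  then have "0 < b" "b < a" using assms by auto
  have "\<exists>z>b. z < a \<and> a powr (p - 1) - b powr (p - 1) = (a - b) * ((p - 1) * z powr (p - 1 - 1))"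
  proof (intro MVT2)
    fix x assume "b \<le> x"
    then have "((\<lambda>a. a powr (p - 1)) has_real_derivative (p - 1) * x powr (p - 1 - 1)) (at x)"
      using \<open>0 < b\<close> by (intro has_real_derivative_powr) auto
    then show "((\<lambda>a. a powr (p - 1)) has_real_derivative (p - 1) * x powr (p - 1 - 1)) (at x)" .
  qed (rule \<open>b < a\<close>)
  then obtain z where z: "b < z" "z < a"
    "a powr (p - 1) - b powr (p - 1) = (a - b) * ((p - 1) * z powr (p - 2))" by (auto simp: algebra_simps)
  have "z powr (p - 2) \<le> a powr (p - 2)" using z \<open>0 < b\<close> p by (intro powr_mono2) auto
  then have "(a - b) * ((p - 1) * z powr (p - 2)) \<le> (a - b) * ((p - 1) * a powr (p - 2))"
    using \<open>b < a\<close> p by (intro mult_left_mono) auto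
  then show ?thesis using z by (simp add: mult_ac)
qed

lemma spow_diff_le:
  assumes p: "2 < p"
  shows "\<bar>spow p a - spow p b\<bar> \<le> (p - 1) * \<bar>a - b\<bar> * (\<bar>a\<bar> + \<bar>b\<bar>) powr (p - 2)"
proof -
  have pos: "spow p x - spow p y \<le> (p - 1) * (x - y) * (\<bar>x\<bar> + \<bar>y\<bar>) powr (p - 2)"
    if "0 \<le> y" "y \<le> x" for x y
  proof -
    have "x powr (p - 1) - y powr (p - 1) \<le> (p - 1) * (x - y) * x powr (p - 2)"
      by (rule powr_diff_le) (use p that in auto)
    also have "\<dots> \<le> (p - 1) * (x - y) * (\<bar>x\<bar> + \<bar>y\<bar>) powr (p - 2)"
      using p that by (intro mult_left_mono powr_mono2) auto
    finally show ?thesis using that by (simp add: spow_nonneg_eq)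
  qed
  have main: "spow p x - spow p y \<le> (p - 1) * (x - y) * (\<bar>x\<bar> + \<bar>y\<bar>) powr (p - 2)"
    if "y \<le> x" for x y
  proof -
    consider "0 \<le> y" | "x \<le> 0" | "y < 0" "0 < x" by linarith
    then show ?thesis
    proof cases
      case 1 then show ?thesis using pos that by blast
    next
      case 2 then show ?thesis using pos[of "- x" "- y"] that by (simp add: add.commute)
    next
      case 3
      have "spow p x - spow p y = \<bar>x\<bar> powr (p - 2) * \<bar>x\<bar> + \<bar>y\<bar> powr (p - 2) * \<bar>y\<bar>"
        using 3 by (simp add: spow_def)
      also have "\<dots> \<le> (\<bar>x\<bar> + \<bar>y\<bar>) powr (p - 2) * \<bar>x\<bar> + (\<bar>x\<bar> + \<bar>y\<bar>) powr (p - 2) * \<bar>y\<bar>"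
        using p by (intro add_mono mult_right_mono powr_mono2) auto
      also have "\<dots> = 1 * ((x - y) * (\<bar>x\<bar> + \<bar>y\<bar>) powr (p - 2))" using 3 by (simp add: algebra_simps)
      also have "\<dots> \<le> (p - 1) * ((x - y) * (\<bar>x\<bar> + \<bar>y\<bar>) powr (p - 2))"
        using p that by (intro mult_right_mono) auto
      finally show ?thesis by (simp add: mult_ac)
    qed
  qed
  show ?thesis
    using main[of a b] main[of b a] spow_mono[OF p, of a b] spow_mono[OF p, of b a]
    by (cases "a \<le> b") (auto simp: add.commute)
qed

text \<open>For \<open>F \<le> E \<le> 0\<close> the factor
  \<open>\<bar>F\<bar> powr (p - 2)\<close> may be replaced by the smaller
  \<open>\<bar>E\<bar> powr (p - 2)\<close>. This overcomes the degeneracy of \<open>spow\<close> at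
  0: a large negative \<open>E\<close> turns a small difference \<open>E - F\<close> into a definite
  gain.\<close>

lemma spow_diff_ge:
  assumes p: "2 < p" and "E \<le> 0" "F \<le> E"
  shows "\<bar>E\<bar> powr (p - 2) * (E - F) \<le> spow p E - spow p F"
proof -
  have "\<bar>E\<bar> powr (p - 2) * (- F) \<le> \<bar>F\<bar> powr (p - 2) * (- F)"
    using assms by (intro mult_right_mono powr_mono2) auto
  then show ?thesis by (simp add: spow_def algebra_simps)
qed

text \<open>Compare \<open>x\<close> with \<open>l * y\<close>: each case is covered by one of the
  two terms. The weight \<open>l\<close> stays free; in \<open>far_diff\<close> it is
  \<open>r powr \<theta>\<close>.\<close>

lemma powr_young:
  assumes p: "2 < p" and "0 \<le> x" "0 \<le> y" "0 < (l::real)"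
  shows "x * y powr (p - 2) \<le> l * y powr (p - 1) + l powr (- (p - 2)) * x powr (p - 1)"
proof (cases "x \<le> l * y")
  case True
  then have "x * y powr (p - 2) \<le> l * y * y powr (p - 2)" by (intro mult_right_mono) auto
  also have "\<dots> = l * y powr (p - 1)" using powr_mult_base[of y "p - 2"] assms by simp
  finally show ?thesis by (smt (verit) mult_nonneg_nonneg powr_ge_zero)
next
  case False
  then have "y \<le> x / l" using assms by (simp add: field_simps)
  then have "x * y powr (p - 2) \<le> x * (x / l) powr (p - 2)"
    using assms by (intro mult_left_mono powr_mono2) auto
  also have "\<dots> = l powr (- (p - 2)) * x powr (p - 1)"
  proof -
    have "l powr (- (p - 2)) = 1 / l powr (p - 2)" by (rule powr_minus_divide)
    moreover have "(x / l) powr (p - 2) = x powr (p - 2) / l powr (p - 2)" using assms by (simp add: powr_divide)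
    moreover have "x powr (p - 1) = x * x powr (p - 2)" using powr_mult_base[of x "p - 2"] assms by simp
    ultimately show ?thesis by simp
  qed
  finally show ?thesis using assms by (smt (verit) mult_nonneg_nonneg powr_ge_zero)
qed

lemma powr_add_le:
  assumes "0 \<le> a" "0 \<le> b" "0 \<le> (e::real)"
  shows "(a + b) powr e \<le> 2 powr e * (a powr e + b powr e)"
proof -
  have "(a + b) powr e \<le> (2 * max a b) powr e" using assms by (intro powr_mono2) auto
  also have "\<dots> = 2 powr e * max a b powr e" using assms by (simp add: powr_mult)
  also have "\<dots> \<le> 2 powr e * (a powr e + b powr e)"
    by (intro mult_left_mono) (auto simp: max_def)
  finally show ?thesis .
qed

section \<open>Radial integrals by means of dyadic balls\<close>

lemma powr_of_power: "0 < x \<Longrightarrow> (x ^ k) powr q = (x powr q) ^ k" for x q :: real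
  by (induction k) (auto simp: powr_mult)

text \<open>Stands in for polar coordinates: the integrand is dominated by a superposition of
  multiples of indicators of balls, whose volumes are known. Domination is asked only where
  \<open>0 < f h\<close>, since \<open>ennreal\<close> sends all other values to 0.\<close>

lemma nn_integral_dyadic_le:
  fixes f :: "real ^ 'd \<Rightarrow> real"
  assumes "\<And>k. 0 \<le> c k" "\<And>k. 0 < \<rho> k" "(\<lambda>k. c k * \<rho> k ^ CARD('d)) sums S"
    and "\<And>h. 0 < f h \<Longrightarrow> \<exists>k. norm h < \<rho> k \<and> f h \<le> c k"
  shows "(\<integral>\<^sup>+h. ennreal (f h) \<partial>lebesgue) \<le> ennreal (unit_ball_vol (real CARD('d)) * S)"
proof -
  have "(\<integral>\<^sup>+h. ennreal (f h) \<partial>lebesgue) \<le>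
        (\<integral>\<^sup>+h. (\<Sum>k. ennreal (c k) * indicator (ball 0 (\<rho> k)) h) \<partial>(lebesgue :: (real ^ 'd) measure))"
  proof (rule nn_integral_mono)
    fix h :: "real ^ 'd"
    show "ennreal (f h) \<le> (\<Sum>k. ennreal (c k) * indicator (ball 0 (\<rho> k)) h)"
    proof (cases "0 < f h")
      case True
    obtain k where k: "norm h < \<rho> k" "f h \<le> c k" using assms(4)[OF True] by blast
    have "ennreal (f h) \<le> sum (\<lambda>k. ennreal (c k) * indicator (ball 0 (\<rho> k)) h) {k}"
      using k by (simp add: indicator_def ennreal_leI)
    also have "\<dots> \<le> (\<Sum>k. ennreal (c k) * indicator (ball 0 (\<rho> k)) h)"
      by (rule sum_le_suminf) auto
    finally show ?thesis .
    qed (simp add: ennreal_neg)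
  qed
  also have "\<dots> = (\<Sum>k. ennreal (c k) * emeasure lebesgue (ball (0 :: real ^ 'd) (\<rho> k)))"
  proof -
    have "(\<lambda>h. ennreal (c k) * indicator (ball (0 :: real ^ 'd) (\<rho> k)) h) \<in> borel_measurable lebesgue" for k
      by (intro borel_measurable_times_ennreal borel_measurable_const borel_measurable_indicator) simp
    then have "(\<integral>\<^sup>+h. (\<Sum>k. ennreal (c k) * indicator (ball (0 :: real ^ 'd) (\<rho> k)) h) \<partial>lebesgue) =
      (\<Sum>k. \<integral>\<^sup>+h. ennreal (c k) * indicator (ball (0 :: real ^ 'd) (\<rho> k)) h \<partial>lebesgue)"
      by (rule nn_integral_suminf)
    also have "\<dots> = (\<Sum>k. ennreal (c k) * emeasure lebesgue (ball (0 :: real ^ 'd) (\<rho> k)))"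
      by (intro suminf_cong nn_integral_cmult_indicator) simp
    finally show ?thesis .
  qed
  also have "\<dots> = (\<Sum>k. ennreal (unit_ball_vol (real CARD('d)) * (c k * \<rho> k ^ CARD('d))))"
  proof (intro suminf_cong)
    fix k
    have "emeasure lebesgue (ball (0 :: real ^ 'd) (\<rho> k)) = ennreal (unit_ball_vol (real CARD('d)) * \<rho> k ^ CARD('d))"
      using emeasure_ball[of "\<rho> k" "0 :: real ^ 'd"] assms(2)[of k] by simp
    then show "ennreal (c k) * emeasure lebesgue (ball (0 :: real ^ 'd) (\<rho> k)) =
      ennreal (unit_ball_vol (real CARD('d)) * (c k * \<rho> k ^ CARD('d)))"
      using assms(1)[of k] by (simp add: ennreal_mult'[symmetric] mult.left_commute)
  qed
  also have "\<dots> = ennreal (unit_ball_vol (real CARD('d)) * S)"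
  proof -
    have "(\<lambda>k. unit_ball_vol (real CARD('d)) * (c k * \<rho> k ^ CARD('d))) sums (unit_ball_vol (real CARD('d)) * S)"
      using assms(3) by (rule sums_mult)
    then show ?thesis
      using assms(1,2) by (intro suminf_ennreal_eq) (auto simp: less_imp_le)
  qed
  finally show ?thesis .
qed

lemma integrable_nonneg_bound:
  assumes "f \<in> borel_measurable M" "\<And>x. 0 \<le> f x" "(\<integral>\<^sup>+x. ennreal (f x) \<partial>M) \<le> ennreal C" "0 \<le> C"
  shows "integrable M f" "integral\<^sup>L M f \<le> C"
proof -
  have "(\<integral>\<^sup>+x. ennreal (norm (f x)) \<partial>M) < \<infinity>"
    using assms(2) le_less_trans[OF assms(3) ennreal_less_top] by simp
  then show i: "integrable M f"
    by (intro integrableI_bounded assms(1))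
  show "integral\<^sup>L M f \<le> C"
  proof -
    have "ennreal (integral\<^sup>L M f) \<le> ennreal C"
      using assms(3) nn_integral_eq_integral[OF i] assms(2) by simp
    then show ?thesis using assms(4) by (simp only: ennreal_le_iff)
  qed
qed

lemma lebesgue_borelI: "f \<in> borel_measurable borel \<Longrightarrow> f \<in> borel_measurable lebesgue"
  by (rule measurable_completion) simp

text \<open>Balls of radius \<open>\<delta> * (1/2) ^ k\<close> turn the integral into a geometric
  series with ratio \<open>(1/2) powr q\<close>. The radius \<open>\<delta>\<close> factors out by
  scaling, so \<open>K\<close> does not depend on it.\<close>

lemma radial_integral:
  assumes "0 < q"
  shows "\<exists>K>0. \<forall>\<delta>>0. integrable lebesgue (\<lambda>h :: real ^ 'd. indicator (ball 0 \<delta>) h * norm h powr (q - real CARD('d)))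
     \<and> (LINT h|lebesgue. indicator (ball 0 \<delta>) (h :: real ^ 'd) * norm h powr (q - real CARD('d))) \<le> K * \<delta> powr q"
proof -
  let ?d = "real CARD('d)"
  let ?V = "unit_ball_vol ?d"
  let ?x = "(1/2) powr q"
  have x: "0 < ?x" "?x < 1" using assms powr_less_mono2[of q "1/2" 1] by auto
  let ?K = "?V * (2 powr ?d * (1 / (1 - ?x)))"
  have "?K > 0" using x by (intro mult_pos_pos) auto
  moreover
  { fix \<delta> :: real assume \<delta>: "0 < \<delta>"
    let ?f = "\<lambda>h :: real ^ 'd. indicator (ball 0 \<delta>) h * norm h powr (q - ?d)"
    let ?\<rho> = "\<lambda>k. \<delta> * (1/2) ^ k"
    \<comment> \<open>The factor \<open>2 powr ?d\<close> pays for the case \<open>q < ?d\<close>,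
      in which the power is largest at the inner radius of the shell, half of
      \<open>?\<rho> k\<close>.\<close>
    let ?c = "\<lambda>k. 2 powr ?d * ?\<rho> k powr (q - ?d)"
    have "(\<integral>\<^sup>+h. ennreal (?f h) \<partial>lebesgue) \<le> ennreal (?V * (2 powr ?d * \<delta> powr q * (1 / (1 - ?x))))"
    proof (rule nn_integral_dyadic_le)
      have "(\<lambda>k. 2 powr ?d * \<delta> powr q * ?x ^ k) sums (2 powr ?d * \<delta> powr q * (1 / (1 - ?x)))"
        using x by (intro sums_mult geometric_sums) auto
      moreover have "?c k * ?\<rho> k ^ CARD('d) = 2 powr ?d * \<delta> powr q * ?x ^ k" for k
      proof -
        have "?\<rho> k powr (q - ?d) * ?\<rho> k ^ CARD('d) = ?\<rho> k powr (q - ?d) * ?\<rho> k powr ?d"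
          using \<delta> by (subst powr_realpow) auto
        also have "\<dots> = ?\<rho> k powr q" by (simp add: powr_add[symmetric])
        also have "\<dots> = \<delta> powr q * ((1/2) ^ k) powr q" using \<delta> by (simp add: powr_mult)
        also have "((1/2) ^ k) powr q = ?x ^ k" by (rule powr_of_power) simp
        finally show ?thesis by (simp add: mult_ac)
      qed
      ultimately show "(\<lambda>k. ?c k * ?\<rho> k ^ CARD('d)) sums (2 powr ?d * \<delta> powr q * (1 / (1 - ?x)))"
        by (simp only:)
      fix h :: "real ^ 'd" assume h: "0 < ?f h"
      \<comment> \<open>Since \<open>0 powr a = 0\<close>, the origin does not satisfy
        \<open>0 < ?f h\<close>, even for a singular power.\<close>
      have "h \<noteq> 0" using h by (cases "h = 0") auto
      have "norm h < \<delta>" using h by (cases "norm h < \<delta>") auto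
      define k where "k = (LEAST k. ?\<rho> k \<le> norm h)"
      have ex: "\<exists>k. ?\<rho> k \<le> norm h"
      proof -
        obtain k where "\<delta> / norm h < 2 ^ k" using real_arch_pow[of 2 "\<delta> / norm h"] by auto
        then show ?thesis using \<open>h \<noteq> 0\<close> by (intro exI[of _ k]) (simp add: field_simps power_one_over)
      qed
      have k1: "?\<rho> k \<le> norm h" unfolding k_def by (rule LeastI_ex[OF ex])
      have "k \<noteq> 0" using k1 \<open>norm h < \<delta>\<close> by (intro notI) simp
      then obtain j where j: "k = Suc j" by (cases k) auto
      have k2: "norm h < ?\<rho> j" using not_less_Least[of j "\<lambda>k. ?\<rho> k \<le> norm h"] j unfolding k_def by auto
      have "norm h powr (q - ?d) \<le> ?c j"
      proof (cases "0 \<le> q - ?d")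
        case True
        then have "1 * norm h powr (q - ?d) \<le> 2 powr ?d * ?\<rho> j powr (q - ?d)"
          using k2 by (intro mult_mono powr_mono2) (auto intro: ge_one_powr_ge_zero)
        then show ?thesis by simp
      next
        case False
        have "norm h powr (q - ?d) \<le> (?\<rho> j / 2) powr (q - ?d)"
          using k1 j False \<delta> by (intro powr_mono2') auto
        also have "\<dots> = ?\<rho> j powr (q - ?d) / 2 powr (q - ?d)" by (rule powr_divide)
        also have "\<dots> = 2 powr (?d - q) * ?\<rho> j powr (q - ?d)"
        proof -
          have "2 powr (?d - q) = inverse (2 powr (q - ?d))" using powr_minus[of 2 "q - ?d"] by (simp only: minus_diff_eq)
          then show ?thesis by (simp only: divide_inverse mult.commute)
        qed
        also have "\<dots> \<le> ?c j" using assms by (intro mult_right_mono powr_mono) auto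
        finally show ?thesis .
      qed
      then show "\<exists>k. norm h < ?\<rho> k \<and> ?f h \<le> ?c k"
        using k2 \<open>norm h < \<delta>\<close> by (intro exI[of _ j]) auto
    qed (use \<delta> in auto)
    moreover have "?f \<in> borel_measurable lebesgue"
      by (intro lebesgue_borelI borel_measurable_times borel_measurable_indicator powr_real_measurable) auto
    moreover have "0 \<le> ?f h" for h :: "real ^ 'd" by simp
    moreover have "0 \<le> ?V * (2 powr ?d * \<delta> powr q * (1 / (1 - ?x)))"
      using x by (intro mult_nonneg_nonneg) auto
    ultimately have "integrable lebesgue ?f \<and> (LINT h|lebesgue. ?f h) \<le> ?V * (2 powr ?d * \<delta> powr q * (1 / (1 - ?x)))"
      by (intro conjI integrable_nonneg_bound)
    moreover have "?V * (2 powr ?d * \<delta> powr q * (1 / (1 - ?x))) = ?K * \<delta> powr q" by (simp only: mult_ac)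
    ultimately have "integrable lebesgue ?f \<and> (LINT h|lebesgue. ?f h) \<le> ?K * \<delta> powr q" by simp }
  ultimately show ?thesis by blast
qed

text \<open>The same scheme with growing balls of radius \<open>2 ^ k\<close>: the weight is at most
  1 in the unit ball, and outside its decay beats the volume of the balls by a geometric factor with
  ratio \<open>(1/2) powr q\<close>.\<close>

lemma weight_integrable:
  assumes "0 < q"
  shows "integrable lebesgue (\<lambda>z :: real ^ 'd. 1 / (1 + norm z powr (real CARD('d) + q)))"
proof -
  let ?d = "real CARD('d)"
  let ?n = "?d + q"
  let ?V = "unit_ball_vol ?d"
  let ?x = "(1/2) powr q"
  have x: "0 < ?x" "?x < 1" using assms powr_less_mono2[of q "1/2" 1] by auto
  let ?f = "\<lambda>z :: real ^ 'd. 1 / (1 + norm z powr ?n)"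
  let ?\<rho> = "\<lambda>k. 2 ^ k :: real"
  let ?c = "\<lambda>k. 2 powr ?n * ?\<rho> k powr - ?n"
  have "(\<integral>\<^sup>+h. ennreal (?f h) \<partial>lebesgue) \<le> ennreal (?V * (2 powr ?n * (1 / (1 - ?x))))"
  proof (rule nn_integral_dyadic_le)
    have "(\<lambda>k. 2 powr ?n * ?x ^ k) sums (2 powr ?n * (1 / (1 - ?x)))"
      using x by (intro sums_mult geometric_sums) auto
    moreover have "?c k * ?\<rho> k ^ CARD('d) = 2 powr ?n * ?x ^ k" for k
    proof -
      have "?\<rho> k powr - ?n * ?\<rho> k ^ CARD('d) = ?\<rho> k powr - ?n * ?\<rho> k powr ?d"
        by (subst powr_realpow) auto
      also have "\<dots> = ?\<rho> k powr - q" by (simp add: powr_add[symmetric])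
      also have "\<dots> = (2 powr - q) ^ k" by (rule powr_of_power) simp
      also have "2 powr - q = ?x" by (simp add: powr_divide powr_minus_divide)
      finally show ?thesis by (simp add: mult_ac)
    qed
    ultimately show "(\<lambda>k. ?c k * ?\<rho> k ^ CARD('d)) sums (2 powr ?n * (1 / (1 - ?x)))"
      by (simp only:)
    fix h :: "real ^ 'd"
    have ex: "\<exists>k. norm h < ?\<rho> k" using real_arch_pow[of 2 "norm h"] by simp
    define k where "k = (LEAST k. norm h < ?\<rho> k)"
    have k1: "norm h < ?\<rho> k" unfolding k_def by (rule LeastI_ex[OF ex])
    have "?f h \<le> ?c k"
    proof (cases k)
      case 0
      have "?f h \<le> 1" by (simp add: divide_simps add_pos_nonneg)
      also have "1 \<le> 2 powr ?n" using assms by (intro ge_one_powr_ge_zero) auto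
      finally show ?thesis using 0 by simp
    next
      case (Suc j)
      have k2: "?\<rho> j \<le> norm h" using not_less_Least[of j "\<lambda>k. norm h < ?\<rho> k"] Suc unfolding k_def by auto
      have "0 < ?\<rho> j" by simp
      then have h0: "0 < norm h" using k2 by linarith
      have "?f h \<le> 1 / norm h powr ?n"
        using h0 by (intro divide_left_mono) (auto intro!: mult_pos_pos add_pos_nonneg)
      also have "\<dots> \<le> 1 / ?\<rho> j powr ?n"
        using k2 h0 assms by (intro divide_left_mono powr_mono2 mult_pos_pos) auto
      also have "\<dots> = ?c k"
      proof -
        have "?\<rho> k powr ?n = 2 powr ?n * ?\<rho> j powr ?n" using Suc powr_mult[of 2 "?\<rho> j" ?n] by simp
        moreover have "1 / b = a * (1 / (a * b))" if "a \<noteq> 0" for a b :: real using that by simp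
        ultimately show ?thesis unfolding powr_minus_divide by simp
      qed
      finally show ?thesis .
    qed
    then show "\<exists>k. norm h < ?\<rho> k \<and> ?f h \<le> ?c k" using k1 by blast
  qed auto
  moreover have "?f \<in> borel_measurable lebesgue"
    by (intro lebesgue_borelI) measurable
  ultimately show ?thesis
    using x by (intro integrable_nonneg_bound(1)[where C="?V * (2 powr ?n * (1 / (1 - ?x)))"]) auto
qed

section \<open>Invariance of integrals under translation and reflection\<close>

lemma lebesgue_distr_affine:
  fixes a :: "'a::euclidean_space" and k :: real
  assumes "\<bar>k\<bar> = 1"
  shows "lebesgue = distr lebesgue lebesgue (\<lambda>x. a + k *\<^sub>R x)"
    and "(\<lambda>x. a + k *\<^sub>R x) \<in> lebesgue \<rightarrow>\<^sub>M lebesgue"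
proof -
  have T: "(\<lambda>x. a + (\<Sum>j\<in>Basis. (k * (x \<bullet> j)) *\<^sub>R j)) = (\<lambda>x. a + k *\<^sub>R x)"
  proof (rule ext)
    fix x :: 'a
    have "(\<Sum>j\<in>Basis. (k * (x \<bullet> j)) *\<^sub>R j) = k *\<^sub>R (\<Sum>j\<in>Basis. (x \<bullet> j) *\<^sub>R j)"
      by (simp add: scaleR_sum_right)
    then show "a + (\<Sum>j\<in>Basis. (k * (x \<bullet> j)) *\<^sub>R j) = a + k *\<^sub>R x"
      by (simp only: euclidean_representation)
  qed
  have k: "k \<noteq> 0" using assms by auto
  show "lebesgue = distr lebesgue lebesgue (\<lambda>x. a + k *\<^sub>R x)"
    using lebesgue_affine_euclidean[of "\<lambda>_. k" a] k assms unfolding T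
    by (simp add: density_1)
  show "(\<lambda>x. a + k *\<^sub>R x) \<in> lebesgue \<rightarrow>\<^sub>M lebesgue"
    using lebesgue_affine_measurable[of "\<lambda>_. k" a] k unfolding T by simp
qed

lemma lebesgue_integral_affine:
  fixes f :: "'a::euclidean_space \<Rightarrow> real"
  assumes "\<bar>k\<bar> = 1" "f \<in> borel_measurable lebesgue"
  shows "(LINT x|lebesgue. f (a + k *\<^sub>R x)) = integral\<^sup>L lebesgue f"
    and "integrable lebesgue (\<lambda>x. f (a + k *\<^sub>R x)) \<longleftrightarrow> integrable lebesgue f"
    and "(\<lambda>x. f (a + k *\<^sub>R x)) \<in> borel_measurable lebesgue"
proof -
  note T = lebesgue_distr_affine[OF assms(1), of a]
  show "(LINT x|lebesgue. f (a + k *\<^sub>R x)) = integral\<^sup>L lebesgue f"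
    using integral_distr[OF T(2) assms(2)] T(1) by simp
  show "integrable lebesgue (\<lambda>x. f (a + k *\<^sub>R x)) \<longleftrightarrow> integrable lebesgue f"
    using integrable_distr_eq[OF T(2) assms(2)] T(1) by simp
  show "(\<lambda>x. f (a + k *\<^sub>R x)) \<in> borel_measurable lebesgue"
    using measurable_compose[OF T(2) assms(2)] .
qed

subsection \<open>The nonlocal term and its principal value\<close>

lemma measurable_id_lebesgue [measurable]: "(\<lambda>x :: 'a::euclidean_space. x) \<in> borel_measurable lebesgue"
  by (rule lebesgue_borelI) simp

lemma ball_compl_lebesgue [measurable]: "- ball (x :: 'a::euclidean_space) \<epsilon> \<in> sets lebesgue"
  by (simp add: borel_closed)

text \<open>The operator truncated to jumps of length at least \<open>\<delta>\<close>. With the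
  jump \<open>h\<close> as variable, the values at two different centres can be compared jump by
  jump.\<close>

definition nonloc :: "real \<Rightarrow> real \<Rightarrow> (real ^ 'd \<Rightarrow> real) \<Rightarrow> real ^ 'd \<Rightarrow> real \<Rightarrow> real" where
  "nonloc p n w x \<delta> =
     (LINT h|lebesgue. indicator (- ball 0 \<delta>) h * (spow p (w x - w (x + h)) * norm h powr - n))"

definition tail_fun :: "real \<Rightarrow> real \<Rightarrow> (real ^ 'd \<Rightarrow> real) \<Rightarrow> bool" where
  "tail_fun p n w \<longleftrightarrow> w \<in> borel_measurable lebesgue \<and>
     integrable lebesgue (\<lambda>z. \<bar>w z\<bar> powr (p - 1) / (1 + norm z powr n))"

text \<open>This is \<open>tail_norm\<close> to the power \<open>p - 1\<close>, so the root is
  avoided and the bounds can be obtained by integrating pointwise estimates.\<close>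

definition tail_int :: "real \<Rightarrow> real \<Rightarrow> (real ^ 'd \<Rightarrow> real) \<Rightarrow> real" where
  "tail_int p n w = (LINT z|lebesgue. \<bar>w z\<bar> powr (p - 1) / (1 + norm z powr n))"

text \<open>\<open>1 + norm z\<close> is at most a fixed multiple of
  \<open>max (norm (z - x)) R\<close>, uniformly for \<open>norm x \<le> X\<close>. Hence every
  kernel cut off at distance \<open>R\<close> is dominated by the tail weight.\<close>

lemma kernel_bound:
  fixes x z :: "'a::real_normed_vector"
  assumes "0 \<le> n" "0 < R" "norm x \<le> X"
  shows "max (norm (z - x)) R powr - n \<le> 2 * ((1 + X) / R + 1) powr n / (1 + norm z powr n)"
proof -
  let ?m = "max (norm (z - x)) R"
  let ?B = "(1 + X) / R + 1"
  have X: "0 \<le> X" using assms(3) norm_ge_zero[of x] by linarith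
  have m: "0 < ?m" using assms by auto
  have "norm z \<le> norm (z - x) + norm x" using norm_triangle_ineq[of "z - x" x] by simp
  moreover have "1 + X \<le> (1 + X) / R * ?m"
    using X assms mult_left_mono[of R ?m "(1 + X) / R"] by simp
  ultimately have le: "1 + norm z \<le> ?B * ?m" using assms by (simp add: algebra_simps)
  have "1 + norm z powr n \<le> 2 * (1 + norm z) powr n"
    using powr_mono2[of n "norm z" "1 + norm z"] powr_mono2[of n 1 "1 + norm z"] assms by auto
  also have "\<dots> \<le> 2 * (?B * ?m) powr n" using le assms by (intro mult_left_mono powr_mono2) auto
  also have "\<dots> = 2 * ?B powr n * ?m powr n" using X assms m by (subst powr_mult) auto
  finally have *: "1 + norm z powr n \<le> 2 * ?B powr n * ?m powr n" .
  have "0 < 1 + norm z powr n" by (intro add_pos_nonneg) auto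
  moreover have "0 < ?m powr n" using m by simp
  ultimately show ?thesis using * unfolding powr_minus_divide by (simp add: divide_simps mult.commute)
qed

lemma tail_kernel_integrable:
  fixes w :: "real ^ 'd \<Rightarrow> real"
  assumes p: "2 < p" and q: "0 < q" and n: "n = real CARD('d) + q" and w: "tail_fun p n w" and \<delta>: "0 < \<delta>"
  shows "integrable lebesgue (\<lambda>h. indicator (- ball 0 \<delta>) h * (spow p (c - w (x + h)) * norm h powr - n))"
proof -
  have [measurable]: "w \<in> borel_measurable lebesgue" using w by (simp add: tail_fun_def)
  let ?f = "\<lambda>z. indicator (- ball x \<delta>) z * (spow p (c - w z) * norm (z - x) powr - n)"
  have f: "?f \<in> borel_measurable lebesgue" by measurable
  let ?C = "2 powr (p - 1) * (2 * ((1 + norm x) / \<delta> + 1) powr n)"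
  let ?g = "\<lambda>z. ?C * (\<bar>c\<bar> powr (p - 1) * (1 / (1 + norm z powr n)) + \<bar>w z\<bar> powr (p - 1) / (1 + norm z powr n))"
  have n0: "0 \<le> n" using n q by simp
  have "integrable lebesgue ?f"
  proof (rule Bochner_Integration.integrable_bound)
    show "integrable lebesgue ?g"
      using w weight_integrable[OF q, where 'd='d] n
      by (intro integrable_mult_right Bochner_Integration.integrable_add) (auto simp: tail_fun_def)
    show "AE z in lebesgue. norm (?f z) \<le> norm (?g z)"
    proof (rule AE_I2)
      fix z
      show "norm (?f z) \<le> norm (?g z)"
      proof (cases "z \<in> ball x \<delta>")
        case False
        then have d: "\<delta> \<le> norm (z - x)" by (simp add: dist_norm norm_minus_commute)
        have "\<bar>spow p (c - w z)\<bar> \<le> (\<bar>c\<bar> + \<bar>w z\<bar>) powr (p - 1)"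
          unfolding abs_spow using p by (intro powr_mono2) auto
        also have "\<dots> \<le> 2 powr (p - 1) * (\<bar>c\<bar> powr (p - 1) + \<bar>w z\<bar> powr (p - 1))"
          using p by (intro powr_add_le) auto
        finally have 1: "\<bar>spow p (c - w z)\<bar> \<le> 2 powr (p - 1) * (\<bar>c\<bar> powr (p - 1) + \<bar>w z\<bar> powr (p - 1))" .
        have 2: "norm (z - x) powr - n \<le> 2 * ((1 + norm x) / \<delta> + 1) powr n / (1 + norm z powr n)"
          using kernel_bound[OF n0 \<delta> order_refl, of z x] d by (simp add: max_def split: if_splits)
        have "norm (?f z) = \<bar>spow p (c - w z)\<bar> * norm (z - x) powr - n"
          using False by (simp add: abs_mult)
        also have "\<dots> \<le> (2 powr (p - 1) * (\<bar>c\<bar> powr (p - 1) + \<bar>w z\<bar> powr (p - 1))) * (2 * ((1 + norm x) / \<delta> + 1) powr n / (1 + norm z powr n))"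
          using 1 2 by (intro mult_mono) auto
        also have "\<dots> = ?g z"
        proof -
          have "(a * (b + e)) * (k / m) = a * k * (b * (1 / m) + e / m)" for a b e k m :: real
          proof -
            have "(a * (b + e)) * (k / m) = a * k * ((b + e) / m)" by simp
            also have "(b + e) / m = b * (1 / m) + e / m" by (simp add: add_divide_distrib)
            finally show ?thesis .
          qed
          then show ?thesis .
        qed
        also have "\<dots> \<le> \<bar>?g z\<bar>" by (rule abs_ge_self)
        finally show ?thesis by (simp only: real_norm_def)
      qed simp
    qed
  qed (rule f)
  then have "integrable lebesgue (\<lambda>h. ?f (x + 1 *\<^sub>R h))"
    by (subst lebesgue_integral_affine(2)[OF _ f]) auto
  moreover have "(\<lambda>h. ?f (x + 1 *\<^sub>R h)) = (\<lambda>h. indicator (- ball 0 \<delta>) h * (spow p (c - w (x + h)) * norm h powr - n))"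
    by (rule ext) (auto simp: indicator_def dist_norm)
  ultimately show ?thesis by simp
qed

lemma tendsto_at_right_mono_bounded:
  fixes f :: "real \<Rightarrow> real"
  assumes "0 < a" "\<And>e e'. 0 < e \<Longrightarrow> e \<le> e' \<Longrightarrow> e' < a \<Longrightarrow> f e \<le> f e'" "\<And>e. 0 < e \<Longrightarrow> e < a \<Longrightarrow> c \<le> f e"
  shows "\<exists>l\<ge>c. (f \<longlongrightarrow> l) (at_right 0)"
proof -
  let ?S = "f ` {0<..<a}"
  have ne: "?S \<noteq> {}" using assms(1) by simp
  have bd: "bdd_below ?S" using assms(3) by (auto intro!: bdd_belowI)
  have "c \<le> Inf ?S" by (rule cInf_greatest[OF ne]) (use assms(3) in auto)
  moreover have "(f \<longlongrightarrow> Inf ?S) (at_right 0)"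
  proof (rule order_tendstoI)
    fix y assume "y < Inf ?S"
    then have "y < f e" if "0 < e" "e < a" for e
      using cInf_lower[OF _ bd, of "f e"] that by force
    then show "\<forall>\<^sub>F x in at_right 0. y < f x"
      using assms(1) by (auto simp: eventually_at intro!: exI[of _ a])
  next
    fix y assume "Inf ?S < y"
    then obtain e where e: "0 < e" "e < a" "f e < y" using cInf_lessD[OF ne, of y] by auto
    have "f e' < y" if "0 < e'" "e' < e" for e' using assms(2)[of e' e] e that by force
    then show "\<forall>\<^sub>F x in at_right 0. f x < y"
      using e by (auto simp: eventually_at intro!: exI[of _ e])
  qed
  ultimately show ?thesis by blast
qed

lemma ext_integral_integrable:
  assumes "integrable M f"
  shows "ext_integral M f = ereal (integral\<^sup>L M f)"
proof -
  have "(\<integral>\<^sup>+ x. ennreal (f x) \<partial>M) < \<infinity>" "(\<integral>\<^sup>+ x. ennreal (- f x) \<partial>M) < \<infinity>"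
    using assms real_integrable_def[of M f] by (auto simp: top.not_eq_extremum)
  then show ?thesis
    unfolding ext_integral_def real_lebesgue_integral_def[OF assms]
    by (cases "\<integral>\<^sup>+ x. ennreal (f x) \<partial>M"; cases "\<integral>\<^sup>+ x. ennreal (- f x) \<partial>M")
      (auto simp: enn2real_def)
qed


text \<open>\<open>W1\<close> is a quadratic test function near \<open>x\<close> and \<open>W\<close> elsewhere. The radius \<open>\<delta>'\<close> of the test
  function may be arbitrarily small; the error depends only on the larger ball of radius \<open>\<delta>\<close>
  in which the quadratic polynomial stays above \<open>W\<close>.\<close>

definition pv_bound :: "'d::finite itself \<Rightarrow> real \<Rightarrow> real \<Rightarrow> real \<Rightarrow> real \<Rightarrow> bool" where
  "pv_bound ty p q n C \<longleftrightarrow> (\<forall>W (x :: real ^ 'd) g \<Lambda> \<delta> \<delta>' W1.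
     tail_fun p n W \<and> 0 \<le> \<Lambda> \<and> 0 < \<delta>' \<and> \<delta>' \<le> \<delta> \<and>
     (\<forall>h. norm h < \<delta> \<longrightarrow> W (x + h) \<le> W x + g \<bullet> h + \<Lambda> * (norm h)\<^sup>2) \<and>
     (\<forall>y. W1 y = (if norm (y - x) < \<delta>' then W x + g \<bullet> (y - x) + \<Lambda> * (norm (y - x))\<^sup>2 else W y)) \<longrightarrow>
     (\<forall>\<epsilon>>0. integrable lebesgue (\<lambda>h. indicator (- ball 0 \<epsilon>) h * (spow p (W1 x - W1 (x + h)) * norm h powr - n))) \<and>
     (\<exists>l \<ge> nonloc p n W x \<delta> - C * (\<Lambda> * (norm g + \<Lambda> * \<delta>) powr (p - 2) * \<delta> powr (p - q)).
       ((\<lambda>\<epsilon>. nonloc p n W1 x \<epsilon>) \<longlongrightarrow> l) (at_right 0)))"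

text \<open>Averaging over \<open>h\<close> and \<open>-h\<close> turns the contribution of the quadratic polynomial into an integrand of
  constant sign, so the principal value exists by monotonicity.\<close>

lemma pv_limit:
  assumes p: "2 < p" and q: "0 < q" "q < p" and n: "n = real CARD('d::finite) + q"
  shows "\<exists>C>0. pv_bound TYPE('d::finite) p q n C"
proof -
  have "0 < p - q" using q by simp
  from radial_integral[OF this, where 'd='d] obtain K where K: "0 < K"
    "\<And>\<delta>. 0 < \<delta> \<Longrightarrow> integrable lebesgue (\<lambda>h :: real ^ 'd. indicator (ball 0 \<delta>) h * norm h powr (p - q - real CARD('d)))"
    "\<And>\<delta>. 0 < \<delta> \<Longrightarrow> (LINT h|lebesgue. indicator (ball 0 \<delta>) (h :: real ^ 'd) * norm h powr (p - q - real CARD('d))) \<le> K * \<delta> powr (p - q)"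
    by blast
  \<comment> \<open>\<open>p - 1\<close> and the power of 2 come from \<open>spow_diff_le\<close>
    applied to \<open>Q h\<close> and \<open>- Q (- h)\<close>, both of modulus at most
    \<open>(norm g + \<Lambda> * \<delta>) * norm h\<close>. The symmetrised integrand then has
    order \<open>norm h powr (p - q - d)\<close>, d being the dimension, and \<open>K\<close> is the
    radial constant of this power.\<close>
  let ?C = "(p - 1) * 2 powr (p - 2) * K"
  have C: "?C > 0" using p K by simp
  moreover
  { fix W :: "real ^ 'd \<Rightarrow> real" and x g \<Lambda> \<delta> \<delta>' W1
    assume W: "tail_fun p n W" and \<Lambda>: "0 \<le> \<Lambda>" and \<delta>: "0 < \<delta>'" "\<delta>' \<le> \<delta>"
      and le: "\<And>h. norm h < \<delta> \<Longrightarrow> W (x + h) \<le> W x + g \<bullet> h + \<Lambda> * (norm h)\<^sup>2"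
      and W1: "\<And>y. W1 y = (if norm (y - x) < \<delta>' then W x + g \<bullet> (y - x) + \<Lambda> * (norm (y - x))\<^sup>2 else W y)"
    have \<delta>0: "0 < \<delta>" using \<delta> by simp
    define Q where "Q h = g \<bullet> h + \<Lambda> * (norm h)\<^sup>2" for h
    define k where "k h = norm h powr - n" for h :: "real ^ 'd"
    define S where "S h = (spow p (- Q h) + spow p (- Q (- h))) * k h" for h
    have n0: "0 \<le> n" using n q by simp
    have Qm [measurable]: "Q \<in> borel_measurable borel" unfolding Q_def by measurable
    have km [measurable]: "k \<in> borel_measurable borel" unfolding k_def by measurable
    have Sm [measurable]: "S \<in> borel_measurable borel" unfolding S_def Q_def k_def by measurable
    have k0: "0 \<le> k h" for h unfolding k_def by simp
    have Qkm: "(\<lambda>h. spow p (- Q h) * k h) \<in> borel_measurable borel" by measurable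
    have indm: "(\<lambda>h :: real ^ 'd. indicator (ball 0 a - ball 0 \<epsilon>) h * (spow p (- Q h) * k h)) \<in> borel_measurable lebesgue" for a \<epsilon>
      by (intro lebesgue_borelI borel_measurable_times borel_measurable_indicator Qkm) auto
    have Qb: "\<bar>Q h\<bar> \<le> (norm g + \<Lambda> * \<delta>) * \<delta>" if "norm h < \<delta>" for h
    proof -
      have "\<bar>Q h\<bar> \<le> norm g * norm h + \<Lambda> * (norm h)\<^sup>2"
        unfolding Q_def using Cauchy_Schwarz_ineq2[of g h] \<Lambda> by (smt (verit) mult_nonneg_nonneg zero_le_power2)
      also have "\<dots> \<le> norm g * \<delta> + \<Lambda> * \<delta>\<^sup>2"
        using that \<Lambda> by (intro add_mono mult_left_mono power_mono) auto
      finally show ?thesis by (simp add: algebra_simps power2_eq_square)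
    qed
    have intQ: "integrable lebesgue (\<lambda>h. indicator (ball 0 a - ball 0 \<epsilon>) h * (spow p (- Q h) * k h))" if "0 < \<epsilon>" "a \<le> \<delta>" for \<epsilon> a
    proof (rule Bochner_Integration.integrable_bound)
      show "integrable lebesgue (\<lambda>h :: real ^ 'd. indicator (ball 0 a) h * (((norm g + \<Lambda> * \<delta>) * \<delta>) powr (p - 1) * \<epsilon> powr - n))"
        by (intro integrable_mult_left integrable_real_indicator) (use emeasure_lborel_ball_finite[of "0 :: real ^ 'd" a] in \<open>auto simp: infinity_ennreal_def\<close>)
      show "AE h in lebesgue. norm (indicator (ball 0 a - ball 0 \<epsilon>) h * (spow p (- Q h) * k h))
         \<le> norm (indicator (ball 0 a) h * (((norm g + \<Lambda> * \<delta>) * \<delta>) powr (p - 1) * \<epsilon> powr - n))"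
      proof (rule AE_I2)
        fix h :: "real ^ 'd"
        show "norm (indicator (ball 0 a - ball 0 \<epsilon>) h * (spow p (- Q h) * k h))
         \<le> norm (indicator (ball 0 a) h * (((norm g + \<Lambda> * \<delta>) * \<delta>) powr (p - 1) * \<epsilon> powr - n))"
        proof (cases "h \<in> ball 0 a - ball 0 \<epsilon>")
          case True
          then have h: "norm h < \<delta>" "\<epsilon> \<le> norm h" using that by auto
          have "\<bar>spow p (- Q h)\<bar> \<le> ((norm g + \<Lambda> * \<delta>) * \<delta>) powr (p - 1)"
            unfolding abs_spow using Qb[OF h(1)] p by (intro powr_mono2) auto
          moreover have "k h \<le> \<epsilon> powr - n" unfolding k_def using h that n0 by (intro powr_mono2') auto
          ultimately have "\<bar>spow p (- Q h)\<bar> * k h \<le> ((norm g + \<Lambda> * \<delta>) * \<delta>) powr (p - 1) * \<epsilon> powr - n"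
            by (intro mult_mono) (auto simp: k0)
          then show ?thesis using True k0[of h] by (simp add: abs_mult)
        qed simp
      qed
    qed (rule indm)
    define P where "P a \<epsilon> = (LINT h|lebesgue. indicator (ball 0 a - ball 0 \<epsilon>) h * (spow p (- Q h) * k h))" for a \<epsilon>
    have Psym: "integrable lebesgue (\<lambda>h. indicator (ball 0 a - ball 0 \<epsilon>) h * S h)"
      "2 * P a \<epsilon> = (LINT h|lebesgue. indicator (ball 0 a - ball 0 \<epsilon>) h * S h)" if "0 < \<epsilon>" "a \<le> \<delta>" for a \<epsilon>
    proof -
      let ?f = "\<lambda>h. indicator (ball 0 a - ball 0 \<epsilon>) h * (spow p (- Q h) * k h)"
      have fm: "?f \<in> borel_measurable lebesgue" by (rule indm)
      have r: "(\<lambda>h. ?f (0 + (- 1) *\<^sub>R h)) = (\<lambda>h. indicator (ball 0 a - ball 0 \<epsilon>) h * (spow p (- Q (- h)) * k h))"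
        by (rule ext) (simp add: indicator_def k_def)
      have i2: "integrable lebesgue (\<lambda>h. indicator (ball 0 a - ball 0 \<epsilon>) h * (spow p (- Q (- h)) * k h))"
        using lebesgue_integral_affine(2)[of "- 1", OF _ fm, of 0] intQ[OF that] unfolding r by simp
      have e2: "(LINT h|lebesgue. indicator (ball 0 a - ball 0 \<epsilon>) h * (spow p (- Q (- h)) * k h)) = P a \<epsilon>"
        using lebesgue_integral_affine(1)[of "- 1", OF _ fm, of 0] unfolding r P_def by simp
      have s: "(\<lambda>h. indicator (ball 0 a - ball 0 \<epsilon>) h * S h) =
        (\<lambda>h. indicator (ball 0 a - ball 0 \<epsilon>) h * (spow p (- Q h) * k h) + indicator (ball 0 a - ball 0 \<epsilon>) h * (spow p (- Q (- h)) * k h))"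
        by (rule ext) (simp only: S_def distrib_left distrib_right)
      show "integrable lebesgue (\<lambda>h. indicator (ball 0 a - ball 0 \<epsilon>) h * S h)"
        unfolding s by (rule Bochner_Integration.integrable_add[OF intQ[OF that] i2])
      show "2 * P a \<epsilon> = (LINT h|lebesgue. indicator (ball 0 a - ball 0 \<epsilon>) h * S h)"
        unfolding s Bochner_Integration.integral_add[OF intQ[OF that] i2] e2 by (simp add: P_def)
    qed
    \<comment> \<open>The linear parts cancel:
      \<open>Q h + Q (- h) = 2 * \<Lambda> * (norm h)\<^sup>2\<close> is nonnegative.\<close>
    have S_le: "S h \<le> 0" for h
    proof -
      have "spow p (- Q (- h)) \<le> spow p (Q h)"
        using \<Lambda> p by (intro spow_mono) (auto simp: Q_def)
      then show ?thesis unfolding S_def using k0[of h] by (simp add: mult_nonpos_nonneg)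
    qed
    let ?B = "\<Lambda> * (norm g + \<Lambda> * \<delta>) powr (p - 2)"
    have S_ge: "- (2 * ((p - 1) * 2 powr (p - 2) * ?B) * (indicator (ball 0 \<delta>) h * norm h powr (p - q - real CARD('d)))) \<le> indicator (ball 0 \<delta> - ball 0 \<epsilon>) h * S h" for h \<epsilon>
    proof (cases "norm h < \<delta> \<and> h \<noteq> 0")
      case True
      then have h: "norm h < \<delta>" "0 < norm h" by auto
      have "\<bar>spow p (Q h) - spow p (- Q (- h))\<bar> \<le> (p - 1) * \<bar>Q h - (- Q (- h))\<bar> * (\<bar>Q h\<bar> + \<bar>- Q (- h)\<bar>) powr (p - 2)"
        by (rule spow_diff_le[OF p])
      also have "\<dots> \<le> (p - 1) * (2 * (\<Lambda> * (norm h)\<^sup>2)) * (2 * ((norm g + \<Lambda> * \<delta>) * norm h)) powr (p - 2)"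
      proof -
        have 1: "\<bar>Q h - (- Q (- h))\<bar> = 2 * (\<Lambda> * (norm h)\<^sup>2)" using \<Lambda> by (simp add: Q_def)
        have b: "\<bar>Q h'\<bar> \<le> (norm g + \<Lambda> * \<delta>) * norm h" if "norm h' = norm h" for h'
        proof -
          have "\<bar>Q h'\<bar> \<le> norm g * norm h' + \<Lambda> * (norm h')\<^sup>2"
            unfolding Q_def using Cauchy_Schwarz_ineq2[of g h'] \<Lambda> by (smt (verit) mult_nonneg_nonneg zero_le_power2)
          also have "\<Lambda> * (norm h')\<^sup>2 \<le> \<Lambda> * (\<delta> * norm h)"
            using that \<Lambda> h unfolding power2_eq_square by (intro mult_left_mono mult_right_mono) auto
          finally show ?thesis using that by (simp add: algebra_simps)
        qed
        have 2: "\<bar>Q h\<bar> + \<bar>- Q (- h)\<bar> \<le> 2 * ((norm g + \<Lambda> * \<delta>) * norm h)" using b[of h] b[of "- h"] by simp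
        show ?thesis unfolding 1 using 2 p \<Lambda> by (intro mult_left_mono powr_mono2) auto
      qed
      also have "\<dots> = 2 * ((p - 1) * 2 powr (p - 2) * ?B) * ((norm h)\<^sup>2 * norm h powr (p - 2))"
        by (simp only: powr_mult mult_ac)
      also have "(norm h)\<^sup>2 * norm h powr (p - 2) = norm h powr p"
        using h by (simp add: powr_realpow[symmetric] powr_add[symmetric] del: powr_numeral)
      finally have "- (2 * ((p - 1) * 2 powr (p - 2) * ?B) * norm h powr p) * k h \<le> S h"
        unfolding S_def using k0[of h] by (intro mult_right_mono) auto
      moreover have "norm h powr p * k h = norm h powr (p - q - real CARD('d))"
        unfolding k_def using n by (simp add: powr_add[symmetric] algebra_simps)
      ultimately have *: "- (2 * ((p - 1) * 2 powr (p - 2) * ?B) * norm h powr (p - q - real CARD('d))) \<le> S h"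
        by (simp add: mult.assoc)
      have "0 \<le> 2 * ((p - 1) * 2 powr (p - 2) * ?B) * norm h powr (p - q - real CARD('d))" using p \<Lambda> by simp
      then show ?thesis using * h by (auto simp: indicator_def)
    next
      case False
      then show ?thesis using S_le[of h] p \<Lambda> by (auto simp: indicator_def S_def k_def)
    qed
    have P_ge: "- (?C * (?B * \<delta> powr (p - q))) \<le> P \<delta> \<epsilon>" if "0 < \<epsilon>" for \<epsilon>
    proof -
      let ?c = "2 * ((p - 1) * 2 powr (p - 2) * ?B)"
      have c0: "0 \<le> ?c" using p \<Lambda> by simp
      have "- (?c * (K * \<delta> powr (p - q))) \<le> - (?c * (LINT h|lebesgue. indicator (ball 0 \<delta>) (h :: real ^ 'd) * norm h powr (p - q - real CARD('d))))"
        using mult_left_mono[OF K(3)[OF \<delta>0] c0] by simp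
      also have "\<dots> = (LINT h|lebesgue. - (?c * (indicator (ball 0 \<delta>) (h :: real ^ 'd) * norm h powr (p - q - real CARD('d)))))"
        by (simp only: Bochner_Integration.integral_minus Bochner_Integration.integral_mult_right_zero)
      also have "\<dots> \<le> (LINT h|lebesgue. indicator (ball 0 \<delta> - ball 0 \<epsilon>) h * S h)"
        by (intro integral_mono Psym(1) Bochner_Integration.integrable_minus integrable_mult_right K(2) \<delta>0 that S_ge order_refl)
      also have "\<dots> = 2 * P \<delta> \<epsilon>" using Psym(2)[OF that order_refl] by simp
      finally show ?thesis by (simp add: mult_ac)
    qed
    have P_mono: "P \<delta>' \<epsilon> \<le> P \<delta>' \<epsilon>'" if "0 < \<epsilon>" "\<epsilon> \<le> \<epsilon>'" for \<epsilon> \<epsilon>'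
    proof -
      have "2 * P \<delta>' \<epsilon> \<le> 2 * P \<delta>' \<epsilon>'"
        unfolding Psym(2)[OF that(1) \<delta>(2)] Psym(2)[OF order_less_le_trans[OF that] \<delta>(2)]
        using that S_le by (intro integral_mono Psym(1) \<delta>(2)) (auto simp: indicator_def)
      then show ?thesis by simp
    qed
    have Wi: "integrable lebesgue (\<lambda>h. indicator (- ball 0 a) h * (spow p (W x - W (x + h)) * norm h powr - n))" if "0 < a" for a
      by (rule tail_kernel_integrable[OF p q(1) n W that])
    have split: "(\<lambda>h. indicator (- ball 0 \<epsilon>) h * (spow p (W1 x - W1 (x + h)) * norm h powr - n)) =
      (\<lambda>h. indicator (ball 0 \<delta>' - ball 0 \<epsilon>) h * (spow p (- Q h) * k h) + indicator (- ball 0 \<delta>') h * (spow p (W x - W (x + h)) * norm h powr - n))"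
      if "0 < \<epsilon>" "\<epsilon> < \<delta>'" for \<epsilon>
      using that \<delta> by (intro ext) (auto simp: indicator_def W1 Q_def k_def)
    have I: "integrable lebesgue (\<lambda>h. indicator (- ball 0 \<epsilon>) h * (spow p (W1 x - W1 (x + h)) * norm h powr - n))"
      "nonloc p n W1 x \<epsilon> = P \<delta>' \<epsilon> + nonloc p n W x \<delta>'" if "0 < \<epsilon>" "\<epsilon> < \<delta>'" for \<epsilon>
      unfolding nonloc_def split[OF that]
      using Bochner_Integration.integral_add[OF intQ[OF that(1) \<delta>(2)] Wi[OF \<delta>(1)]] Bochner_Integration.integrable_add[OF intQ[OF that(1) \<delta>(2)] Wi[OF \<delta>(1)]]
      by (simp_all add: P_def)
    have I': "integrable lebesgue (\<lambda>h. indicator (- ball 0 \<epsilon>) h * (spow p (W1 x - W1 (x + h)) * norm h powr - n))" if "0 < \<epsilon>" for \<epsilon>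
    proof (cases "\<epsilon> < \<delta>'")
      case False
      have "W1 x = W x" using W1[of x] \<delta> by simp
      then have "(\<lambda>h. indicator (- ball 0 \<epsilon>) h * (spow p (W1 x - W1 (x + h)) * norm h powr - n)) =
        (\<lambda>h. indicator (- ball 0 \<epsilon>) h * (spow p (W x - W (x + h)) * norm h powr - n))"
        using False \<delta> by (intro ext) (auto simp: indicator_def W1)
      then show ?thesis using Wi[OF that] by simp
    qed (use I that in blast)
    \<comment> \<open>For \<open>\<delta>' \<le> norm h < \<delta>\<close> the function
      \<open>W1\<close> equals \<open>W\<close>, which lies below the polynomial; replacing it there
      by the polynomial only lowers the integral. Thus the bound depends on \<open>\<delta>\<close>,
      however small \<open>\<delta>'\<close> is.\<close>
    have W_ge: "nonloc p n W x \<delta> + P \<delta> \<epsilon> \<le> nonloc p n W1 x \<epsilon>" if "0 < \<epsilon>" "\<epsilon> < \<delta>'" for \<epsilon>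
    proof -
      have "nonloc p n W x \<delta> + P \<delta> \<epsilon> = (LINT h|lebesgue. indicator (- ball 0 \<delta>) h * (spow p (W x - W (x + h)) * norm h powr - n) + indicator (ball 0 \<delta> - ball 0 \<epsilon>) h * (spow p (- Q h) * k h))"
        unfolding nonloc_def P_def by (rule Bochner_Integration.integral_add[symmetric, OF Wi[OF \<delta>0] intQ[OF that(1) order_refl]])
      also have "\<dots> \<le> nonloc p n W1 x \<epsilon>"
        unfolding nonloc_def
      proof (intro integral_mono I'[OF that(1)] Bochner_Integration.integrable_add[OF Wi[OF \<delta>0] intQ[OF that(1) order_refl]])
        fix h
        have "spow p (- Q h) \<le> spow p (W x - W (x + h))" if "norm h < \<delta>"
          using le[OF that] by (intro spow_mono p) (simp add: Q_def)
        then have *: "spow p (- Q h) * k h \<le> spow p (W x - W (x + h)) * k h" if "norm h < \<delta>"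
          using that k0[of h] by (intro mult_right_mono) auto
        show "indicator (- ball 0 \<delta>) h * (spow p (W x - W (x + h)) * norm h powr - n) + indicator (ball 0 \<delta> - ball 0 \<epsilon>) h * (spow p (- Q h) * k h) \<le> indicator (- ball 0 \<epsilon>) h * (spow p (W1 x - W1 (x + h)) * norm h powr - n)"
          using * that \<delta> by (auto simp: indicator_def W1 k_def Q_def)
      qed
      finally show ?thesis .
    qed
    have "\<exists>l \<ge> nonloc p n W x \<delta> - ?C * (?B * \<delta> powr (p - q)). ((\<lambda>\<epsilon>. nonloc p n W1 x \<epsilon>) \<longlongrightarrow> l) (at_right 0)"
    proof (rule tendsto_at_right_mono_bounded[OF \<delta>(1)])
      fix e e' :: real assume e: "0 < e" "e \<le> e'" "e' < \<delta>'"
      then show "nonloc p n W1 x e \<le> nonloc p n W1 x e'"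
        using P_mono[of e e'] I(2)[of e] I(2)[of e'] by simp
    next
      fix e :: real assume e: "0 < e" "e < \<delta>'"
      show "nonloc p n W x \<delta> - ?C * (?B * \<delta> powr (p - q)) \<le> nonloc p n W1 x e"
        using W_ge[OF e] P_ge[OF e(1)] by simp
    qed
    note I' this }
  ultimately show ?thesis unfolding pv_bound_def by (intro exI[of _ ?C]) auto
qed

lemma frac_lap_eq:
  fixes w :: "real ^ 'd \<Rightarrow> real"
  assumes n: "n = real CARD('d) + s * p" and [measurable]: "w \<in> borel_measurable lebesgue"
    and i: "\<And>\<epsilon>. 0 < \<epsilon> \<Longrightarrow> integrable lebesgue (\<lambda>h. indicator (- ball 0 \<epsilon>) h * (spow p (w x - w (x + h)) * norm h powr - n))"
    and l: "((\<lambda>\<epsilon>. nonloc p n w x \<epsilon>) \<longlongrightarrow> l) (at_right 0)"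
  shows "frac_p_laplacian p s w x = ereal l"
proof -
  let ?f = "\<lambda>y. \<bar>w x - w y\<bar> powr (p - 2) * (w x - w y) / norm (x - y) powr n"
  have ext: "ext_integral (lebesgue_on (- ball x \<epsilon>)) ?f = ereal (nonloc p n w x \<epsilon>)" if \<epsilon>: "0 < \<epsilon>" for \<epsilon>
  proof -
    let ?F = "\<lambda>y. indicator (- ball x \<epsilon>) y * (spow p (w x - w y) * norm (y - x) powr - n)"
    have Fm: "?F \<in> borel_measurable lebesgue" by measurable
    have sh: "(\<lambda>h. ?F (x + 1 *\<^sub>R h)) = (\<lambda>h. indicator (- ball 0 \<epsilon>) h * (spow p (w x - w (x + h)) * norm h powr - n))"
      by (rule ext) (auto simp: indicator_def dist_norm)
    have Fi: "integrable lebesgue ?F"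
      using lebesgue_integral_affine(2)[of 1, OF _ Fm, of x] i[OF \<epsilon>] unfolding sh by simp
    have Fe: "integral\<^sup>L lebesgue ?F = nonloc p n w x \<epsilon>"
      using lebesgue_integral_affine(1)[of 1, OF _ Fm, of x] unfolding sh nonloc_def by simp
    have F: "(\<lambda>y. indicator (- ball x \<epsilon>) y *\<^sub>R ?f y) = ?F"
      by (rule ext) (simp add: spow_def powr_minus_divide norm_minus_commute)
    have S: "- ball x \<epsilon> \<inter> space lebesgue \<in> sets lebesgue" using ball_compl_lebesgue by simp
    have "integrable (lebesgue_on (- ball x \<epsilon>)) ?f"
      using Fi integrable_restrict_space[OF S, of ?f] unfolding F by simp
    moreover have "integral\<^sup>L (lebesgue_on (- ball x \<epsilon>)) ?f = nonloc p n w x \<epsilon>"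
      using Fe integral_restrict_space[OF S, of ?f] unfolding F by simp
    ultimately show ?thesis by (simp add: ext_integral_integrable)
  qed
  have "((\<lambda>\<epsilon>. ext_integral (lebesgue_on (- ball x \<epsilon>)) ?f) \<longlongrightarrow> ereal l) (at_right 0)"
  proof (rule Lim_transform_eventually)
    show "((\<lambda>\<epsilon>. ereal (nonloc p n w x \<epsilon>)) \<longlongrightarrow> ereal l) (at_right 0)" using l by simp
    show "\<forall>\<^sub>F \<epsilon> in at_right 0. ereal (nonloc p n w x \<epsilon>) = ext_integral (lebesgue_on (- ball x \<epsilon>)) ?f"
      using ext by (auto simp: eventually_at intro!: exI[of _ 1])
  qed
  then show ?thesis
    unfolding frac_p_laplacian_def n[symmetric] by (intro tendsto_Lim) auto
qed

subsection \<open>Quadratic test functions\<close>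

text \<open>The spatial Hessian is \<open>2 * \<Lambda>\<close> times the identity. Such polynomials
  suffice: the tangent majorant of a concave modulus of the distance and the squared-distance
  penalties all have this form.\<close>

definition test_fun :: "((real ^ 'd) \<times> real \<Rightarrow> real) \<Rightarrow> real ^ 'd \<Rightarrow> real \<Rightarrow> real ^ 'd \<Rightarrow> real \<Rightarrow> (real \<Rightarrow> real) \<Rightarrow> (real ^ 'd) \<times> real \<Rightarrow> real" where
  "test_fun v x0 t0 g \<Lambda> \<beta> = (\<lambda>(x, t). v (x0, t0) + g \<bullet> (x - x0) + \<Lambda> * (norm (x - x0))\<^sup>2 + \<beta> t - \<beta> t0)"

lemma C2_on_uminus:
  fixes f :: "(real ^ 'd) \<times> real \<Rightarrow> real"
  assumes "C2_on Q f" shows "C2_on Q (\<lambda>z. - f z)"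
proof -
  from assms obtain G H T where 1: "continuous_on Q G" "continuous_on Q H" "continuous_on Q T"
    and 0: "\<forall>(x, t)\<in>Q. ((\<lambda>y. f (y, t)) has_derivative (\<lambda>h. G (x, t) \<bullet> h)) (at x) \<and>
           ((\<lambda>y. G (y, t)) has_derivative (\<lambda>h. H (x, t) *v h)) (at x) \<and>
           ((\<lambda>\<tau>. f (x, \<tau>)) has_real_derivative T (x, t)) (at t within {\<tau>. (x, \<tau>) \<in> Q})"
    unfolding C2_on_def by blast
  have 2: "((\<lambda>y. f (y, t)) has_derivative (\<lambda>h. G (x, t) \<bullet> h)) (at x)"
      "((\<lambda>y. G (y, t)) has_derivative (\<lambda>h. H (x, t) *v h)) (at x)"
      "((\<lambda>\<tau>. f (x, \<tau>)) has_real_derivative T (x, t)) (at t within {\<tau>. (x, \<tau>) \<in> Q})"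
    if "(x, t) \<in> Q" for x t
    using bspec[OF 0 that] by auto
  have m: "(- A) *v h = - (A *v h)" for A :: "real ^ 'd ^ 'd" and h
    by (simp add: vec_eq_iff matrix_vector_mult_def sum_negf)
  show ?thesis
    unfolding C2_on_def
  proof (rule exI[of _ "\<lambda>z. - G z"], rule exI[of _ "\<lambda>z. - H z"], rule exI[of _ "\<lambda>z. - T z"], intro conjI ballI)
    fix z assume z: "z \<in> Q"
    obtain x t where z': "z = (x, t)" by (cases z)
    show "case z of (x, t) \<Rightarrow> ((\<lambda>y. - f (y, t)) has_derivative (\<lambda>h. - G (x, t) \<bullet> h)) (at x) \<and>
        ((\<lambda>y. - G (y, t)) has_derivative (\<lambda>h. - H (x, t) *v h)) (at x) \<and>
        ((\<lambda>\<tau>. - f (x, \<tau>)) has_real_derivative - T (x, t)) (at t within {\<tau>. (x, \<tau>) \<in> Q})"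
      using has_derivative_minus[OF 2(1)] has_derivative_minus[OF 2(2)] DERIV_minus[OF 2(3)] z
      unfolding z' by (auto simp: m inner_minus_left)
  qed (use 1 in \<open>auto intro: continuous_on_minus\<close>)
qed

lemma C2_on_test_fun:
  fixes v :: "(real ^ 'd) \<times> real \<Rightarrow> real"
  assumes "\<And>t. (\<beta> has_real_derivative \<beta>' t) (at t)" "continuous_on UNIV \<beta>'"
  shows "C2_on Q (test_fun v x0 t0 g \<Lambda> \<beta>)"
  unfolding C2_on_def
proof (rule exI[of _ "\<lambda>(x, t). g + (2 * \<Lambda>) *\<^sub>R (x - x0)"], rule exI[of _ "\<lambda>_. (2 * \<Lambda>) *\<^sub>R mat 1"],
    rule exI[of _ "\<lambda>(x, t). \<beta>' t"], intro conjI ballI)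
  show "continuous_on Q (\<lambda>(x, t). g + (2 * \<Lambda>) *\<^sub>R (x - x0))"
    by (auto simp: case_prod_unfold intro!: continuous_intros)
  show "continuous_on Q (\<lambda>(x, t). \<beta>' t)"
  proof -
    have "continuous_on Q (\<lambda>z. \<beta>' (snd z))"
      by (rule continuous_on_compose2[OF assms(2)]) (auto intro: continuous_intros)
    then show ?thesis by (simp add: case_prod_unfold)
  qed
  fix z assume "z \<in> Q"
  obtain x t where z: "z = (x, t)" by (cases z)
  have "((\<lambda>y. test_fun v x0 t0 g \<Lambda> \<beta> (y, t)) has_derivative (\<lambda>h. (g + (2 * \<Lambda>) *\<^sub>R (x - x0)) \<bullet> h)) (at x)"
    unfolding test_fun_def case_prod_conv power2_norm_eq_inner
    by (rule derivative_eq_intros refl | simp)+ (auto simp: fun_eq_iff algebra_simps inner_commute)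
  moreover have "((\<lambda>y. g + (2 * \<Lambda>) *\<^sub>R (y - x0)) has_derivative (\<lambda>h. ((2 * \<Lambda>) *\<^sub>R mat 1) *v h)) (at x)"
    by (rule derivative_eq_intros refl | simp)+ (auto simp: fun_eq_iff scaleR_matrix_vector_assoc[symmetric])
  moreover have "((\<lambda>\<tau>. test_fun v x0 t0 g \<Lambda> \<beta> (x, \<tau>)) has_real_derivative \<beta>' t) (at t within {\<tau>. (x, \<tau>) \<in> Q})"
    unfolding test_fun_def case_prod_conv
    by (rule derivative_eq_intros has_field_derivative_at_within[OF assms(1)] refl | simp)+
  ultimately show "case z of (x, t) \<Rightarrow>
     ((\<lambda>y. test_fun v x0 t0 g \<Lambda> \<beta> (y, t)) has_derivative (\<lambda>h. (case (x, t) of (x, t) \<Rightarrow> g + (2 * \<Lambda>) *\<^sub>R (x - x0)) \<bullet> h)) (at x) \<and>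
     ((\<lambda>y. case (y, t) of (x, t) \<Rightarrow> g + (2 * \<Lambda>) *\<^sub>R (x - x0)) has_derivative (\<lambda>h. ((2 * \<Lambda>) *\<^sub>R mat 1) *v h)) (at x) \<and>
     ((\<lambda>\<tau>. test_fun v x0 t0 g \<Lambda> \<beta> (x, \<tau>)) has_real_derivative (case (x, t) of (x, t) \<Rightarrow> \<beta>' t)) (at t within {\<tau>. (x, \<tau>) \<in> Q})"
    unfolding z by simp
qed auto

text \<open>Two radii occur. Touching in space and time is only required in some small cylinder,
  whereas at the fixed time \<open>t0\<close> the quadratic bound holds up to
  \<open>\<delta>\<close>, the radius that enters the error of \<open>pv_bound\<close>.\<close>

definition touch :: "((real ^ 'd) \<times> real \<Rightarrow> real) \<Rightarrow> real ^ 'd \<Rightarrow> real \<Rightarrow> real ^ 'd \<Rightarrow> real \<Rightarrow> (real \<Rightarrow> real) \<Rightarrow> (real \<Rightarrow> real) \<Rightarrow> real \<Rightarrow> bool" where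
  "touch v x0 t0 g \<Lambda> \<beta> \<beta>' \<delta> \<longleftrightarrow> norm x0 < 1 \<and> - 1 < t0 \<and> t0 \<le> 0 \<and> 0 \<le> \<Lambda> \<and> 0 < \<delta> \<and>
     (\<forall>t. (\<beta> has_real_derivative \<beta>' t) (at t)) \<and> continuous_on UNIV \<beta>' \<and>
     (\<exists>\<delta>'>0. \<forall>x t. norm (x - x0) < \<delta>' \<and> t0 - \<delta>'\<^sup>2 < t \<and> t \<le> t0 \<longrightarrow> v (x, t) \<le> test_fun v x0 t0 g \<Lambda> \<beta> (x, t)) \<and>
     (\<forall>h. norm h < \<delta> \<longrightarrow> v (x0 + h, t0) \<le> v (x0, t0) + g \<bullet> h + \<Lambda> * (norm h)\<^sup>2)"

text \<open>One polynomial serves both signs: if it lies above \<open>v\<close>, its negative lies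
  below \<open>- v\<close>, and the truncated integrals and the time derivative just change sign.
  The conclusion therefore feeds both the subsolution and the supersolution property.\<close>

lemma touch_data:
  fixes v :: "(real ^ 'd) \<times> real \<Rightarrow> real"
  assumes n: "n = real CARD('d) + s * p" and C: "pv_bound TYPE('d) p q n C"
    and tail: "tail_fun p n (\<lambda>x. v (x, t0))" and touch: "touch v x0 t0 g \<Lambda> \<beta> \<beta>' \<delta>"
  obtains r l where "0 < r" "parab_cyl r x0 t0 \<subseteq> ball 0 1 \<times> {-1<..0}"
    "\<forall>z\<in>parab_cyl r x0 t0. v z \<le> test_fun v x0 t0 g \<Lambda> \<beta> z"
    "visc_operator p s v (test_fun v x0 t0 g \<Lambda> \<beta>) r x0 t0 = ereal (\<beta>' t0 + l)"
    "visc_operator p s (\<lambda>z. - v z) (\<lambda>z. - test_fun v x0 t0 g \<Lambda> \<beta> z) r x0 t0 = ereal (- (\<beta>' t0 + l))"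
    "l \<ge> nonloc p n (\<lambda>x. v (x, t0)) x0 \<delta> - C * (\<Lambda> * (norm g + \<Lambda> * \<delta>) powr (p - 2) * \<delta> powr (p - q))"
proof -
  from touch obtain \<delta>' where x0: "norm x0 < 1" "- 1 < t0" "t0 \<le> 0" "0 \<le> \<Lambda>" "0 < \<delta>"
    and \<beta>: "\<And>t. (\<beta> has_real_derivative \<beta>' t) (at t)" "continuous_on UNIV \<beta>'"
    and \<delta>': "0 < \<delta>'" "\<And>x t. norm (x - x0) < \<delta>' \<Longrightarrow> t0 - \<delta>'\<^sup>2 < t \<Longrightarrow> t \<le> t0 \<Longrightarrow> v (x, t) \<le> test_fun v x0 t0 g \<Lambda> \<beta> (x, t)"
    and le: "\<And>h. norm h < \<delta> \<Longrightarrow> v (x0 + h, t0) \<le> v (x0, t0) + g \<bullet> h + \<Lambda> * (norm h)\<^sup>2"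
    unfolding touch_def by blast
  let ?\<phi> = "test_fun v x0 t0 g \<Lambda> \<beta>"
  \<comment> \<open>Since \<open>r \<le> 1\<close>, the bound
    \<open>r\<^sup>2 \<le> r \<le> 1 + t0\<close> keeps the cylinder above time -1.\<close>
  define r where "r = Min {\<delta>', \<delta>, 1 - norm x0, 1 + t0, 1}"
  have r: "0 < r" "r \<le> \<delta>'" "r \<le> \<delta>" "r \<le> 1 - norm x0" "r \<le> 1 + t0" "r \<le> 1"
    unfolding r_def using x0 \<delta>' by auto
  have r2: "r\<^sup>2 \<le> r" using r by (simp add: power2_eq_square mult_left_le_one_le)
  have r3: "r\<^sup>2 \<le> \<delta>'\<^sup>2" using r by (intro power_mono) auto
  have sub: "parab_cyl r x0 t0 \<subseteq> ball 0 1 \<times> {-1<..0}"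
  proof (clarsimp simp: parab_cyl_def)
    fix x t assume "dist x0 x < r" "t0 - r\<^sup>2 < t" "t \<le> t0"
    moreover have "norm x \<le> norm x0 + dist x0 x" by (metis dist_commute dist_norm norm_triangle_sub)
    ultimately show "norm x < 1 \<and> - 1 < t \<and> t \<le> 0" using r r2 x0 by auto
  qed
  have above: "v z \<le> ?\<phi> z" if "z \<in> parab_cyl r x0 t0" for z
  proof -
    obtain x t where z: "z = (x, t)" by (cases z)
    have "norm (x - x0) < r" "t0 - r\<^sup>2 < t" "t \<le> t0"
      using that by (auto simp: z parab_cyl_def dist_norm norm_minus_commute)
    then show ?thesis unfolding z using r(2) r3 by (intro \<delta>'(2)) linarith+
  qed
  define W1 where "W1 y = (if norm (y - x0) < r then v (x0, t0) + g \<bullet> (y - x0) + \<Lambda> * (norm (y - x0))\<^sup>2 else v (y, t0))" for y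
  have [measurable]: "(\<lambda>x. v (x, t0)) \<in> borel_measurable lebesgue" using tail by (simp add: tail_fun_def)
  have W1m: "W1 \<in> borel_measurable lebesgue" unfolding W1_def by measurable
  have W1e: "(\<lambda>y. if (y, t0) \<in> parab_cyl r x0 t0 then ?\<phi> (y, t0) else v (y, t0)) = W1"
    using r by (intro ext) (auto simp: W1_def parab_cyl_def test_fun_def dist_norm norm_minus_commute)
  have W1e': "(\<lambda>y. if (y, t0) \<in> parab_cyl r x0 t0 then - ?\<phi> (y, t0) else - v (y, t0)) = (\<lambda>y. - W1 y)"
    using r by (intro ext) (auto simp: W1_def parab_cyl_def test_fun_def dist_norm norm_minus_commute)
  have "(\<forall>\<epsilon>>0. integrable lebesgue (\<lambda>h. indicator (- ball 0 \<epsilon>) h * (spow p (W1 x0 - W1 (x0 + h)) * norm h powr - n))) \<and>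
     (\<exists>l \<ge> nonloc p n (\<lambda>x. v (x, t0)) x0 \<delta> - C * (\<Lambda> * (norm g + \<Lambda> * \<delta>) powr (p - 2) * \<delta> powr (p - q)).
       ((\<lambda>\<epsilon>. nonloc p n W1 x0 \<epsilon>) \<longlongrightarrow> l) (at_right 0))"
  proof (rule C[unfolded pv_bound_def, THEN spec, of "\<lambda>x. v (x, t0)", THEN spec, of x0, THEN spec, of g,
        THEN spec, of \<Lambda>, THEN spec, of \<delta>, THEN spec, of r, THEN spec, of W1, THEN mp], intro conjI allI impI)
    show "W1 y = (if norm (y - x0) < r then v (x0, t0) + g \<bullet> (y - x0) + \<Lambda> * (norm (y - x0))\<^sup>2 else v (y, t0))" for y
      by (rule W1_def)
  qed (use tail x0 r le in auto)
  then obtain l where i: "\<And>\<epsilon>. 0 < \<epsilon> \<Longrightarrow> integrable lebesgue (\<lambda>h. indicator (- ball 0 \<epsilon>) h * (spow p (W1 x0 - W1 (x0 + h)) * norm h powr - n))"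
    and l: "l \<ge> nonloc p n (\<lambda>x. v (x, t0)) x0 \<delta> - C * (\<Lambda> * (norm g + \<Lambda> * \<delta>) powr (p - 2) * \<delta> powr (p - q))"
      "((\<lambda>\<epsilon>. nonloc p n W1 x0 \<epsilon>) \<longlongrightarrow> l) (at_right 0)" by blast
  have neg: "spow p (- W1 x0 - - W1 y) = - spow p (W1 x0 - W1 y)" for y
    using spow_minus[of p "W1 x0 - W1 y"] by simp
  have i': "integrable lebesgue (\<lambda>h. indicator (- ball 0 \<epsilon>) h * (spow p (- W1 x0 - - W1 (x0 + h)) * norm h powr - n))" if "0 < \<epsilon>" for \<epsilon>
    using Bochner_Integration.integrable_minus[OF i[OF that]] unfolding neg by simp
  have l': "((\<lambda>\<epsilon>. nonloc p n (\<lambda>y. - W1 y) x0 \<epsilon>) \<longlongrightarrow> - l) (at_right 0)"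
  proof -
    have "nonloc p n (\<lambda>y. - W1 y) x0 \<epsilon> = - nonloc p n W1 x0 \<epsilon>" for \<epsilon>
      unfolding nonloc_def neg by simp
    then show ?thesis using tendsto_minus[OF l(2)] by simp
  qed
  have fr: "frac_p_laplacian p s W1 x0 = ereal l" by (rule frac_lap_eq[OF n W1m i l(2)])
  have fr': "frac_p_laplacian p s (\<lambda>y. - W1 y) x0 = ereal (- l)"
    by (rule frac_lap_eq[OF n _ i' l']) (use W1m in auto)
  \<comment> \<open>\<open>t0\<close> is the right end of the interval and a limit point of it,
    which makes the one-sided derivative unique.\<close>
  have nb: "at t0 within {t0 - r\<^sup>2<..t0} \<noteq> bot"
    using r by (simp add: trivial_limit_within islimpt_Ioc)
  have d: "((\<lambda>\<tau>. ?\<phi> (x0, \<tau>)) has_vector_derivative \<beta>' t0) (at t0 within {t0 - r\<^sup>2<..t0})"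
    unfolding has_real_derivative_iff_has_vector_derivative[symmetric] test_fun_def case_prod_conv
    by (rule derivative_eq_intros has_field_derivative_at_within[OF \<beta>(1)] refl | simp)+
  have d': "((\<lambda>\<tau>. - ?\<phi> (x0, \<tau>)) has_vector_derivative - \<beta>' t0) (at t0 within {t0 - r\<^sup>2<..t0})"
    by (rule has_vector_derivative_minus[OF d])
  show ?thesis
  proof (rule that[OF r(1) sub])
    show "\<forall>z\<in>parab_cyl r x0 t0. v z \<le> ?\<phi> z" using above by blast
    show "visc_operator p s v ?\<phi> r x0 t0 = ereal (\<beta>' t0 + l)"
      unfolding visc_operator_def W1e fr vector_derivative_within[OF nb d] by simp
    show "visc_operator p s (\<lambda>z. - v z) (\<lambda>z. - ?\<phi> z) r x0 t0 = ereal (- (\<beta>' t0 + l))"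
      unfolding visc_operator_def W1e' fr' vector_derivative_within[OF nb d'] by simp
  qed (rule l(1))
qed

text \<open>\<open>Z\<close> plays the role of the contact set. The supersolution property of \<open>u\<close> is expressed by
  applying \<open>qsub\<close> to \<open>-u\<close> with \<open>Z = {}\<close>.\<close>

definition qsub :: "real \<Rightarrow> real \<Rightarrow> real \<Rightarrow> real \<Rightarrow> real \<Rightarrow> ((real ^ 'd) \<times> real \<Rightarrow> real) \<Rightarrow> ((real ^ 'd) \<times> real) set \<Rightarrow> bool" where
  "qsub p q n \<kappa> C v Z \<longleftrightarrow> (\<forall>x0 t0 g \<Lambda> \<beta> \<beta>' \<delta>. touch v x0 t0 g \<Lambda> \<beta> \<beta>' \<delta> \<longrightarrow> (x0, t0) \<in> Z \<or>
     \<kappa> * \<beta>' t0 + nonloc p n (\<lambda>x. v (x, t0)) x0 \<delta> \<le> C * (\<Lambda> * (norm g + \<Lambda> * \<delta>) powr (p - 2) * \<delta> powr (p - q)))"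

lemma tail_fun_tail_space:
  fixes u :: "(real ^ 'd) \<times> real \<Rightarrow> real"
  assumes "tail_continuous p s (- 1) 0 u" "- 1 < t" "t \<le> 0" "n = real CARD('d) + s * p"
  shows "tail_fun p n (\<lambda>x. u (x, t))"
  using assms by (auto simp: tail_continuous_def tail_space_def tail_fun_def)

lemma tail_fun_uminus: "tail_fun p n (\<lambda>x. - w x) \<longleftrightarrow> tail_fun p n w"
  by (simp add: tail_fun_def)

lemma visc_sub_qsub:
  fixes u :: "(real ^ 'd) \<times> real \<Rightarrow> real"
  assumes n: "n = real CARD('d) + s * p" and C: "pv_bound TYPE('d) p q n C"
    and u: "visc_subsolution p s ob (ball 0 1) (- 1) 0 u"
  shows "qsub p q n 1 C u {z. u z \<le> ob z}"
  unfolding qsub_def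
proof (intro allI impI)
  fix x0 t0 g \<Lambda> \<beta> \<beta>' \<delta> assume touch: "touch u x0 t0 g \<Lambda> \<beta> \<beta>' \<delta>"
  have tf: "tail_fun p n (\<lambda>x. u (x, t0))"
    using u touch by (intro tail_fun_tail_space[OF _ _ _ n]) (auto simp: visc_subsolution_def touch_def)
  obtain r l where r: "0 < r" "parab_cyl r x0 t0 \<subseteq> ball 0 1 \<times> {-1<..0}"
    "\<forall>z\<in>parab_cyl r x0 t0. u z \<le> test_fun u x0 t0 g \<Lambda> \<beta> z"
    "visc_operator p s u (test_fun u x0 t0 g \<Lambda> \<beta>) r x0 t0 = ereal (\<beta>' t0 + l)"
    "visc_operator p s (\<lambda>z. - u z) (\<lambda>z. - test_fun u x0 t0 g \<Lambda> \<beta> z) r x0 t0 = ereal (- (\<beta>' t0 + l))"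
    "l \<ge> nonloc p n (\<lambda>x. u (x, t0)) x0 \<delta> - C * (\<Lambda> * (norm g + \<Lambda> * \<delta>) powr (p - 2) * \<delta> powr (p - q))"
    by (rule touch_data[OF n C tf touch])
  have "C2_on (parab_cyl r x0 t0) (test_fun u x0 t0 g \<Lambda> \<beta>)"
    by (rule C2_on_test_fun[of _ \<beta>']) (use touch in \<open>auto simp: touch_def\<close>)
  moreover have "test_fun u x0 t0 g \<Lambda> \<beta> (x0, t0) = u (x0, t0)" by (simp add: test_fun_def)
  ultimately have "min (ereal (u (x0, t0) - ob (x0, t0))) (visc_operator p s u (test_fun u x0 t0 g \<Lambda> \<beta>) r x0 t0) \<le> 0"
    using u r(1-3) unfolding visc_subsolution_def by blast
  then have "u (x0, t0) \<le> ob (x0, t0) \<or> \<beta>' t0 + l \<le> 0"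
    unfolding r(4) by (auto simp: min_def split: if_splits)
  then show "(x0, t0) \<in> {z. u z \<le> ob z} \<or> 1 * \<beta>' t0 + nonloc p n (\<lambda>x. u (x, t0)) x0 \<delta> \<le> C * (\<Lambda> * (norm g + \<Lambda> * \<delta>) powr (p - 2) * \<delta> powr (p - q))"
    using r(6) by auto
qed

text \<open>A nonnegative minimum yields two facts at a touching point: the obstacle lies below
  \<open>u\<close>, and the operator has the sign of a subsolution for \<open>- u\<close>, without
  any exceptional set.\<close>

lemma visc_super_touch:
  fixes u :: "(real ^ 'd) \<times> real \<Rightarrow> real"
  assumes n: "n = real CARD('d) + s * p" and C: "pv_bound TYPE('d) p q n C"
    and u: "visc_supersolution p s ob (ball 0 1) (- 1) 0 u"
    and touch: "touch (\<lambda>z. - u z) x0 t0 g \<Lambda> \<beta> \<beta>' \<delta>"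
  shows "ob (x0, t0) \<le> u (x0, t0)"
    and "\<beta>' t0 + nonloc p n (\<lambda>x. - u (x, t0)) x0 \<delta> \<le> C * (\<Lambda> * (norm g + \<Lambda> * \<delta>) powr (p - 2) * \<delta> powr (p - q))"
proof -
  let ?v = "\<lambda>z. - u z"
  have "tail_fun p n (\<lambda>x. u (x, t0))"
    using u touch by (intro tail_fun_tail_space[OF _ _ _ n]) (auto simp: visc_supersolution_def touch_def)
  then have tf: "tail_fun p n (\<lambda>x. ?v (x, t0))" by (simp add: tail_fun_uminus)
  obtain r l where r: "0 < r" "parab_cyl r x0 t0 \<subseteq> ball 0 1 \<times> {-1<..0}"
    "\<forall>z\<in>parab_cyl r x0 t0. ?v z \<le> test_fun ?v x0 t0 g \<Lambda> \<beta> z"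
    "visc_operator p s ?v (test_fun ?v x0 t0 g \<Lambda> \<beta>) r x0 t0 = ereal (\<beta>' t0 + l)"
    "visc_operator p s (\<lambda>z. - ?v z) (\<lambda>z. - test_fun ?v x0 t0 g \<Lambda> \<beta> z) r x0 t0 = ereal (- (\<beta>' t0 + l))"
    "l \<ge> nonloc p n (\<lambda>x. ?v (x, t0)) x0 \<delta> - C * (\<Lambda> * (norm g + \<Lambda> * \<delta>) powr (p - 2) * \<delta> powr (p - q))"
    by (rule touch_data[OF n C tf touch])
  let ?\<phi> = "\<lambda>z. - test_fun ?v x0 t0 g \<Lambda> \<beta> z"
  have "C2_on (parab_cyl r x0 t0) ?\<phi>"
    by (rule C2_on_uminus, rule C2_on_test_fun[of _ \<beta>']) (use touch in \<open>auto simp: touch_def\<close>)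
  moreover have "?\<phi> (x0, t0) = u (x0, t0)" by (simp add: test_fun_def)
  moreover have "\<forall>z\<in>parab_cyl r x0 t0. ?\<phi> z \<le> u z" using r(3) by force
  ultimately have "min (ereal (u (x0, t0) - ob (x0, t0))) (visc_operator p s u ?\<phi> r x0 t0) \<ge> 0"
    using u r(1,2) unfolding visc_supersolution_def by blast
  then have "ob (x0, t0) \<le> u (x0, t0) \<and> \<beta>' t0 + l \<le> 0"
    using r(5) by (auto simp: min_def split: if_splits)
  then show "ob (x0, t0) \<le> u (x0, t0)"
    "\<beta>' t0 + nonloc p n (\<lambda>x. - u (x, t0)) x0 \<delta> \<le> C * (\<Lambda> * (norm g + \<Lambda> * \<delta>) powr (p - 2) * \<delta> powr (p - q))"
    using r(6) by auto
qed

subsection \<open>Comparison of the nonlocal terms at two points\<close>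

definition weight :: "real \<Rightarrow> real ^ 'd \<Rightarrow> real" where
  "weight n z = 1 / (1 + norm z powr n)"

definition kmax :: "real \<Rightarrow> real \<Rightarrow> real ^ 'd \<Rightarrow> real" where
  "kmax n R h = max (norm h) R powr - n"

lemma weight_nonneg: "0 \<le> weight n z"
  unfolding weight_def by (intro divide_nonneg_nonneg add_nonneg_nonneg) auto

lemma tail_fun_iff: "tail_fun p n w \<longleftrightarrow> w \<in> borel_measurable lebesgue \<and> integrable lebesgue (\<lambda>z. \<bar>w z\<bar> powr (p - 1) * weight n z)"
  by (simp add: tail_fun_def weight_def)

lemma tail_int_eq: "tail_int p n w = (LINT z|lebesgue. \<bar>w z\<bar> powr (p - 1) * weight n z)"
  by (simp add: tail_int_def weight_def)

lemma kmax_nonneg: "0 \<le> kmax n R h"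
  by (simp add: kmax_def)

lemma borel_measurable_kmax [measurable]: "kmax n R \<in> borel_measurable borel"
  unfolding kmax_def by measurable

lemma borel_measurable_weight [measurable]: "weight n \<in> borel_measurable borel"
  unfolding weight_def by measurable

lemma tail_fun_diff:
  assumes p: "2 < p" and W: "tail_fun p n W" and V: "tail_fun p n V"
  shows "tail_fun p n (\<lambda>z. W z - V z)"
    and "tail_int p n (\<lambda>z. W z - V z) \<le> 2 powr (p - 1) * (tail_int p n W + tail_int p n V)"
proof -
  have [measurable]: "W \<in> borel_measurable lebesgue" "V \<in> borel_measurable lebesgue"
    using W V by (auto simp: tail_fun_iff)
  let ?g = "\<lambda>z. 2 powr (p - 1) * (\<bar>W z\<bar> powr (p - 1) * weight n z + \<bar>V z\<bar> powr (p - 1) * weight n z)"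
  have g: "integrable lebesgue ?g"
    using W V by (intro integrable_mult_right Bochner_Integration.integrable_add) (auto simp: tail_fun_iff)
  have le: "\<bar>W z - V z\<bar> powr (p - 1) * weight n z \<le> ?g z" for z
  proof -
    have "\<bar>W z - V z\<bar> powr (p - 1) \<le> (\<bar>W z\<bar> + \<bar>V z\<bar>) powr (p - 1)"
      using p by (intro powr_mono2) auto
    also have "\<dots> \<le> 2 powr (p - 1) * (\<bar>W z\<bar> powr (p - 1) + \<bar>V z\<bar> powr (p - 1))"
      using p by (intro powr_add_le) auto
    finally have "\<bar>W z - V z\<bar> powr (p - 1) * weight n z \<le> 2 powr (p - 1) * (\<bar>W z\<bar> powr (p - 1) + \<bar>V z\<bar> powr (p - 1)) * weight n z"
      by (intro mult_right_mono weight_nonneg)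
    then show ?thesis by (simp only: distrib_left distrib_right mult.assoc)
  qed
  have i: "integrable lebesgue (\<lambda>z. \<bar>W z - V z\<bar> powr (p - 1) * weight n z)"
  proof (rule Bochner_Integration.integrable_bound[OF g])
    show "(\<lambda>z. \<bar>W z - V z\<bar> powr (p - 1) * weight n z) \<in> borel_measurable lebesgue" by measurable
    show "AE z in lebesgue. norm (\<bar>W z - V z\<bar> powr (p - 1) * weight n z) \<le> norm (?g z)"
    proof (rule AE_I2)
      fix z
      have "norm (\<bar>W z - V z\<bar> powr (p - 1) * weight n z) = \<bar>W z - V z\<bar> powr (p - 1) * weight n z"
        using weight_nonneg[of n z] by simp
      also have "\<dots> \<le> ?g z" by (rule le)
      also have "\<dots> \<le> norm (?g z)" unfolding real_norm_def by (rule abs_ge_self)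
      finally show "norm (\<bar>W z - V z\<bar> powr (p - 1) * weight n z) \<le> norm (?g z)" .
    qed
  qed
  then show "tail_fun p n (\<lambda>z. W z - V z)" by (simp add: tail_fun_iff)
  have "tail_int p n (\<lambda>z. W z - V z) \<le> integral\<^sup>L lebesgue ?g"
    unfolding tail_int_eq by (rule integral_mono[OF i g le])
  also have "\<dots> = 2 powr (p - 1) * (tail_int p n W + tail_int p n V)"
    using W V unfolding tail_int_eq tail_fun_iff by simp
  finally show "tail_int p n (\<lambda>z. W z - V z) \<le> 2 powr (p - 1) * (tail_int p n W + tail_int p n V)" .
qed

lemma powr_neg_diff_le:
  assumes "0 < a" "a \<le> b" "0 \<le> (n::real)"
  shows "a powr - n - b powr - n \<le> n * (b - a) * a powr (- n - 1)"
proof (cases "a = b")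
  case False
  then have ab: "a < b" using assms by simp
  have "\<exists>z>a. z < b \<and> b powr - n - a powr - n = (b - a) * (- n * z powr (- n - 1))"
  proof (intro MVT2 ab)
    fix x assume "a \<le> x"
    then show "((\<lambda>x. x powr - n) has_real_derivative - n * x powr (- n - 1)) (at x)"
      using assms by (intro has_real_derivative_powr) auto
  qed
  then obtain z where z: "a < z" "b powr - n - a powr - n = (b - a) * (- n * z powr (- n - 1))" by blast
  have "z powr (- n - 1) \<le> a powr (- n - 1)" using z assms by (intro powr_mono2') auto
  then have "n * (b - a) * z powr (- n - 1) \<le> n * (b - a) * a powr (- n - 1)"
    using ab assms by (intro mult_left_mono) auto
  then show ?thesis using z(2) by (simp add: algebra_simps)
qed simp

lemma kmax_le_weight:
  assumes "0 \<le> n" "0 < R" "norm x \<le> 1"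
  shows "kmax n R (z - x) \<le> 2 * (2 / R + 1) powr n * weight n z"
  using kernel_bound[OF assms, of z] by (simp add: kmax_def weight_def)

text \<open>A relative Lipschitz bound: for radii at least \<open>R\<close>, the derivative of the
  power \<open>- n\<close> is at most \<open>n / R\<close> times the power itself. The error is thus
  again dominated by the tail weight.\<close>

lemma kmax_diff_le:
  assumes "0 \<le> n" "0 < R"
  shows "\<bar>kmax n R (z - x) - kmax n R (z - y)\<bar> \<le> n / R * norm (x - y) * (kmax n R (z - x) + kmax n R (z - y))"
proof -
  have main: "k1 powr - n - k2 powr - n \<le> n / R * d * (k1 powr - n + k2 powr - n)"
    if "R \<le> k1" "k1 \<le> k2" "k2 - k1 \<le> d" for k1 k2 d :: real
  proof -
    have k: "0 < k1" "0 \<le> d" using that assms by auto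
    have "k1 powr - n - k2 powr - n \<le> n * (k2 - k1) * k1 powr (- n - 1)"
      by (rule powr_neg_diff_le) (use k that assms in auto)
    also have "\<dots> \<le> n * d * (k1 powr - n / R)"
    proof (intro mult_mono)
      have "k1 powr (- n - 1) = k1 powr - n / k1" using k by (simp add: powr_diff)
      also have "\<dots> \<le> k1 powr - n / R" using that assms by (intro divide_left_mono mult_pos_pos) auto
      finally show "k1 powr (- n - 1) \<le> k1 powr - n / R" .
    qed (use k that assms in auto)
    also have "\<dots> = n / R * d * k1 powr - n" by simp
    also have "\<dots> \<le> n / R * d * (k1 powr - n + k2 powr - n)"
      using k assms by (intro mult_left_mono) auto
    finally show ?thesis .
  qed
  have d: "\<bar>norm (z - x) - norm (z - y)\<bar> \<le> norm (x - y)"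
    using norm_triangle_ineq3[of "z - x" "z - y"] by (simp add: norm_minus_commute)
  show ?thesis
  proof (cases "max (norm (z - x)) R \<le> max (norm (z - y)) R")
    case True
    then have "kmax n R (z - y) \<le> kmax n R (z - x)"
      unfolding kmax_def using assms by (intro powr_mono2') auto
    then show ?thesis
      using main[OF _ True, of "norm (x - y)"] d unfolding kmax_def by (auto simp: max_def split: if_splits)
  next
    case False
    then have F: "max (norm (z - y)) R \<le> max (norm (z - x)) R" by linarith
    then have "kmax n R (z - x) \<le> kmax n R (z - y)"
      unfolding kmax_def using assms by (intro powr_mono2') auto
    then show ?thesis
      using main[OF _ F, of "norm (x - y)"] d unfolding kmax_def by (auto simp: max_def add.commute split: if_splits)
  qed
qed

lemma abs_spow_diff_le:
  assumes "2 < p" "\<bar>c\<bar> \<le> 1"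
  shows "\<bar>spow p (c - w)\<bar> \<le> 2 powr (p - 1) * (1 + \<bar>w\<bar> powr (p - 1))"
proof -
  have "\<bar>spow p (c - w)\<bar> \<le> (1 + \<bar>w\<bar>) powr (p - 1)"
    unfolding abs_spow using assms by (intro powr_mono2) auto
  also have "\<dots> \<le> 2 powr (p - 1) * (1 powr (p - 1) + \<bar>w\<bar> powr (p - 1))"
    using assms by (intro powr_add_le) auto
  finally show ?thesis by simp
qed

lemma kmax_integrable:
  fixes W :: "real ^ 'd \<Rightarrow> real"
  assumes p: "2 < p" and q: "0 < q" and n: "n = real CARD('d) + q" and R: "0 < R" and W: "tail_fun p n W"
    and x: "norm x \<le> 1" and c: "\<bar>c\<bar> \<le> 1"
  shows "integrable lebesgue (\<lambda>z. spow p (c - W z) * kmax n R (z - x))"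
    and "(\<lambda>z. spow p (c - W z) * kmax n R (z - x)) \<in> borel_measurable lebesgue"
proof -
  have [measurable]: "W \<in> borel_measurable lebesgue" using W by (simp add: tail_fun_iff)
  show m: "(\<lambda>z. spow p (c - W z) * kmax n R (z - x)) \<in> borel_measurable lebesgue" by measurable
  have n0: "0 \<le> n" using n q by simp
  let ?C = "2 powr (p - 1) * (2 * (2 / R + 1) powr n)"
  let ?g = "\<lambda>z. ?C * (weight n z + \<bar>W z\<bar> powr (p - 1) * weight n z)"
  have g: "integrable lebesgue ?g"
    using W weight_integrable[OF q, where 'd='d] n unfolding tail_fun_iff weight_def
    by (intro integrable_mult_right Bochner_Integration.integrable_add) auto
  show "integrable lebesgue (\<lambda>z. spow p (c - W z) * kmax n R (z - x))"
  proof (rule Bochner_Integration.integrable_bound[OF g m], rule AE_I2)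
    fix z
    have "norm (spow p (c - W z) * kmax n R (z - x)) = \<bar>spow p (c - W z)\<bar> * kmax n R (z - x)"
      using kmax_nonneg[of n R "z - x"] by (simp add: abs_mult)
    also have "\<dots> \<le> 2 powr (p - 1) * (1 + \<bar>W z\<bar> powr (p - 1)) * (2 * (2 / R + 1) powr n * weight n z)"
      by (intro mult_mono abs_spow_diff_le p c kmax_le_weight n0 R x) (auto simp: kmax_nonneg)
    also have "\<dots> = ?g z" by (simp only: distrib_left distrib_right mult_1_left mult_1_right mult_ac)
    also have "\<dots> \<le> norm (?g z)" unfolding real_norm_def by (rule abs_ge_self)
    finally show "norm (spow p (c - W z) * kmax n R (z - x)) \<le> norm (?g z)" .
  qed
qed

text \<open>In the absolute variable \<open>z\<close> the values \<open>W z\<close> and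
  \<open>V z\<close> are close, because \<open>W\<close> and \<open>V\<close> will be the solution
  at two nearby times, while the kernels differ by a shift of length \<open>norm (x0 - y0)\<close>.
  The difference is telescoped accordingly. \<open>powr_young\<close> with weight
  \<open>l = r powr \<theta>\<close> separates the small difference of the two increments from their
  possibly large sizes.\<close>

lemma far_diff:
  assumes p: "2 < p" and q: "0 < q" and n: "n = real CARD('d) + q" and R: "0 < R"
    and \<theta>: "0 \<le> \<theta>" "\<theta> \<le> 1" and c2: "0 \<le> c2"
  shows "\<exists>c>0. \<forall>W V (x0 :: real ^ 'd) y0.
     tail_fun p n W \<and> tail_fun p n V \<and> tail_int p n W \<le> 1 \<and> tail_int p n V \<le> 1 \<and>
     x0 \<noteq> y0 \<and> norm (x0 - y0) \<le> 1 \<and> norm x0 \<le> 1 \<and> norm y0 \<le> 1 \<and> \<bar>W x0\<bar> \<le> 1 \<and> \<bar>V y0\<bar> \<le> 1 \<and>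
     \<bar>W x0 - V y0\<bar> \<le> c2 * norm (x0 - y0) powr \<theta> \<and> tail_int p n (\<lambda>z. W z - V z) \<le> norm (x0 - y0) powr (p - 1) \<longrightarrow>
     - (c * norm (x0 - y0) powr \<theta>) \<le> (LINT z|lebesgue. spow p (W x0 - W z) * kmax n R (z - x0)) - (LINT z|lebesgue. spow p (V y0 - V z) * kmax n R (z - y0))"
proof -
  define I0 where "I0 = (LINT z|lebesgue. weight n (z :: real ^ 'd))"
  have wi: "integrable lebesgue (weight n :: real ^ 'd \<Rightarrow> real)"
    using weight_integrable[OF q, where 'd='d] n unfolding weight_def[abs_def] by simp
  have I0: "0 \<le> I0" unfolding I0_def by (intro integral_nonneg_AE AE_I2 weight_nonneg)
  have n0: "0 \<le> n" using n q by simp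
  define CR where "CR = 2 * (2 / R + 1) powr n"
  have "0 < 2 / R + 1" using R by (simp add: add_pos_pos)
  then have CR: "0 < CR" unfolding CR_def by simp
  \<comment> \<open>\<open>?a\<close> belongs to the Young term with the sizes of the increments,
    \<open>?b\<close> to the one with their difference, \<open>?e\<close> to the shift of the
    kernel.\<close>
  let ?a = "(p - 1) * 4 powr (p - 1)" and ?b = "(p - 1) * 2 powr (p - 1)" and ?e = "2 * n / R * 2 powr (p - 1)"
  let ?c = "CR * (?a * (I0 + 2) + ?b * (c2 powr (p - 1) * I0 + 1) + ?e * (I0 + 1))"
  have abe: "0 < ?a" "0 < ?b" "0 \<le> ?e" using p n0 R by auto
  have "0 < ?a * (I0 + 2)" using I0 by (intro mult_pos_pos[OF abe(1)]) auto
  moreover have "0 \<le> ?b * (c2 powr (p - 1) * I0 + 1)"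
    using abe(2) I0 by (intro mult_nonneg_nonneg[of ?b] less_imp_le[OF abe(2)] add_nonneg_nonneg) auto
  moreover have "0 \<le> ?e * (I0 + 1)" using I0 by (intro mult_nonneg_nonneg[of ?e] abe(3)) auto
  ultimately have c: "0 < ?c" using CR by (intro mult_pos_pos) linarith+
  moreover
  { fix W V :: "real ^ 'd \<Rightarrow> real" and x0 y0
    assume W: "tail_fun p n W" "tail_int p n W \<le> 1" and V: "tail_fun p n V" "tail_int p n V \<le> 1"
      and ne: "x0 \<noteq> y0" and r1: "norm (x0 - y0) \<le> 1" and x0: "norm x0 \<le> 1" "norm y0 \<le> 1" "\<bar>W x0\<bar> \<le> 1" "\<bar>V y0\<bar> \<le> 1"
      and d: "\<bar>W x0 - V y0\<bar> \<le> c2 * norm (x0 - y0) powr \<theta>" and t: "tail_int p n (\<lambda>z. W z - V z) \<le> norm (x0 - y0) powr (p - 1)"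
    define r where "r = norm (x0 - y0)"
    define l where "l = r powr \<theta>"
    define D where "D z = W z - V z" for z
    have r: "0 < r" "r \<le> 1" using ne r1 by (auto simp: r_def)
    have l: "0 < l" using r by (simp add: l_def)
    have rl: "r \<le> l" unfolding l_def using r \<theta> powr_mono'[of \<theta> 1 r] by simp
    define A2 where "A2 = CR * (?a * l)"
    define A3 where "A3 = CR * (?a * l + ?e * r)"
    define A1 where "A1 = CR * (?a * l + ?b * c2 powr (p - 1) * l + ?e * r)"
    define A4 where "A4 = CR * (?b * l powr - (p - 2))"
    have pt: "- (A1 * weight n z + A2 * (\<bar>W z\<bar> powr (p - 1) * weight n z) + A3 * (\<bar>V z\<bar> powr (p - 1) * weight n z) + A4 * (\<bar>D z\<bar> powr (p - 1) * weight n z))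
       \<le> spow p (W x0 - W z) * kmax n R (z - x0) - spow p (V y0 - V z) * kmax n R (z - y0)" for z
    proof -
      let ?\<alpha> = "W x0 - W z" and ?\<beta> = "V y0 - V z"
      let ?w = "\<bar>W z\<bar> powr (p - 1)" and ?v = "\<bar>V z\<bar> powr (p - 1)" and ?d = "\<bar>D z\<bar> powr (p - 1)"
      have k: "kmax n R (z - x0) \<le> CR * weight n z" "kmax n R (z - y0) \<le> CR * weight n z"
        using kmax_le_weight[OF n0 R] x0 unfolding CR_def by auto
      have s: "(\<bar>?\<alpha>\<bar> + \<bar>?\<beta>\<bar>) powr (p - 1) \<le> 4 powr (p - 1) * (1 + ?w + ?v)"
      proof -
        have "(\<bar>?\<alpha>\<bar> + \<bar>?\<beta>\<bar>) powr (p - 1) \<le> (2 + (\<bar>W z\<bar> + \<bar>V z\<bar>)) powr (p - 1)"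
          using p x0 by (intro powr_mono2) auto
        also have "\<dots> \<le> 2 powr (p - 1) * (2 powr (p - 1) + (\<bar>W z\<bar> + \<bar>V z\<bar>) powr (p - 1))"
          using p by (intro powr_add_le) auto
        also have "\<dots> \<le> 2 powr (p - 1) * (2 powr (p - 1) + 2 powr (p - 1) * (?w + ?v))"
          using p powr_add_le[of "\<bar>W z\<bar>" "\<bar>V z\<bar>" "p - 1"] by (intro mult_left_mono add_left_mono) auto
        also have "\<dots> = (2 powr (p - 1) * 2 powr (p - 1)) * (1 + ?w + ?v)" by (simp add: algebra_simps)
        also have "2 powr (p - 1) * 2 powr (p - 1) = (4 :: real) powr (p - 1)"
          using powr_mult[of 2 2 "p - 1"] by simp
        finally show ?thesis .
      qed
      have ab: "\<bar>?\<alpha> - ?\<beta>\<bar> powr (p - 1) \<le> 2 powr (p - 1) * (c2 powr (p - 1) * l powr (p - 1) + ?d)"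
      proof -
        have "\<bar>?\<alpha> - ?\<beta>\<bar> powr (p - 1) \<le> (c2 * l + \<bar>D z\<bar>) powr (p - 1)"
          using p d unfolding D_def l_def r_def by (intro powr_mono2) auto
        also have "\<dots> \<le> 2 powr (p - 1) * ((c2 * l) powr (p - 1) + ?d)"
          using p c2 l by (intro powr_add_le) auto
        finally show ?thesis by (simp only: powr_mult)
      qed
      have ll: "l powr - (p - 2) * l powr (p - 1) = l" using l by (simp add: powr_add[symmetric])
      have "\<bar>spow p ?\<alpha> - spow p ?\<beta>\<bar> \<le> (p - 1) * \<bar>?\<alpha> - ?\<beta>\<bar> * (\<bar>?\<alpha>\<bar> + \<bar>?\<beta>\<bar>) powr (p - 2)"
        by (rule spow_diff_le[OF p])
      also have "\<dots> = (p - 1) * (\<bar>?\<alpha> - ?\<beta>\<bar> * (\<bar>?\<alpha>\<bar> + \<bar>?\<beta>\<bar>) powr (p - 2))" by simp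
      also have "\<dots> \<le> (p - 1) * (l * (\<bar>?\<alpha>\<bar> + \<bar>?\<beta>\<bar>) powr (p - 1) + l powr - (p - 2) * \<bar>?\<alpha> - ?\<beta>\<bar> powr (p - 1))"
        using p l by (intro mult_left_mono powr_young) auto
      also have "\<dots> \<le> (p - 1) * (l * (4 powr (p - 1) * (1 + ?w + ?v)) + l powr - (p - 2) * (2 powr (p - 1) * (c2 powr (p - 1) * l powr (p - 1) + ?d)))"
        using p l s ab by (intro mult_left_mono add_mono) auto
      also have "\<dots> = ?a * l * (1 + ?w + ?v) + ?b * (c2 powr (p - 1) * (l powr - (p - 2) * l powr (p - 1)) + l powr - (p - 2) * ?d)"
        by (simp only: distrib_left distrib_right mult_ac)
      also have "\<dots> = ?a * l * (1 + ?w + ?v) + ?b * (c2 powr (p - 1) * l + l powr - (p - 2) * ?d)"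
        unfolding ll ..
      finally have 1: "\<bar>spow p ?\<alpha> - spow p ?\<beta>\<bar> \<le> ?a * l * (1 + ?w + ?v) + ?b * (c2 powr (p - 1) * l + l powr - (p - 2) * ?d)" .
      have "\<bar>kmax n R (z - x0) - kmax n R (z - y0)\<bar> \<le> n / R * r * (kmax n R (z - x0) + kmax n R (z - y0))"
        unfolding r_def by (rule kmax_diff_le[OF n0 R])
      also have "\<dots> \<le> n / R * r * (2 * (CR * weight n z))"
        using k n0 R r by (intro mult_left_mono) auto
      finally have 2: "\<bar>kmax n R (z - x0) - kmax n R (z - y0)\<bar> \<le> 2 * n / R * r * (CR * weight n z)" by (simp add: mult_ac)
      have 3: "\<bar>spow p ?\<beta>\<bar> \<le> 2 powr (p - 1) * (1 + ?v)" by (rule abs_spow_diff_le[OF p x0(4)])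
      have 0: "\<bar>spow p ?\<alpha> - spow p ?\<beta>\<bar> * kmax n R (z - x0) + \<bar>spow p ?\<beta>\<bar> * \<bar>kmax n R (z - x0) - kmax n R (z - y0)\<bar> \<le>
         (?a * l * (1 + ?w + ?v) + ?b * (c2 powr (p - 1) * l + l powr - (p - 2) * ?d)) * (CR * weight n z)
         + (2 powr (p - 1) * (1 + ?v)) * (2 * n / R * r * (CR * weight n z))"
        by (rule add_mono[OF mult_mono[OF 1 k(1) order_trans[OF abs_ge_zero 1] kmax_nonneg]
              mult_mono[OF 3 2 order_trans[OF abs_ge_zero 3] abs_ge_zero]])
      also have "\<dots> = A1 * weight n z + A2 * (?w * weight n z) + A3 * (?v * weight n z) + A4 * (?d * weight n z)"
        unfolding A1_def A2_def A3_def A4_def by (simp add: algebra_simps)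
      finally have 4: "\<bar>spow p ?\<alpha> - spow p ?\<beta>\<bar> * kmax n R (z - x0) + \<bar>spow p ?\<beta>\<bar> * \<bar>kmax n R (z - x0) - kmax n R (z - y0)\<bar> \<le> \<dots>" .
      have "spow p ?\<alpha> * kmax n R (z - x0) - spow p ?\<beta> * kmax n R (z - y0) =
        (spow p ?\<alpha> - spow p ?\<beta>) * kmax n R (z - x0) + spow p ?\<beta> * (kmax n R (z - x0) - kmax n R (z - y0))"
        by (simp add: algebra_simps)
      moreover have "- (\<bar>spow p ?\<alpha> - spow p ?\<beta>\<bar> * kmax n R (z - x0)) \<le> (spow p ?\<alpha> - spow p ?\<beta>) * kmax n R (z - x0)"
        using mult_right_mono[of "- \<bar>spow p ?\<alpha> - spow p ?\<beta>\<bar>" "spow p ?\<alpha> - spow p ?\<beta>" "kmax n R (z - x0)"] kmax_nonneg[of n R "z - x0"] by simp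
      moreover have "- (\<bar>spow p ?\<beta>\<bar> * \<bar>kmax n R (z - x0) - kmax n R (z - y0)\<bar>) \<le> spow p ?\<beta> * (kmax n R (z - x0) - kmax n R (z - y0))"
        by (metis abs_ge_minus_self abs_mult minus_le_iff)
      ultimately show ?thesis using 4 by linarith
    qed
    have D: "tail_fun p n D" unfolding D_def[abs_def] by (rule tail_fun_diff[OF p W(1) V(1)])
    have i: "integrable lebesgue (\<lambda>z. \<bar>W z\<bar> powr (p - 1) * weight n z)" "integrable lebesgue (\<lambda>z. \<bar>V z\<bar> powr (p - 1) * weight n z)"
      "integrable lebesgue (\<lambda>z. \<bar>D z\<bar> powr (p - 1) * weight n z)" using W V D by (auto simp: tail_fun_iff)
    let ?L = "\<lambda>z. A1 * weight n z + A2 * (\<bar>W z\<bar> powr (p - 1) * weight n z) + A3 * (\<bar>V z\<bar> powr (p - 1) * weight n z) + A4 * (\<bar>D z\<bar> powr (p - 1) * weight n z)"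
    have Li: "integrable lebesgue ?L" by (intro Bochner_Integration.integrable_add integrable_mult_right i wi)
    have Le: "integral\<^sup>L lebesgue ?L = A1 * I0 + A2 * tail_int p n W + A3 * tail_int p n V + A4 * tail_int p n D"
      unfolding tail_int_eq I0_def using i wi by simp
    have kW: "integrable lebesgue (\<lambda>z. spow p (W x0 - W z) * kmax n R (z - x0))" by (rule kmax_integrable(1)[OF p q n R W(1) x0(1,3)])
    have kV: "integrable lebesgue (\<lambda>z. spow p (V y0 - V z) * kmax n R (z - y0))" by (rule kmax_integrable(1)[OF p q n R V(1) x0(2,4)])
    have "- integral\<^sup>L lebesgue ?L = (LINT z|lebesgue. - ?L z)" by (rule Bochner_Integration.integral_minus[symmetric])
    also have "\<dots> \<le> (LINT z|lebesgue. spow p (W x0 - W z) * kmax n R (z - x0) - spow p (V y0 - V z) * kmax n R (z - y0))"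
      by (intro integral_mono Bochner_Integration.integrable_minus Bochner_Integration.integrable_diff Li kW kV pt)
    also have "\<dots> = (LINT z|lebesgue. spow p (W x0 - W z) * kmax n R (z - x0)) - (LINT z|lebesgue. spow p (V y0 - V z) * kmax n R (z - y0))"
      by (rule Bochner_Integration.integral_diff[OF kW kV])
    finally have F: "- (A1 * I0 + A2 * tail_int p n W + A3 * tail_int p n V + A4 * tail_int p n D) \<le> \<dots>" unfolding Le .
    \<comment> \<open>This explains the power \<open>p - 1\<close> in the hypothesis on the tail of
      \<open>W - V\<close>: it compensates the factor \<open>l powr - (p - 2)\<close> from Young's
      inequality, because \<open>r \<le> l\<close>.\<close>
    have r4: "l powr - (p - 2) * r powr (p - 1) \<le> l"
    proof -
      have "l powr - (p - 2) * r powr (p - 1) \<le> l powr - (p - 2) * l powr (p - 1)"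
        using rl r p by (intro mult_left_mono powr_mono2) auto
      also have "\<dots> = l" using l by (simp add: powr_add[symmetric])
      finally show ?thesis .
    qed
    have er: "?e * r \<le> ?e * l" using abe(3) rl by (rule mult_left_mono[rotated])
    have "A1 * I0 \<le> CR * (?a * l + ?b * c2 powr (p - 1) * l + ?e * l) * I0"
      unfolding A1_def using CR I0 by (intro mult_right_mono[OF mult_left_mono[OF add_left_mono[OF er]]]) auto
    moreover have "A2 * tail_int p n W \<le> CR * (?a * l) * 1"
      unfolding A2_def using W(2) CR p l by (intro mult_left_mono) auto
    moreover have "A3 * tail_int p n V \<le> CR * (?a * l + ?e * l) * 1"
    proof -
      have "A3 * tail_int p n V \<le> A3 * 1" unfolding A3_def using V(2) CR p n0 R l r by (intro mult_left_mono mult_nonneg_nonneg add_nonneg_nonneg) auto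
      also have "\<dots> \<le> CR * (?a * l + ?e * l) * 1" unfolding A3_def using CR by (intro mult_right_mono[OF mult_left_mono[OF add_left_mono[OF er]]]) auto
      finally show ?thesis .
    qed
    moreover have "A4 * tail_int p n D \<le> CR * (?b * l)"
    proof -
      have "A4 * tail_int p n D \<le> A4 * r powr (p - 1)"
        unfolding A4_def using t CR p unfolding D_def[abs_def] r_def by (intro mult_left_mono mult_nonneg_nonneg) auto
      also have "\<dots> = CR * (?b * (l powr - (p - 2) * r powr (p - 1)))" unfolding A4_def by (simp only: mult_ac)
      also have "\<dots> \<le> CR * (?b * l)" using r4 CR abe by (intro mult_left_mono) auto
      finally show ?thesis .
    qed
    ultimately have "A1 * I0 + A2 * tail_int p n W + A3 * tail_int p n V + A4 * tail_int p n D \<le>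
      CR * (?a * l + ?b * c2 powr (p - 1) * l + ?e * l) * I0 + CR * (?a * l) * 1 + CR * (?a * l + ?e * l) * 1 + CR * (?b * l)"
      by linarith
    also have "\<dots> = ?c * l"
    proof -
      have "CR * (a * l + b * k * l + e * l) * I0 + CR * (a * l) * 1 + CR * (a * l + e * l) * 1 + CR * (b * l)
        = CR * (a * (I0 + 2) + b * (k * I0 + 1) + e * (I0 + 1)) * l" for a b e k :: real
        by (simp add: algebra_simps)
      then show ?thesis .
    qed
    finally have "- (?c * l) \<le> (LINT z|lebesgue. spow p (W x0 - W z) * kmax n R (z - x0)) - (LINT z|lebesgue. spow p (V y0 - V z) * kmax n R (z - y0))"
      using F by linarith
    then have "- (?c * norm (x0 - y0) powr \<theta>) \<le> (LINT z|lebesgue. spow p (W x0 - W z) * kmax n R (z - x0)) - (LINT z|lebesgue. spow p (V y0 - V z) * kmax n R (z - y0))"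
      unfolding l_def r_def . }
  ultimately show ?thesis by (intro exI[of _ ?c] conjI allI impI) auto
qed

lemma measure_ball_le:
  assumes "0 < \<delta>" "\<delta> \<le> 1"
  shows "measure lebesgue (ball (0 :: real ^ 'd) \<delta>) \<le> unit_ball_vol (real CARD('d)) * \<delta>"
proof -
  have "\<delta> ^ CARD('d) \<le> \<delta> ^ 1" using assms by (intro power_decreasing) (auto simp: Suc_le_eq)
  then show ?thesis
    using content_ball[of \<delta> "0 :: real ^ 'd"] assms by simp
qed

text \<open>\<open>B\<close> is a set of jumps on which the integrands differ by at least \<open>g0\<close>.\<close>

definition nonloc_gap_bound :: "'d::finite itself \<Rightarrow> real \<Rightarrow> real \<Rightarrow> real \<Rightarrow> real \<Rightarrow> real \<Rightarrow> real \<Rightarrow> real \<Rightarrow> real \<Rightarrow> real \<Rightarrow> real \<Rightarrow> bool" where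
  "nonloc_gap_bound ty p n q' \<theta> \<sigma> c1 c2 A R C \<longleftrightarrow> (\<forall>W V (x0 :: real ^ 'd) y0 r \<delta> g0 B.
     tail_fun p n W \<and> tail_fun p n V \<and> tail_int p n W \<le> 1 \<and> tail_int p n V \<le> 1 \<and>
     r = norm (x0 - y0) \<and> 0 < r \<and> r \<le> 1 \<and> norm x0 \<le> 1 \<and> norm y0 \<le> 1 \<and> \<bar>W x0\<bar> \<le> 1 \<and> \<bar>V y0\<bar> \<le> 1 \<and>
     \<bar>W x0 - V y0\<bar> \<le> c2 * r powr \<theta> \<and> tail_int p n (\<lambda>z. W z - V z) \<le> r powr (p - 1) \<and>
     0 < \<delta> \<and> \<delta> \<le> r \<and> \<delta> \<le> R \<and>
     (\<forall>h. norm h < R \<longrightarrow> - (c1 * r powr (\<theta> * (1 - \<sigma>)) * norm h powr (2 * \<sigma>)) \<le> (W x0 - W (x0 + h)) - (V y0 - V (y0 + h))) \<and>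
     (\<forall>h. norm h < R \<longrightarrow> \<bar>W x0 - W (x0 + h)\<bar> \<le> A * norm h powr \<theta> \<and> \<bar>V y0 - V (y0 + h)\<bar> \<le> A * norm h powr \<theta>) \<and>
     B \<in> sets lebesgue \<and> 0 \<le> g0 \<and>
     (\<forall>h\<in>B. \<delta> \<le> norm h \<and> norm h \<le> R / 2 \<and> norm h \<le> r \<and> g0 \<le> spow p (W x0 - W (x0 + h)) - spow p (V y0 - V (y0 + h))) \<longrightarrow>
     g0 * (r powr - n / 2) * measure lebesgue B - C * (r powr (\<theta> * (1 - \<sigma>)) * \<delta> powr q' + r powr \<theta>)
       \<le> nonloc p n W x0 \<delta> - nonloc p n V y0 \<delta>)"

text \<open>The kernel is split as \<open>(k - kmax) + kmax\<close>, where \<open>k - kmax\<close> is supported in the ball of radius \<open>R\<close>,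
  in which the increments are compared pointwise, and \<open>kmax\<close> is bounded and Lipschitz, so that
  its contributions at \<open>x0\<close> and \<open>y0\<close> can be compared after a translation.\<close>

lemma nonloc_diff:
  assumes p: "2 < p" and q: "0 < q" and n: "n = real CARD('d::finite) + q" and R: "0 < R" "R \<le> 1"
    and \<theta>: "0 \<le> \<theta>" "\<theta> \<le> 1" and \<sigma>: "0 < \<sigma>" and c: "0 \<le> c1" "0 \<le> c2" "0 \<le> A"
    and q': "q' = 3 * \<sigma> / 2 + \<theta> * (p - 2) - q" "q' \<le> 0"
  shows "\<exists>C>0. nonloc_gap_bound TYPE('d::finite) p n q' \<theta> \<sigma> c1 c2 A R C"
proof -
  from far_diff[OF p q n R(1) \<theta> c(2)] obtain cf where cf: "0 < cf" and far: "\<And>W V (x0 :: real ^ 'd) y0.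
     tail_fun p n W \<and> tail_fun p n V \<and> tail_int p n W \<le> 1 \<and> tail_int p n V \<le> 1 \<and>
     x0 \<noteq> y0 \<and> norm (x0 - y0) \<le> 1 \<and> norm x0 \<le> 1 \<and> norm y0 \<le> 1 \<and> \<bar>W x0\<bar> \<le> 1 \<and> \<bar>V y0\<bar> \<le> 1 \<and>
     \<bar>W x0 - V y0\<bar> \<le> c2 * norm (x0 - y0) powr \<theta> \<and> tail_int p n (\<lambda>z. W z - V z) \<le> norm (x0 - y0) powr (p - 1) \<Longrightarrow>
     - (cf * norm (x0 - y0) powr \<theta>) \<le> (LINT z|lebesgue. spow p (W x0 - W z) * kmax n R (z - x0)) - (LINT z|lebesgue. spow p (V y0 - V z) * kmax n R (z - y0))"
    by blast
  have "0 < \<sigma> / 2" using \<sigma> by simp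
  from radial_integral[OF this, where 'd='d] obtain K where K: "0 < K"
    "\<And>\<delta>. 0 < \<delta> \<Longrightarrow> integrable lebesgue (\<lambda>h :: real ^ 'd. indicator (ball 0 \<delta>) h * norm h powr (\<sigma> / 2 - real CARD('d)))"
    "\<And>\<delta>. 0 < \<delta> \<Longrightarrow> (LINT h|lebesgue. indicator (ball 0 \<delta>) (h :: real ^ 'd) * norm h powr (\<sigma> / 2 - real CARD('d))) \<le> K * \<delta> powr (\<sigma> / 2)"
    by blast
  define C1 where "C1 = (p - 1) * c1 * (2 * A) powr (p - 2)"
  define C3 where "C3 = 2 * A powr (p - 1) * R powr - n"
  have C1: "0 \<le> C1" "0 \<le> C3" using p c by (auto simp: C1_def C3_def)
  let ?V = "unit_ball_vol (real CARD('d))"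
  let ?C = "C1 * K + C3 * ?V + cf"
  have n1: "1 \<le> n" using n q by (simp add: add_increasing2)
  have "0 < ?C" using C1 K(1) cf by (intro add_nonneg_pos add_nonneg_nonneg mult_nonneg_nonneg) auto
  moreover
  { fix W V :: "real ^ 'd \<Rightarrow> real" and x0 y0 r \<delta> g0 B
    assume W: "tail_fun p n W" "tail_int p n W \<le> 1" and V: "tail_fun p n V" "tail_int p n V \<le> 1"
      and r: "r = norm (x0 - y0)" "0 < r" "r \<le> 1" and x0: "norm x0 \<le> 1" "norm y0 \<le> 1" "\<bar>W x0\<bar> \<le> 1" "\<bar>V y0\<bar> \<le> 1"
      and d: "\<bar>W x0 - V y0\<bar> \<le> c2 * r powr \<theta>" and t: "tail_int p n (\<lambda>z. W z - V z) \<le> r powr (p - 1)"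
      and \<delta>: "0 < \<delta>" "\<delta> \<le> r" "\<delta> \<le> R"
      and i: "\<And>h. norm h < R \<Longrightarrow> - (c1 * r powr (\<theta> * (1 - \<sigma>)) * norm h powr (2 * \<sigma>)) \<le> (W x0 - W (x0 + h)) - (V y0 - V (y0 + h))"
      and ii: "\<And>h. norm h < R \<Longrightarrow> \<bar>W x0 - W (x0 + h)\<bar> \<le> A * norm h powr \<theta> \<and> \<bar>V y0 - V (y0 + h)\<bar> \<le> A * norm h powr \<theta>"
      and B: "B \<in> sets lebesgue" "0 \<le> g0"
      and g: "\<And>h. h \<in> B \<Longrightarrow> \<delta> \<le> norm h \<and> norm h \<le> R / 2 \<and> norm h \<le> r \<and> g0 \<le> spow p (W x0 - W (x0 + h)) - spow p (V y0 - V (y0 + h))"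
    define e where "e h = spow p (W x0 - W (x0 + h))" for h
    define f where "f h = spow p (V y0 - V (y0 + h))" for h
    define k where "k h = norm h powr - n" for h :: "real ^ 'd"
    have k0: "0 \<le> k h" for h by (simp add: k_def)
    let ?ind = "\<lambda>h :: real ^ 'd. indicator (- ball 0 \<delta>) h :: real"
    have NW: "integrable lebesgue (\<lambda>h. ?ind h * (e h * k h))" unfolding e_def k_def by (rule tail_kernel_integrable[OF p q n W(1) \<delta>(1)])
    have NV: "integrable lebesgue (\<lambda>h. ?ind h * (f h * k h))" unfolding f_def k_def by (rule tail_kernel_integrable[OF p q n V(1) \<delta>(1)])
    have FW: "integrable lebesgue (\<lambda>h. e h * kmax n R h)" "(LINT h|lebesgue. e h * kmax n R h) = (LINT z|lebesgue. spow p (W x0 - W z) * kmax n R (z - x0))"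
      using kmax_integrable[OF p q n R(1) W(1) x0(1,3)] lebesgue_integral_affine(1,2)[of 1 "\<lambda>z. spow p (W x0 - W z) * kmax n R (z - x0)" x0]
      unfolding e_def by auto
    have FV: "integrable lebesgue (\<lambda>h. f h * kmax n R h)" "(LINT h|lebesgue. f h * kmax n R h) = (LINT z|lebesgue. spow p (V y0 - V z) * kmax n R (z - y0))"
      using kmax_integrable[OF p q n R(1) V(1) x0(2,4)] lebesgue_integral_affine(1,2)[of 1 "\<lambda>z. spow p (V y0 - V z) * kmax n R (z - y0)" y0]
      unfolding f_def by auto
    let ?D = "\<lambda>h. (?ind h * (e h * k h) - e h * kmax n R h) - (?ind h * (f h * k h) - f h * kmax n R h)"
    have Di: "integrable lebesgue ?D" by (intro Bochner_Integration.integrable_diff NW NV FW(1) FV(1))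
    have De: "integral\<^sup>L lebesgue ?D = (nonloc p n W x0 \<delta> - (LINT h|lebesgue. e h * kmax n R h)) - (nonloc p n V y0 \<delta> - (LINT h|lebesgue. f h * kmax n R h))"
      using NW NV FW(1) FV(1) by (simp add: nonloc_def e_def f_def k_def)
    let ?P = "r powr (\<theta> * (1 - \<sigma>)) * \<delta> powr q'"
    let ?L = "\<lambda>h. g0 * (r powr - n / 2) * indicator B h - C1 * ?P * (indicator (ball 0 R) h * norm h powr (\<sigma> / 2 - real CARD('d))) - C3 * indicator (ball 0 \<delta>) h"
    have pt: "?L h \<le> ?D h" for h
    proof -
      have D: "?D h = (e h - f h) * (?ind h * k h - kmax n R h)" by (simp add: algebra_simps)
      consider "norm h < \<delta>" | "\<delta> \<le> norm h" "norm h < R" | "R \<le> norm h" by linarith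
      then show ?thesis
      proof cases
        case 1
        \<comment> \<open>Jumps shorter than \<open>\<delta>\<close> are missing from
          \<open>nonloc\<close> but not from the part with \<open>kmax\<close>. The integrand is
          bounded there and costs at most the volume of the small ball.\<close>
        then have hB: "h \<notin> B" using g by force
        have hR: "norm h < R" using 1 \<delta> by simp
        have "norm h powr \<theta> \<le> 1" using hR R \<theta> powr_mono2[of \<theta> "norm h" 1] by simp
        then have "A * norm h powr \<theta> \<le> A" using c by (simp add: mult_left_le)
        then have "\<bar>e h\<bar> \<le> A powr (p - 1)" "\<bar>f h\<bar> \<le> A powr (p - 1)"
          unfolding e_def f_def abs_spow using ii[OF hR] p by (auto intro!: powr_mono2)
        then have "(e h - f h) * R powr - n \<le> 2 * A powr (p - 1) * R powr - n"
          by (intro mult_right_mono) auto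
        moreover have "kmax n R h = R powr - n" using hR by (simp add: kmax_def)
        moreover have "0 \<le> C1 * ?P * norm h powr (\<sigma> / 2 - real CARD('d))" using C1 by simp
        ultimately show ?thesis unfolding D C3_def using 1 hR hB by simp
      next
        case 2
        have hp: "0 < norm h" using 2 \<delta> by linarith
        have km: "kmax n R h = R powr - n" using 2 by (simp add: kmax_def)
        have kk: "R powr - n \<le> k h" unfolding k_def using 2 hp n1 by (intro powr_mono2') auto
        have err: "0 \<le> C1 * ?P * norm h powr (\<sigma> / 2 - real CARD('d))" using C1 by simp
        show ?thesis
        proof (cases "h \<in> B")
          case True
          note gh = g[OF True]
          \<comment> \<open>From \<open>1 \<le> n\<close> and \<open>norm h \<le> R / 2\<close>, the
            truncated kernel is at most half of the full one, so at least \<open>k h / 2\<close> is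
            left.\<close>
          have "2 * R powr - n \<le> 2 powr n * R powr - n"
            using powr_mono[of 1 n 2] n1 by (intro mult_right_mono) auto
          also have "\<dots> = (R / 2) powr - n" by (simp add: powr_divide powr_minus_divide)
          also have "\<dots> \<le> k h" unfolding k_def using gh hp n1 by (intro powr_mono2') auto
          finally have "k h / 2 \<le> k h - R powr - n" by simp
          moreover have "r powr - n \<le> k h" unfolding k_def using gh hp n1 by (intro powr_mono2') auto
          ultimately have "r powr - n / 2 \<le> k h - R powr - n" by simp
          then have "g0 * (r powr - n / 2) \<le> (e h - f h) * (k h - R powr - n)"
            using gh B unfolding e_def f_def by (intro mult_mono) auto
          moreover have "?L h = g0 * (r powr - n / 2) - C1 * ?P * norm h powr (\<sigma> / 2 - real CARD('d))" using 2 True by simp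
          moreover have "?D h = (e h - f h) * (k h - R powr - n)" unfolding D using 2 km by simp
          ultimately show ?thesis using err by linarith
        next
          case False
          have "- (C1 * r powr (\<theta> * (1 - \<sigma>)) * norm h powr (2 * \<sigma> + \<theta> * (p - 2))) \<le> e h - f h"
          proof (cases "V y0 - V (y0 + h) \<le> W x0 - W (x0 + h)")
            case True
            then have "f h \<le> e h" unfolding e_def f_def by (intro spow_mono p)
            moreover have "0 \<le> C1 * r powr (\<theta> * (1 - \<sigma>)) * norm h powr (2 * \<sigma> + \<theta> * (p - 2))" using C1 by simp
            ultimately show ?thesis by linarith
          next
            case False
            have "\<bar>e h - f h\<bar> \<le> (p - 1) * \<bar>(W x0 - W (x0 + h)) - (V y0 - V (y0 + h))\<bar> * (\<bar>W x0 - W (x0 + h)\<bar> + \<bar>V y0 - V (y0 + h)\<bar>) powr (p - 2)"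
              unfolding e_def f_def by (rule spow_diff_le[OF p])
            also have "\<dots> \<le> (p - 1) * (c1 * r powr (\<theta> * (1 - \<sigma>)) * norm h powr (2 * \<sigma>)) * ((2 * A) * norm h powr \<theta>) powr (p - 2)"
              using False i[OF 2(2)] ii[OF 2(2)] p by (intro mult_mono powr_mono2) auto
            also have "((2 * A) * norm h powr \<theta>) powr (p - 2) = (2 * A) powr (p - 2) * norm h powr (\<theta> * (p - 2))"
              unfolding powr_mult by (simp add: powr_powr)
            also have "(p - 1) * (c1 * r powr (\<theta> * (1 - \<sigma>)) * norm h powr (2 * \<sigma>)) * ((2 * A) powr (p - 2) * norm h powr (\<theta> * (p - 2)))
              = C1 * r powr (\<theta> * (1 - \<sigma>)) * norm h powr (2 * \<sigma> + \<theta> * (p - 2))"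
              unfolding C1_def powr_add by (simp only: mult_ac)
            finally show ?thesis by linarith
          qed
          then have "- (C1 * r powr (\<theta> * (1 - \<sigma>)) * norm h powr (2 * \<sigma> + \<theta> * (p - 2))) * (k h - R powr - n) \<le> (e h - f h) * (k h - R powr - n)"
            using kk by (intro mult_right_mono) auto
          moreover have "C1 * r powr (\<theta> * (1 - \<sigma>)) * norm h powr (2 * \<sigma> + \<theta> * (p - 2)) * (k h - R powr - n) \<le> C1 * r powr (\<theta> * (1 - \<sigma>)) * norm h powr (2 * \<sigma> + \<theta> * (p - 2)) * k h"
            using C1 by (intro mult_left_mono) auto
          \<comment> \<open>The exponent \<open>2 * \<sigma>\<close> is split:
            \<open>\<sigma> / 2\<close> keeps the integral convergent at the origin, and the
            remaining \<open>3 * \<sigma> / 2\<close> goes into \<open>q'\<close>, a power that is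
            estimated at \<open>norm h = \<delta>\<close> because \<open>q' \<le> 0\<close>.\<close>
          moreover have "norm h powr (2 * \<sigma> + \<theta> * (p - 2)) * k h = norm h powr q' * norm h powr (\<sigma> / 2 - real CARD('d))"
            unfolding k_def q'(1) n powr_add[symmetric] by (rule arg_cong[where f="\<lambda>x. norm h powr x"]) simp
          moreover have "C1 * r powr (\<theta> * (1 - \<sigma>)) * (norm h powr q' * norm h powr (\<sigma> / 2 - real CARD('d))) \<le> C1 * r powr (\<theta> * (1 - \<sigma>)) * (\<delta> powr q' * norm h powr (\<sigma> / 2 - real CARD('d)))"
            using C1 2 \<delta> q' by (intro mult_left_mono mult_right_mono powr_mono2') auto
          ultimately have "- (C1 * ?P * norm h powr (\<sigma> / 2 - real CARD('d))) \<le> (e h - f h) * (k h - R powr - n)"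
            by (simp only: mult.assoc mult_minus_left)
          moreover have "?L h = - (C1 * ?P * norm h powr (\<sigma> / 2 - real CARD('d)))" using 2 False by simp
          moreover have "?D h = (e h - f h) * (k h - R powr - n)" unfolding D using 2 km by simp
          ultimately show ?thesis by linarith
        qed
      next
        case 3
        then have "h \<notin> B" using g R by force
        moreover have "kmax n R h = k h" using 3 by (simp add: kmax_def k_def)
        ultimately show ?thesis unfolding D using 3 \<delta> by simp
      qed
    qed
    have Bf: "emeasure lebesgue B < \<infinity>"
    proof -
      have "B \<subseteq> ball 0 R" using g R by force
      then have "emeasure lebesgue B \<le> emeasure lebesgue (ball (0 :: real ^ 'd) R)" by (intro emeasure_mono) auto
      also have "\<dots> < \<infinity>" using emeasure_lborel_ball_finite[of "0 :: real ^ 'd" R] by simp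
      finally show ?thesis .
    qed
    have iB: "integrable lebesgue (indicator B :: real ^ 'd \<Rightarrow> real)" using B Bf by (intro integrable_real_indicator)
    have i\<delta>: "integrable lebesgue (indicator (ball 0 \<delta>) :: real ^ 'd \<Rightarrow> real)"
      using emeasure_lborel_ball_finite[of "0 :: real ^ 'd" \<delta>] by (intro integrable_real_indicator) auto
    have Li: "integrable lebesgue ?L"
      by (intro Bochner_Integration.integrable_diff integrable_mult_right iB i\<delta> K(2) R(1))
    have Le: "integral\<^sup>L lebesgue ?L = g0 * (r powr - n / 2) * measure lebesgue B - C1 * ?P * (LINT h|lebesgue. indicator (ball 0 R) (h :: real ^ 'd) * norm h powr (\<sigma> / 2 - real CARD('d))) - C3 * measure lebesgue (ball (0 :: real ^ 'd) \<delta>)"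
      using iB i\<delta> K(2)[OF R(1)] by simp
    have "integral\<^sup>L lebesgue ?L \<le> integral\<^sup>L lebesgue ?D" by (rule integral_mono[OF Li Di pt])
    moreover have "- (cf * r powr \<theta>) \<le> (LINT h|lebesgue. e h * kmax n R h) - (LINT h|lebesgue. f h * kmax n R h)"
      unfolding FW(2) FV(2) r(1) by (rule far) (use W V r x0 d t in auto)
    moreover have "C1 * ?P * (LINT h|lebesgue. indicator (ball 0 R) (h :: real ^ 'd) * norm h powr (\<sigma> / 2 - real CARD('d))) \<le> C1 * ?P * K"
    proof (intro mult_left_mono)
      have "R powr (\<sigma> / 2) \<le> 1" using R \<sigma> powr_mono2[of "\<sigma> / 2" R 1] by simp
      then have "K * R powr (\<sigma> / 2) \<le> K" using K(1) by (simp add: mult_left_le)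
      then show "(LINT h|lebesgue. indicator (ball 0 R) (h :: real ^ 'd) * norm h powr (\<sigma> / 2 - real CARD('d))) \<le> K"
        using K(3)[OF R(1)] by linarith
    qed (use C1 in auto)
    moreover have "C3 * measure lebesgue (ball (0 :: real ^ 'd) \<delta>) \<le> C3 * (?V * r powr \<theta>)"
    proof (intro mult_left_mono C1)
      have "measure lebesgue (ball (0 :: real ^ 'd) \<delta>) \<le> ?V * \<delta>" using \<delta> R by (intro measure_ball_le) auto
      also have "\<dots> \<le> ?V * r" using \<delta> by (intro mult_left_mono) auto
      also have "\<dots> \<le> ?V * r powr \<theta>" using r \<theta> powr_mono'[of \<theta> 1 r] by (intro mult_left_mono) auto
      finally show "measure lebesgue (ball (0 :: real ^ 'd) \<delta>) \<le> ?V * r powr \<theta>" .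
    qed
    ultimately have "g0 * (r powr - n / 2) * measure lebesgue B - (C1 * ?P * K + C3 * (?V * r powr \<theta>) + cf * r powr \<theta>)
       \<le> nonloc p n W x0 \<delta> - nonloc p n V y0 \<delta>" unfolding Le De by linarith
    moreover have "C1 * ?P * K + C3 * (?V * r powr \<theta>) + cf * r powr \<theta> \<le> ?C * (?P + r powr \<theta>)"
    proof -
      have "?C * (?P + r powr \<theta>) = (C1 * ?P * K + C3 * (?V * r powr \<theta>) + cf * r powr \<theta>) + (C3 * ?V * ?P + cf * ?P + C1 * K * r powr \<theta>)"
        by (simp add: algebra_simps)
      moreover have "0 \<le> C3 * ?V * ?P + cf * ?P + C1 * K * r powr \<theta>" using C1 cf K(1) by simp
      ultimately show ?thesis by linarith
    qed
    ultimately have "g0 * (r powr - n / 2) * measure lebesgue B - ?C * (?P + r powr \<theta>) \<le> nonloc p n W x0 \<delta> - nonloc p n V y0 \<delta>"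
      by linarith }
  ultimately show ?thesis unfolding nonloc_gap_bound_def by (intro exI[of _ ?C] conjI allI impI) auto
qed

subsection \<open>The concave modulus\<close>

text \<open>The factor \<open>1 - r powr \<gamma> / 2\<close> of the derivative makes the modulus strictly concave even for
  \<open>\<theta> = 1\<close>.\<close>

definition modulus :: "real \<Rightarrow> real \<Rightarrow> real \<Rightarrow> real" where
  "modulus \<theta> \<gamma> r = r powr \<theta> / \<theta> - r powr (\<theta> + \<gamma>) / (2 * (\<theta> + \<gamma>))"

definition modulus' :: "real \<Rightarrow> real \<Rightarrow> real \<Rightarrow> real" where
  "modulus' \<theta> \<gamma> r = r powr (\<theta> - 1) * (1 - r powr \<gamma> / 2)"

text \<open>Divide \<open>0 \<le> (norm (a + h) - norm a)\<^sup>2\<close> by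
  \<open>2 * norm a\<close>. The bound holds for all \<open>h\<close>, not only for small ones, so
  it can be used at every scale.\<close>

lemma norm_add_le_quadratic:
  fixes a h :: "'a::real_inner"
  assumes "a \<noteq> 0"
  shows "norm (a + h) \<le> norm a + (a \<bullet> h) / norm a + (norm h)\<^sup>2 / (2 * norm a)"
proof -
  let ?r = "norm a"
  have r: "0 < ?r" using assms by simp
  have "(norm (a + h))\<^sup>2 = ?r\<^sup>2 + 2 * (a \<bullet> h) + (norm h)\<^sup>2"
    by (simp add: power2_norm_eq_inner algebra_simps inner_commute)
  moreover have "0 \<le> (norm (a + h) - ?r)\<^sup>2" by simp
  ultimately have "2 * ?r * norm (a + h) \<le> 2 * ?r\<^sup>2 + 2 * (a \<bullet> h) + (norm h)\<^sup>2"
    by (simp add: power2_eq_square algebra_simps)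
  then have "norm (a + h) \<le> (2 * ?r\<^sup>2 + 2 * (a \<bullet> h) + (norm h)\<^sup>2) / (2 * ?r)"
    using r by (simp add: pos_le_divide_eq mult.commute)
  also have "\<dots> = ?r + (a \<bullet> h) / ?r + (norm h)\<^sup>2 / (2 * ?r)"
    using r by (simp add: add_divide_distrib power2_eq_square)
  finally show ?thesis .
qed

context
  fixes \<theta> \<gamma> :: real
  assumes \<theta>: "0 < \<theta>" "\<theta> \<le> 1" and \<gamma>: "0 < \<gamma>" "\<gamma> \<le> 1"
begin

lemma modulus_0 [simp]: "modulus \<theta> \<gamma> 0 = 0"
  by (simp add: modulus_def)

lemma modulus_deriv: "0 < r \<Longrightarrow> (modulus \<theta> \<gamma> has_real_derivative modulus' \<theta> \<gamma> r) (at r)"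
proof -
  assume r: "0 < r"
  have "((\<lambda>r. r powr \<theta> / \<theta> - r powr (\<theta> + \<gamma>) / (2 * (\<theta> + \<gamma>))) has_real_derivative
     \<theta> * r powr (\<theta> - 1) / \<theta> - (\<theta> + \<gamma>) * r powr (\<theta> + \<gamma> - 1) / (2 * (\<theta> + \<gamma>))) (at r)"
    using r by (intro DERIV_diff DERIV_cdivide has_real_derivative_powr)
  moreover have "\<theta> * r powr (\<theta> - 1) / \<theta> - (\<theta> + \<gamma>) * r powr (\<theta> + \<gamma> - 1) / (2 * (\<theta> + \<gamma>)) = modulus' \<theta> \<gamma> r"
  proof -
    have "r powr (\<theta> + \<gamma> - 1) = r powr (\<theta> - 1) * r powr \<gamma>" by (simp add: powr_add[symmetric] algebra_simps)
    moreover have "(\<theta> + \<gamma>) * x / (2 * (\<theta> + \<gamma>)) = x / 2" for x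
    proof -
      have "\<theta> + \<gamma> \<noteq> 0" using \<theta> \<gamma> by simp
      then show ?thesis unfolding mult.commute[of 2] by (rule mult_divide_mult_cancel_left)
    qed
    moreover have "\<theta> * r powr (\<theta> - 1) / \<theta> = r powr (\<theta> - 1)" using \<theta> by simp
    ultimately show ?thesis
      by (simp only: modulus'_def right_diff_distrib mult_1_right times_divide_eq_right)
  qed
  ultimately show ?thesis unfolding modulus_def[abs_def] by simp
qed

lemma modulus_continuous: "continuous_on {0..} (modulus \<theta> \<gamma>)"
  unfolding modulus_def[abs_def] using \<theta> \<gamma>
  by (intro continuous_intros continuous_on_powr') auto

text \<open>Source of the range up to 2: as \<open>\<gamma> \<le> 1\<close>, the derivative stays
  nonnegative there, and this range covers all distances between points of the unit ball.\<close>

lemma half_powr_le: "0 \<le> r \<Longrightarrow> r \<le> 2 \<Longrightarrow> r powr \<gamma> / 2 \<le> 1"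
  using powr_mono2[of \<gamma> r 2] powr_mono[of \<gamma> 1 2] \<gamma> by simp

lemma modulus'_nonneg: "0 \<le> r \<Longrightarrow> r \<le> 2 \<Longrightarrow> 0 \<le> modulus' \<theta> \<gamma> r"
  using half_powr_le[of r] unfolding modulus'_def by (intro mult_nonneg_nonneg) auto

lemma modulus'_le: "modulus' \<theta> \<gamma> r \<le> r powr (\<theta> - 1)"
  unfolding modulus'_def by (rule mult_left_le) auto

lemma modulus'_ge: "0 \<le> r \<Longrightarrow> r \<le> 1 \<Longrightarrow> r powr (\<theta> - 1) / 2 \<le> modulus' \<theta> \<gamma> r"
proof -
  assume r: "0 \<le> r" "r \<le> 1"
  have "r powr \<gamma> \<le> 1" using powr_mono2[of \<gamma> r 1] r \<gamma> by simp
  then have "r powr (\<theta> - 1) * (1 / 2) \<le> r powr (\<theta> - 1) * (1 - r powr \<gamma> / 2)" by (intro mult_left_mono) auto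
  then show ?thesis by (simp add: modulus'_def)
qed

lemma modulus'_antimono: "0 < r \<Longrightarrow> r \<le> \<rho> \<Longrightarrow> \<rho> \<le> 2 \<Longrightarrow> modulus' \<theta> \<gamma> \<rho> \<le> modulus' \<theta> \<gamma> r"
  unfolding modulus'_def using half_powr_le[of \<rho>] \<theta> \<gamma>
  by (intro mult_mono powr_mono2') (auto intro!: powr_mono2)

text \<open>Concavity through the mean value theorem and the decreasing derivative. Continuity at 0
  includes \<open>\<rho> = 0\<close>, near which the derivative may blow up.\<close>

lemma modulus_tangent:
  assumes r: "0 < r" "r \<le> 2" and \<rho>: "0 \<le> \<rho>" "\<rho> \<le> 2"
  shows "modulus \<theta> \<gamma> \<rho> \<le> modulus \<theta> \<gamma> r + modulus' \<theta> \<gamma> r * (\<rho> - r)"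
proof -
  have cont: "continuous_on {x..y} (modulus \<theta> \<gamma>)" if "0 \<le> x" for x y
    by (rule continuous_on_subset[OF modulus_continuous]) (use that in auto)
  have diff: "modulus \<theta> \<gamma> differentiable (at x)" if "0 < x" for x
    using modulus_deriv[OF that] unfolding real_differentiable_def by (rule exI)
  consider "\<rho> = r" | "r < \<rho>" | "\<rho> < r" by linarith
  then show ?thesis
  proof cases
    case 2
    obtain l z where z: "r < z" "z < \<rho>" "(modulus \<theta> \<gamma> has_real_derivative l) (at z)"
      "modulus \<theta> \<gamma> \<rho> - modulus \<theta> \<gamma> r = (\<rho> - r) * l"
    proof -
      have "\<exists>l z. r < z \<and> z < \<rho> \<and> (modulus \<theta> \<gamma> has_real_derivative l) (at z) \<and> modulus \<theta> \<gamma> \<rho> - modulus \<theta> \<gamma> r = (\<rho> - r) * l"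
        by (rule MVT[OF 2 cont diff]) (use r in auto)
      then show ?thesis using that by blast
    qed
    have "l = modulus' \<theta> \<gamma> z" using z r by (intro DERIV_unique[OF z(3) modulus_deriv]) auto
    moreover have "modulus' \<theta> \<gamma> z \<le> modulus' \<theta> \<gamma> r" using z r \<rho> by (intro modulus'_antimono) auto
    ultimately have "(\<rho> - r) * l \<le> (\<rho> - r) * modulus' \<theta> \<gamma> r" using 2 by (intro mult_left_mono) auto
    then show ?thesis using z(4) by (simp add: mult.commute)
  next
    case 3
    obtain l z where z: "\<rho> < z" "z < r" "(modulus \<theta> \<gamma> has_real_derivative l) (at z)"
      "modulus \<theta> \<gamma> r - modulus \<theta> \<gamma> \<rho> = (r - \<rho>) * l"
    proof -
      have "\<exists>l z. \<rho> < z \<and> z < r \<and> (modulus \<theta> \<gamma> has_real_derivative l) (at z) \<and> modulus \<theta> \<gamma> r - modulus \<theta> \<gamma> \<rho> = (r - \<rho>) * l"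
        by (rule MVT[OF 3 cont diff]) (use \<rho> in auto)
      then show ?thesis using that by blast
    qed
    have "l = modulus' \<theta> \<gamma> z" using z \<rho> by (intro DERIV_unique[OF z(3) modulus_deriv]) auto
    moreover have "modulus' \<theta> \<gamma> r \<le> modulus' \<theta> \<gamma> z" using z r \<rho> by (intro modulus'_antimono) auto
    ultimately have "(r - \<rho>) * modulus' \<theta> \<gamma> r \<le> (r - \<rho>) * l" using 3 by (intro mult_left_mono) auto
    then show ?thesis using z(4) by (simp add: algebra_simps)
  qed simp
qed

lemma modulus_mono:
  assumes "0 \<le> x" "x \<le> y" "y \<le> 2"
  shows "modulus \<theta> \<gamma> x \<le> modulus \<theta> \<gamma> y"
proof (cases "y = 0")
  case False
  then have "modulus \<theta> \<gamma> x \<le> modulus \<theta> \<gamma> y + modulus' \<theta> \<gamma> y * (x - y)"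
    using assms by (intro modulus_tangent) auto
  moreover have "modulus' \<theta> \<gamma> y * (x - y) \<le> 0"
    using assms modulus'_nonneg[of y] by (intro mult_nonneg_nonpos) auto
  ultimately show ?thesis by simp
qed (use assms in simp)

lemma modulus_nonneg: "0 \<le> x \<Longrightarrow> x \<le> 2 \<Longrightarrow> 0 \<le> modulus \<theta> \<gamma> x"
  using modulus_mono[of 0 x] by simp

lemma modulus_ge: 
  assumes "0 \<le> r" "r \<le> 1"
  shows "r powr \<theta> / 2 \<le> modulus \<theta> \<gamma> r"
proof -
  have "r powr (\<theta> + \<gamma>) \<le> r powr \<theta>"
    using assms \<gamma> \<theta> by (cases "r = 0") (auto intro!: powr_mono')
  then have "r powr (\<theta> + \<gamma>) / (2 * (\<theta> + \<gamma>)) \<le> r powr \<theta> / (2 * \<theta>)"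
    using \<theta> \<gamma> by (intro frac_le) auto
  moreover have "r powr \<theta> / 2 \<le> r powr \<theta> / (2 * \<theta>)" using \<theta> by (intro divide_left_mono) auto
  moreover have "r powr \<theta> / \<theta> = r powr \<theta> / (2 * \<theta>) + r powr \<theta> / (2 * \<theta>)" using \<theta> by (simp add: field_simps)
  ultimately show ?thesis unfolding modulus_def by linarith
qed

lemma modulus_le: "modulus \<theta> \<gamma> r \<le> r powr \<theta> / \<theta>"
  using \<theta> \<gamma> unfolding modulus_def by simp

text \<open>Tangents at \<open>r\<close> control the values at \<open>r + t\<close> and at the
  intermediate point \<open>r - t / 2\<close>, and a tangent at the latter controls the value at
  \<open>r - t\<close>. What remains is \<open>t / 2\<close> times the increase of the slope between
  the two points. The factor 7/8 is the largest ratio of the intermediate point to \<open>r\<close>;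
  half of the slope difference times \<open>t / 2 \<ge> r / 8\<close> gives 1/16.\<close>

lemma modulus_second_diff:
  assumes r: "0 < r" "r \<le> 1" and t: "r / 4 \<le> t" "t \<le> r / 2"
  shows "modulus \<theta> \<gamma> (r + t) + modulus \<theta> \<gamma> (r - t) - 2 * modulus \<theta> \<gamma> r \<le> - ((1 - (7/8) powr \<gamma>) / 16) * r powr (\<theta> + \<gamma>)"
proof -
  let ?s = "r - t / 2"
  let ?b = "1 - (7/8) powr \<gamma>"
  have s: "0 < ?s" "?s \<le> 7 / 8 * r" using r t by auto
  have b: "0 \<le> ?b" using powr_mono2[of \<gamma> "7/8" 1] \<gamma> by simp
  have 1: "modulus \<theta> \<gamma> (r + t) \<le> modulus \<theta> \<gamma> r + modulus' \<theta> \<gamma> r * t"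
    using modulus_tangent[of r "r + t"] r t by simp
  have 2: "modulus \<theta> \<gamma> ?s \<le> modulus \<theta> \<gamma> r - modulus' \<theta> \<gamma> r * (t / 2)"
    using modulus_tangent[of r ?s] r t by simp
  have 3: "modulus \<theta> \<gamma> (r - t) \<le> modulus \<theta> \<gamma> ?s - modulus' \<theta> \<gamma> ?s * (t / 2)"
  proof -
    have "r - t - ?s = - (t / 2)" by simp
    then show ?thesis using modulus_tangent[of ?s "r - t"] r t s by simp
  qed
  have 4: "?b / 2 * r powr (\<theta> + \<gamma> - 1) \<le> modulus' \<theta> \<gamma> ?s - modulus' \<theta> \<gamma> r"
  proof -
    have "?s powr \<gamma> \<le> (7 / 8 * r) powr \<gamma>" using s \<gamma> by (intro powr_mono2) auto
    then have sg: "?b * r powr \<gamma> \<le> r powr \<gamma> - ?s powr \<gamma>" by (simp only: powr_mult left_diff_distrib mult_1_left)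
    have "r powr (\<theta> - 1) * (1 - ?s powr \<gamma> / 2) \<le> modulus' \<theta> \<gamma> ?s"
      unfolding modulus'_def using s r t \<theta> half_powr_le[of ?s] by (intro mult_right_mono powr_mono2') auto
    moreover have "r powr (\<theta> - 1) * (1 - ?s powr \<gamma> / 2) - modulus' \<theta> \<gamma> r = r powr (\<theta> - 1) * ((r powr \<gamma> - ?s powr \<gamma>) / 2)"
      unfolding modulus'_def by (simp add: right_diff_distrib diff_divide_distrib)
    moreover have "r powr (\<theta> - 1) * (?b * r powr \<gamma> / 2) \<le> r powr (\<theta> - 1) * ((r powr \<gamma> - ?s powr \<gamma>) / 2)"
      using sg by (intro mult_left_mono) auto
    moreover have "r powr (\<theta> - 1) * (?b * r powr \<gamma> / 2) = ?b / 2 * r powr (\<theta> + \<gamma> - 1)"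
    proof -
      have "r powr (\<theta> + \<gamma> - 1) = r powr (\<theta> - 1) * r powr \<gamma>" by (simp add: powr_add[symmetric] algebra_simps)
      then show ?thesis by simp
    qed
    ultimately show ?thesis by linarith
  qed
  have "?b / 16 * r powr (\<theta> + \<gamma>) = ?b / 2 * r powr (\<theta> + \<gamma> - 1) * (r / 8)"
    using r by (simp add: powr_diff)
  also have "\<dots> \<le> (modulus' \<theta> \<gamma> ?s - modulus' \<theta> \<gamma> r) * (t / 2)"
    using 4 t r b order_trans[OF _ 4, of 0] by (intro mult_mono) auto
  finally have "?b / 16 * r powr (\<theta> + \<gamma>) \<le> modulus' \<theta> \<gamma> ?s * (t / 2) - modulus' \<theta> \<gamma> r * (t / 2)"
    by (simp only: left_diff_distrib)
  then show ?thesis using 1 2 3 by (simp only: mult_minus_left)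
qed

text \<open>The negative second derivative of the modulus is thrown away and only the curvature of
  the norm is kept. Strict concavity enters separately, through
  \<open>gain_geometry\<close>.\<close>

lemma modulus_norm_tangent:
  fixes a h :: "'a::real_inner"
  assumes "0 < norm a" "norm a \<le> 2" "norm (a + h) \<le> 2"
  shows "modulus \<theta> \<gamma> (norm (a + h)) \<le> modulus \<theta> \<gamma> (norm a) + (modulus' \<theta> \<gamma> (norm a) / norm a) * (a \<bullet> h) + modulus' \<theta> \<gamma> (norm a) / (2 * norm a) * (norm h)\<^sup>2"
proof -
  have "modulus \<theta> \<gamma> (norm (a + h)) \<le> modulus \<theta> \<gamma> (norm a) + modulus' \<theta> \<gamma> (norm a) * (norm (a + h) - norm a)"
    using assms by (intro modulus_tangent) auto
  also have "\<dots> \<le> modulus \<theta> \<gamma> (norm a) + modulus' \<theta> \<gamma> (norm a) * ((a \<bullet> h) / norm a + (norm h)\<^sup>2 / (2 * norm a))"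
    using norm_add_le_quadratic[of a h] assms modulus'_nonneg[of "norm a"] by (intro add_left_mono mult_left_mono) auto
  finally show ?thesis by (simp add: distrib_left)
qed

text \<open>A shift along \<open>a\<close> changes the length to first order, and
  \<open>modulus_second_diff\<close> gives a gain of order
  \<open>b * r powr (\<theta> + \<gamma>)\<close>. Besides its component along \<open>a\<close>, the
  perturbation \<open>k\<close> lengthens \<open>a + h\<close> and \<open>a - h\<close> by at most
  \<open>(norm k)\<^sup>2 / r\<close>; the radius allowed for \<open>k\<close> keeps the cost of
  this below half of the gain.\<close>

lemma gain_geometry:
  fixes a k :: "'a::real_inner"
  defines "r \<equiv> norm a" and "b \<equiv> 1 - (7/8) powr \<gamma>" and "h \<equiv> (3/8) *\<^sub>R a + k"
  assumes r: "0 < r" "r \<le> 1/2" and k: "norm k \<le> sqrt (b / 128) * r powr (\<gamma> / 2) * r"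
  shows "r / 4 \<le> norm h" "norm h \<le> r / 2"
    and "r powr \<theta> / 10 \<le> modulus \<theta> \<gamma> (norm (a + h)) - modulus \<theta> \<gamma> r"
    and "modulus \<theta> \<gamma> (norm (a + h)) + modulus \<theta> \<gamma> (norm (a - h)) - 2 * modulus \<theta> \<gamma> r \<le> - (b / 32) * r powr (\<theta> + \<gamma>)"
proof -
  have a: "a \<noteq> 0" using r unfolding r_def by auto
  have "(7/8 :: real) powr 1 \<le> (7/8) powr \<gamma>" using \<gamma> by (intro powr_mono') auto
  moreover have "(7/8 :: real) powr \<gamma> < 1 powr \<gamma>" using \<gamma> by (intro powr_less_mono2) auto
  ultimately have b: "0 < b" "b \<le> 1/8" unfolding b_def by auto
  have k2: "(norm k)\<^sup>2 \<le> b / 128 * r powr \<gamma> * r\<^sup>2"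
  proof -
    have "(norm k)\<^sup>2 \<le> (sqrt (b / 128) * r powr (\<gamma> / 2) * r)\<^sup>2" using k by (intro power_mono) auto
    also have "\<dots> = b / 128 * (r powr (\<gamma> / 2))\<^sup>2 * r\<^sup>2" using b by (simp add: power_mult_distrib)
    also have "(r powr (\<gamma> / 2))\<^sup>2 = r powr \<gamma>" by (simp add: power2_eq_square powr_add[symmetric])
    finally show ?thesis .
  qed
  have k1: "norm k \<le> r / 32"
  proof -
    have "r powr \<gamma> \<le> 1" using powr_mono2[of \<gamma> r 1] r \<gamma> by simp
    then have "b / 128 * r powr \<gamma> * r\<^sup>2 \<le> 1 / 1024 * 1 * r\<^sup>2" using b by (intro mult_mono) auto
    then have "(norm k)\<^sup>2 \<le> (r / 32)\<^sup>2" using k2 by (simp add: power_divide)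
    then show ?thesis using r by (simp add: power2_le_iff_abs_le)
  qed
  define d where "d = (a \<bullet> k) / r"
  have d: "\<bar>d\<bar> \<le> r / 32"
  proof -
    have "\<bar>a \<bullet> k\<bar> \<le> r * norm k" using Cauchy_Schwarz_ineq2[of a k] by (simp add: r_def)
    then have "\<bar>d\<bar> \<le> norm k" unfolding d_def using r by (simp add: abs_divide pos_divide_le_eq mult.commute)
    then show ?thesis using k1 by simp
  qed
  have s1: "a + (3/8) *\<^sub>R a = (11/8) *\<^sub>R a" using scaleR_add_left[of 1 "3/8" a] by simp
  have s2: "a - (3/8) *\<^sub>R a = (5/8) *\<^sub>R a" using scaleR_diff_left[of 1 "3/8" a] by simp
  have n38: "norm ((3/8) *\<^sub>R a) = 3/8 * r" by (simp add: r_def)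
  show h1: "r / 4 \<le> norm h" "norm h \<le> r / 2"
    using norm_triangle_ineq[of "(3/8) *\<^sub>R a" k] norm_triangle_ineq2[of "(3/8) *\<^sub>R a" "- k"] k1 n38 r unfolding h_def by auto
  \<comment> \<open>The shift along \<open>a\<close>, including the component of \<open>k\<close>;
    \<open>P\<close> below bounds the transversal lengthening.\<close>
  define t where "t = 3/8 * r + d"
  have t: "r / 4 \<le> t" "t \<le> r / 2" using d unfolding t_def by auto
  define P where "P = b / 128 * r powr \<gamma> * r"
  have P0: "0 \<le> P" using b r by (simp add: P_def)
  have kP: "(norm k)\<^sup>2 / r \<le> P" using k2 r unfolding P_def by (simp add: pos_divide_le_eq power2_eq_square mult_ac)
  have P1: "P \<le> r / 32"
  proof -
    have "r powr \<gamma> \<le> 1" using powr_mono2[of \<gamma> r 1] r \<gamma> by simp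
    then have "b / 128 * r powr \<gamma> \<le> 1/32 * 1" using b by (intro mult_mono) auto
    then have "b / 128 * r powr \<gamma> * r \<le> 1/32 * 1 * r" using r by (intro mult_right_mono) auto
    then show ?thesis by (simp add: P_def)
  qed
  have ap: "norm (a + h) \<le> r + t + P"
  proof -
    have e: "a + h = (11/8) *\<^sub>R a + k" unfolding h_def s1[symmetric] by (simp only: add.assoc)
    have "norm ((11/8) *\<^sub>R a + k) \<le> norm ((11/8) *\<^sub>R a) + (((11/8) *\<^sub>R a) \<bullet> k) / norm ((11/8) *\<^sub>R a) + (norm k)\<^sup>2 / (2 * norm ((11/8) *\<^sub>R a))"
      using a by (intro norm_add_le_quadratic) auto
    also have "\<dots> = 11/8 * r + d + (norm k)\<^sup>2 / r * (4/11)" using r by (simp add: r_def d_def field_simps)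
    also have "\<dots> \<le> r + t + P" using kP P0 zero_le_power2[of "norm k"] unfolding t_def by (simp add: mult.commute)
    finally show ?thesis unfolding e .
  qed
  have am: "norm (a - h) \<le> r - t + P"
  proof -
    have e: "a - h = (5/8) *\<^sub>R a + (- k)" unfolding h_def s2[symmetric] by simp
    have "norm ((5/8) *\<^sub>R a + (- k)) \<le> norm ((5/8) *\<^sub>R a) + (((5/8) *\<^sub>R a) \<bullet> (- k)) / norm ((5/8) *\<^sub>R a) + (norm (- k))\<^sup>2 / (2 * norm ((5/8) *\<^sub>R a))"
      using a by (intro norm_add_le_quadratic) auto
    also have "\<dots> = 5/8 * r - d + (norm k)\<^sup>2 / r * (4/5)" using r by (simp add: r_def d_def field_simps)
    also have "\<dots> \<le> r - t + P" using kP P0 zero_le_power2[of "norm k"] unfolding t_def by (simp add: mult.commute)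
    finally show ?thesis unfolding e .
  qed
  have ge: "5/4 * r \<le> norm (a + h)"
  proof -
    have e: "a + h = (11/8) *\<^sub>R a - (- k)" unfolding h_def s1[symmetric] by simp
    have "norm ((11/8) *\<^sub>R a) = 11/8 * r" by (simp add: r_def)
    moreover have "norm (- k) \<le> r / 32" using k1 by simp
    ultimately show ?thesis unfolding e using norm_triangle_ineq2[of "(11/8) *\<^sub>R a" "- k"] r(1) by linarith
  qed
  show "r powr \<theta> / 10 \<le> modulus \<theta> \<gamma> (norm (a + h)) - modulus \<theta> \<gamma> r"
  proof -
    have "modulus \<theta> \<gamma> (5/4 * r) \<le> modulus \<theta> \<gamma> (norm (a + h))" using ge r ap t P1 by (intro modulus_mono) auto
    moreover have "modulus \<theta> \<gamma> r \<le> modulus \<theta> \<gamma> (5/4 * r) + modulus' \<theta> \<gamma> (5/4 * r) * (r - 5/4 * r)"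
      using r by (intro modulus_tangent) auto
    \<comment> \<open>Slope at \<open>5/4 * r\<close>: the factor
      \<open>(5/4) powr (\<theta> - 1)\<close> is at least 4/5, and \<open>modulus'_ge\<close> costs
      one half. Over the length \<open>r / 4\<close> this gives the constant 1/10.\<close>
    moreover have "r powr (\<theta> - 1) * (2/5) \<le> modulus' \<theta> \<gamma> (5/4 * r)"
    proof -
      have "(4/5 :: real) = (5/4) powr (- 1)" by (simp add: powr_minus_divide)
      also have "\<dots> \<le> (5/4) powr (\<theta> - 1)" using \<theta> by (intro powr_mono) auto
      finally have "4/5 * r powr (\<theta> - 1) \<le> (5/4 * r) powr (\<theta> - 1)" unfolding powr_mult by (intro mult_right_mono) auto
      moreover have "(5/4 * r) powr (\<theta> - 1) / 2 \<le> modulus' \<theta> \<gamma> (5/4 * r)" using r by (intro modulus'_ge) auto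
      ultimately show ?thesis by (simp add: mult.commute)
    qed
    moreover have "r powr (\<theta> - 1) * (2/5) * (r / 4) = r powr \<theta> / 10" using r by (simp add: powr_diff)
    moreover have "modulus' \<theta> \<gamma> (5/4 * r) * (r - 5/4 * r) = - (modulus' \<theta> \<gamma> (5/4 * r) * (r / 4))" by (simp add: algebra_simps)
    moreover have "r powr (\<theta> - 1) * (2/5) * (r / 4) \<le> modulus' \<theta> \<gamma> (5/4 * r) * (r / 4)"
      by (rule mult_right_mono[OF \<open>r powr (\<theta> - 1) * (2/5) \<le> modulus' \<theta> \<gamma> (5/4 * r)\<close>]) (use r in auto)
    ultimately show ?thesis by linarith
  qed
  show "modulus \<theta> \<gamma> (norm (a + h)) + modulus \<theta> \<gamma> (norm (a - h)) - 2 * modulus \<theta> \<gamma> r \<le> - (b / 32) * r powr (\<theta> + \<gamma>)"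
  proof -
    have "modulus \<theta> \<gamma> (norm (a + h)) \<le> modulus \<theta> \<gamma> (r + t + P)" using ap r t P1 by (intro modulus_mono) auto
    also have "\<dots> \<le> modulus \<theta> \<gamma> (r + t) + modulus' \<theta> \<gamma> (r + t) * (r + t + P - (r + t))"
      using r t P1 P0 by (intro modulus_tangent) auto
    also have "\<dots> \<le> modulus \<theta> \<gamma> (r + t) + r powr (\<theta> - 1) * P"
    proof -
      have "modulus' \<theta> \<gamma> (r + t) \<le> modulus' \<theta> \<gamma> r" using r t by (intro modulus'_antimono) auto
      also have "\<dots> \<le> r powr (\<theta> - 1)" by (rule modulus'_le)
      finally show ?thesis using P0 by (simp add: mult_right_mono)
    qed
    finally have 1: "modulus \<theta> \<gamma> (norm (a + h)) \<le> modulus \<theta> \<gamma> (r + t) + r powr (\<theta> - 1) * P" .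
    have "modulus \<theta> \<gamma> (norm (a - h)) \<le> modulus \<theta> \<gamma> (r - t + P)" using am r t P1 by (intro modulus_mono) auto
    also have "\<dots> \<le> modulus \<theta> \<gamma> (r - t) + modulus' \<theta> \<gamma> (r - t) * (r - t + P - (r - t))"
      using r t P1 P0 by (intro modulus_tangent) auto
    also have "\<dots> \<le> modulus \<theta> \<gamma> (r - t) + 2 * r powr (\<theta> - 1) * P"
    proof -
      have "modulus' \<theta> \<gamma> (r - t) \<le> modulus' \<theta> \<gamma> (1/2 * r)" using r t by (intro modulus'_antimono) auto
      also have "\<dots> \<le> (1/2 * r) powr (\<theta> - 1)" by (rule modulus'_le)
      also have "\<dots> \<le> 2 * r powr (\<theta> - 1)"
      proof -
        have "(1/2 :: real) powr (\<theta> - 1) \<le> (1/2) powr (- 1)" using \<theta> by (intro powr_mono') auto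
        then show ?thesis unfolding powr_mult by (intro mult_right_mono) (auto simp: powr_minus_divide)
      qed
      finally have "modulus' \<theta> \<gamma> (r - t) * P \<le> 2 * r powr (\<theta> - 1) * P" using P0 by (intro mult_right_mono) auto
      then show ?thesis by simp
    qed
    finally have 2: "modulus \<theta> \<gamma> (norm (a - h)) \<le> modulus \<theta> \<gamma> (r - t) + 2 * r powr (\<theta> - 1) * P" .
    have 3: "modulus \<theta> \<gamma> (r + t) + modulus \<theta> \<gamma> (r - t) - 2 * modulus \<theta> \<gamma> r \<le> - (b / 16) * r powr (\<theta> + \<gamma>)"
      unfolding b_def by (rule modulus_second_diff) (use r t in auto)
    \<comment> \<open>This quantity is lost once in the bound for \<open>a + h\<close> and twice in
      the one for \<open>a - h\<close>: together \<open>3 * b / 128\<close>, which is less than half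
      of \<open>b / 16\<close>.\<close>
    have 4: "r powr (\<theta> - 1) * P = b / 128 * r powr (\<theta> + \<gamma>)"
      unfolding P_def using r by (simp add: powr_diff powr_add)
    have "0 \<le> b * r powr (\<theta> + \<gamma>)" using b by simp
    then show ?thesis using 1 2 3 4 by (simp only: mult.assoc mult_minus_left)
  qed
qed

end

subsection \<open>Normalised solutions and doubling of variables\<close>

lemma tail_fun_uminus_int: "tail_int p n (\<lambda>z. - w z) = tail_int p n w"
  by (simp add: tail_int_def)

section \<open>Compactness in time for the tail integrals\<close>

lemma tail_int_local:
  assumes "((\<lambda>\<tau>. tail_int p n (\<lambda>x. w \<tau> x - w t x)) \<longlongrightarrow> 0) (at t within I)" "0 < \<zeta>"
  shows "\<exists>d>0. \<forall>\<tau>\<in>I. dist \<tau> t < d \<longrightarrow> tail_int p n (\<lambda>x. w \<tau> x - w t x) < \<zeta>"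
proof -
  have "\<forall>\<^sub>F \<tau> in at t within I. tail_int p n (\<lambda>x. w \<tau> x - w t x) < \<zeta>"
    by (rule order_tendstoD(2)[OF assms])
  then obtain d where d: "0 < d" "\<forall>\<tau>\<in>I. \<tau> \<noteq> t \<and> dist \<tau> t < d \<longrightarrow> tail_int p n (\<lambda>x. w \<tau> x - w t x) < \<zeta>"
    unfolding eventually_at by blast
  have "tail_int p n (\<lambda>x. w t x - w t x) = 0" by (simp add: tail_int_def)
  then show ?thesis using d assms(2) by (intro exI[of _ d]) auto
qed

text \<open>The Heine-Cantor argument with a Lebesgue number. The distance
  \<open>tail_int p n (\<lambda>x. w t x - w \<tau> x)\<close> satisfies the triangle inequality
  only up to the factor \<open>2 powr (p - 1)\<close>, whence the choice of
  \<open>?z\<close>.\<close>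

lemma tail_int_uniform:
  fixes w :: "real \<Rightarrow> real ^ 'd \<Rightarrow> real"
  assumes p: "2 < p" and K: "compact K" "K \<subseteq> I" and w: "\<And>t. t \<in> I \<Longrightarrow> tail_fun p n (w t)"
    and lim: "\<And>t. t \<in> I \<Longrightarrow> ((\<lambda>\<tau>. tail_int p n (\<lambda>x. w \<tau> x - w t x)) \<longlongrightarrow> 0) (at t within I)"
    and \<zeta>: "0 < \<zeta>"
  shows "\<exists>\<eta>>0. \<forall>t\<in>K. \<forall>\<tau>\<in>K. \<bar>t - \<tau>\<bar> < \<eta> \<longrightarrow> tail_int p n (\<lambda>x. w t x - w \<tau> x) < \<zeta>"
proof -
  let ?c = "2 powr (p - 1)"
  let ?z = "\<zeta> / (2 * ?c)"
  have z: "0 < ?z" using \<zeta> by simp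
  have "\<forall>t\<in>K. \<exists>d>0. \<forall>\<tau>\<in>I. dist \<tau> t < d \<longrightarrow> tail_int p n (\<lambda>x. w \<tau> x - w t x) < ?z"
    using tail_int_local[OF lim z] K(2) by blast
  then obtain d where d: "\<And>t. t \<in> K \<Longrightarrow> 0 < d t"
    "\<And>t \<tau>. t \<in> K \<Longrightarrow> \<tau> \<in> I \<Longrightarrow> dist \<tau> t < d t \<Longrightarrow> tail_int p n (\<lambda>x. w \<tau> x - w t x) < ?z" by metis
  have "\<exists>e>0. \<forall>x\<in>K. \<exists>G\<in>(\<lambda>t. ball t (d t)) ` K. ball x e \<subseteq> G"
  proof (rule Heine_Borel_lemma[OF K(1)])
    show "K \<subseteq> \<Union> ((\<lambda>t. ball t (d t)) ` K)" using d(1) by force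
  qed auto
  then obtain e where e: "0 < e" "\<And>x. x \<in> K \<Longrightarrow> \<exists>s\<in>K. ball x e \<subseteq> ball s (d s)" by blast
  have "tail_int p n (\<lambda>x. w t x - w \<tau> x) < \<zeta>" if t: "t \<in> K" "\<tau> \<in> K" "\<bar>t - \<tau>\<bar> < e" for t \<tau>
  proof -
    obtain s where s: "s \<in> K" "ball t e \<subseteq> ball s (d s)" using e(2)[OF t(1)] by blast
    have te: "t \<in> ball t e" "\<tau> \<in> ball t e" using e(1) t(3) by (auto simp: dist_real_def)
    have "dist t s < d s" "dist \<tau> s < d s"
      using subsetD[OF s(2) te(1)] subsetD[OF s(2) te(2)] by (simp_all only: mem_ball dist_commute)
    then have 1: "tail_int p n (\<lambda>x. w t x - w s x) < ?z" "tail_int p n (\<lambda>x. w \<tau> x - w s x) < ?z"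
      using d(2)[OF s(1)] t K(2) by blast+
    have T: "tail_fun p n (w t)" "tail_fun p n (w \<tau>)" "tail_fun p n (w s)" using w t s(1) K(2) by auto
    have "tail_int p n (\<lambda>x. (w t x - w s x) - (w \<tau> x - w s x)) \<le> ?c * (tail_int p n (\<lambda>x. w t x - w s x) + tail_int p n (\<lambda>x. w \<tau> x - w s x))"
      by (rule tail_fun_diff(2)[OF p tail_fun_diff(1)[OF p T(1,3)] tail_fun_diff(1)[OF p T(2,3)]])
    also have "\<dots> < ?c * (?z + ?z)" using 1 by (intro mult_strict_left_mono add_strict_mono) auto
    also have "?c * (?z + ?z) = \<zeta>" by simp
    finally show ?thesis by simp
  qed
  then show ?thesis using e(1) by blast
qed

text \<open>A finite net at the scale of uniform continuity reduces the bound to finitely many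
  times.\<close>

lemma tail_int_bounded:
  fixes w :: "real \<Rightarrow> real ^ 'd \<Rightarrow> real"
  assumes p: "2 < p" and K: "compact K" "K \<subseteq> I" and w: "\<And>t. t \<in> I \<Longrightarrow> tail_fun p n (w t)"
    and lim: "\<And>t. t \<in> I \<Longrightarrow> ((\<lambda>\<tau>. tail_int p n (\<lambda>x. w \<tau> x - w t x)) \<longlongrightarrow> 0) (at t within I)"
  shows "\<exists>B. \<forall>t\<in>K. tail_int p n (w t) \<le> B"
proof -
  let ?c = "2 powr (p - 1)"
  from tail_int_uniform[OF p K w lim, of 1] obtain \<eta> where \<eta>: "0 < \<eta>"
    "\<And>t \<tau>. t \<in> K \<Longrightarrow> \<tau> \<in> K \<Longrightarrow> \<bar>t - \<tau>\<bar> < \<eta> \<Longrightarrow> tail_int p n (\<lambda>x. w t x - w \<tau> x) < 1" by auto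
  obtain F where F: "finite F" "F \<subseteq> K" "K \<subseteq> (\<Union>x\<in>F. ball x \<eta>)"
    using compact_imp_seq_compact[OF K(1)] seq_compact_imp_totally_bounded \<eta>(1) by metis
  let ?B = "?c * (1 + (\<Sum>s\<in>F. tail_int p n (w s)))"
  have nn: "0 \<le> tail_int p n v" for v :: "real ^ 'd \<Rightarrow> real"
    unfolding tail_int_eq by (intro integral_nonneg_AE AE_I2 mult_nonneg_nonneg weight_nonneg) auto
  have "tail_int p n (w t) \<le> ?B" if t: "t \<in> K" for t
  proof -
    obtain s where s: "s \<in> F" "dist s t < \<eta>" using F(3) t by auto
    then have sK: "s \<in> K" using F(2) by blast
    have T: "tail_fun p n (w t)" "tail_fun p n (w s)" using w t sK K(2) by auto
    have "tail_int p n (\<lambda>x. (w t x - w s x) - (- w s x)) \<le> ?c * (tail_int p n (\<lambda>x. w t x - w s x) + tail_int p n (\<lambda>x. - w s x))"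
      using T by (intro tail_fun_diff[OF p]) (auto simp: tail_fun_uminus)
    also have "\<dots> \<le> ?c * (1 + (\<Sum>s\<in>F. tail_int p n (w s)))"
    proof (intro mult_left_mono add_mono)
      show "tail_int p n (\<lambda>x. w t x - w s x) \<le> 1" using \<eta>(2)[OF t sK] s(2) by (simp add: dist_real_def abs_minus_commute)
      show "tail_int p n (\<lambda>x. - w s x) \<le> (\<Sum>s\<in>F. tail_int p n (w s))"
        unfolding tail_fun_uminus_int by (rule member_le_sum[OF s(1) nn F(1)])
    qed simp
    finally show ?thesis by simp
  qed
  then show ?thesis by blast
qed

text \<open>The class in which all estimates are uniform: the solution and its tail integral are
  bounded by 1 on the cylinder of radius 3/4, and 9/16 is the square of that radius. The regularity
  of the obstacle is one inequality whose time exponent is the final \<open>\<alpha>\<close> rather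
  than that of the obstacle.\<close>

definition nsol :: "real \<Rightarrow> real \<Rightarrow> real \<Rightarrow> real \<Rightarrow> real \<Rightarrow> real \<Rightarrow> real \<Rightarrow> real \<Rightarrow>
    ((real ^ 'd) \<times> real \<Rightarrow> real) \<Rightarrow> ((real ^ 'd) \<times> real \<Rightarrow> real) \<Rightarrow> bool" where
  "nsol p q C \<kappa> Lx Lt \<alpha> n v ob \<longleftrightarrow> 0 < \<kappa> \<and> \<kappa> \<le> 1 \<and>
     continuous_on (ball 0 1 \<times> {-1<..0}) v \<and>
     (\<forall>x t. norm x < 3/4 \<and> - (9/16) < t \<and> t \<le> 0 \<longrightarrow> \<bar>v (x, t)\<bar> \<le> 1) \<and>
     (\<forall>t. - (9/16) < t \<and> t \<le> 0 \<longrightarrow> tail_fun p n (\<lambda>x. v (x, t)) \<and> tail_int p n (\<lambda>x. v (x, t)) \<le> 1) \<and>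
     (\<forall>t. - (9/16) < t \<and> t \<le> 0 \<longrightarrow> ((\<lambda>\<tau>. tail_int p n (\<lambda>x. v (x, \<tau>) - v (x, t))) \<longlongrightarrow> 0) (at t within {- (9/16)<..0})) \<and>
     (\<forall>x t. norm x < 1 \<and> - 1 < t \<and> t \<le> 0 \<longrightarrow> ob (x, t) \<le> v (x, t)) \<and>
     (\<forall>x t y \<tau>. norm x < 1 \<and> norm y < 1 \<and> - 1 < t \<and> t \<le> 0 \<and> - 1 < \<tau> \<and> \<tau> \<le> 0 \<longrightarrow>
        ob (x, t) - ob (y, \<tau>) \<le> Lx * norm (x - y) + Lt * \<bar>t - \<tau>\<bar> powr \<alpha>) \<and>
     qsub p q n \<kappa> C v {z. v z \<le> ob z} \<and> qsub p q n \<kappa> C (\<lambda>z. - v z) {}"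

text \<open>The localising penalties act on \<open>(x, t)\<close> alone, so a common jump of
  \<open>x\<close> and \<open>y\<close> changes a single quadratic term. The high power
  \<open>m\<close> in time matters: if this penalty is of order \<open>r powr \<theta>\<close>, its
  derivative is of order \<open>r powr (\<theta> * (1 - 1 / m))\<close>, which is almost as
  small.\<close>

definition doubled :: "real \<Rightarrow> real \<Rightarrow> (real \<Rightarrow> real) \<Rightarrow> real ^ 'd \<Rightarrow> real \<Rightarrow> nat \<Rightarrow> real \<Rightarrow>
    ((real ^ 'd) \<times> real \<Rightarrow> real) \<Rightarrow> real ^ 'd \<Rightarrow> real \<Rightarrow> real ^ 'd \<Rightarrow> real \<Rightarrow> real" where
  "doubled L N \<omega> xs ts m e v x t y \<tau> =
     v (x, t) - v (y, \<tau>) - L * \<omega> (norm (x - y)) - N * (norm (x - xs))\<^sup>2 - N * (ts - t) ^ m - (t - \<tau>)\<^sup>2 / (2 * e)"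

text \<open>The time variable is doubled with penalty \<open>(t - \<tau>)\<^sup>2 / (2 e)\<close>. Since a positive maximum forces
  \<open>|x0 - y0|\<close> to stay away from 0 uniformly in \<open>e\<close>, a small \<open>e\<close> makes all effects of \<open>t0 \<noteq> \<tau>0\<close>
  negligible with respect to \<open>|x0 - y0|\<close>.\<close>

lemma doubling:
  fixes v :: "(real ^ 'd) \<times> real \<Rightarrow> real"
  assumes p: "2 < p" and \<alpha>: "0 < \<alpha>" and sol: "nsol p q C \<kappa> Lx Lt \<alpha> n v ob"
    and \<rho>: "0 < \<rho>" "\<rho> < 3/4" and xs: "norm xs \<le> \<rho>" "norm ys \<le> \<rho>" "- \<rho>\<^sup>2 \<le> ts" "ts \<le> 0"
    and LN: "0 \<le> L" "0 \<le> N" and m: "0 < m" and \<omega>: "continuous_on {0..} \<omega>" "\<And>r. 0 \<le> r \<Longrightarrow> r \<le> 2 \<Longrightarrow> 0 \<le> \<omega> r"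
    and viol: "L * \<omega> (norm (xs - ys)) < v (xs, ts) - v (ys, ts)"
  obtains x0 t0 y0 \<tau>0 e where "0 < e" "norm x0 \<le> \<rho>" "norm y0 \<le> \<rho>" "- \<rho>\<^sup>2 \<le> t0" "t0 \<le> ts" "- \<rho>\<^sup>2 \<le> \<tau>0" "\<tau>0 \<le> ts"
    "\<forall>x t y \<tau>. norm x \<le> \<rho> \<and> norm y \<le> \<rho> \<and> - \<rho>\<^sup>2 \<le> t \<and> t \<le> ts \<and> - \<rho>\<^sup>2 \<le> \<tau> \<and> \<tau> \<le> ts \<longrightarrow>
       doubled L N \<omega> xs ts m e v x t y \<tau> \<le> doubled L N \<omega> xs ts m e v x0 t0 y0 \<tau>0"
    "0 < doubled L N \<omega> xs ts m e v x0 t0 y0 \<tau>0" "x0 \<noteq> y0"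
    "\<forall>x. norm x \<le> \<rho> \<longrightarrow> \<bar>v (x, t0) - v (x, \<tau>0)\<bar> \<le> norm (x0 - y0)"
    "tail_int p n (\<lambda>x. v (x, t0) - v (x, \<tau>0)) \<le> norm (x0 - y0) powr (p - 1)"
    "\<bar>t0 - \<tau>0\<bar> powr \<alpha> \<le> norm (x0 - y0)" "\<bar>t0 - \<tau>0\<bar> \<le> norm (x0 - y0)"
proof -
  have r2: "\<rho>\<^sup>2 < (3/4)\<^sup>2" using \<rho> by (intro power_strict_mono) auto
  then have r2: "\<rho>\<^sup>2 < 9/16" by (simp add: power2_eq_square)
  define K where "K = cball (0 :: real ^ 'd) \<rho> \<times> {- \<rho>\<^sup>2..0}"
  have Kc: "compact K" unfolding K_def by (intro compact_Times compact_cball compact_Icc)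
  have Ksub: "K \<subseteq> ball 0 1 \<times> {-1<..0}" unfolding K_def using \<rho> r2 by auto
  have vc: "continuous_on (ball 0 1 \<times> {-1<..0}) v" using sol by (simp add: nsol_def)
  have vK: "continuous_on K v" by (rule continuous_on_subset[OF vc Ksub])
  have uc: "uniformly_continuous_on K v" by (rule compact_uniformly_continuous[OF vK Kc])
  have vb: "\<bar>v (x, t)\<bar> \<le> 1" if "norm x \<le> \<rho>" "- \<rho>\<^sup>2 \<le> t" "t \<le> 0" for x t
    using sol that \<rho> r2 unfolding nsol_def by auto
  define s0 where "s0 = v (xs, ts) - v (ys, ts) - L * \<omega> (norm (xs - ys))"
  have s0: "0 < s0" using viol by (simp add: s0_def)
  obtain a where a: "0 < a" "\<And>z z'. z \<in> K \<Longrightarrow> z' \<in> K \<Longrightarrow> dist z' z < a \<Longrightarrow> dist (v z') (v z) < s0"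
    using uc s0 unfolding uniformly_continuous_on_def by metis
  define am where "am = min (a / 2) 1"
  have am: "0 < am" "am \<le> 1" "am \<le> a / 2" using a by (auto simp: am_def)
  obtain \<eta>1 where \<eta>1: "0 < \<eta>1" "\<And>z z'. z \<in> K \<Longrightarrow> z' \<in> K \<Longrightarrow> dist z' z < \<eta>1 \<Longrightarrow> dist (v z') (v z) < am"
    using uc am(1) unfolding uniformly_continuous_on_def by metis
  have "\<exists>\<eta>>0. \<forall>t\<in>{- \<rho>\<^sup>2..0}. \<forall>\<tau>\<in>{- \<rho>\<^sup>2..0}. \<bar>t - \<tau>\<bar> < \<eta> \<longrightarrow> tail_int p n (\<lambda>x. v (x, t) - v (x, \<tau>)) < am powr (p - 1)"
    by (rule tail_int_uniform[OF p, where I = "{- (9/16)<..0}" and w = "\<lambda>t x. v (x, t)"])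
      (use sol r2 am(1) in \<open>auto simp: nsol_def\<close>)
  then obtain \<eta>2 where \<eta>2: "0 < \<eta>2" "\<And>t \<tau>. t \<in> {- \<rho>\<^sup>2..0} \<Longrightarrow> \<tau> \<in> {- \<rho>\<^sup>2..0} \<Longrightarrow> \<bar>t - \<tau>\<bar> < \<eta>2 \<Longrightarrow> tail_int p n (\<lambda>x. v (x, t) - v (x, \<tau>)) < am powr (p - 1)"
    by blast
  define \<eta> where "\<eta> = Min {\<eta>1, \<eta>2, am, am powr (1 / \<alpha>)}"
  have \<eta>: "0 < \<eta>" "\<eta> \<le> \<eta>1" "\<eta> \<le> \<eta>2" "\<eta> \<le> am" "\<eta> \<le> am powr (1 / \<alpha>)"
    unfolding \<eta>_def using \<eta>1(1) \<eta>2(1) am(1) by auto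
  \<comment> \<open>At the maximum the penalty is below 2, the largest possible difference of two
    values of \<open>v\<close>, so
    \<open>(t0 - \<tau>0)\<^sup>2 < 4 * e = \<eta>\<^sup>2\<close>.\<close>
  define e where "e = \<eta>\<^sup>2 / 4"
  have e: "0 < e" using \<eta>(1) by (simp add: e_def)
  define D where "D = cball (0 :: real ^ 'd) \<rho> \<times> {- \<rho>\<^sup>2..ts} \<times> cball (0 :: real ^ 'd) \<rho> \<times> {- \<rho>\<^sup>2..ts}"
  define f where "f = (\<lambda>(x, t, y, \<tau>). doubled L N \<omega> xs ts m e v x t y \<tau>)"
  have Dc: "compact D" unfolding D_def by (intro compact_Times compact_cball compact_Icc)
  have D0: "(xs, ts, ys, ts) \<in> D" using xs by (auto simp: D_def)
  have fc: "continuous_on D f"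
  proof -
    have c1: "continuous_on D (\<lambda>z. v (fst z, fst (snd z)))"
      by (rule continuous_on_compose2[OF vK]) (use xs in \<open>auto simp: D_def K_def intro!: continuous_intros\<close>)
    have c2: "continuous_on D (\<lambda>z. v (fst (snd (snd z)), snd (snd (snd z))))"
      by (rule continuous_on_compose2[OF vK]) (use xs in \<open>auto simp: D_def K_def intro!: continuous_intros\<close>)
    have c3: "continuous_on D (\<lambda>z. \<omega> (norm (fst z - fst (snd (snd z)))))"
      by (rule continuous_on_compose2[OF \<omega>(1)]) (auto intro!: continuous_intros)
    show ?thesis
      unfolding f_def doubled_def case_prod_unfold
      by (intro continuous_intros c1 c2 c3) (use e in auto)
  qed
  obtain z where z: "z \<in> D" "\<And>w. w \<in> D \<Longrightarrow> f w \<le> f z"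
    using continuous_attains_sup[OF Dc _ fc] D0 by blast
  obtain x0 t0 y0 \<tau>0 where z': "z = (x0, t0, y0, \<tau>0)" by (cases z) auto
  have in0: "norm x0 \<le> \<rho>" "norm y0 \<le> \<rho>" "- \<rho>\<^sup>2 \<le> t0" "t0 \<le> ts" "- \<rho>\<^sup>2 \<le> \<tau>0" "\<tau>0 \<le> ts"
    using z(1) by (auto simp: z' D_def)
  have max: "doubled L N \<omega> xs ts m e v x t y \<tau> \<le> doubled L N \<omega> xs ts m e v x0 t0 y0 \<tau>0"
    if "norm x \<le> \<rho>" "norm y \<le> \<rho>" "- \<rho>\<^sup>2 \<le> t" "t \<le> ts" "- \<rho>\<^sup>2 \<le> \<tau>" "\<tau> \<le> ts" for x t y \<tau>
    using z(2)[of "(x, t, y, \<tau>)"] that by (simp add: z' D_def f_def)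
  have s0_le: "s0 \<le> doubled L N \<omega> xs ts m e v x0 t0 y0 \<tau>0"
    using max[of xs ys ts ts] xs m by (simp add: doubled_def s0_def power_0_left)
  have nxy: "norm (x0 - y0) \<le> 2" using norm_triangle_ineq4[of x0 y0] in0 \<rho> by simp
  have le_diff: "doubled L N \<omega> xs ts m e v x0 t0 y0 \<tau>0 + (t0 - \<tau>0)\<^sup>2 / (2 * e) \<le> v (x0, t0) - v (y0, \<tau>0)"
  proof -
    have "0 \<le> L * \<omega> (norm (x0 - y0))" using LN \<omega>(2)[OF norm_ge_zero nxy] by simp
    moreover have "0 \<le> N * (norm (x0 - xs))\<^sup>2" "0 \<le> N * (ts - t0) ^ m" using LN in0 by auto
    ultimately show ?thesis unfolding doubled_def by linarith
  qed
  have t\<eta>: "\<bar>t0 - \<tau>0\<bar> < \<eta>"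
  proof -
    have "(t0 - \<tau>0)\<^sup>2 / (2 * e) < 2"
      using le_diff s0_le s0 vb[of x0 t0] vb[of y0 \<tau>0] in0 xs by auto
    then have "(t0 - \<tau>0)\<^sup>2 < \<eta>\<^sup>2" using \<eta>(1) unfolding e_def by (simp add: field_simps)
    then have "\<bar>t0 - \<tau>0\<bar>\<^sup>2 < \<eta>\<^sup>2" by simp
    then show ?thesis by (rule power2_less_imp_less) (use \<eta>(1) in simp)
  qed
  have zK: "(x0, t0) \<in> K" "(y0, \<tau>0) \<in> K" using in0 xs by (auto simp: K_def)
  have r_am: "am \<le> norm (x0 - y0)"
  proof (rule ccontr)
    assume "\<not> am \<le> norm (x0 - y0)"
    then have "norm (x0 - y0) < a / 2" "\<bar>t0 - \<tau>0\<bar> < a / 2" using am t\<eta> \<eta>(4) by linarith+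
    moreover have "dist (x0, t0) (y0, \<tau>0) \<le> norm (x0 - y0) + \<bar>t0 - \<tau>0\<bar>"
      using sqrt_sum_squares_le_sum[of "norm (x0 - y0)" "\<bar>t0 - \<tau>0\<bar>"]
      by (simp add: dist_Pair_Pair dist_norm[of x0 y0] dist_real_def)
    ultimately have "dist (x0, t0) (y0, \<tau>0) < a" by linarith
    then have "dist (v (x0, t0)) (v (y0, \<tau>0)) < s0" by (intro a(2) zK)
    then have "v (x0, t0) - v (y0, \<tau>0) < s0" by (simp add: dist_real_def)
    moreover have "0 \<le> (t0 - \<tau>0)\<^sup>2 / (2 * e)" using e by simp
    ultimately show False using le_diff s0_le by linarith
  qed
  show ?thesis
  proof (rule that[OF e in0])
    show "\<forall>x t y \<tau>. norm x \<le> \<rho> \<and> norm y \<le> \<rho> \<and> - \<rho>\<^sup>2 \<le> t \<and> t \<le> ts \<and> - \<rho>\<^sup>2 \<le> \<tau> \<and> \<tau> \<le> ts \<longrightarrow>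
       doubled L N \<omega> xs ts m e v x t y \<tau> \<le> doubled L N \<omega> xs ts m e v x0 t0 y0 \<tau>0" using max by blast
    show "0 < doubled L N \<omega> xs ts m e v x0 t0 y0 \<tau>0" using s0 s0_le by linarith
    show "x0 \<noteq> y0" using r_am am(1) by auto
    show "\<forall>x. norm x \<le> \<rho> \<longrightarrow> \<bar>v (x, t0) - v (x, \<tau>0)\<bar> \<le> norm (x0 - y0)"
    proof (intro allI impI)
      fix x :: "real ^ 'd" assume x: "norm x \<le> \<rho>"
      have "dist (v (x, t0)) (v (x, \<tau>0)) < am"
        by (rule \<eta>1(2)) (use x in0 xs t\<eta> \<eta>(2) in \<open>auto simp: K_def dist_Pair_Pair dist_real_def\<close>)
      then show "\<bar>v (x, t0) - v (x, \<tau>0)\<bar> \<le> norm (x0 - y0)" using r_am by (simp add: dist_real_def)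
    qed
    have "tail_int p n (\<lambda>x. v (x, t0) - v (x, \<tau>0)) < am powr (p - 1)"
      by (rule \<eta>2(2)) (use in0 xs t\<eta> \<eta>(3) in auto)
    also have "\<dots> \<le> norm (x0 - y0) powr (p - 1)" using r_am am p by (intro powr_mono2) auto
    finally show "tail_int p n (\<lambda>x. v (x, t0) - v (x, \<tau>0)) \<le> norm (x0 - y0) powr (p - 1)" by simp
    have "\<bar>t0 - \<tau>0\<bar> powr \<alpha> \<le> (am powr (1 / \<alpha>)) powr \<alpha>" using t\<eta> \<eta>(5) \<alpha> by (intro powr_mono2) auto
    also have "\<dots> = am" using \<alpha> am by (simp add: powr_powr)
    finally show "\<bar>t0 - \<tau>0\<bar> powr \<alpha> \<le> norm (x0 - y0)" using r_am by simp
    show "\<bar>t0 - \<tau>0\<bar> \<le> norm (x0 - y0)" using t\<eta> \<eta>(4) r_am by simp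
  qed
qed

subsection \<open>The Ishii--Lions argument\<close>

text \<open>The situation at a maximum of \<open>doubled\<close>, in the step from exponent
  \<open>\<theta>\<close> to \<open>\<theta>'\<close>. The bounds on \<open>N\<close> make each
  penalty reach the oscillation 2 at distance \<open>R\<close> or \<open>T\<close>. On jumps of
  length about r, the spatial penalty has an effect of order
  \<open>r powr (1 + \<theta> / 2)\<close>; the condition on \<open>\<theta>' + \<gamma>\<close>
  makes this at most the order of the concavity gain, and the third lower bound on \<open>L\<close>
  absorbs the constant.\<close>

locale doubled_max =
  fixes p q n C \<kappa> Lx Lt \<alpha> :: real and v ob :: "(real ^ 'd) \<times> real \<Rightarrow> real"
    and \<theta> \<theta>' \<gamma> A \<rho> R T L N e ts t0 \<tau>0 :: real and m :: nat and xs x0 y0 :: "real ^ 'd"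
  assumes p: "2 < p" and q: "0 < q" "q < p" and n: "n = real CARD('d) + q" and C: "0 \<le> C"
    and sol: "nsol p q C \<kappa> Lx Lt \<alpha> n v ob" and Lt: "0 \<le> Lt"
    and \<theta>: "0 \<le> \<theta>" "\<theta> \<le> 1" and \<theta>': "0 < \<theta>'" "\<theta>' \<le> 1" and \<gamma>: "0 < \<gamma>" "\<gamma> \<le> 1" "\<theta>' + \<gamma> \<le> 1 + \<theta> / 2"
    and A: "1 \<le> A" and reg: "\<And>x y t. norm x \<le> \<rho> \<Longrightarrow> norm y \<le> \<rho> \<Longrightarrow> - \<rho>\<^sup>2 \<le> t \<Longrightarrow> t \<le> 0 \<Longrightarrow> \<bar>v (x, t) - v (y, t)\<bar> \<le> A * norm (x - y) powr \<theta>"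
    and \<rho>: "0 < \<rho>" "\<rho> < 3/4" and R: "0 < R" "norm xs + 4 * R \<le> \<rho>" and T: "0 < T" "- \<rho>\<^sup>2 + 2 * T \<le> ts" "ts \<le> 0"
    and N: "1 \<le> N" "2 \<le> N * R\<^sup>2" "2 \<le> N * T ^ m" and m: "2 \<le> m"
    and L: "N \<le> L" "2 * (Lx + Lt) \<le> L" "64 * N * (A + 3) \<le> (1 - (7/8) powr \<gamma>) * L" and e: "0 < e"
    and dom: "norm x0 \<le> \<rho>" "norm y0 \<le> \<rho>" "- \<rho>\<^sup>2 \<le> t0" "t0 \<le> ts" "- \<rho>\<^sup>2 \<le> \<tau>0" "\<tau>0 \<le> ts"
    and max: "\<forall>x t y \<tau>. norm x \<le> \<rho> \<and> norm y \<le> \<rho> \<and> - \<rho>\<^sup>2 \<le> t \<and> t \<le> ts \<and> - \<rho>\<^sup>2 \<le> \<tau> \<and> \<tau> \<le> ts \<longrightarrow>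
       doubled L N (modulus \<theta>' \<gamma>) xs ts m e v x t y \<tau> \<le> doubled L N (modulus \<theta>' \<gamma>) xs ts m e v x0 t0 y0 \<tau>0"
    and pos: "0 < doubled L N (modulus \<theta>' \<gamma>) xs ts m e v x0 t0 y0 \<tau>0" and ne: "x0 \<noteq> y0"
    and close: "\<forall>x. norm x \<le> \<rho> \<longrightarrow> \<bar>v (x, t0) - v (x, \<tau>0)\<bar> \<le> norm (x0 - y0)"
    "\<bar>t0 - \<tau>0\<bar> powr \<alpha> \<le> norm (x0 - y0)" "\<bar>t0 - \<tau>0\<bar> \<le> norm (x0 - y0)"
    and small: "norm (x0 - y0) \<le> R" "norm (x0 - y0) \<le> T / 2" "norm (x0 - y0) \<le> 1 / 2"
begin

abbreviation "\<omega> \<equiv> modulus \<theta>' \<gamma>"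
abbreviation "\<omega>' \<equiv> modulus' \<theta>' \<gamma>"
definition "a = x0 - y0"
definition "r = norm (x0 - y0)"
definition "b = 1 - (7/8) powr \<gamma>"

lemma r: "0 < r" "r \<le> R" "r \<le> T / 2" "r \<le> 1 / 2" and norm_a: "norm a = r"
  using ne small by (auto simp: r_def a_def)

lemma rho2: "\<rho>\<^sup>2 < 9/16"
proof -
  have "\<rho>\<^sup>2 < (3/4)\<^sup>2" using \<rho> by (intro power_strict_mono) auto
  then show ?thesis by (simp add: power2_eq_square)
qed

lemma v_bound: "norm x \<le> \<rho> \<Longrightarrow> - \<rho>\<^sup>2 \<le> t \<Longrightarrow> t \<le> 0 \<Longrightarrow> \<bar>v (x, t)\<bar> \<le> 1"
  using sol \<rho> rho2 unfolding nsol_def by auto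

lemma r_le_powr: "0 \<le> s \<Longrightarrow> s \<le> 1 \<Longrightarrow> r \<le> r powr s"
  using r powr_mono'[of s 1 r] by simp

lemma modulus_r: "r / 2 \<le> \<omega> r" "0 \<le> \<omega> r"
proof -
  have "r powr \<theta>' / 2 \<le> \<omega> r" by (rule modulus_ge[OF \<theta>' \<gamma>(1,2)]) (use r in auto)
  then show "r / 2 \<le> \<omega> r" using r_le_powr[of \<theta>'] \<theta>' by simp
  then show "0 \<le> \<omega> r" using r by simp
qed

section \<open>Position of the maximum\<close>

lemma value_gap: "L * \<omega> r + N * (norm (x0 - xs))\<^sup>2 + N * (ts - t0) ^ m < v (x0, t0) - v (y0, \<tau>0)"
proof -
  have "0 \<le> (t0 - \<tau>0)\<^sup>2 / (2 * e)" using e by simp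
  then show ?thesis using pos unfolding doubled_def r_def by linarith
qed

lemma gap_le: "v (x0, t0) - v (y0, \<tau>0) \<le> (A + 1) * r powr \<theta>" "\<bar>v (x0, t0) - v (y0, \<tau>0)\<bar> \<le> (A + 1) * r powr \<theta>" "v (x0, t0) - v (y0, \<tau>0) \<le> 2"
proof -
  have "\<bar>v (x0, t0) - v (y0, t0)\<bar> \<le> A * r powr \<theta>" unfolding r_def by (rule reg) (use dom T in auto)
  moreover have "\<bar>v (y0, t0) - v (y0, \<tau>0)\<bar> \<le> r powr \<theta>" using close(1) dom r_le_powr[OF \<theta>] unfolding r_def by fastforce
  ultimately show "\<bar>v (x0, t0) - v (y0, \<tau>0)\<bar> \<le> (A + 1) * r powr \<theta>" by (simp add: algebra_simps)
  then show "v (x0, t0) - v (y0, \<tau>0) \<le> (A + 1) * r powr \<theta>" by simp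
  show "v (x0, t0) - v (y0, \<tau>0) \<le> 2" using v_bound[of x0 t0] v_bound[of y0 \<tau>0] dom T by auto
qed

lemma L_pos: "0 < L" "1 \<le> L"
  using L N by auto

lemma pieces_nonneg: "0 \<le> L * \<omega> r" "0 \<le> N * (norm (x0 - xs))\<^sup>2" "0 \<le> N * (ts - t0) ^ m"
  using L_pos modulus_r N dom by (auto intro!: mult_nonneg_nonneg)

text \<open>Positivity of the maximum bounds the penalties by the value gap. The gap is at most 2,
  which gives the first bound, and at most \<open>(A + 1) * r powr \<theta>\<close> by the known
  regularity, which makes the gradient of the spatial penalty small with r.\<close>

lemma x0_near: "norm (x0 - xs) < R" "norm (x0 - xs) \<le> (A + 1) * r powr (\<theta> / 2)"
proof -
  have "N * (norm (x0 - xs))\<^sup>2 < N * R\<^sup>2" using value_gap gap_le(3) pieces_nonneg N(2) by linarith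
  then have "(norm (x0 - xs))\<^sup>2 < R\<^sup>2" using N(1) by simp
  then show "norm (x0 - xs) < R" by (rule power2_less_imp_less) (use R in simp)
  have "1 * (norm (x0 - xs))\<^sup>2 \<le> N * (norm (x0 - xs))\<^sup>2" using N(1) by (intro mult_right_mono) auto
  then have "(norm (x0 - xs))\<^sup>2 \<le> (A + 1) * r powr \<theta>" using value_gap gap_le(1) pieces_nonneg by linarith
  also have "\<dots> \<le> (A + 1)\<^sup>2 * r powr \<theta>" using A by (intro mult_right_mono) (auto simp: power2_eq_square)
  also have "\<dots> = ((A + 1) * r powr (\<theta> / 2))\<^sup>2" by (simp add: power_mult_distrib power2_eq_square powr_add[symmetric])
  finally show "norm (x0 - xs) \<le> (A + 1) * r powr (\<theta> / 2)" by (rule power2_le_imp_le) (use A in simp)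
qed

text \<open>The last bound controls the derivative of the time penalty. The others keep both times
  away from the bottom of the cylinder, so that there is room for touching in the past.\<close>

lemma time_near: "ts - t0 < T" "T \<le> t0 + \<rho>\<^sup>2" "T / 2 \<le> \<tau>0 + \<rho>\<^sup>2"
  "(ts - t0) ^ (m - 1) \<le> (A + 1) * r powr (\<theta> * (1 - 1 / real m))"
proof -
  have "N * (ts - t0) ^ m < N * T ^ m" using value_gap gap_le(3) pieces_nonneg N(3) by linarith
  then have "(ts - t0) ^ m < T ^ m" using N(1) by simp
  then show 1: "ts - t0 < T" by (rule power_less_imp_less_base) (use T in simp)
  then show "T \<le> t0 + \<rho>\<^sup>2" using T by linarith
  then show "T / 2 \<le> \<tau>0 + \<rho>\<^sup>2" using close(3) r(3) unfolding r_def by linarith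
  have "1 * (ts - t0) ^ m \<le> N * (ts - t0) ^ m" using N(1) dom by (intro mult_right_mono) auto
  then have le: "(ts - t0) ^ m \<le> (A + 1) * r powr \<theta>" using value_gap gap_le(1) pieces_nonneg by linarith
  show "(ts - t0) ^ (m - 1) \<le> (A + 1) * r powr (\<theta> * (1 - 1 / real m))"
  proof (cases "ts = t0")
    case True
    then show ?thesis using m A by (simp add: power_0_left)
  next
    case False
    then have x: "0 < ts - t0" using dom by simp
    have s: "0 \<le> 1 - 1 / real m" "1 - 1 / real m \<le> 1" using m by auto
    have "(ts - t0) ^ (m - 1) = (ts - t0) powr (real m * (1 - 1 / real m))"
      using x m by (simp add: powr_realpow[symmetric] of_nat_diff right_diff_distrib)
    also have "\<dots> = ((ts - t0) ^ m) powr (1 - 1 / real m)" using x by (simp add: powr_powr powr_realpow[symmetric])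
    also have "\<dots> \<le> ((A + 1) * r powr \<theta>) powr (1 - 1 / real m)" using le s x by (intro powr_mono2) auto
    also have "\<dots> = (A + 1) powr (1 - 1 / real m) * r powr (\<theta> * (1 - 1 / real m))" by (simp add: powr_mult powr_powr)
    also have "\<dots> \<le> (A + 1) powr 1 * r powr (\<theta> * (1 - 1 / real m))" using A s by (intro mult_right_mono powr_mono) auto
    finally show ?thesis using A by simp
  qed
qed

text \<open>The margin \<open>4 * R\<close> leaves room for the distance of \<open>x0\<close> from
  \<open>xs\<close>, for \<open>r\<close>, and for a jump, each of length at most
  \<open>R\<close>.\<close>

lemma norm_shift: "norm h \<le> R \<Longrightarrow> norm (x0 + h) \<le> \<rho>" "norm h \<le> R \<Longrightarrow> norm (y0 + h) \<le> \<rho>"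
proof -
  assume h: "norm h \<le> R"
  have 1: "norm x0 \<le> norm xs + R" using norm_triangle_ineq2[of x0 xs] x0_near(1) by linarith
  then show "norm (x0 + h) \<le> \<rho>" using norm_triangle_ineq[of x0 h] h R by linarith
  have "norm y0 \<le> norm x0 + r" using norm_triangle_ineq2[of y0 x0] unfolding r_def by (simp add: norm_minus_commute)
  then show "norm (y0 + h) \<le> \<rho>" using 1 norm_triangle_ineq[of y0 h] h R r by linarith
qed

lemma rho_bounds: "R \<le> 1" "norm (x0 + h) \<le> \<rho> \<Longrightarrow> norm (x0 + h - y0) \<le> 2" "norm (y0 + h) \<le> \<rho> \<Longrightarrow> norm (x0 - (y0 + h)) \<le> 2"
proof -
  show "R \<le> 1" using R \<rho> norm_ge_zero[of xs] by linarith
  show "norm (x0 + h) \<le> \<rho> \<Longrightarrow> norm (x0 + h - y0) \<le> 2"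
    using norm_triangle_ineq4[of "x0 + h" y0] dom \<rho> by linarith
  show "norm (y0 + h) \<le> \<rho> \<Longrightarrow> norm (x0 - (y0 + h)) \<le> 2"
    using norm_triangle_ineq4[of x0 "y0 + h"] dom \<rho> by linarith
qed

lemma penalty_diff: "(norm (x0 + h - xs))\<^sup>2 - (norm (x0 - xs))\<^sup>2 = 2 * ((x0 - xs) \<bullet> h) + (norm h)\<^sup>2"
  by (simp add: power2_norm_eq_inner algebra_simps inner_commute)

lemma max_x:
  assumes "norm (x0 + h) \<le> \<rho>" "- \<rho>\<^sup>2 \<le> t" "t \<le> ts"
  shows "v (x0 + h, t) \<le> v (x0, t0) + L * (\<omega> (norm (a + h)) - \<omega> r) + N * (2 * ((x0 - xs) \<bullet> h) + (norm h)\<^sup>2)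
     + (N * (ts - t) ^ m + (t - \<tau>0)\<^sup>2 / (2 * e)) - (N * (ts - t0) ^ m + (t0 - \<tau>0)\<^sup>2 / (2 * e))"
proof -
  have "doubled L N \<omega> xs ts m e v (x0 + h) t y0 \<tau>0 \<le> doubled L N \<omega> xs ts m e v x0 t0 y0 \<tau>0"
    using max assms dom by blast
  moreover have "x0 + h - y0 = a + h" by (simp add: a_def)
  moreover have "N * (norm (x0 + h - xs))\<^sup>2 = N * (norm (x0 - xs))\<^sup>2 + N * (2 * ((x0 - xs) \<bullet> h) + (norm h)\<^sup>2)"
    unfolding penalty_diff[symmetric] by (simp add: algebra_simps)
  ultimately show ?thesis unfolding doubled_def r_def by (simp only: right_diff_distrib)
qed

lemma max_y:
  assumes "norm (y0 + h) \<le> \<rho>" "- \<rho>\<^sup>2 \<le> \<tau>" "\<tau> \<le> ts"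
  shows "- v (y0 + h, \<tau>) \<le> - v (y0, \<tau>0) + L * (\<omega> (norm (a - h)) - \<omega> r) + (t0 - \<tau>)\<^sup>2 / (2 * e) - (t0 - \<tau>0)\<^sup>2 / (2 * e)"
proof -
  have "doubled L N \<omega> xs ts m e v x0 t0 (y0 + h) \<tau> \<le> doubled L N \<omega> xs ts m e v x0 t0 y0 \<tau>0"
    using max assms dom by blast
  moreover have "x0 - (y0 + h) = a - h" by (simp add: a_def)
  ultimately show ?thesis unfolding doubled_def r_def by (simp only: right_diff_distrib)
qed

text \<open>A common jump leaves \<open>x0 - y0\<close> and both times unchanged, so only the
  spatial penalty is left of all the terms of \<open>doubled\<close>.\<close>

lemma max_xy:
  assumes "norm h \<le> R"
  shows "v (x0 + h, t0) - v (y0 + h, \<tau>0) \<le> v (x0, t0) - v (y0, \<tau>0) + N * (2 * ((x0 - xs) \<bullet> h) + (norm h)\<^sup>2)"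
proof -
  have "doubled L N \<omega> xs ts m e v (x0 + h) t0 (y0 + h) \<tau>0 \<le> doubled L N \<omega> xs ts m e v x0 t0 y0 \<tau>0"
    using max norm_shift[OF assms] dom by blast
  moreover have "x0 + h - (y0 + h) = x0 - y0" by simp
  moreover have "N * (norm (x0 + h - xs))\<^sup>2 = N * (norm (x0 - xs))\<^sup>2 + N * (2 * ((x0 - xs) \<bullet> h) + (norm h)\<^sup>2)"
    unfolding penalty_diff[symmetric] by (simp add: algebra_simps)
  ultimately show ?thesis unfolding doubled_def by (simp only:)
qed

text \<open>\<open>G\<close> is the gradient of the modulus term at \<open>a\<close>, and
  \<open>\<Lambda>\<close> is the coefficient of the quadratic term in its majorant from
  \<open>modulus_norm_tangent\<close>.\<close>

definition "G = (L * (\<omega>' r / r)) *\<^sub>R a"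
definition "\<Lambda> = L * (\<omega>' r / (2 * r))"

lemma modulus'_r: "0 \<le> \<omega>' r" "\<omega>' r \<le> r powr (\<theta>' - 1)"
  using modulus'_nonneg[OF \<theta>' \<gamma>(1,2), of r] modulus'_le[OF \<theta>' \<gamma>(1,2), of r] r by auto

lemma modulus_shift: "norm (a + h) \<le> 2 \<Longrightarrow> L * (\<omega> (norm (a + h)) - \<omega> r) \<le> G \<bullet> h + \<Lambda> * (norm h)\<^sup>2"
proof -
  assume h: "norm (a + h) \<le> 2"
  have "\<omega> (norm (a + h)) - \<omega> r \<le> (\<omega>' r / r) * (a \<bullet> h) + \<omega>' r / (2 * r) * (norm h)\<^sup>2"
    using modulus_norm_tangent[OF \<theta>' \<gamma>(1,2), of a h] h r unfolding norm_a by simp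
  then have "L * (\<omega> (norm (a + h)) - \<omega> r) \<le> L * ((\<omega>' r / r) * (a \<bullet> h) + \<omega>' r / (2 * r) * (norm h)\<^sup>2)"
    using L_pos by (intro mult_left_mono) auto
  also have "\<dots> = G \<bullet> h + \<Lambda> * (norm h)\<^sup>2" unfolding G_def \<Lambda>_def inner_scaleR_left distrib_left by (simp only: mult.assoc)
  finally show ?thesis .
qed

lemma Lambda_nonneg: "0 \<le> \<Lambda>"
  unfolding \<Lambda>_def using L_pos modulus'_r r by (intro mult_nonneg_nonneg) auto

text \<open>Radius for which the past cylinders at both points stay in the domain of the maximum;
  the entry 1 provides \<open>\<delta>'\<^sup>2 \<le> \<delta>'\<close>.\<close>

definition "\<delta>' = Min {R, T / 2, 1}"

lemma delta': "0 < \<delta>'" "\<delta>' \<le> R" "\<delta>'\<^sup>2 \<le> T / 2"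
proof -
  show d: "0 < \<delta>'" "\<delta>' \<le> R" unfolding \<delta>'_def using R T by auto
  have "\<delta>' \<le> 1" "\<delta>' \<le> T / 2" unfolding \<delta>'_def by auto
  then have "\<delta>' * \<delta>' \<le> \<delta>' * 1" "\<delta>' \<le> T / 2" using d by (auto intro!: mult_left_mono)
  then show "\<delta>'\<^sup>2 \<le> T / 2" by (simp only: power2_eq_square mult_1_right)
qed

text \<open>Freeze \<open>(y0, \<tau>0)\<close> in the maximum. Since the majorant of the modulus
  holds for all admissible jumps, the quadratic inequality extends up to \<open>R\<close>, and
  \<open>\<delta>\<close> can be chosen later.\<close>

lemma touch_x:
  assumes "0 < \<delta>" "\<delta> \<le> R"
  shows "touch v x0 t0 (G + (2 * N) *\<^sub>R (x0 - xs)) (\<Lambda> + N) (\<lambda>t. N * (ts - t) ^ m + (t - \<tau>0)\<^sup>2 / (2 * e))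
     (\<lambda>t. - (N * m * (ts - t) ^ (m - 1)) + (t - \<tau>0) / e) \<delta>"
  unfolding touch_def
proof (intro conjI allI impI)
  show "norm x0 < 1" "- 1 < t0" "t0 \<le> 0" using dom \<rho> rho2 T by auto
  show "0 \<le> \<Lambda> + N" using Lambda_nonneg N by simp
  show "((\<lambda>t. N * (ts - t) ^ m + (t - \<tau>0)\<^sup>2 / (2 * e)) has_real_derivative - (N * m * (ts - t) ^ (m - 1)) + (t - \<tau>0) / e) (at t)" for t
    using e by (auto intro!: derivative_eq_intros simp: field_simps)
  show "continuous_on UNIV (\<lambda>t. - (N * m * (ts - t) ^ (m - 1)) + (t - \<tau>0) / e)"
    using e by (intro continuous_intros) auto
  have sp: "L * (\<omega> (norm (a + h)) - \<omega> r) + N * (2 * ((x0 - xs) \<bullet> h) + (norm h)\<^sup>2) \<le> (G + (2 * N) *\<^sub>R (x0 - xs)) \<bullet> h + (\<Lambda> + N) * (norm h)\<^sup>2"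
    if "norm (x0 + h) \<le> \<rho>" for h :: "real ^ 'd"
  proof -
    have "norm (a + h) \<le> 2" using rho_bounds(2)[OF that] by (simp add: a_def algebra_simps)
    from modulus_shift[OF this] show ?thesis by (simp add: inner_add_left inner_scaleR_left algebra_simps)
  qed
  show "\<exists>\<delta>'>0. \<forall>x t. norm (x - x0) < \<delta>' \<and> t0 - \<delta>'\<^sup>2 < t \<and> t \<le> t0 \<longrightarrow>
     v (x, t) \<le> test_fun v x0 t0 (G + (2 * N) *\<^sub>R (x0 - xs)) (\<Lambda> + N) (\<lambda>t. N * (ts - t) ^ m + (t - \<tau>0)\<^sup>2 / (2 * e)) (x, t)"
  proof (intro exI[of _ \<delta>'] conjI allI impI delta')
    fix x t assume h: "norm (x - x0) < \<delta>' \<and> t0 - \<delta>'\<^sup>2 < t \<and> t \<le> t0"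
    have nx: "norm (x0 + (x - x0)) \<le> \<rho>" using h delta' by (intro norm_shift) auto
    have "v (x0 + (x - x0), t) \<le> v (x0, t0) + L * (\<omega> (norm (a + (x - x0))) - \<omega> r) + N * (2 * ((x0 - xs) \<bullet> (x - x0)) + (norm (x - x0))\<^sup>2)
     + (N * (ts - t) ^ m + (t - \<tau>0)\<^sup>2 / (2 * e)) - (N * (ts - t0) ^ m + (t0 - \<tau>0)\<^sup>2 / (2 * e))"
      by (rule max_x[OF nx]) (use h delta'(3) time_near(2) dom T in linarith)+
    then show "v (x, t) \<le> test_fun v x0 t0 (G + (2 * N) *\<^sub>R (x0 - xs)) (\<Lambda> + N) (\<lambda>t. N * (ts - t) ^ m + (t - \<tau>0)\<^sup>2 / (2 * e)) (x, t)"
      using sp[OF nx] unfolding test_fun_def by simp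
  qed
  fix h :: "real ^ 'd" assume h: "norm h < \<delta>"
  have nx: "norm (x0 + h) \<le> \<rho>" using h assms by (intro norm_shift) auto
  show "v (x0 + h, t0) \<le> v (x0, t0) + (G + (2 * N) *\<^sub>R (x0 - xs)) \<bullet> h + (\<Lambda> + N) * (norm h)\<^sup>2"
    using max_x[OF nx dom(3,4)] sp[OF nx] by simp
qed (use assms in auto)

lemma touch_y:
  assumes "0 < \<delta>" "\<delta> \<le> R"
  shows "touch (\<lambda>z. - v z) y0 \<tau>0 (- G) \<Lambda> (\<lambda>\<tau>. (t0 - \<tau>)\<^sup>2 / (2 * e)) (\<lambda>\<tau>. - ((t0 - \<tau>) / e)) \<delta>"
  unfolding touch_def
proof (intro conjI allI impI)
  show "norm y0 < 1" "- 1 < \<tau>0" "\<tau>0 \<le> 0" using dom \<rho> rho2 T by auto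
  show "((\<lambda>\<tau>. (t0 - \<tau>)\<^sup>2 / (2 * e)) has_real_derivative - ((t0 - t) / e)) (at t)" for t
    using e by (auto intro!: derivative_eq_intros simp: field_simps)
  show "continuous_on UNIV (\<lambda>\<tau>. - ((t0 - \<tau>) / e))"
    using e by (intro continuous_intros) auto
  have sp: "L * (\<omega> (norm (a - h)) - \<omega> r) \<le> - G \<bullet> h + \<Lambda> * (norm h)\<^sup>2"
    if "norm (y0 + h) \<le> \<rho>" for h :: "real ^ 'd"
  proof -
    have "norm (a + (- h)) \<le> 2" using rho_bounds(3)[OF that] by (simp add: a_def algebra_simps)
    from modulus_shift[OF this] show ?thesis by simp
  qed
  show "\<exists>\<delta>'>0. \<forall>x t. norm (x - y0) < \<delta>' \<and> \<tau>0 - \<delta>'\<^sup>2 < t \<and> t \<le> \<tau>0 \<longrightarrow>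
     - v (x, t) \<le> test_fun (\<lambda>z. - v z) y0 \<tau>0 (- G) \<Lambda> (\<lambda>\<tau>. (t0 - \<tau>)\<^sup>2 / (2 * e)) (x, t)"
  proof (intro exI[of _ \<delta>'] conjI allI impI delta')
    fix x t assume h: "norm (x - y0) < \<delta>' \<and> \<tau>0 - \<delta>'\<^sup>2 < t \<and> t \<le> \<tau>0"
    have nx: "norm (y0 + (x - y0)) \<le> \<rho>" using h delta' by (intro norm_shift) auto
    have "- v (y0 + (x - y0), t) \<le> - v (y0, \<tau>0) + L * (\<omega> (norm (a - (x - y0))) - \<omega> r) + (t0 - t)\<^sup>2 / (2 * e) - (t0 - \<tau>0)\<^sup>2 / (2 * e)"
      by (rule max_y[OF nx]) (use h delta'(3) time_near(3) dom T in linarith)+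
    then show "- v (x, t) \<le> test_fun (\<lambda>z. - v z) y0 \<tau>0 (- G) \<Lambda> (\<lambda>\<tau>. (t0 - \<tau>)\<^sup>2 / (2 * e)) (x, t)"
      using sp[OF nx] unfolding test_fun_def by simp
  qed
  fix h :: "real ^ 'd" assume h: "norm h < \<delta>"
  have nx: "norm (y0 + h) \<le> \<rho>" using h assms by (intro norm_shift) auto
  show "- v (y0 + h, \<tau>0) \<le> - v (y0, \<tau>0) + (- G) \<bullet> h + \<Lambda> * (norm h)\<^sup>2"
    using max_y[OF nx dom(5,6)] sp[OF nx] by simp
qed (use assms Lambda_nonneg in auto)

text \<open>At a contact point the value gap is at most that of the obstacle, and
  \<open>close\<close> converts the time difference into a distance, so it is at most
  \<open>(Lx + Lt) * r\<close>. As \<open>\<omega> r \<ge> r / 2\<close> and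
  \<open>2 * (Lx + Lt) \<le> L\<close>, this contradicts \<open>value_gap\<close>.\<close>

lemma no_contact: "\<not> v (x0, t0) \<le> ob (x0, t0)"
proof
  assume c: "v (x0, t0) \<le> ob (x0, t0)"
  have d1: "norm x0 < 1" "norm y0 < 1" "- 1 < t0" "t0 \<le> 0" "- 1 < \<tau>0" "\<tau>0 \<le> 0" using dom \<rho> rho2 T by auto
  have "ob (y0, \<tau>0) \<le> v (y0, \<tau>0)" using sol d1 unfolding nsol_def by blast
  moreover have "ob (x0, t0) - ob (y0, \<tau>0) \<le> Lx * norm (x0 - y0) + Lt * \<bar>t0 - \<tau>0\<bar> powr \<alpha>"
    using sol d1 unfolding nsol_def by blast
  moreover have "Lt * \<bar>t0 - \<tau>0\<bar> powr \<alpha> \<le> Lt * r" using close(2) Lt unfolding r_def by (rule mult_left_mono)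
  ultimately have "v (x0, t0) - v (y0, \<tau>0) \<le> (Lx + Lt) * r" using c unfolding r_def by (simp add: algebra_simps)
  also have "\<dots> \<le> (L / 2) * r" using L(2) r by (intro mult_right_mono) auto
  also have "\<dots> = L * (r / 2)" by simp
  also have "\<dots> \<le> L * \<omega> r" using modulus_r(1) L_pos by (intro mult_left_mono) auto
  finally show False using value_gap pieces_nonneg by linarith
qed

lemma nonloc_uminus: "nonloc p n (\<lambda>x. - w x) x \<delta> = - nonloc p n w x \<delta>"
proof -
  have "spow p (- w x - - w (x + h)) = - spow p (w x - w (x + h))" for h
    using spow_minus[of p "w x - w (x + h)"] by simp
  then show ?thesis unfolding nonloc_def by simp
qed

text \<open>The factors 2 and 3 in the hypotheses leave room for the contributions of the penalty
  with \<open>N\<close>. As \<open>\<delta> \<le> r\<close>, the sum of gradient and Hessian terms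
  is at most 3 + 2 = 5 times the natural size \<open>L * r powr (\<theta>' - 1)\<close>.\<close>

lemma C_term:
  assumes "0 < \<delta>" "\<delta> \<le> r" "0 \<le> \<Lambda>1" "\<Lambda>1 \<le> 2 * L * r powr (\<theta>' - 2)" "norm g \<le> 3 * L * r powr (\<theta>' - 1)"
  shows "C * (\<Lambda>1 * (norm g + \<Lambda>1 * \<delta>) powr (p - 2) * \<delta> powr (p - q)) \<le>
     C * (2 * 5 powr (p - 2)) * L powr (p - 1) * (r powr ((\<theta>' - 1) * (p - 1) - 1) * \<delta> powr (p - q))"
proof -
  have "\<Lambda>1 * \<delta> \<le> (2 * L * r powr (\<theta>' - 2)) * r" using assms r by (intro mult_mono) auto
  also have "\<dots> = 2 * L * r powr (\<theta>' - 1)" using r powr_mult_base[of r "\<theta>' - 2"] by (simp add: mult_ac)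
  finally have s: "norm g + \<Lambda>1 * \<delta> \<le> 5 * (L * r powr (\<theta>' - 1))" using assms(5) by simp
  have "\<Lambda>1 * (norm g + \<Lambda>1 * \<delta>) powr (p - 2) \<le> (2 * L * r powr (\<theta>' - 2)) * (5 * (L * r powr (\<theta>' - 1))) powr (p - 2)"
    using assms s p L_pos by (intro mult_mono powr_mono2) auto
  also have "(5 * (L * r powr (\<theta>' - 1))) powr (p - 2) = 5 powr (p - 2) * (L powr (p - 2) * r powr ((\<theta>' - 1) * (p - 2)))"
    by (simp only: powr_mult powr_powr)
  also have "(2 * L * r powr (\<theta>' - 2)) * (5 powr (p - 2) * (L powr (p - 2) * r powr ((\<theta>' - 1) * (p - 2))))
     = (2 * 5 powr (p - 2)) * (L * L powr (p - 2)) * (r powr (\<theta>' - 2) * r powr ((\<theta>' - 1) * (p - 2)))" by (simp only: mult_ac)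
  also have "L * L powr (p - 2) = L powr (p - 1)" using L_pos powr_mult_base[of L "p - 2"] by simp
  also have "r powr (\<theta>' - 2) * r powr ((\<theta>' - 1) * (p - 2)) = r powr ((\<theta>' - 1) * (p - 1) - 1)"
    unfolding powr_add[symmetric] by (rule arg_cong[where f="\<lambda>x. r powr x"]) (simp add: algebra_simps)
  finally have "\<Lambda>1 * (norm g + \<Lambda>1 * \<delta>) powr (p - 2) * \<delta> powr (p - q) \<le> (2 * 5 powr (p - 2)) * L powr (p - 1) * r powr ((\<theta>' - 1) * (p - 1) - 1) * \<delta> powr (p - q)"
    by (intro mult_right_mono) auto
  then have "C * (\<Lambda>1 * (norm g + \<Lambda>1 * \<delta>) powr (p - 2) * \<delta> powr (p - q)) \<le> C * ((2 * 5 powr (p - 2)) * L powr (p - 1) * r powr ((\<theta>' - 1) * (p - 1) - 1) * \<delta> powr (p - q))"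
    using C by (rule mult_left_mono)
  then show ?thesis by (simp only: mult.assoc)
qed

text \<open>Add the viscosity inequalities for \<open>v\<close> and \<open>- v\<close>. The doubled
  time penalty contributes \<open>\<kappa> * ((t0 - \<tau>0) / e)\<close> with opposite signs and
  drops out, whatever its size; the derivative of the time localisation is bounded using
  \<open>\<kappa> \<le> 1\<close>. Two principal value errors remain, each treated by
  \<open>C_term\<close>.\<close>

lemma upper_bound:
  assumes \<delta>: "0 < \<delta>" "\<delta> \<le> r"
  shows "nonloc p n (\<lambda>x. v (x, t0)) x0 \<delta> - nonloc p n (\<lambda>x. v (x, \<tau>0)) y0 \<delta> \<le>
     N * real m * (A + 1) * r powr (\<theta> * (1 - 1 / real m)) +
     2 * C * (2 * 5 powr (p - 2)) * L powr (p - 1) * (r powr ((\<theta>' - 1) * (p - 1) - 1) * \<delta> powr (p - q))"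
proof -
  have \<delta>R: "\<delta> \<le> R" using \<delta> r by simp
  let ?c = "C * (2 * 5 powr (p - 2)) * L powr (p - 1) * (r powr ((\<theta>' - 1) * (p - 1) - 1) * \<delta> powr (p - q))"
  have k: "0 < \<kappa>" "\<kappa> \<le> 1" and qs: "qsub p q n \<kappa> C v {z. v z \<le> ob z}" "qsub p q n \<kappa> C (\<lambda>z. - v z) {}" using sol unfolding nsol_def by auto
  let ?g = "G + (2 * N) *\<^sub>R (x0 - xs)"
  have X0: "\<kappa> * (- (N * m * (ts - t0) ^ (m - 1)) + (t0 - \<tau>0) / e) + nonloc p n (\<lambda>x. v (x, t0)) x0 \<delta>
     \<le> C * ((\<Lambda> + N) * (norm ?g + (\<Lambda> + N) * \<delta>) powr (p - 2) * \<delta> powr (p - q))"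
    using qs(1)[unfolded qsub_def, rule_format, OF touch_x[OF \<delta>(1) \<delta>R]] no_contact by simp
  have r1: "1 \<le> r powr (\<theta>' - 1)" "r powr (\<theta>' - 1) \<le> r powr (\<theta>' - 2)"
    using r \<theta>' powr_mono'[of "\<theta>' - 1" 0 r] powr_mono'[of "\<theta>' - 2" "\<theta>' - 1" r] by auto
  have GL: "norm G \<le> L * r powr (\<theta>' - 1)"
    unfolding G_def using L_pos modulus'_r r norm_a by (simp add: mult_left_mono)
  have \<Lambda>L: "\<Lambda> \<le> L * r powr (\<theta>' - 2)"
  proof -
    have "\<omega>' r / (2 * r) \<le> r powr (\<theta>' - 1) / r" using modulus'_r r by (intro frac_le) auto
    also have "\<dots> = r powr (\<theta>' - 2)" using r powr_diff[of r "\<theta>' - 1" 1] by (simp add: algebra_simps)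
    finally show ?thesis unfolding \<Lambda>_def using L_pos by (intro mult_left_mono) auto
  qed
  have NL: "N * 1 \<le> L * r powr (\<theta>' - 1)" using L N r1 by (intro mult_mono) auto
  have NL2: "N * 1 \<le> L * r powr (\<theta>' - 2)" using L N r1 by (intro mult_mono) auto
  have X1: "C * ((\<Lambda> + N) * (norm ?g + (\<Lambda> + N) * \<delta>) powr (p - 2) * \<delta> powr (p - q)) \<le> ?c"
  proof (rule C_term[OF \<delta>])
    show "0 \<le> \<Lambda> + N" using Lambda_nonneg N by simp
    show "\<Lambda> + N \<le> 2 * L * r powr (\<theta>' - 2)" using \<Lambda>L NL2 by simp
    have "norm ?g \<le> norm G + 2 * N * norm (x0 - xs)" using norm_triangle_ineq[of G "(2 * N) *\<^sub>R (x0 - xs)"] N by simp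
    moreover have "2 * N * norm (x0 - xs) \<le> 2 * N * 1" using x0_near(1) rho_bounds(1) N by (intro mult_left_mono) auto
    ultimately show "norm ?g \<le> 3 * L * r powr (\<theta>' - 1)" using GL NL by simp
  qed
  from X0 X1 have X: "\<kappa> * (- (N * m * (ts - t0) ^ (m - 1)) + (t0 - \<tau>0) / e) + nonloc p n (\<lambda>x. v (x, t0)) x0 \<delta> \<le> ?c" by (rule order_trans)
  have "\<kappa> * (- ((t0 - \<tau>0) / e)) + nonloc p n (\<lambda>x. - v (x, \<tau>0)) y0 \<delta> \<le> C * (\<Lambda> * (norm (- G) + \<Lambda> * \<delta>) powr (p - 2) * \<delta> powr (p - q))"
    using qs(2)[unfolded qsub_def, rule_format, OF touch_y[OF \<delta>(1) \<delta>R]] by simp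
  also have "\<dots> \<le> ?c"
  proof (rule C_term[OF \<delta> Lambda_nonneg])
    have "0 \<le> L * r powr (\<theta>' - 2)" "0 \<le> L * r powr (\<theta>' - 1)" using L_pos by auto
    then show "\<Lambda> \<le> 2 * L * r powr (\<theta>' - 2)" "norm (- G) \<le> 3 * L * r powr (\<theta>' - 1)" using \<Lambda>L GL by auto
  qed
  finally have Y: "\<kappa> * (- ((t0 - \<tau>0) / e)) - nonloc p n (\<lambda>x. v (x, \<tau>0)) y0 \<delta> \<le> ?c" unfolding nonloc_uminus by simp
  have "\<kappa> * (N * m * (ts - t0) ^ (m - 1)) \<le> 1 * (N * m * (ts - t0) ^ (m - 1))"
    using k N dom by (intro mult_right_mono mult_nonneg_nonneg) auto
  also have "\<dots> = N * m * (ts - t0) ^ (m - 1)" by simp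
  also have "\<dots> \<le> N * m * ((A + 1) * r powr (\<theta> * (1 - 1 / real m)))"
    using time_near(4) N by (intro mult_left_mono) auto
  finally have Z: "\<kappa> * (N * m * (ts - t0) ^ (m - 1)) \<le> N * m * ((A + 1) * r powr (\<theta> * (1 - 1 / real m)))" .
  have "\<kappa> * (- (N * m * (ts - t0) ^ (m - 1)) + (t0 - \<tau>0) / e) = - (\<kappa> * (N * m * (ts - t0) ^ (m - 1))) + \<kappa> * ((t0 - \<tau>0) / e)"
    by (simp only: distrib_left mult_minus_right)
  moreover have "\<kappa> * (- ((t0 - \<tau>0) / e)) = - (\<kappa> * ((t0 - \<tau>0) / e))" by (simp only: mult_minus_right)
  moreover have "2 * C * (2 * 5 powr (p - 2)) * L powr (p - 1) * (r powr ((\<theta>' - 1) * (p - 1) - 1) * \<delta> powr (p - q)) = ?c + ?c" by simp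
  moreover have "N * m * ((A + 1) * r powr (\<theta> * (1 - 1 / real m))) = N * real m * (A + 1) * r powr (\<theta> * (1 - 1 / real m))" by simp
  ultimately show ?thesis using X Y Z by linarith
qed

end

text \<open>The first bound is used for \<open>y \<le> u\<close>, the second for
  \<open>y > u\<close>; both are dominated by the same geometric mean. This trades a little of the
  smallness \<open>u\<^sup>2\<close> for a positive power of \<open>y\<close>, which makes the
  singular kernel less singular.\<close>

lemma min_power_bound:
  fixes u y \<sigma> K X :: real
  assumes "0 < u" "0 \<le> y" "0 \<le> \<sigma>" "\<sigma> \<le> 1 / 2" "0 \<le> K"
    and X: "- (K * (u * y + y\<^sup>2)) \<le> X" "- (K * u\<^sup>2) \<le> X"
  shows "- (2 * K * u powr (2 - 2 * \<sigma>) * y powr (2 * \<sigma>)) \<le> X"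
proof (cases "y \<le> u")
  case True
  have "u * y + y\<^sup>2 \<le> 2 * (u * y)" using True assms by (simp add: power2_eq_square mult_right_mono)
  also have "u * y \<le> u powr (2 - 2 * \<sigma>) * y powr (2 * \<sigma>)"
  proof (cases "y = 0")
    case False
    then have y: "0 < y" using assms by simp
    have "u * y = u powr 1 * (y powr (1 - 2 * \<sigma>) * y powr (2 * \<sigma>))" using y assms by (simp add: powr_add[symmetric])
    also have "\<dots> \<le> u powr 1 * (u powr (1 - 2 * \<sigma>) * y powr (2 * \<sigma>))"
      using True y assms by (intro mult_left_mono mult_right_mono powr_mono2) auto
    also have "\<dots> = (u powr 1 * u powr (1 - 2 * \<sigma>)) * y powr (2 * \<sigma>)" by (simp only: mult.assoc)
    also have "u powr 1 * u powr (1 - 2 * \<sigma>) = u powr (2 - 2 * \<sigma>)" unfolding powr_add[symmetric] by simp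
    finally show ?thesis .
  qed simp
  finally have "K * (u * y + y\<^sup>2) \<le> K * (2 * (u powr (2 - 2 * \<sigma>) * y powr (2 * \<sigma>)))" using assms by (intro mult_left_mono) auto
  then show ?thesis using X(1) by (simp add: mult_ac)
next
  case False
  have "u\<^sup>2 = u powr (2 - 2 * \<sigma>) * u powr (2 * \<sigma>)" using assms by (simp add: powr_add[symmetric])
  also have "\<dots> \<le> u powr (2 - 2 * \<sigma>) * y powr (2 * \<sigma>)" using False assms by (intro mult_left_mono powr_mono2) auto
  finally have "K * u\<^sup>2 \<le> K * (u powr (2 - 2 * \<sigma>) * y powr (2 * \<sigma>))" using assms by (intro mult_left_mono) auto
  moreover have "0 \<le> K * (u powr (2 - 2 * \<sigma>) * y powr (2 * \<sigma>))" using assms by simp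
  ultimately have "K * u\<^sup>2 \<le> 2 * K * u powr (2 - 2 * \<sigma>) * y powr (2 * \<sigma>)" by (simp add: mult_ac)
  then show ?thesis using X(2) by linarith
qed

context doubled_max
begin

lemma increment_holder:
  assumes "norm h < R"
  shows "\<bar>v (x0, t0) - v (x0 + h, t0)\<bar> \<le> A * norm h powr \<theta>" "\<bar>v (y0, \<tau>0) - v (y0 + h, \<tau>0)\<bar> \<le> A * norm h powr \<theta>"
  using reg[OF dom(1) norm_shift(1)[of h] dom(3)] reg[OF dom(2) norm_shift(2)[of h] dom(5)] assms dom T by auto

text \<open>Two competing bounds with \<open>u = r powr (\<theta> / 2)\<close>: the penalty of a
  common jump, good for short jumps, and the known Hoelder estimate at distance r before and after
  the jump, which does not depend on its length. They are interpolated with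
  \<open>\<sigma> = 1 / m\<close>.\<close>

lemma increment_diff:
  assumes h: "norm h < R"
  shows "- (4 * N * (A + 1) * r powr (\<theta> * (1 - 1 / real m)) * norm h powr (2 * (1 / real m)))
    \<le> (v (x0, t0) - v (x0 + h, t0)) - (v (y0, \<tau>0) - v (y0 + h, \<tau>0))" (is "_ \<le> ?X")
proof -
  let ?u = "r powr (\<theta> / 2)"
  have u: "0 < ?u" using r by simp
  have u2: "?u\<^sup>2 = r powr \<theta>" by (simp add: power2_eq_square powr_add[symmetric])
  have sh: "norm (x0 + h) \<le> \<rho>" "norm (y0 + h) \<le> \<rho>" using norm_shift h by auto
  have 1: "- (2 * N * (A + 1) * (?u * norm h + (norm h)\<^sup>2)) \<le> ?X"
  proof -
    have "(x0 - xs) \<bullet> h \<le> norm (x0 - xs) * norm h" by (rule norm_cauchy_schwarz)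
    also have "\<dots> \<le> (A + 1) * ?u * norm h" using x0_near(2) by (rule mult_right_mono) simp
    finally have "2 * ((x0 - xs) \<bullet> h) + (norm h)\<^sup>2 \<le> 2 * ((A + 1) * ?u * norm h) + (2 * (A + 1)) * (norm h)\<^sup>2"
      using A mult_right_mono[of 1 "2 * (A + 1)" "(norm h)\<^sup>2"] by simp
    then have "N * (2 * ((x0 - xs) \<bullet> h) + (norm h)\<^sup>2) \<le> N * (2 * ((A + 1) * ?u * norm h) + (2 * (A + 1)) * (norm h)\<^sup>2)"
      using N by (intro mult_left_mono) auto
    moreover have "N * (2 * ((A + 1) * ?u * norm h) + (2 * (A + 1)) * (norm h)\<^sup>2) = 2 * N * (A + 1) * (?u * norm h + (norm h)\<^sup>2)"
      by (simp add: algebra_simps)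
    ultimately show ?thesis using max_xy[of h] h by linarith
  qed
  have 2: "- (2 * N * (A + 1) * ?u\<^sup>2) \<le> ?X"
  proof -
    have "x0 + h - (y0 + h) = x0 - y0" by simp
    then have "\<bar>v (x0 + h, t0) - v (y0 + h, t0)\<bar> \<le> A * r powr \<theta>"
      using reg[OF sh(1,2) dom(3)] dom T unfolding r_def by simp
    moreover have "\<bar>v (y0 + h, t0) - v (y0 + h, \<tau>0)\<bar> \<le> r powr \<theta>"
      using close(1) sh(2) r_le_powr[OF \<theta>] unfolding r_def by fastforce
    ultimately have "?X \<ge> - (2 * (A + 1) * r powr \<theta>)" using gap_le(2) by (simp add: algebra_simps)
    moreover have "1 * (2 * (A + 1) * r powr \<theta>) \<le> N * (2 * (A + 1) * r powr \<theta>)" using N A by (intro mult_right_mono) auto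
    ultimately show ?thesis unfolding u2 by (simp add: mult_ac)
  qed
  have "- (2 * (2 * N * (A + 1)) * ?u powr (2 - 2 * (1 / real m)) * norm h powr (2 * (1 / real m))) \<le> ?X"
    by (rule min_power_bound[OF u norm_ge_zero _ _ _ 1 2]) (use m N A in auto)
  moreover have "?u powr (2 - 2 * (1 / real m)) = r powr (\<theta> * (1 - 1 / real m))"
    unfolding powr_powr by (rule arg_cong[where f="\<lambda>x. r powr x"]) (simp add: algebra_simps)
  ultimately show ?thesis by simp
qed

section \<open>The gain from strict concavity\<close>

lemma b_pos: "0 < b"
  unfolding b_def using powr_less_mono2[of \<gamma> "7/8" 1] \<gamma> by simp

text \<open>The jumps of \<open>gain_geometry\<close> and the value that \<open>spow_diff_ge\<close>
  yields for them: the first factor of \<open>gain_val\<close> bounds the size of the increment, the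
  second one the difference of the two increments.\<close>

definition "gain_ball = ball ((3/8) *\<^sub>R a) (sqrt (b / 128) * r powr (\<gamma> / 2) * r)"
definition "gain_val = (L * r powr \<theta>' / 20) powr (p - 2) * (L * (b / 64) * r powr (\<theta>' + \<gamma>))"

text \<open>Moving only \<open>x0\<close> or only \<open>y0\<close> by \<open>h\<close> changes
  \<open>a\<close> into \<open>a + h\<close> or \<open>a - h\<close>, so the maximum bounds the
  increment at \<open>x0\<close> from below by \<open>E\<close> and the one at \<open>y0\<close>
  from above by \<open>F\<close>. The second difference of the modulus makes \<open>E\<close> exceed
  \<open>F\<close>, and monotonicity of \<open>spow\<close> carries the comparison over to the
  solution.\<close>

lemma gain:
  assumes h: "h \<in> gain_ball"
  shows "r / 4 \<le> norm h" "norm h \<le> r / 2"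
    and "gain_val \<le> spow p (v (x0, t0) - v (x0 + h, t0)) - spow p (v (y0, \<tau>0) - v (y0 + h, \<tau>0))"
proof -
  define k where "k = h - (3/8) *\<^sub>R a"
  have hk: "h = (3/8) *\<^sub>R a + k" by (simp add: k_def)
  have k: "norm k \<le> sqrt ((1 - (7/8) powr \<gamma>) / 128) * norm a powr (\<gamma> / 2) * norm a"
    using h unfolding gain_ball_def b_def k_def norm_a by (simp add: dist_norm norm_minus_commute)
  note geo = gain_geometry[OF \<theta>' \<gamma>(1,2) _ _ k, folded hk b_def, unfolded norm_a, OF r(1,4)]
  show nh: "r / 4 \<le> norm h" "norm h \<le> r / 2" using geo(1,2) .
  let ?s = "r powr (\<theta>' + \<gamma>)"
  let ?P = "N * (2 * ((x0 - xs) \<bullet> h) + (norm h)\<^sup>2)"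
  have hR: "norm h \<le> R" using nh r by simp
  have P: "\<bar>?P\<bar> \<le> L * (b / 64) * ?s"
  proof -
    have rp: "r * r powr (\<theta> / 2) = r powr (1 + \<theta> / 2)" using r by (simp add: powr_add)
    have "\<bar>(x0 - xs) \<bullet> h\<bar> \<le> norm (x0 - xs) * norm h" by (rule Cauchy_Schwarz_ineq2)
    also have "\<dots> \<le> ((A + 1) * r powr (\<theta> / 2)) * (r / 2)" using x0_near(2) nh A by (intro mult_mono) auto
    finally have 1: "\<bar>2 * ((x0 - xs) \<bullet> h)\<bar> \<le> (A + 1) * r powr (1 + \<theta> / 2)" unfolding rp[symmetric] by (simp add: mult_ac)
    have "(norm h)\<^sup>2 \<le> (r / 2)\<^sup>2" using nh by (intro power_mono) auto
    also have "\<dots> \<le> r * r" by (simp add: power2_eq_square)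
    also have "\<dots> \<le> r * r powr (\<theta> / 2)" using r r_le_powr[of "\<theta> / 2"] \<theta> by (intro mult_left_mono) auto
    finally have 2: "(norm h)\<^sup>2 \<le> r powr (1 + \<theta> / 2)" unfolding rp .
    have "(A + 2) * r powr (1 + \<theta> / 2) = (A + 1) * r powr (1 + \<theta> / 2) + r powr (1 + \<theta> / 2)" by (simp add: algebra_simps)
    moreover have "\<bar>(norm h)\<^sup>2\<bar> = (norm h)\<^sup>2" by simp
    ultimately have "\<bar>2 * ((x0 - xs) \<bullet> h) + (norm h)\<^sup>2\<bar> \<le> (A + 2) * r powr (1 + \<theta> / 2)"
      using 1 2 abs_triangle_ineq[of "2 * ((x0 - xs) \<bullet> h)" "(norm h)\<^sup>2"] by linarith
    also have "\<dots> \<le> (A + 3) * ?s" using A r \<gamma> by (intro mult_mono powr_mono') auto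
    finally have "N * \<bar>2 * ((x0 - xs) \<bullet> h) + (norm h)\<^sup>2\<bar> \<le> N * ((A + 3) * ?s)" using N by (intro mult_left_mono) auto
    then have "\<bar>?P\<bar> \<le> N * (A + 3) * ?s" using N by (simp add: abs_mult mult.assoc)
    \<comment> \<open>Here the third lower bound on \<open>L\<close> enters: the spatial penalty
      consumes at most half of the concavity gain \<open>b / 32\<close>.\<close>
    also have "\<dots> \<le> (L * (b / 64)) * ?s" using L(3) unfolding b_def by (intro mult_right_mono) (auto simp: algebra_simps)
    finally show ?thesis .
  qed
  define E where "E = - (L * (\<omega> (norm (a + h)) - \<omega> r)) - ?P"
  define F where "F = L * (\<omega> (norm (a - h)) - \<omega> r)"
  have e: "E \<le> v (x0, t0) - v (x0 + h, t0)"
    using max_x[OF norm_shift(1)[OF hR] dom(3,4)] unfolding E_def by simp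
  have f: "v (y0, \<tau>0) - v (y0 + h, \<tau>0) \<le> F"
    using max_y[OF norm_shift(2)[OF hR] dom(5,6)] unfolding F_def by simp
  have EF: "L * (b / 64) * ?s \<le> E - F"
  proof -
    have "E - F = - (L * (\<omega> (norm (a + h)) + \<omega> (norm (a - h)) - 2 * \<omega> r)) - ?P"
      unfolding E_def F_def by (simp add: algebra_simps)
    moreover have "L * (\<omega> (norm (a + h)) + \<omega> (norm (a - h)) - 2 * \<omega> r) \<le> L * (- (b / 32) * ?s)"
      using geo(4) L_pos by (intro mult_left_mono) auto
    moreover have "L * (- (b / 32) * ?s) = - (2 * (L * (b / 64) * ?s))" by simp
    ultimately show ?thesis using P by linarith
  qed
  have EL: "E \<le> - (L * r powr \<theta>' / 20)"
  proof -
    have "L * (r powr \<theta>' / 10) \<le> L * (\<omega> (norm (a + h)) - \<omega> r)" using geo(3) L_pos by (intro mult_left_mono) auto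
    moreover have "L * (b / 64) * ?s \<le> L * (1 / 20) * r powr \<theta>'"
    proof (intro mult_mono)
      have "b \<le> 1" by (simp add: b_def)
      then show "b / 64 \<le> 1 / 20" by simp
      show "?s \<le> r powr \<theta>'" using r \<gamma> by (intro powr_mono') auto
    qed (use L_pos b_pos in auto)
    ultimately show ?thesis using P unfolding E_def by simp
  qed
  have E0: "E \<le> 0" using EL L_pos by (smt (verit) divide_nonneg_nonneg mult_nonneg_nonneg powr_ge_zero)
  have p0: "0 \<le> L * (b / 64) * ?s" using L_pos b_pos by simp
  have "gain_val \<le> \<bar>E\<bar> powr (p - 2) * (E - F)"
    unfolding gain_val_def
  proof (intro mult_mono EF)
    show "(L * r powr \<theta>' / 20) powr (p - 2) \<le> \<bar>E\<bar> powr (p - 2)"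
      using EL E0 p L_pos by (intro powr_mono2) auto
  qed (use p0 in auto)
  also have "\<dots> \<le> spow p E - spow p F" by (rule spow_diff_ge[OF p E0]) (use EF p0 in linarith)
  also have "\<dots> \<le> spow p (v (x0, t0) - v (x0 + h, t0)) - spow p (v (y0, \<tau>0) - v (y0 + h, \<tau>0))"
    using spow_mono[OF p e] spow_mono[OF p f] by linarith
  finally show "gain_val \<le> spow p (v (x0, t0) - v (x0 + h, t0)) - spow p (v (y0, \<tau>0) - v (y0 + h, \<tau>0))" .
qed

lemma gain_val_nonneg: "0 \<le> gain_val"
  unfolding gain_val_def using L_pos b_pos by simp

text \<open>\<open>\<theta>' * (p - 1) - q\<close> is the natural scaling of the operator. The loss
  consists of \<open>\<gamma>\<close> from the weak concavity and of \<open>\<gamma> / 2\<close> per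
  dimension from the narrow ball of jumps.\<close>

lemma gain_total:
  "gain_val * (r powr - n / 2) * measure lebesgue gain_ball =
   ((1 / 20) powr (p - 2) * (b / 64) / 2 * unit_ball_vol (real CARD('d)) * sqrt (b / 128) ^ CARD('d)) *
   (L powr (p - 1) * r powr (\<theta>' * (p - 1) + \<gamma> * (1 + real CARD('d) / 2) - q))"
proof -
  let ?d = "real CARD('d)"
  have rr: "0 \<le> sqrt (b / 128) * r powr (\<gamma> / 2) * r" using b_pos r by simp
  have "measure lebesgue gain_ball = unit_ball_vol ?d * (sqrt (b / 128) * r powr (\<gamma> / 2) * r) ^ CARD('d)"
    unfolding gain_ball_def using content_ball[OF rr, of "(3/8) *\<^sub>R a"] by simp
  also have "(sqrt (b / 128) * r powr (\<gamma> / 2) * r) ^ CARD('d) = sqrt (b / 128) ^ CARD('d) * (r powr (\<gamma> / 2 * ?d) * r powr ?d)"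
    using r by (simp add: power_mult_distrib powr_realpow[symmetric] powr_powr mult.commute)
  finally have M: "measure lebesgue gain_ball = unit_ball_vol ?d * (sqrt (b / 128) ^ CARD('d) * (r powr (\<gamma> / 2 * ?d) * r powr ?d))" .
  have "(L * r powr \<theta>' / 20) powr (p - 2) = (1 / 20 * (L * r powr \<theta>')) powr (p - 2)" by simp
  also have "\<dots> = (1 / 20) powr (p - 2) * (L powr (p - 2) * r powr (\<theta>' * (p - 2)))" by (simp only: powr_mult powr_powr)
  finally have g: "gain_val = (1 / 20) powr (p - 2) * (L powr (p - 2) * r powr (\<theta>' * (p - 2))) * (L * (b / 64) * r powr (\<theta>' + \<gamma>))"
    unfolding gain_val_def by simp
  have "gain_val * (r powr - n / 2) * measure lebesgue gain_ball =
    ((1 / 20) powr (p - 2) * (b / 64) / 2 * unit_ball_vol ?d * sqrt (b / 128) ^ CARD('d)) *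
    ((L * L powr (p - 2)) * (r powr (\<theta>' * (p - 2)) * r powr (\<theta>' + \<gamma>) * r powr - n * r powr (\<gamma> / 2 * ?d) * r powr ?d))"
    unfolding M g by simp
  also have "L * L powr (p - 2) = L powr (p - 1)" using L_pos powr_mult_base[of L "p - 2"] by simp
  also have "r powr (\<theta>' * (p - 2)) * r powr (\<theta>' + \<gamma>) * r powr - n * r powr (\<gamma> / 2 * ?d) * r powr ?d = r powr (\<theta>' * (p - 1) + \<gamma> * (1 + ?d / 2) - q)"
    unfolding powr_add[symmetric] n by (rule arg_cong[where f="\<lambda>x. r powr x"]) (simp add: algebra_simps)
  finally show ?thesis .
qed

text \<open>The truncation radius is \<open>\<delta> = r powr (1 + \<mu>)\<close>. With
  \<open>\<delta> = r\<close> the principal value error would scale like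
  \<open>r powr (\<theta>' * (p - 1) - q)\<close> and beat the gain, which has the extra power
  \<open>\<gamma> * (1 + d / 2)\<close>, d being the dimension; \<open>H3\<close> makes the error
  smaller than the gain by that same power. \<open>H1\<close> and \<open>H2\<close> bring the
  remaining errors, which carry no power of \<open>L\<close>, to the order in r of the gain.\<close>

lemma core_inequality:
  fixes \<mu> q' Cn :: real
  assumes \<mu>: "0 \<le> \<mu>" "r powr \<mu> \<le> 1 / 4" and Cn: "0 \<le> Cn"
    and nd: "nonloc_gap_bound TYPE('d) p n q' \<theta> (1 / real m) (4 * N * (A + 1)) (A + 1) A R Cn"
    and tails: "tail_int p n (\<lambda>z. v (z, t0) - v (z, \<tau>0)) \<le> r powr (p - 1)"
    and H1: "\<theta>' * (p - 1) + \<gamma> * (1 + real CARD('d) / 2) - q \<le> \<theta> * (1 - 1 / real m)"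
    and H2: "\<theta>' * (p - 1) + \<gamma> * (1 + real CARD('d) / 2) - q \<le> \<theta> * (1 - 1 / real m) + (1 + \<mu>) * q'"
    and H3: "\<mu> * (p - q) = 2 * (\<gamma> * (1 + real CARD('d) / 2))"
  shows "((1 / 20) powr (p - 2) * (b / 64) / 2 * unit_ball_vol (real CARD('d)) * sqrt (b / 128) ^ CARD('d)) * L powr (p - 1)
    \<le> 2 * Cn + N * real m * (A + 1) + 2 * C * (2 * 5 powr (p - 2)) * L powr (p - 1) * r powr (\<gamma> * (1 + real CARD('d) / 2))"
    (is "?cg * _ \<le> _")
proof -
  let ?\<Gamma> = "\<gamma> * (1 + real CARD('d) / 2)"
  let ?G = "\<theta>' * (p - 1) + ?\<Gamma> - q"
  let ?\<delta> = "r powr (1 + \<mu>)"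
  let ?u = "r powr (\<theta> * (1 - 1 / real m))"
  have \<delta>e: "?\<delta> = r * r powr \<mu>" using r by (simp add: powr_add)
  \<comment> \<open>Jumps in \<open>gain_ball\<close> have length at least \<open>r / 4\<close>,
    hence are not cut off by the truncation.\<close>
  have \<delta>: "0 < ?\<delta>" "?\<delta> \<le> r / 4" using r \<mu> mult_left_mono[of "r powr \<mu>" "1/4" r] unfolding \<delta>e by auto
  have tl: "tail_fun p n (\<lambda>x. v (x, t))" "tail_int p n (\<lambda>x. v (x, t)) \<le> 1" if "- \<rho>\<^sup>2 \<le> t" "t \<le> 0" for t
    using sol that rho2 unfolding nsol_def by auto
  have gb: "?\<delta> \<le> norm h" "norm h \<le> R / 2" "norm h \<le> r" if "h \<in> gain_ball" for h
    using gain(1,2)[OF that] \<delta>(2) r by linarith+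
  have "gain_val * (r powr - n / 2) * measure lebesgue gain_ball - Cn * (?u * ?\<delta> powr q' + r powr \<theta>)
    \<le> nonloc p n (\<lambda>x. v (x, t0)) x0 ?\<delta> - nonloc p n (\<lambda>x. v (x, \<tau>0)) y0 ?\<delta>"
  proof (rule nd[unfolded nonloc_gap_bound_def, rule_format], intro conjI allI ballI impI)
    show "r = norm (x0 - y0)" by (simp add: r_def)
    show "\<bar>v (x0, t0)\<bar> \<le> 1" "\<bar>v (y0, \<tau>0)\<bar> \<le> 1" using v_bound dom T by auto
    show "\<bar>v (x0, t0) - v (y0, \<tau>0)\<bar> \<le> (A + 1) * r powr \<theta>" by (rule gap_le(2))
    show "tail_int p n (\<lambda>z. v (z, t0) - v (z, \<tau>0)) \<le> r powr (p - 1)" by (rule tails)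
    show "gain_ball \<in> sets lebesgue" by (simp add: gain_ball_def)
    show "gain_val \<le> spow p (v (x0, t0) - v (x0 + h, t0)) - spow p (v (y0, \<tau>0) - v (y0 + h, \<tau>0))" if "h \<in> gain_ball" for h
      by (rule gain(3)[OF that])
  qed (use \<delta> r dom \<rho> T tl increment_diff increment_holder gb gain_val_nonneg in \<open>auto intro: order_trans\<close>)
  also have "\<dots> \<le> N * real m * (A + 1) * ?u + 2 * C * (2 * 5 powr (p - 2)) * L powr (p - 1) * (r powr ((\<theta>' - 1) * (p - 1) - 1) * ?\<delta> powr (p - q))"
    by (rule upper_bound) (use \<delta> r in auto)
  also have "r powr ((\<theta>' - 1) * (p - 1) - 1) * ?\<delta> powr (p - q) = r powr ?G * r powr ?\<Gamma>"
    unfolding powr_powr powr_add[symmetric] using H3 by (intro arg_cong[where f="\<lambda>x. r powr x"]) (simp add: algebra_simps)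
  also have "?u * ?\<delta> powr q' = r powr (\<theta> * (1 - 1 / real m) + (1 + \<mu>) * q')" by (simp only: powr_powr powr_add[symmetric])
  finally have main: "?cg * (L powr (p - 1) * r powr ?G) - Cn * (r powr (\<theta> * (1 - 1 / real m) + (1 + \<mu>) * q') + r powr \<theta>)
    \<le> N * real m * (A + 1) * ?u + 2 * C * (2 * 5 powr (p - 2)) * L powr (p - 1) * (r powr ?G * r powr ?\<Gamma>)" unfolding gain_total .
  have r1: "r \<le> 1" using r by simp
  have uG: "?u \<le> r powr ?G" using H1 r r1 by (intro powr_mono') auto
  have 2: "r powr (\<theta> * (1 - 1 / real m) + (1 + \<mu>) * q') \<le> r powr ?G" using H2 r r1 by (intro powr_mono') auto
  have "\<theta> * (1 - 1 / real m) \<le> \<theta>" using \<theta> m by (simp add: mult_left_le)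
  then have "r powr \<theta> \<le> ?u" using r r1 by (intro powr_mono') auto
  then have "Cn * (r powr (\<theta> * (1 - 1 / real m) + (1 + \<mu>) * q') + r powr \<theta>) \<le> Cn * (r powr ?G + r powr ?G)"
    using 2 uG Cn by (intro mult_left_mono add_mono) auto
  moreover have "N * real m * (A + 1) * ?u \<le> N * real m * (A + 1) * r powr ?G"
    using uG N A by (intro mult_left_mono) auto
  ultimately have fin: "?cg * (L powr (p - 1) * r powr ?G) \<le> Cn * (r powr ?G + r powr ?G) + N * real m * (A + 1) * r powr ?G
     + 2 * C * (2 * 5 powr (p - 2)) * L powr (p - 1) * (r powr ?G * r powr ?\<Gamma>)" using main by linarith
  have gen: "g * l \<le> 2 * Cn + k + c * l * y"
    if "g * (l * x) \<le> Cn * (x + x) + k * x + c * l * (x * y)" "0 < x" for g l x k c y :: real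
  proof -
    have "(g * l) * x \<le> (2 * Cn + k + c * l * y) * x" using that(1) by (simp add: algebra_simps)
    then show ?thesis using that(2) by (rule mult_right_le_imp_le)
  qed
  show ?thesis by (rule gen[OF fin]) (use r in simp)
qed

end

definition space_reg :: "real \<Rightarrow> real \<Rightarrow> real \<Rightarrow> ((real ^ 'd) \<times> real \<Rightarrow> real) \<Rightarrow> bool" where
  "space_reg A \<theta> \<rho> v \<longleftrightarrow> (\<forall>x y t. norm x \<le> \<rho> \<and> norm y \<le> \<rho> \<and> - \<rho>\<^sup>2 \<le> t \<and> t \<le> 0 \<longrightarrow>
     \<bar>v (x, t) - v (y, t)\<bar> \<le> A * norm (x - y) powr \<theta>)"

text \<open>\<open>N\<close> and \<open>Cn\<close> are fixed before \<open>L\<close>. If the modulus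
  bound failed, the maximum would satisfy \<open>L * r powr \<theta>' < 4\<close>, so a large
  \<open>L\<close> makes r so small that half of the gain absorbs the principal value error. Then
  \<open>core_inequality\<close> bounds \<open>L\<close> itself, a contradiction.\<close>

lemma space_step:
  assumes p: "2 < p" and q: "0 < q" "q < p" and n: "n = real CARD('d) + q" and C: "0 \<le> C"
    and \<alpha>: "0 < \<alpha>" and Lt: "0 \<le> Lt"
    and \<theta>: "0 \<le> \<theta>" "\<theta> \<le> 1" and \<theta>': "0 < \<theta>'" "\<theta>' \<le> 1" and \<gamma>: "0 < \<gamma>" "\<gamma> \<le> 1" "\<theta>' + \<gamma> \<le> 1 + \<theta> / 2"
    and m: "2 \<le> m" and q': "q' = 3 * (1 / real m) / 2 + \<theta> * (p - 2) - q" "q' \<le> 0" and \<mu>: "0 < \<mu>"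
    and H1: "\<theta>' * (p - 1) + \<gamma> * (1 + real CARD('d) / 2) - q \<le> \<theta> * (1 - 1 / real m)"
    and H2: "\<theta>' * (p - 1) + \<gamma> * (1 + real CARD('d) / 2) - q \<le> \<theta> * (1 - 1 / real m) + (1 + \<mu>) * q'"
    and H3: "\<mu> * (p - q) = 2 * (\<gamma> * (1 + real CARD('d) / 2))"
    and A: "1 \<le> A" and \<rho>: "0 < \<rho>" "\<rho> < \<rho>1" "\<rho>1 < 3/4"
  shows "\<exists>A'\<ge>1. \<forall>\<kappa> (v :: (real ^ 'd) \<times> real \<Rightarrow> real) ob. nsol p q C \<kappa> Lx Lt \<alpha> n v ob \<and> space_reg A \<theta> \<rho>1 v \<longrightarrow> space_reg A' \<theta>' \<rho> v"
proof -
  \<comment> \<open>These give the margins \<open>4 * R\<close> in space and \<open>2 * T\<close> in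
    time that \<open>doubled_max\<close> demands at points of the smaller cylinder.\<close>
  define R where "R = (\<rho>1 - \<rho>) / 4"
  define T where "T = (\<rho>1\<^sup>2 - \<rho>\<^sup>2) / 2"
  have R: "0 < R" "R \<le> 1" using \<rho> by (auto simp: R_def)
  have "\<rho>\<^sup>2 < \<rho>1\<^sup>2" using \<rho> by (intro power_strict_mono) auto
  then have T: "0 < T" by (simp add: T_def)
  define N where "N = Max {1, 2 / R\<^sup>2, 2 / T ^ m}"
  have N: "1 \<le> N" "2 \<le> N * R\<^sup>2" "2 \<le> N * T ^ m"
  proof -
    have "2 / R\<^sup>2 \<le> N" "2 / T ^ m \<le> N" unfolding N_def by auto
    then show "2 \<le> N * R\<^sup>2" "2 \<le> N * T ^ m" using R T by (simp_all add: pos_divide_le_eq)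
    show "1 \<le> N" unfolding N_def by simp
  qed
  let ?\<sigma> = "1 / real m"
  have \<sigma>: "0 < ?\<sigma>" using m by simp
  have c: "0 \<le> 4 * N * (A + 1)" "0 \<le> A + 1" "0 \<le> A" using N A by auto
  obtain Cn where Cn: "0 < Cn" and nd: "nonloc_gap_bound TYPE('d) p n q' \<theta> (1 / real m) (4 * N * (A + 1)) (A + 1) A R Cn"
    using nonloc_diff[OF p q(1) n R \<theta> \<sigma> c q'] by blast
  define b where "b = 1 - (7/8) powr \<gamma>"
  have b: "0 < b" unfolding b_def using powr_less_mono2[of \<gamma> "7/8" 1] \<gamma> by simp
  let ?\<Gamma> = "\<gamma> * (1 + real CARD('d) / 2)"
  define cg where "cg = (1 / 20) powr (p - 2) * (b / 64) / 2 * unit_ball_vol (real CARD('d)) * sqrt (b / 128) ^ CARD('d)"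
  have cg: "0 < cg" unfolding cg_def using b by simp
  define c1 where "c1 = 2 * Cn + N * real m * (A + 1)"
  define c2 where "c2 = 2 * C * (2 * 5 powr (p - 2))"
  have c12: "0 < c1" "0 \<le> c2" unfolding c1_def c2_def using Cn N A C by (auto intro!: add_pos_nonneg)
  have \<Gamma>: "0 < ?\<Gamma>" using \<gamma> by simp
  \<comment> \<open>The first three entries are the smallness assumptions of
    \<open>doubled_max\<close>, the fourth gives \<open>r powr \<mu> \<le> 1 / 4\<close>, and the
    last lets half of the gain absorb the principal value error.\<close>
  define r1 where "r1 = Min {R, T / 2, 1 / 2, (1 / 4) powr (1 / \<mu>), (cg / (2 * (c2 + 1))) powr (1 / ?\<Gamma>)}"
  have r1: "0 < r1" "r1 \<le> R" "r1 \<le> T / 2" "r1 \<le> 1 / 2" "r1 \<le> (1 / 4) powr (1 / \<mu>)" "r1 \<le> (cg / (2 * (c2 + 1))) powr (1 / ?\<Gamma>)"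
    unfolding r1_def using R T cg c12 by auto
  \<comment> \<open>The first three entries are required by \<open>doubled_max\<close>;
    \<open>4 / r1 powr \<theta>'\<close> forces \<open>?r \<le> r1\<close>, the entry 4 excludes
    \<open>?r > 1\<close>, and the last one contradicts the core inequality.\<close>
  define L where "L = Max {N, 2 * (Lx + Lt), 64 * N * (A + 3) / b, 4 / r1 powr \<theta>', 4, 2 * c1 / cg + 1}"
  have L: "N \<le> L" "2 * (Lx + Lt) \<le> L" "64 * N * (A + 3) / b \<le> L" "4 / r1 powr \<theta>' \<le> L" "4 \<le> L" "2 * c1 / cg + 1 \<le> L"
    unfolding L_def by (intro Max_ge; simp)+
  have L0: "0 < L" using L by simp
  have main: "v (x, t) - v (y, t) \<le> L * modulus \<theta>' \<gamma> (norm (x - y))"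
    if sol: "nsol p q C \<kappa> Lx Lt \<alpha> n v ob" and reg: "space_reg A \<theta> \<rho>1 v"
      and x: "norm x \<le> \<rho>" "norm y \<le> \<rho>" "- \<rho>\<^sup>2 \<le> t" "t \<le> 0"
    for \<kappa> t and v ob :: "(real ^ 'd) \<times> real \<Rightarrow> real" and x y
  proof (rule ccontr)
    assume "\<not> v (x, t) - v (y, t) \<le> L * modulus \<theta>' \<gamma> (norm (x - y))"
    then have viol: "L * modulus \<theta>' \<gamma> (norm (x - y)) < v (x, t) - v (y, t)" by simp
    have "0 \<le> N" using N by simp
    have mc: "continuous_on {0..} (modulus \<theta>' \<gamma>)" by (rule modulus_continuous[OF \<theta>' \<gamma>(1,2)])
    have \<rho>1: "0 < \<rho>1" using \<rho> by simp
    have xs: "norm x \<le> \<rho>1" "norm y \<le> \<rho>1" "- \<rho>1\<^sup>2 \<le> t" using x \<rho> T unfolding T_def by auto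
    have m0: "0 < m" using m by simp
    obtain x0 t0 y0 \<tau>0 e where e: "0 < e" and dom: "norm x0 \<le> \<rho>1" "norm y0 \<le> \<rho>1" "- \<rho>1\<^sup>2 \<le> t0" "t0 \<le> t" "- \<rho>1\<^sup>2 \<le> \<tau>0" "\<tau>0 \<le> t"
      and max: "\<forall>x' t' y' \<tau>. norm x' \<le> \<rho>1 \<and> norm y' \<le> \<rho>1 \<and> - \<rho>1\<^sup>2 \<le> t' \<and> t' \<le> t \<and> - \<rho>1\<^sup>2 \<le> \<tau> \<and> \<tau> \<le> t \<longrightarrow>
         doubled L N (modulus \<theta>' \<gamma>) x t m e v x' t' y' \<tau> \<le> doubled L N (modulus \<theta>' \<gamma>) x t m e v x0 t0 y0 \<tau>0"
      and pos: "0 < doubled L N (modulus \<theta>' \<gamma>) x t m e v x0 t0 y0 \<tau>0" and ne: "x0 \<noteq> y0"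
      and close: "\<forall>x. norm x \<le> \<rho>1 \<longrightarrow> \<bar>v (x, t0) - v (x, \<tau>0)\<bar> \<le> norm (x0 - y0)"
      and tails: "tail_int p n (\<lambda>x. v (x, t0) - v (x, \<tau>0)) \<le> norm (x0 - y0) powr (p - 1)"
      and close': "\<bar>t0 - \<tau>0\<bar> powr \<alpha> \<le> norm (x0 - y0)" "\<bar>t0 - \<tau>0\<bar> \<le> norm (x0 - y0)"
      by (rule doubling[OF p \<alpha> sol \<rho>1 \<rho>(3) xs x(4) less_imp_le[OF L0] \<open>0 \<le> N\<close> m0 mc modulus_nonneg[OF \<theta>' \<gamma>(1,2)] viol])
    let ?r = "norm (x0 - y0)"
    have r0: "0 < ?r" using ne by simp
    have r2: "?r \<le> 2" using norm_triangle_ineq4[of x0 y0] dom \<rho> by linarith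
    have Lw: "L * modulus \<theta>' \<gamma> ?r < 2"
    proof -
      have vb: "\<bar>v (x0, t0)\<bar> \<le> 1" "\<bar>v (y0, \<tau>0)\<bar> \<le> 1"
      proof -
        have "\<rho>1\<^sup>2 < (3/4)\<^sup>2" using \<rho> by (intro power_strict_mono) auto
        then have "\<rho>1\<^sup>2 < 9/16" by (simp add: power2_eq_square)
        then show "\<bar>v (x0, t0)\<bar> \<le> 1" "\<bar>v (y0, \<tau>0)\<bar> \<le> 1" using sol dom x(4) \<rho> unfolding nsol_def by auto
      qed
      have "0 \<le> (t0 - \<tau>0)\<^sup>2 / (2 * e)" "0 \<le> N * (norm (x0 - x))\<^sup>2" "0 \<le> N * (t - t0) ^ m" using e N dom by auto
      then show ?thesis using pos vb unfolding doubled_def by linarith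
    qed
    have rle1: "?r \<le> 1"
    proof (rule ccontr)
      assume "\<not> ?r \<le> 1"
      then have "modulus \<theta>' \<gamma> 1 \<le> modulus \<theta>' \<gamma> ?r" using r2 by (intro modulus_mono[OF \<theta>' \<gamma>(1,2)]) auto
      moreover have "1 / 2 \<le> modulus \<theta>' \<gamma> 1" using modulus_ge[OF \<theta>' \<gamma>(1,2), of 1] by simp
      ultimately have "4 * (1 / 2) \<le> L * modulus \<theta>' \<gamma> ?r" using L(5) by (intro mult_mono) auto
      then show False using Lw by simp
    qed
    have "L * (?r powr \<theta>' / 2) \<le> L * modulus \<theta>' \<gamma> ?r"
      using modulus_ge[OF \<theta>' \<gamma>(1,2) _ rle1] L0 by (intro mult_left_mono) auto
    then have "L * ?r powr \<theta>' < 4" using Lw by simp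
    moreover have "4 \<le> L * r1 powr \<theta>'" using L(4) r1(1) by (simp add: pos_divide_le_eq)
    ultimately have "L * ?r powr \<theta>' < L * r1 powr \<theta>'" by simp
    then have "?r powr \<theta>' < r1 powr \<theta>'" using L0 by simp
    then have rr1: "?r \<le> r1" using r1(1) \<theta>' powr_mono2[of \<theta>' r1 ?r] by (cases "r1 \<le> ?r") auto
    interpret D: doubled_max p q n C \<kappa> Lx Lt \<alpha> v ob \<theta> \<theta>' \<gamma> A \<rho>1 R T L N e t t0 \<tau>0 m x x0 y0
    proof unfold_locales
      show "\<bar>v (x, t) - v (y, t)\<bar> \<le> A * norm (x - y) powr \<theta>"
        if "norm x \<le> \<rho>1" "norm y \<le> \<rho>1" "- \<rho>1\<^sup>2 \<le> t" "t \<le> 0" for x y t using reg that unfolding space_reg_def by blast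
      have "4 * R = \<rho>1 - \<rho>" by (simp add: R_def)
      then show "norm x + 4 * R \<le> \<rho>1" using x(1) by linarith
      have "2 * T = \<rho>1\<^sup>2 - \<rho>\<^sup>2" by (simp add: T_def)
      then show "- \<rho>1\<^sup>2 + 2 * T \<le> t" using x(3) by linarith
      show "64 * N * (A + 3) \<le> (1 - (7/8) powr \<gamma>) * L" using L(3) b unfolding b_def by (simp add: pos_divide_le_eq mult.commute)
    qed (fact p q n C sol Lt \<theta> \<theta>' \<gamma> A \<rho>1 \<rho>(3) R(1) T x(4) N m L(1,2) e dom max pos ne close close' | use rr1 r1 in linarith)+
    have Dr: "D.r = ?r" "D.b = b" by (simp_all add: D.r_def D.b_def b_def)
    have "?r powr \<mu> \<le> ((1 / 4) powr (1 / \<mu>)) powr \<mu>" using rr1 r1(5) r0 \<mu> by (intro powr_mono2) auto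
    then have r\<mu>: "?r powr \<mu> \<le> 1 / 4" using \<mu> by (simp add: powr_powr)
    have "?r powr ?\<Gamma> \<le> ((cg / (2 * (c2 + 1))) powr (1 / ?\<Gamma>)) powr ?\<Gamma>" using rr1 r1(6) r0 \<Gamma> by (intro powr_mono2) auto
    then have r\<Gamma>: "?r powr ?\<Gamma> \<le> cg / (2 * (c2 + 1))" using \<Gamma> cg c12 \<gamma>(1) by (simp add: powr_powr)
    have core: "cg * L powr (p - 1) \<le> 2 * Cn + N * real m * (A + 1) + 2 * C * (2 * 5 powr (p - 2)) * L powr (p - 1) * ?r powr ?\<Gamma>"
      unfolding cg_def Dr(2)[symmetric]
      by (rule D.core_inequality[OF less_imp_le[OF \<mu>] _ less_imp_le[OF Cn] nd _ H1 H2 H3, unfolded Dr(1), OF r\<mu> tails])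
    then have core: "cg * L powr (p - 1) \<le> c1 + c2 * L powr (p - 1) * ?r powr ?\<Gamma>" unfolding c1_def c2_def .
    have "c2 * ?r powr ?\<Gamma> \<le> c2 * (cg / (2 * (c2 + 1)))" using r\<Gamma> c12 by (intro mult_left_mono) auto
    also have "\<dots> \<le> cg / 2" using c12 cg by (simp add: field_simps)
    finally have "c2 * ?r powr ?\<Gamma> * L powr (p - 1) \<le> cg / 2 * L powr (p - 1)" by (intro mult_right_mono) auto
    moreover have "c2 * L powr (p - 1) * ?r powr ?\<Gamma> = c2 * ?r powr ?\<Gamma> * L powr (p - 1)" by (simp only: mult_ac)
    ultimately have "cg / 2 * L powr (p - 1) \<le> c1" using core by linarith
    moreover have "L powr 1 \<le> L powr (p - 1)" using L p by (intro powr_mono) auto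
    then have "cg / 2 * L \<le> cg / 2 * L powr (p - 1)" using cg L0 by (intro mult_left_mono) auto
    moreover have "c1 < cg / 2 * L"
    proof -
      have "2 * c1 / cg < L" using L(6) by simp
      then show ?thesis using cg by (simp add: field_simps)
    qed
    ultimately show False by linarith
  qed
  have "space_reg (Max {1, L / \<theta>'}) \<theta>' \<rho> v" if "nsol p q C \<kappa> Lx Lt \<alpha> n v ob" "space_reg A \<theta> \<rho>1 v"
    for \<kappa> and v ob :: "(real ^ 'd) \<times> real \<Rightarrow> real"
    unfolding space_reg_def
  proof (intro allI impI)
    fix x y :: "real ^ 'd" and t assume x: "norm x \<le> \<rho> \<and> norm y \<le> \<rho> \<and> - \<rho>\<^sup>2 \<le> t \<and> t \<le> 0"
    have "L * modulus \<theta>' \<gamma> (norm (x - y)) \<le> L * (norm (x - y) powr \<theta>' / \<theta>')"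
      using modulus_le[OF \<theta>' \<gamma>(1,2)] L0 by (intro mult_left_mono) auto
    also have "\<dots> = L / \<theta>' * norm (x - y) powr \<theta>'" by simp
    also have "\<dots> \<le> Max {1, L / \<theta>'} * norm (x - y) powr \<theta>'" by (intro mult_right_mono) auto
    finally show "\<bar>v (x, t) - v (y, t)\<bar> \<le> Max {1, L / \<theta>'} * norm (x - y) powr \<theta>'"
      using main[OF that, of x y t] main[OF that, of y x t] x by (simp add: norm_minus_commute)
  qed
  then show ?thesis by (intro exI[of _ "Max {1, L / \<theta>'}"]) auto
qed

text \<open>Bootstrap over the exponents \<open>j / k\<close>. The parameters are chosen in the order \<open>m\<close>, \<open>k\<close>, \<open>\<gamma>\<close>, \<open>\<mu>\<close>, each small
  with respect to the gap \<open>D = q - (p - 2) > 0\<close> and to the previous ones.\<close>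

lemma space_lipschitz:
  assumes p: "2 < p" and q: "0 < q" "q < p" "p - 2 < q" and n: "n = real CARD('d) + q" and C: "0 \<le> C"
    and \<alpha>: "0 < \<alpha>" and Lt: "0 \<le> Lt" and \<rho>: "0 < \<rho>" "\<rho> < 3/4"
  shows "\<exists>A\<ge>1. \<forall>\<kappa> (v :: (real ^ 'd) \<times> real \<Rightarrow> real) ob. nsol p q C \<kappa> Lx Lt \<alpha> n v ob \<longrightarrow> space_reg A 1 \<rho> v"
proof -
  let ?d = "real CARD('d)"
  define D where "D = q - (p - 2)"
  have D: "0 < D" "D < 2" using q by (auto simp: D_def)
  obtain m :: nat where m: "8 / D < real m" using reals_Archimedean2 by blast
  define \<sigma> where "\<sigma> = 1 / real m"
  have "4 < 8 / D" using D by (simp add: less_divide_eq)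
  then have m4: "4 < real m" using m by linarith
  have \<sigma>: "0 < \<sigma>" "\<sigma> \<le> D / 8" "\<sigma> \<le> 1 / 4" unfolding \<sigma>_def using m m4 D by (auto simp: field_simps)
  obtain k :: nat where k: "8 * (p - 1) / \<sigma> + 4 < real k" using reals_Archimedean2 by blast
  define \<epsilon> where "\<epsilon> = 1 / real k"
  have kp: "4 < real k" using k p \<sigma> by (smt (verit) divide_nonneg_nonneg mult_nonneg_nonneg)
  have \<epsilon>: "0 < \<epsilon>" "\<epsilon> \<le> 1 / 4" using kp unfolding \<epsilon>_def by (auto simp: field_simps)
  have \<epsilon>p: "\<epsilon> * (p - 1) \<le> \<sigma> / 8"
  proof -
    have "8 * (p - 1) / \<sigma> \<le> real k" using k by linarith
    then show ?thesis using \<sigma> kp unfolding \<epsilon>_def by (simp add: field_simps)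
  qed
  \<comment> \<open>The second entry makes \<open>?\<Gamma> \<le> \<sigma> / 8\<close>, and the
    third makes \<open>\<mu> * q \<le> \<sigma> / 8\<close> once \<open>\<mu>\<close> is tied to
    \<open>?\<Gamma>\<close>. The first, with \<open>\<epsilon> \<le> 1 / 4\<close>, ensures
    \<open>\<theta>' + \<gamma> \<le> 1 + \<theta> / 2\<close>.\<close>
  define \<gamma> where "\<gamma> = Min {1 / 4, \<sigma> / (8 * (1 + ?d / 2)), \<sigma> * (p - q) / (16 * q * (1 + ?d / 2))}"
  have \<gamma>: "0 < \<gamma>" "\<gamma> \<le> 1 / 4" "\<gamma> \<le> \<sigma> / (8 * (1 + ?d / 2))" "\<gamma> \<le> \<sigma> * (p - q) / (16 * q * (1 + ?d / 2))"
  proof -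
    show "0 < \<gamma>" unfolding \<gamma>_def using \<sigma> q by (auto intro!: divide_pos_pos mult_pos_pos add_pos_nonneg)
    show "\<gamma> \<le> 1 / 4" "\<gamma> \<le> \<sigma> / (8 * (1 + ?d / 2))" "\<gamma> \<le> \<sigma> * (p - q) / (16 * q * (1 + ?d / 2))"
      unfolding \<gamma>_def by (intro Min_le; simp)+
  qed
  have dp: "0 < 1 + ?d / 2" by (simp add: add_pos_nonneg)
  let ?\<Gamma> = "\<gamma> * (1 + ?d / 2)"
  have \<Gamma>: "0 < ?\<Gamma>" "?\<Gamma> \<le> \<sigma> / 8"
    using \<gamma>(1) dp apply simp
    using \<gamma>(3) dp by (simp add: pos_le_divide_eq mult_ac)
  define \<mu> where "\<mu> = 2 * ?\<Gamma> / (p - q)"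
  have \<mu>: "0 < \<mu>" "\<mu> * (p - q) = 2 * ?\<Gamma>" using \<Gamma> q unfolding \<mu>_def by auto
  have \<mu>q: "\<mu> * q \<le> \<sigma> / 8"
  proof -
    have "\<gamma> * (16 * q * (1 + ?d / 2)) \<le> \<sigma> * (p - q)" using \<gamma>(4) dp q by (simp add: pos_le_divide_eq)
    then have "2 * ?\<Gamma> * q * 8 \<le> \<sigma> * (p - q)" by (simp add: mult_ac)
    then show ?thesis unfolding \<mu>_def using q by (simp add: pos_divide_le_eq mult_ac)
  qed
  have "\<forall>\<rho>. 0 < \<rho> \<and> \<rho> < 3/4 \<longrightarrow> (\<exists>A\<ge>1. \<forall>\<kappa> (v :: (real ^ 'd) \<times> real \<Rightarrow> real) ob. nsol p q C \<kappa> Lx Lt \<alpha> n v ob \<longrightarrow> space_reg A (real j * \<epsilon>) \<rho> v)"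
    if "j \<le> k" for j
    using that
  proof (induction j)
    case 0
    show ?case
    proof (intro allI impI exI[of _ 2] conjI)
      fix \<rho> \<kappa> :: real and v ob :: "(real ^ 'd) \<times> real \<Rightarrow> real"
      assume \<rho>: "0 < \<rho> \<and> \<rho> < 3 / 4" and sol: "nsol p q C \<kappa> Lx Lt \<alpha> n v ob"
      then have "\<rho>\<^sup>2 < (3/4)\<^sup>2" by (intro power_strict_mono) auto
      then have r2: "\<rho>\<^sup>2 < 9/16" by (simp add: power2_eq_square)
      show "space_reg 2 (real 0 * \<epsilon>) \<rho> v"
        unfolding space_reg_def
      proof (intro allI impI)
        fix x y :: "real ^ 'd" and t assume x: "norm x \<le> \<rho> \<and> norm y \<le> \<rho> \<and> - \<rho>\<^sup>2 \<le> t \<and> t \<le> 0"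
        then have "\<bar>v (x, t)\<bar> \<le> 1" "\<bar>v (y, t)\<bar> \<le> 1" using sol \<rho> r2 unfolding nsol_def by auto
        \<comment> \<open>Exponent 0 only says that the oscillation is at most 2. The case
          \<open>x = y\<close> is separate because \<open>0 powr 0 = 0\<close>.\<close>
        then show "\<bar>v (x, t) - v (y, t)\<bar> \<le> 2 * norm (x - y) powr (real 0 * \<epsilon>)" by (cases "x = y") auto
      qed
    qed simp
  next
    case (Suc j)
    define \<theta> where "\<theta> = real j * \<epsilon>"
    define \<theta>' where "\<theta>' = real (Suc j) * \<epsilon>"
    have \<theta>e: "\<theta>' = \<theta> + \<epsilon>" by (simp add: \<theta>_def \<theta>'_def algebra_simps)
    have "\<theta>' \<le> real k * \<epsilon>" unfolding \<theta>'_def using Suc.prems \<epsilon> by (intro mult_right_mono) auto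
    also have "\<dots> = 1" using kp by (simp add: \<epsilon>_def)
    finally have \<theta>'1: "\<theta>' \<le> 1" .
    have \<theta>0: "0 \<le> \<theta>" using \<epsilon> by (simp add: \<theta>_def)
    have \<theta>1: "\<theta> \<le> 1" "0 < \<theta>'" using \<theta>e \<theta>'1 \<theta>0 \<epsilon> by auto
    define q' where "q' = 3 * (1 / real m) / 2 + \<theta> * (p - 2) - q"
    have \<theta>p: "0 \<le> \<theta> * (p - 2)" "\<theta> * (p - 2) \<le> 1 * (p - 2)" using \<theta>0 \<theta>1 p by (auto intro: mult_right_mono)
    have q': "q' \<le> 0" "- q \<le> q'"
      using \<theta>p \<sigma> unfolding q'_def \<sigma>_def[symmetric] D_def by auto
    have \<theta>\<sigma>: "0 \<le> \<theta> * \<sigma>" "\<theta> * \<sigma> \<le> \<sigma>" using \<theta>0 \<theta>1 \<sigma> by (auto simp: mult_left_le_one_le)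
    have ex: "\<theta>' * (p - 1) = \<theta> * (p - 2) + \<theta> + \<epsilon> * (p - 1)" unfolding \<theta>e by (simp add: algebra_simps)
    have ex2: "\<theta> * (1 - 1 / real m) = \<theta> - \<theta> * \<sigma>" unfolding \<sigma>_def by (simp add: algebra_simps)
    \<comment> \<open>Here the gap is spent: \<open>D \<ge> 8 * \<sigma>\<close> covers the
      increment \<open>\<epsilon>\<close>, the loss \<open>?\<Gamma>\<close>, and the loss
      \<open>\<theta> * \<sigma>\<close> due to the time penalty.\<close>
    have H1: "\<theta>' * (p - 1) + ?\<Gamma> - q \<le> \<theta> * (1 - 1 / real m)"
    proof -
      have "a1 + \<theta> + a2 + a3 - q \<le> \<theta> - a4"
        if "a2 \<le> \<sigma> / 8" "a3 \<le> \<sigma> / 8" "a1 \<le> p - 2" "a4 \<le> \<sigma>" for a1 a2 a3 a4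
        using that \<sigma>(2) D(1) D_def by linarith
      then show ?thesis unfolding ex ex2 using \<epsilon>p \<Gamma>(2) \<theta>p(2) \<theta>\<sigma>(2) by simp
    qed
    \<comment> \<open>The powers \<open>\<theta> * (p - 1) - q\<close> cancel. Of the
      \<open>3 * \<sigma> / 2\<close> in \<open>q'\<close>, the term
      \<open>\<theta> * \<sigma>\<close> leaves at least \<open>\<sigma> / 2\<close> to pay for
      \<open>\<epsilon>\<close>, \<open>?\<Gamma>\<close> and \<open>\<mu> * q\<close>.\<close>
    have H2: "\<theta>' * (p - 1) + ?\<Gamma> - q \<le> \<theta> * (1 - 1 / real m) + (1 + \<mu>) * q'"
    proof -
      have "\<mu> * (- q) \<le> \<mu> * q'" using q'(2) \<mu>(1) by (intro mult_left_mono) auto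
      then have "- (\<sigma> / 8) \<le> \<mu> * q'" using \<mu>q by simp
      moreover have "(1 + \<mu>) * q' = q' + \<mu> * q'" by (simp add: algebra_simps)
      moreover have "q' = 3 * \<sigma> / 2 + \<theta> * (p - 2) - q" unfolding q'_def \<sigma>_def by simp
      ultimately show ?thesis unfolding ex ex2 using \<epsilon>p \<Gamma>(2) \<theta>\<sigma>(2) \<sigma>(1) by linarith
    qed
    have H4: "\<theta>' + \<gamma> \<le> 1 + \<theta> / 2" using \<theta>e \<theta>1 \<epsilon> \<gamma> by linarith
    show ?case
    proof (intro allI impI)
      fix \<rho> :: real assume \<rho>: "0 < \<rho> \<and> \<rho> < 3/4"
      \<comment> \<open>Each step shrinks the cylinder, so the induction hypothesis is kept for all
        radii and used at the midpoint between \<open>\<rho>\<close> and 3/4.\<close>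
      define \<rho>1 where "\<rho>1 = (\<rho> + 3/4) / 2"
      have \<rho>1: "0 < \<rho>1" "\<rho> < \<rho>1" "\<rho>1 < 3/4" using \<rho> by (auto simp: \<rho>1_def)
      obtain A where A: "1 \<le> A" "\<And>\<kappa> (v :: (real ^ 'd) \<times> real \<Rightarrow> real) ob. nsol p q C \<kappa> Lx Lt \<alpha> n v ob \<Longrightarrow> space_reg A \<theta> \<rho>1 v"
        using Suc.IH Suc.prems \<rho>1 unfolding \<theta>_def by (meson Suc_leD)
      have m2: "2 \<le> m" using m4 by simp
      have g1: "\<gamma> \<le> 1" using \<gamma> by simp
      have r0: "0 < \<rho>" using \<rho> by simp
      have "\<exists>A'\<ge>1. \<forall>\<kappa> (v :: (real ^ 'd) \<times> real \<Rightarrow> real) ob. nsol p q C \<kappa> Lx Lt \<alpha> n v ob \<and> space_reg A \<theta> \<rho>1 v \<longrightarrow> space_reg A' \<theta>' \<rho> v"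
        by (rule space_step[OF p q(1,2) n C \<alpha> Lt \<theta>0 \<theta>1 \<theta>'1 \<gamma>(1) g1 H4 m2 q'_def q'(1) \<mu>(1) H1 H2 \<mu>(2) A(1) r0 \<rho>1(2,3)])
      then show "\<exists>A\<ge>1. \<forall>\<kappa> (v :: (real ^ 'd) \<times> real \<Rightarrow> real) ob. nsol p q C \<kappa> Lx Lt \<alpha> n v ob \<longrightarrow> space_reg A (real (Suc j) * \<epsilon>) \<rho> v"
        using A(2) unfolding \<theta>'_def by blast
    qed
  qed
  from this[OF order_refl] have "\<exists>A\<ge>1. \<forall>\<kappa> (v :: (real ^ 'd) \<times> real \<Rightarrow> real) ob. nsol p q C \<kappa> Lx Lt \<alpha> n v ob \<longrightarrow> space_reg A (real k * \<epsilon>) \<rho> v"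
    using \<rho> by blast
  moreover have "real k * \<epsilon> = 1" using kp by (simp add: \<epsilon>_def)
  ultimately show ?thesis by simp
qed

subsection \<open>Regularity in time\<close>

text \<open>For jumps between r and \<open>R\<close> the Lipschitz bound gives the power
  \<open>p - 1 - n\<close> of \<open>norm h\<close>. Splitting off \<open>norm h powr Q\<close>,
  which is at most \<open>r powr Q\<close>, leaves a power integrable at the origin; the strict
  inequality for \<open>Q\<close> is what rules out a logarithm. Longer jumps are controlled by the
  tail.\<close>

lemma nonloc_lower:
  assumes p: "2 < p" and q: "0 < q" and n: "n = real CARD('d) + q" and R: "0 < R" "R \<le> 1"
    and A: "0 \<le> A" and Q: "Q \<le> 0" "Q < p - 1 - q"
  shows "\<exists>c>0. \<forall>w (x0 :: real ^ 'd) r.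
     tail_fun p n w \<and> tail_int p n w \<le> 1 \<and> norm x0 \<le> 1 \<and> \<bar>w x0\<bar> \<le> 1 \<and> 0 < r \<and> r \<le> 1 \<and>
     (\<forall>h. norm h < R \<longrightarrow> \<bar>w x0 - w (x0 + h)\<bar> \<le> A * norm h) \<longrightarrow>
     - (c * r powr Q) \<le> nonloc p n w x0 r"
proof -
  define s where "s = p - 1 - q - Q"
  have s: "0 < s" using Q by (simp add: s_def)
  from radial_integral[OF s, where 'd='d] obtain K where K: "0 < K"
    "\<And>\<delta>. 0 < \<delta> \<Longrightarrow> integrable lebesgue (\<lambda>h :: real ^ 'd. indicator (ball 0 \<delta>) h * norm h powr (s - real CARD('d)))"
    "\<And>\<delta>. 0 < \<delta> \<Longrightarrow> (LINT h|lebesgue. indicator (ball 0 \<delta>) (h :: real ^ 'd) * norm h powr (s - real CARD('d))) \<le> K * \<delta> powr s"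
    by blast
  define I0 where "I0 = (LINT z|lebesgue. weight n (z :: real ^ 'd))"
  have wi: "integrable lebesgue (weight n :: real ^ 'd \<Rightarrow> real)"
    using weight_integrable[OF q, where 'd='d] n unfolding weight_def[abs_def] by simp
  have I0: "0 \<le> I0" unfolding I0_def by (intro integral_nonneg_AE AE_I2 weight_nonneg)
  have n0: "0 \<le> n" using n q by simp
  define F where "F = 2 powr (p - 1) * (2 * (2 / R + 1) powr n)"
  have F0: "0 \<le> F" unfolding F_def by simp
  let ?c = "A powr (p - 1) * K + F * (I0 + 1) + 1"
  have c: "0 < ?c" using K F0 I0 by (intro add_nonneg_pos add_nonneg_nonneg mult_nonneg_nonneg) auto
  moreover
  { fix w :: "real ^ 'd \<Rightarrow> real" and x0 :: "real ^ 'd" and r :: real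
    assume w: "tail_fun p n w" "tail_int p n w \<le> 1" and x0: "norm x0 \<le> 1" "\<bar>w x0\<bar> \<le> 1" and r: "0 < r" "r \<le> 1"
      and lip: "\<And>h. norm h < R \<Longrightarrow> \<bar>w x0 - w (x0 + h)\<bar> \<le> A * norm h"
    have [measurable]: "w \<in> borel_measurable lebesgue" using w by (simp add: tail_fun_iff)
    let ?T = "\<lambda>z. weight n z + \<bar>w z\<bar> powr (p - 1) * weight n z"
    have Tm: "?T \<in> borel_measurable lebesgue" by measurable
    have Ti: "integrable lebesgue ?T" using w wi by (intro Bochner_Integration.integrable_add) (auto simp: tail_fun_iff)
    have Te: "integral\<^sup>L lebesgue ?T = I0 + tail_int p n w" using w wi by (simp add: I0_def tail_int_eq tail_fun_iff)
    have Ti': "integrable lebesgue (\<lambda>h. ?T (x0 + h))" "(LINT h|lebesgue. ?T (x0 + h)) = I0 + tail_int p n w"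
      using lebesgue_integral_affine(1,2)[OF _ Tm, of 1 x0] Ti Te by auto
    let ?P = "A powr (p - 1) * r powr Q"
    let ?L = "\<lambda>h. - (?P * (indicator (ball 0 R) h * norm h powr (s - real CARD('d)))) - F * ?T (x0 + h)"
    have Li: "integrable lebesgue ?L"
      by (intro Bochner_Integration.integrable_diff Bochner_Integration.integrable_minus integrable_mult_right K(2) R Ti')
    have pt: "?L h \<le> indicator (- ball 0 r) h * (spow p (w x0 - w (x0 + h)) * norm h powr - n)" for h
    proof -
      have T0: "0 \<le> F * ?T (x0 + h)" using F0 weight_nonneg[of n "x0 + h"] by simp
      have P0: "0 \<le> ?P * (indicator (ball 0 R) h * norm h powr (s - real CARD('d)))" by simp
      consider "norm h < r" | "r \<le> norm h" "norm h < R" | "r \<le> norm h" "R \<le> norm h" by linarith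
      then show ?thesis
      proof cases
        case 1
        then have "indicator (- ball 0 r) h = (0 :: real)" by simp
        moreover have "?L h \<le> 0" using T0 P0 by linarith
        ultimately show ?thesis by (simp only: mult_zero_left)
      next
        case 2
        have h0: "0 < norm h" using 2 r by linarith
        have "\<bar>spow p (w x0 - w (x0 + h)) * norm h powr - n\<bar> = \<bar>w x0 - w (x0 + h)\<bar> powr (p - 1) * norm h powr - n"
          by (simp add: abs_mult abs_spow)
        also have "\<dots> \<le> (A * norm h) powr (p - 1) * norm h powr - n"
          using lip[OF 2(2)] p by (intro mult_right_mono powr_mono2) auto
        also have "\<dots> = A powr (p - 1) * (norm h powr Q * norm h powr (s - real CARD('d)))"
          unfolding powr_mult mult.assoc powr_add[symmetric] s_def n by (simp add: algebra_simps)
        also have "\<dots> \<le> A powr (p - 1) * (r powr Q * norm h powr (s - real CARD('d)))"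
          using 2 r Q by (intro mult_left_mono mult_right_mono powr_mono2') auto
        finally have b: "- (?P * norm h powr (s - real CARD('d))) \<le> spow p (w x0 - w (x0 + h)) * norm h powr - n"
          by (simp add: mult.assoc) 
        have "indicator (ball 0 R) h = (1 :: real)" "indicator (- ball 0 r) h = (1 :: real)" using 2 by auto
        then show ?thesis using b T0 by (simp only: mult_1_left)
      next
        case 3
        have "\<bar>spow p (w x0 - w (x0 + h)) * norm h powr - n\<bar> = \<bar>spow p (w x0 - w (x0 + h))\<bar> * kmax n R (x0 + h - x0)"
          using 3 by (simp add: abs_mult kmax_def max_def)
        also have "\<dots> \<le> 2 powr (p - 1) * (1 + \<bar>w (x0 + h)\<bar> powr (p - 1)) * (2 * (2 / R + 1) powr n * weight n (x0 + h))"
          by (intro mult_mono abs_spow_diff_le p x0 kmax_le_weight n0 R) (auto simp: kmax_nonneg)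
        also have "\<dots> = F * ?T (x0 + h)" unfolding F_def by (simp add: algebra_simps)
        finally have "- (F * ?T (x0 + h)) \<le> spow p (w x0 - w (x0 + h)) * norm h powr - n" by linarith
        moreover have "indicator (ball 0 R) h = (0 :: real)" "indicator (- ball 0 r) h = (1 :: real)" using 3 by auto
        ultimately show ?thesis by (simp only: mult_1_left mult_zero_left mult_zero_right)
      qed
    qed
    have "integral\<^sup>L lebesgue ?L \<le> nonloc p n w x0 r"
      unfolding nonloc_def by (rule integral_mono[OF Li tail_kernel_integrable[OF p q n w(1) r(1)] pt])
    moreover have "integral\<^sup>L lebesgue ?L = - (?P * (LINT h|lebesgue. indicator (ball 0 R) (h :: real ^ 'd) * norm h powr (s - real CARD('d)))) - F * (I0 + tail_int p n w)"
      using Ti' K(2)[OF R(1)] by simp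
    moreover have "?P * (LINT h|lebesgue. indicator (ball 0 R) (h :: real ^ 'd) * norm h powr (s - real CARD('d))) \<le> ?P * K"
    proof (intro mult_left_mono)
      have "R powr s \<le> 1" using R s powr_mono2[of s R 1] by simp
      then have "K * R powr s \<le> K" using K(1) by (simp add: mult_left_le)
      then show "(LINT h|lebesgue. indicator (ball 0 R) (h :: real ^ 'd) * norm h powr (s - real CARD('d))) \<le> K"
        using K(3)[OF R(1)] by linarith
    qed simp
    moreover have "F * (I0 + tail_int p n w) \<le> F * (I0 + 1) * r powr Q"
    proof -
      have "1 \<le> r powr Q" using r Q powr_mono'[of Q 0 r] by simp
      then have "F * (I0 + 1) * 1 \<le> F * (I0 + 1) * r powr Q" using F0 I0 by (intro mult_left_mono) auto
      moreover have "F * (I0 + tail_int p n w) \<le> F * (I0 + 1)" using F0 w(2) by (intro mult_left_mono) auto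
      ultimately show ?thesis by simp
    qed
    moreover have "?c * r powr Q = ?P * K + F * (I0 + 1) * r powr Q + r powr Q" by (simp add: algebra_simps)
    moreover have "0 \<le> r powr Q" by simp
    ultimately have "- (?c * r powr Q) \<le> nonloc p n w x0 r" by linarith }
  ultimately show ?thesis by (intro exI[of _ ?c] conjI allI impI) auto
qed

text \<open>One-sided on purpose: it applies to \<open>v\<close> with its contact set and to
  \<open>- v\<close> with the empty set, which gives both bounds in time.\<close>

definition lip_subsol :: "real \<Rightarrow> real \<Rightarrow> real \<Rightarrow> real \<Rightarrow> real \<Rightarrow> real \<Rightarrow> ((real ^ 'd) \<times> real \<Rightarrow> real) \<Rightarrow> ((real ^ 'd) \<times> real) set \<Rightarrow> bool" where
  "lip_subsol p q n \<kappa> C A w Z \<longleftrightarrow> 0 < \<kappa> \<and> \<kappa> \<le> 1 \<and> qsub p q n \<kappa> C w Z \<and> continuous_on (ball 0 1 \<times> {-1<..0}) w \<and>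
     (\<forall>x t. norm x < 3/4 \<and> - (9/16) < t \<and> t \<le> 0 \<longrightarrow> \<bar>w (x, t)\<bar> \<le> 1) \<and>
     (\<forall>t. - (9/16) < t \<and> t \<le> 0 \<longrightarrow> tail_fun p n (\<lambda>x. w (x, t)) \<and> tail_int p n (\<lambda>x. w (x, t)) \<le> 1) \<and>
     space_reg A 1 (5/8) w"

text \<open>Only growth forward in time is bounded. If \<open>w\<close> minus the barrier exceeded
  the level \<open>m0\<close>, Lipschitz continuity in space would put the maximum within distance r
  of \<open>y\<close> and strictly after \<open>\<tau>\<close>, the bound on \<open>Z\<close> would
  exclude contact, and the viscosity inequality would fail because \<open>\<kappa> * K\<close> is
  larger than all nonlocal terms.\<close>

lemma time_growth:
  assumes p: "2 < p" and q: "0 < q" "q < p" and n: "n = real CARD('d) + q" and C: "0 \<le> C"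
    and \<alpha>: "0 < \<alpha>" "\<alpha> \<le> 1" "1 - 1 / \<alpha> < p - 1 - q" and A: "1 \<le> A" and L: "0 \<le> Lx" "0 \<le> Lt"
  shows "\<exists>B>0. \<forall>\<kappa> (w :: (real ^ 'd) \<times> real \<Rightarrow> real) Z y \<tau> T.
     lip_subsol p q n \<kappa> C A w Z \<and> norm y \<le> 1/2 \<and> - (1/4) \<le> \<tau> \<and> \<tau> \<le> T \<and> T \<le> 0 \<and>
     (\<forall>x t. (x, t) \<in> Z \<and> norm x < 3/4 \<and> \<tau> \<le> t \<and> t \<le> T \<longrightarrow> w (x, t) \<le> w (y, \<tau>) + Lx * norm (x - y) + Lt * (T - \<tau>) powr \<alpha>) \<longrightarrow>
     w (y, T) - w (y, \<tau>) \<le> B * ((T - \<tau>) / \<kappa>) powr \<alpha>"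
proof -
  define Q where "Q = 1 - 1 / \<alpha>"
  have Q: "Q \<le> 0" "Q < p - 1 - q" using \<alpha> by (auto simp: Q_def)
  have R16: "0 < (1/16 :: real)" "(1/16 :: real) \<le> 1" "0 \<le> A" using A by auto
  from nonloc_lower[OF p q(1) n R16(1,2) R16(3) Q] obtain cn where cn: "0 < cn"
    and nl: "\<And>w (x0 :: real ^ 'd) r. tail_fun p n w \<and> tail_int p n w \<le> 1 \<and> norm x0 \<le> 1 \<and> \<bar>w x0\<bar> \<le> 1 \<and> 0 < r \<and> r \<le> 1 \<and>
     (\<forall>h. norm h < 1/16 \<longrightarrow> \<bar>w x0 - w (x0 + h)\<bar> \<le> A * norm h) \<Longrightarrow> - (cn * r powr Q) \<le> nonloc p n w x0 r"
    by blast
  \<comment> \<open>One slope for the barrier, above the Lipschitz constants of \<open>w\<close> and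
    of the obstacle.\<close>
  define A' where "A' = A + Lx"
  have A': "A \<le> A'" "Lx \<le> A'" "0 < A'" using A L by (auto simp: A'_def)
  define cK where "cK = C * (A' * (3 * A') powr (p - 2)) + cn + 1"
  have cK: "0 < cK" unfolding cK_def using C A' cn by (intro add_nonneg_pos add_nonneg_nonneg) auto
  \<comment> \<open>32 covers the trivial case \<open>r > 1/16\<close>, where the oscillation is at
    most 2. The other terms come from the level \<open>m0\<close>, from the barrier at its centre,
    and from its growth \<open>K * (T - \<tau>)\<close>.\<close>
  let ?B = "32 + Lt + A' + cK"
  have B: "0 < ?B" using L A' cK by linarith
  moreover
  { fix \<kappa> \<tau> T :: real and w :: "(real ^ 'd) \<times> real \<Rightarrow> real" and Z and y :: "real ^ 'd"
    assume sub: "lip_subsol p q n \<kappa> C A w Z" and y: "norm y \<le> 1/2" and \<tau>: "- (1/4) \<le> \<tau>" "\<tau> \<le> T" "T \<le> 0"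
      and contact: "\<And>x t. (x, t) \<in> Z \<Longrightarrow> norm x < 3/4 \<Longrightarrow> \<tau> \<le> t \<Longrightarrow> t \<le> T \<Longrightarrow> w (x, t) \<le> w (y, \<tau>) + Lx * norm (x - y) + Lt * (T - \<tau>) powr \<alpha>"
    have \<kappa>: "0 < \<kappa>" "\<kappa> \<le> 1" and qs: "qsub p q n \<kappa> C w Z" and wc: "continuous_on (ball 0 1 \<times> {-1<..0}) w"
      and wb: "\<And>x t. norm x < 3/4 \<Longrightarrow> - (9/16) < t \<Longrightarrow> t \<le> 0 \<Longrightarrow> \<bar>w (x, t)\<bar> \<le> 1"
      and wt: "\<And>t. - (9/16) < t \<Longrightarrow> t \<le> 0 \<Longrightarrow> tail_fun p n (\<lambda>x. w (x, t)) \<and> tail_int p n (\<lambda>x. w (x, t)) \<le> 1"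
      and reg: "space_reg A 1 (5/8) w" using sub unfolding lip_subsol_def by auto
    define r where "r = ((T - \<tau>) / \<kappa>) powr \<alpha>"
    have lip: "\<bar>w (x, t) - w (x', t)\<bar> \<le> A * norm (x - x')" if "norm x \<le> 5/8" "norm x' \<le> 5/8" "- (1/4) \<le> t" "t \<le> 0" for x x' t
      using reg that unfolding space_reg_def by (auto simp: power2_eq_square)
    have "w (y, T) - w (y, \<tau>) \<le> ?B * r"
    proof (cases "T = \<tau> \<or> 1/16 < r")
      case True
      have r0: "0 \<le> r" by (simp add: r_def)
      show ?thesis
      proof (cases "T = \<tau>")
        case True
        then show ?thesis using B r0 by simp
      next
        case False
        then have "1/16 < r" using True by simp
        moreover have "\<bar>w (y, T)\<bar> \<le> 1" "\<bar>w (y, \<tau>)\<bar> \<le> 1" using wb y \<tau> by auto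
        moreover have "32 * r \<le> ?B * r" using r0 L A' cK by (intro mult_right_mono) auto
        ultimately show ?thesis by linarith
      qed
    next
      case False
      then have r: "0 < r" "r \<le> 1/16" and \<tau>T: "\<tau> < T" using \<tau> \<kappa> by (auto simp: r_def)
      \<comment> \<open>As \<open>(T - \<tau>) / \<kappa> = r powr (1 / \<alpha>)\<close> and
        \<open>Q = 1 - 1 / \<alpha>\<close>, this slope satisfies
        \<open>K * (T - \<tau>) = cK * r\<close>.\<close>
      define K where "K = cK * r powr Q / \<kappa>"
      have K: "0 < K" "\<kappa> * K = cK * r powr Q" unfolding K_def using cK r \<kappa> by auto
      define m0 where "m0 = w (y, \<tau>) + Lt * (T - \<tau>) powr \<alpha>"
      define \<psi> where "\<psi> x = A' * (r + (norm (x - y))\<^sup>2 / r)" for x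
      define f where "f = (\<lambda>(x, t). w (x, t) - \<psi> x - K * (t - \<tau>))"
      define S where "S = cball y (1/8) \<times> {\<tau>..T}"
      have Ssub: "S \<subseteq> ball 0 1 \<times> {-1<..0}"
      proof -
        have "norm x < 1" if "dist y x \<le> 1/8" for x
        proof -
          have "norm x \<le> norm y + dist y x" by (metis dist_commute dist_norm norm_triangle_sub)
          then show ?thesis using that y by simp
        qed
        then show ?thesis using \<tau> unfolding S_def by auto
      qed
      have nS: "norm x \<le> 5/8" if "norm (x - y) \<le> 1/8" for x
        using norm_triangle_sub[of x y] that y by linarith
      have fc: "continuous_on S f"
        unfolding f_def \<psi>_def case_prod_unfold
        by (intro continuous_intros continuous_on_compose2[OF continuous_on_subset[OF wc Ssub]]) (use r in auto)
      have Sc: "compact S" unfolding S_def by (intro compact_Times compact_cball compact_Icc)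
      have "(y, T) \<in> S" using \<tau> by (simp add: S_def)
      then obtain z where z: "z \<in> S" "\<And>z'. z' \<in> S \<Longrightarrow> f z' \<le> f z" using continuous_attains_sup[OF Sc _ fc] by blast
      obtain x0 t0 where z0: "z = (x0, t0)" by (cases z)
      have x0: "norm (x0 - y) \<le> 1/8" "\<tau> \<le> t0" "t0 \<le> T" using z(1) unfolding z0 S_def by (auto simp: dist_norm norm_minus_commute)
      have max: "w (x, t) - \<psi> x - K * (t - \<tau>) \<le> w (x0, t0) - \<psi> x0 - K * (t0 - \<tau>)" if "norm (x - y) \<le> 1/8" "\<tau> \<le> t" "t \<le> T" for x t
        using z(2)[of "(x, t)"] that unfolding z0 S_def f_def by (auto simp: dist_norm norm_minus_commute)
      have "w (x0, t0) - \<psi> x0 - K * (t0 - \<tau>) \<le> m0"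
      proof (rule ccontr)
        assume "\<not> w (x0, t0) - \<psi> x0 - K * (t0 - \<tau>) \<le> m0"
        then have big: "m0 < w (x0, t0) - \<psi> x0 - K * (t0 - \<tau>)" by simp
        have Lt0: "0 \<le> Lt * (T - \<tau>) powr \<alpha>" using L by simp
        have t0': "- (1/4) \<le> t0" "t0 \<le> 0" using x0 \<tau> by auto
        \<comment> \<open>Comparison with the centre \<open>(y, t0)\<close> sets the quadratic
          growth of the barrier against the linear growth of \<open>w\<close>. This takes the place
          of a condition on the lateral boundary, which lies at distance 1/8, beyond
          \<open>2 * r\<close>... and at most reached when \<open>r = 1/16\<close>.\<close>
        have near: "norm (x0 - y) \<le> r"
        proof (rule ccontr)
          assume "\<not> norm (x0 - y) \<le> r"
          then have d: "r < norm (x0 - y)" "0 < norm (x0 - y)" using r by auto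
          have "w (y, t0) - \<psi> y \<le> w (x0, t0) - \<psi> x0" using max[of y t0] x0 by simp
          moreover have "w (x0, t0) - w (y, t0) \<le> A * norm (x0 - y)" using lip[of x0 y t0] nS[OF x0(1)] y t0' by auto
          moreover have "A * norm (x0 - y) \<le> A' * norm (x0 - y)" using A' by (intro mult_right_mono) auto
          moreover have "\<psi> x0 - \<psi> y = A' * ((norm (x0 - y))\<^sup>2 / r)" by (simp add: \<psi>_def algebra_simps)
          ultimately have "A' * ((norm (x0 - y))\<^sup>2 / r) \<le> A' * norm (x0 - y)" by linarith
          then have "(norm (x0 - y))\<^sup>2 / r \<le> norm (x0 - y)" by (rule mult_left_le_imp_le[OF _ A'(3)])
          then have "norm (x0 - y) * norm (x0 - y) \<le> r * norm (x0 - y)" using r by (simp add: pos_divide_le_eq power2_eq_square mult.commute)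
          then have "norm (x0 - y) \<le> r" using d(2) by (rule mult_right_le_imp_le)
          then show False using d by simp
        qed
        have t\<tau>: "\<tau> < t0"
        proof (rule ccontr)
          assume "\<not> \<tau> < t0"
          then have "t0 = \<tau>" using x0 by simp
          have "w (x0, \<tau>) - w (y, \<tau>) \<le> A * norm (x0 - y)" using lip[of x0 y \<tau>] nS[OF x0(1)] y \<tau> by auto
          also have "\<dots> \<le> A' * r" using near A' A by (intro mult_mono) auto
          also have "\<dots> \<le> \<psi> x0" unfolding \<psi>_def using A' r by (intro mult_left_mono) auto
          finally show False using big Lt0 \<open>t0 = \<tau>\<close> by (simp add: m0_def)
        qed
        let ?g = "(2 * A' / r) *\<^sub>R (x0 - y)"
        let ?\<Lambda> = "A' / r"
        have sq: "\<psi> (x0 + h) = \<psi> x0 + ?g \<bullet> h + ?\<Lambda> * (norm h)\<^sup>2" for h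
        proof -
          have "(norm (x0 + h - y))\<^sup>2 = (norm (x0 - y))\<^sup>2 + 2 * ((x0 - y) \<bullet> h) + (norm h)\<^sup>2"
            by (simp add: power2_norm_eq_inner algebra_simps inner_commute)
          moreover have "A' * (r + (a + 2 * i + c) / r) = A' * (r + a / r) + 2 * A' / r * i + A' / r * c" for a i c
            by (simp add: add_divide_distrib distrib_left mult_ac)
          ultimately show ?thesis unfolding \<psi>_def inner_scaleR_left by simp
        qed
        define \<delta>' where "\<delta>' = Min {r, 1, t0 - \<tau>}"
        have \<delta>': "0 < \<delta>'" "\<delta>' \<le> r" "\<delta>'\<^sup>2 \<le> t0 - \<tau>"
        proof -
          show d: "0 < \<delta>'" "\<delta>' \<le> r" unfolding \<delta>'_def using r t\<tau> by auto
          have "\<delta>' \<le> 1" "\<delta>' \<le> t0 - \<tau>" unfolding \<delta>'_def by auto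
          then have "\<delta>' * \<delta>' \<le> \<delta>' * 1" "\<delta>' \<le> t0 - \<tau>" using d by (auto intro!: mult_left_mono)
          then show "\<delta>'\<^sup>2 \<le> t0 - \<tau>" unfolding power2_eq_square by linarith
        qed
        have inS: "norm (x0 + h - y) \<le> 1/8" if "norm h \<le> r" for h
        proof -
          have "x0 + h - y = (x0 - y) + h" by simp
          then have "norm (x0 + h - y) \<le> norm (x0 - y) + norm h" by (simp only: norm_triangle_ineq)
          then show ?thesis using near that r by simp
        qed
        have touch: "touch w x0 t0 ?g ?\<Lambda> (\<lambda>t. K * t) (\<lambda>t. K) r"
          unfolding touch_def
        proof (intro conjI allI impI)
          show "norm x0 < 1" "- 1 < t0" "t0 \<le> 0" using nS[OF x0(1)] t0' by auto
          show "0 \<le> ?\<Lambda>" using A' r by simp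
          show "((\<lambda>t. K * t) has_real_derivative K) (at t)" for t by (auto intro!: derivative_eq_intros)
          show "\<exists>\<delta>'>0. \<forall>x t. norm (x - x0) < \<delta>' \<and> t0 - \<delta>'\<^sup>2 < t \<and> t \<le> t0 \<longrightarrow> w (x, t) \<le> test_fun w x0 t0 ?g ?\<Lambda> (\<lambda>t. K * t) (x, t)"
          proof (intro exI[of _ \<delta>'] conjI allI impI \<delta>')
            fix x t assume h: "norm (x - x0) < \<delta>' \<and> t0 - \<delta>'\<^sup>2 < t \<and> t \<le> t0"
            have "norm (x - x0) \<le> r" using h \<delta>' by simp
            from inS[OF this] have "norm (x - y) \<le> 1/8" by simp
            moreover have "\<tau> \<le> t" "t \<le> T" using h \<delta>'(3) x0 by auto
            ultimately have "w (x, t) - \<psi> x - K * (t - \<tau>) \<le> w (x0, t0) - \<psi> x0 - K * (t0 - \<tau>)" by (rule max)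
            moreover have "\<psi> x = \<psi> x0 + ?g \<bullet> (x - x0) + ?\<Lambda> * (norm (x - x0))\<^sup>2" using sq[of "x - x0"] by simp
            moreover have "K * (t - \<tau>) - K * (t0 - \<tau>) = K * t - K * t0" by (simp add: algebra_simps)
            ultimately show "w (x, t) \<le> test_fun w x0 t0 ?g ?\<Lambda> (\<lambda>t. K * t) (x, t)" unfolding test_fun_def by simp
          qed
          fix h :: "real ^ 'd" assume "norm h < r"
          then have "norm (x0 + h - y) \<le> 1/8" by (intro inS) simp
          from max[OF this x0(2,3)] show "w (x0 + h, t0) \<le> w (x0, t0) + ?g \<bullet> h + ?\<Lambda> * (norm h)\<^sup>2" unfolding sq by simp
        qed (use r in auto)
        have notZ: "(x0, t0) \<notin> Z"
        proof
          assume "(x0, t0) \<in> Z"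
          then have "w (x0, t0) \<le> w (y, \<tau>) + Lx * norm (x0 - y) + Lt * (T - \<tau>) powr \<alpha>" using nS[OF x0(1)] x0 by (intro contact) auto
          moreover have "Lx * norm (x0 - y) \<le> A' * r" using near A' L by (intro mult_mono) auto
          moreover have "A' * r \<le> \<psi> x0" unfolding \<psi>_def using A' r by (intro mult_left_mono) auto
          moreover have "0 \<le> K * (t0 - \<tau>)" using K x0 by simp
          ultimately show False using big unfolding m0_def by linarith
        qed
        have main: "\<kappa> * K + nonloc p n (\<lambda>x. w (x, t0)) x0 r \<le> C * (?\<Lambda> * (norm ?g + ?\<Lambda> * r) powr (p - 2) * r powr (p - q))"
          using qs[unfolded qsub_def, rule_format, OF touch] notZ by blast
        have g: "norm ?g \<le> 2 * A'"
        proof -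
          have "norm ?g = 2 * A' / r * norm (x0 - y)" using A' r by simp
          also have "\<dots> \<le> 2 * A' / r * r" using near A' r by (intro mult_left_mono) auto
          finally show ?thesis using r by simp
        qed
        have "?\<Lambda> * (norm ?g + ?\<Lambda> * r) powr (p - 2) * r powr (p - q) \<le> ?\<Lambda> * (3 * A') powr (p - 2) * r powr (p - q)"
        proof (intro mult_right_mono mult_left_mono powr_mono2)
          have "?\<Lambda> * r = A'" using r by simp
          then show "norm ?g + ?\<Lambda> * r \<le> 3 * A'" using g by linarith
          show "0 \<le> norm ?g + ?\<Lambda> * r" using A' r by (intro add_nonneg_nonneg) auto
        qed (use A' r p in auto)
        also have "\<dots> = A' * (3 * A') powr (p - 2) * (r powr (p - q) / r)" by simp
        also have "r powr (p - q) / r = r powr (p - 1 - q)" using r powr_diff[of r "p - q" 1] by (simp add: algebra_simps)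
        also have "A' * (3 * A') powr (p - 2) * r powr (p - 1 - q) \<le> A' * (3 * A') powr (p - 2) * r powr Q"
          using r Q A' by (intro mult_left_mono powr_mono') auto
        finally have "C * (?\<Lambda> * (norm ?g + ?\<Lambda> * r) powr (p - 2) * r powr (p - q)) \<le> C * (A' * (3 * A') powr (p - 2) * r powr Q)"
          using C by (rule mult_left_mono)
        moreover have "- (cn * r powr Q) \<le> nonloc p n (\<lambda>x. w (x, t0)) x0 r"
        proof (rule nl, intro conjI allI impI)
          show "tail_fun p n (\<lambda>x. w (x, t0))" "tail_int p n (\<lambda>x. w (x, t0)) \<le> 1" using wt[of t0] t0' by auto
          show "norm x0 \<le> 1" "\<bar>w (x0, t0)\<bar> \<le> 1" using nS[OF x0(1)] t0' wb[of x0 t0] by auto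
          fix h :: "real ^ 'd" assume h: "norm h < 1/16"
          have "x0 + h - y = (x0 - y) + h" by simp
          then have "norm (x0 + h - y) \<le> norm (x0 - y) + norm h" by (simp only: norm_triangle_ineq)
          then have "norm (x0 + h - y) \<le> 1/8" using near r h by simp
          then show "\<bar>w (x0, t0) - w (x0 + h, t0)\<bar> \<le> A * norm h" using lip[of x0 "x0 + h" t0] nS x0(1) t0' by simp
        qed (use r in auto)
        moreover have "\<kappa> * K = C * (A' * (3 * A') powr (p - 2) * r powr Q) + cn * r powr Q + r powr Q"
          unfolding K(2) cK_def by (simp add: algebra_simps)
        moreover have "0 < r powr Q" using r by simp
        ultimately show False using main by linarith
      qed
      then have "w (y, T) - \<psi> y - K * (T - \<tau>) \<le> m0" using max[of y T] \<tau> by simp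
      then have "w (y, T) - w (y, \<tau>) \<le> Lt * (T - \<tau>) powr \<alpha> + A' * r + K * (T - \<tau>)" by (simp add: m0_def \<psi>_def)
      moreover have "Lt * (T - \<tau>) powr \<alpha> \<le> Lt * r"
      proof -
        have "T - \<tau> \<le> (T - \<tau>) / \<kappa>" using \<kappa> \<tau> by (simp add: pos_le_divide_eq mult_left_le)
        then show ?thesis unfolding r_def using L \<tau> \<alpha> by (intro mult_left_mono powr_mono2) auto
      qed
      moreover have "K * (T - \<tau>) = cK * r"
      proof -
        have "(T - \<tau>) / \<kappa> = r powr (1 / \<alpha>)" unfolding r_def using \<alpha> \<kappa> \<tau> by (simp add: powr_powr)
        moreover have "K * (T - \<tau>) = cK * (r powr Q * ((T - \<tau>) / \<kappa>))" unfolding K_def by simp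
        ultimately have "K * (T - \<tau>) = cK * (r powr Q * r powr (1 / \<alpha>))" by (simp only:)
        also have "r powr Q * r powr (1 / \<alpha>) = r" using r by (simp add: powr_add[symmetric] Q_def)
        finally show ?thesis .
      qed
      moreover have "?B * r = 32 * r + Lt * r + A' * r + cK * r" by (simp add: algebra_simps)
      ultimately show ?thesis using r by linarith
    qed
    then have "w (y, T) - w (y, \<tau>) \<le> ?B * ((T - \<tau>) / \<kappa>) powr \<alpha>" unfolding r_def . }
  ultimately show ?thesis by (intro exI[of _ ?B] conjI allI impI) auto
qed

text \<open>For \<open>v\<close>, contact is harmless: there
  \<open>v (x, t) \<le> ob (x, t)\<close>, and the obstacle at \<open>(x, t)\<close> is compared
  with its value at \<open>(y, \<tau>)\<close>, which lies below \<open>v (y, \<tau>)\<close>.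
  Applying \<open>time_growth\<close> to \<open>- v\<close> as well bounds the oscillation in time
  at a fixed point.\<close>

lemma nsol_regularity:
  assumes p: "2 < p" and q: "0 < q" "q < p" "p - 2 < q" and n: "n = real CARD('d) + q" and C: "0 \<le> C"
    and \<alpha>: "0 < \<alpha>" "\<alpha> \<le> 1" "1 - 1 / \<alpha> < p - 1 - q" and L: "0 \<le> Lx" "0 \<le> Lt"
  shows "\<exists>B>0. \<forall>\<kappa> (v :: (real ^ 'd) \<times> real \<Rightarrow> real) ob x y t \<tau>. nsol p q C \<kappa> Lx Lt \<alpha> n v ob \<and>
     norm x \<le> 1/2 \<and> norm y \<le> 1/2 \<and> - (1/4) \<le> t \<and> t \<le> 0 \<and> - (1/4) \<le> \<tau> \<and> \<tau> \<le> 0 \<longrightarrow>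
     \<bar>v (x, t) - v (y, \<tau>)\<bar> \<le> B * (norm (x - y) + (\<bar>t - \<tau>\<bar> / \<kappa>) powr \<alpha>)"
proof -
  have r58: "0 < (5/8 :: real)" "(5/8 :: real) < 3/4" by auto
  from space_lipschitz[OF p q n C \<alpha>(1) L(2) r58, of Lx] obtain A where A: "1 \<le> A"
    and reg: "\<And>\<kappa> (v :: (real ^ 'd) \<times> real \<Rightarrow> real) ob. nsol p q C \<kappa> Lx Lt \<alpha> n v ob \<Longrightarrow> space_reg A 1 (5/8) v" by blast
  from time_growth[OF p q(1,2) n C \<alpha> A L] obtain B where B: "0 < B" and time: "\<And>\<kappa> (w :: (real ^ 'd) \<times> real \<Rightarrow> real) Z y \<tau> T.
     lip_subsol p q n \<kappa> C A w Z \<and> norm y \<le> 1/2 \<and> - (1/4) \<le> \<tau> \<and> \<tau> \<le> T \<and> T \<le> 0 \<and>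
     (\<forall>x t. (x, t) \<in> Z \<and> norm x < 3/4 \<and> \<tau> \<le> t \<and> t \<le> T \<longrightarrow> w (x, t) \<le> w (y, \<tau>) + Lx * norm (x - y) + Lt * (T - \<tau>) powr \<alpha>) \<Longrightarrow>
     w (y, T) - w (y, \<tau>) \<le> B * ((T - \<tau>) / \<kappa>) powr \<alpha>" by blast
  { fix \<kappa> t \<tau> :: real and v ob :: "(real ^ 'd) \<times> real \<Rightarrow> real" and x y :: "real ^ 'd"
    assume sol: "nsol p q C \<kappa> Lx Lt \<alpha> n v ob" and x: "norm x \<le> 1/2" "norm y \<le> 1/2" and t: "- (1/4) \<le> t" "t \<le> 0" "- (1/4) \<le> \<tau>" "\<tau> \<le> 0"
    note S = sol[unfolded nsol_def]
    have osc: "\<bar>v (y, T) - v (y, \<tau>)\<bar> \<le> B * ((T - \<tau>) / \<kappa>) powr \<alpha>" if T: "- (1/4) \<le> \<tau>" "\<tau> \<le> T" "T \<le> 0" for \<tau> T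
    proof -
      have lv: "lip_subsol p q n \<kappa> C A v {z. v z \<le> ob z}" using S reg[OF sol] by (auto simp: lip_subsol_def)
      have lv': "lip_subsol p q n \<kappa> C A (\<lambda>z. - v z) {}"
        unfolding lip_subsol_def
      proof (intro conjI)
        show "continuous_on (ball 0 1 \<times> {- 1<..0}) (\<lambda>z. - v z)" using S by (intro continuous_on_minus) auto
        show "space_reg A 1 (5 / 8) (\<lambda>z. - v z)" using reg[OF sol] unfolding space_reg_def by (auto simp: abs_minus_commute)
      qed (use S in \<open>auto simp: tail_fun_uminus tail_fun_uminus_int\<close>)
      have up: "v (y, T) - v (y, \<tau>) \<le> B * ((T - \<tau>) / \<kappa>) powr \<alpha>"
      proof (rule time[where Z = "{z. v z \<le> ob z}"], intro conjI allI impI)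
        fix x t assume a: "(x, t) \<in> {z. v z \<le> ob z} \<and> norm x < 3/4 \<and> \<tau> \<le> t \<and> t \<le> T"
        have "norm x < 1 \<and> norm y < 1 \<and> - 1 < t \<and> t \<le> 0 \<and> - 1 < \<tau> \<and> \<tau> \<le> 0" using a x T by auto
        then have "ob (x, t) - ob (y, \<tau>) \<le> Lx * norm (x - y) + Lt * \<bar>t - \<tau>\<bar> powr \<alpha>" "ob (y, \<tau>) \<le> v (y, \<tau>)"
          using S by blast+
        moreover have "Lt * \<bar>t - \<tau>\<bar> powr \<alpha> \<le> Lt * (T - \<tau>) powr \<alpha>" using a L \<alpha> by (intro mult_left_mono powr_mono2) auto
        ultimately show "v (x, t) \<le> v (y, \<tau>) + Lx * norm (x - y) + Lt * (T - \<tau>) powr \<alpha>" using a by simp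
      qed (use lv x T in auto)
      have "- v (y, T) - (- v (y, \<tau>)) \<le> B * ((T - \<tau>) / \<kappa>) powr \<alpha>"
        by (rule time[OF conjI[OF lv']]) (use x T in auto)
      then show ?thesis using up by linarith
    qed
    have "\<bar>v (x, t) - v (y, t)\<bar> \<le> A * norm (x - y)"
      using reg[OF sol] x t unfolding space_reg_def by (auto simp: power2_eq_square)
    moreover have "\<bar>v (y, t) - v (y, \<tau>)\<bar> \<le> B * (\<bar>t - \<tau>\<bar> / \<kappa>) powr \<alpha>"
      using osc[of \<tau> t] osc[of t \<tau>] t by (cases "\<tau> \<le> t") (auto simp: abs_minus_commute)
    moreover have "A * norm (x - y) \<le> (A + B) * norm (x - y)" "B * (\<bar>t - \<tau>\<bar> / \<kappa>) powr \<alpha> \<le> (A + B) * (\<bar>t - \<tau>\<bar> / \<kappa>) powr \<alpha>"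
      using A B by (auto intro!: mult_right_mono)
    ultimately have "\<bar>v (x, t) - v (y, \<tau>)\<bar> \<le> (A + B) * (norm (x - y) + (\<bar>t - \<tau>\<bar> / \<kappa>) powr \<alpha>)"
      unfolding distrib_left by linarith }
  then show ?thesis using A B by (intro exI[of _ "A + B"]) auto
qed

subsection \<open>Normalisation\<close>

lemma usc_lsc_continuous:
  assumes "usc_on S u" "lsc_on S u"
  shows "continuous_on S u"
  unfolding continuous_on_def
proof (intro ballI order_tendstoI)
  fix z c assume z: "z \<in> S"
  show "\<forall>\<^sub>F w in at z within S. c < u w" if "c < u z" using assms(2) z that unfolding lsc_on_def by blast
  show "\<forall>\<^sub>F w in at z within S. u w < c" if "u z < c" using assms(1) z that unfolding usc_on_def by blast
qed

text \<open>The definition of a supersolution gives \<open>u \<ge> \<phi>\<close> only where \<open>u\<close> can be touched from below; such points are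
  dense.\<close>

lemma visc_super_ge_obstacle:
  fixes u :: "(real ^ 'd) \<times> real \<Rightarrow> real"
  assumes n: "n = real CARD('d) + s * p" and C: "pv_bound TYPE('d) p q n C"
    and super: "visc_supersolution p s ob (ball 0 1) (- 1) 0 u"
    and uc: "continuous_on (ball 0 1 \<times> {-1<..0}) u" and oc: "continuous_on (ball 0 1 \<times> {-1<..0}) ob"
    and y: "norm y < 1" "- 1 < \<tau>" "\<tau> \<le> 0"
  shows "ob (y, \<tau>) \<le> u (y, \<tau>)"
proof (rule ccontr)
  assume "\<not> ob (y, \<tau>) \<le> u (y, \<tau>)"
  then have gap: "u (y, \<tau>) - ob (y, \<tau>) < 0" by simp
  let ?Q = "ball (0 :: real ^ 'd) 1 \<times> {-1<..0 :: real}"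
  have yQ: "(y, \<tau>) \<in> ?Q" using y by auto
  have dc: "continuous_on ?Q (\<lambda>z. u z - ob z)" by (intro continuous_intros uc oc)
  have e: "0 < ob (y, \<tau>) - u (y, \<tau>)" using gap by simp
  obtain d where d: "0 < d" "\<And>z. z \<in> ?Q \<Longrightarrow> dist z (y, \<tau>) < d \<Longrightarrow> dist (u z - ob z) (u (y, \<tau>) - ob (y, \<tau>)) < ob (y, \<tau>) - u (y, \<tau>)"
  proof -
    have "\<exists>d>0. \<forall>z\<in>?Q. dist z (y, \<tau>) < d \<longrightarrow> dist (u z - ob z) (u (y, \<tau>) - ob (y, \<tau>)) < ob (y, \<tau>) - u (y, \<tau>)"
      using bspec[OF dc[unfolded continuous_on_iff] yQ] e by (elim allE impE) assumption
    then show ?thesis using that by (elim exE conjE) (rule that; blast)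
  qed
  define a where "a = Min {d / 4, (1 - norm y) / 2, (1 + \<tau>) / 2}"
  have a: "0 < a" "a \<le> d / 4" "a \<le> (1 - norm y) / 2" "a \<le> (1 + \<tau>) / 2"
  proof -
    show "0 < a" unfolding a_def using d(1) y by auto
    show "a \<le> d / 4" "a \<le> (1 - norm y) / 2" "a \<le> (1 + \<tau>) / 2" unfolding a_def by (intro Min_le; simp)+
  qed
  define S where "S = cball y a \<times> {\<tau> - a..\<tau>}"
  have Sc: "compact S" unfolding S_def by (intro compact_Times compact_cball compact_Icc)
  have SQ: "S \<subseteq> ?Q"
  proof -
    have "norm x < 1" if "dist y x \<le> a" for x
      using norm_triangle_sub[of x y] that a y by (simp add: dist_norm norm_minus_commute)
    then show ?thesis using a y unfolding S_def by auto
  qed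
  have neg: "u z < ob z" if "z \<in> S" for z
  proof -
    obtain x t where z: "z = (x, t)" by (cases z)
    have "dist z (y, \<tau>) \<le> dist x y + \<bar>t - \<tau>\<bar>"
      unfolding z using sqrt_sum_squares_le_sum[of "dist x y" "\<bar>t - \<tau>\<bar>"] by (simp add: dist_Pair_Pair dist_real_def)
    also have "\<dots> < d" using that a d(1) unfolding z S_def by (auto simp: dist_commute)
    finally have "dist (u z - ob z) (u (y, \<tau>) - ob (y, \<tau>)) < ob (y, \<tau>) - u (y, \<tau>)" using SQ that by (intro d(2)) auto
    then show ?thesis by (simp add: dist_real_def)
  qed
  have uS: "continuous_on S u" by (rule continuous_on_subset[OF uc SQ])
  have "bounded (u ` S)" by (rule compact_imp_bounded[OF compact_continuous_image[OF uS Sc]])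
  then obtain U where U: "\<And>z. z \<in> S \<Longrightarrow> \<bar>u z\<bar> \<le> U" unfolding bounded_iff by auto
  have yS: "(y, \<tau>) \<in> S" using a by (simp add: S_def)
  have U0: "0 \<le> U" using U[OF yS] by simp
  \<comment> \<open>Either penalty exceeds the oscillation \<open>2 * U\<close> on the lateral side
    or at the bottom of \<open>S\<close>, which keeps the maximum away from both.\<close>
  define N where "N = (2 * U + 1) / (a\<^sup>2 / 4) + (2 * U + 1) / (a / 4)"
  have N: "0 < N" "2 * U < N * (a\<^sup>2)" "2 * U < N * a"
  proof -
    have p1: "0 < (2 * U + 1) / (a\<^sup>2 / 4)" "0 < (2 * U + 1) / (a / 4)" using U0 a by (auto intro!: divide_pos_pos)
    show "0 < N" unfolding N_def using p1 by simp
    have "(2 * U + 1) / (a\<^sup>2 / 4) \<le> N" "(2 * U + 1) / (a / 4) \<le> N" unfolding N_def using p1 by linarith+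
    then have A: "(2 * U + 1) / (a\<^sup>2 / 4) * a\<^sup>2 \<le> N * a\<^sup>2" "(2 * U + 1) / (a / 4) * a \<le> N * a"
      using a(1) by (intro mult_right_mono; simp)+
    have E: "(2 * U + 1) / (a\<^sup>2 / 4) * a\<^sup>2 = 4 * (2 * U + 1)" "(2 * U + 1) / (a / 4) * a = 4 * (2 * U + 1)" using a by auto
    have lt: "2 * U < 4 * (2 * U + 1)" using U0 by simp
    show "2 * U < N * (a\<^sup>2)" by (rule less_le_trans[OF lt A(1)[unfolded E]])
    show "2 * U < N * a" by (rule less_le_trans[OF lt A(2)[unfolded E]])
  qed
  \<comment> \<open>The maximum may lie on the top \<open>t = \<tau>\<close>; this is admissible
    because touching only concerns earlier times.\<close>
  define f where "f = (\<lambda>(x, t). - u (x, t) - N * (norm (x - y))\<^sup>2 - N * (\<tau> - t))"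
  have fc: "continuous_on S f"
    unfolding f_def case_prod_unfold by (intro continuous_intros continuous_on_compose2[OF uS]) auto
  obtain z where z: "z \<in> S" "\<And>z'. z' \<in> S \<Longrightarrow> f z' \<le> f z" using continuous_attains_sup[OF Sc _ fc] yS by blast
  obtain x0 t0 where z0: "z = (x0, t0)" by (cases z)
  have x0: "norm (x0 - y) \<le> a" "\<tau> - a \<le> t0" "t0 \<le> \<tau>" using z(1) unfolding z0 S_def by (auto simp: dist_norm norm_minus_commute)
  have max: "- u (x, t) - N * (norm (x - y))\<^sup>2 - N * (\<tau> - t) \<le> - u (x0, t0) - N * (norm (x0 - y))\<^sup>2 - N * (\<tau> - t0)"
    if "norm (x - y) \<le> a" "\<tau> - a \<le> t" "t \<le> \<tau>" for x t
    using z(2)[of "(x, t)"] that unfolding z0 S_def f_def by (auto simp: dist_norm norm_minus_commute)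
  have sum: "N * (norm (x0 - y))\<^sup>2 + N * (\<tau> - t0) \<le> 2 * U"
    using max[of y \<tau>] a U[OF yS] U[OF z(1)] unfolding z0 by auto
  have n1: "0 \<le> N * (norm (x0 - y))\<^sup>2" "0 \<le> N * (\<tau> - t0)" using N x0 by auto
  have "N * (norm (x0 - y))\<^sup>2 < N * a\<^sup>2" using sum n1 N(2) by linarith
  then have "(norm (x0 - y))\<^sup>2 < a\<^sup>2" using N(1) by simp
  then have xa: "norm (x0 - y) < a" by (rule power2_less_imp_less) (use a in simp)
  have "N * (\<tau> - t0) < N * a" using sum n1 N(3) by linarith
  then have ta: "\<tau> - t0 < a" using N(1) by simp
  define \<delta> where "\<delta> = Min {a - norm (x0 - y), 1, t0 - (\<tau> - a)}"
  have \<delta>: "0 < \<delta>" "\<delta> \<le> a - norm (x0 - y)" "\<delta>\<^sup>2 \<le> t0 - (\<tau> - a)"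
  proof -
    show d: "0 < \<delta>" "\<delta> \<le> a - norm (x0 - y)" unfolding \<delta>_def using xa ta by auto
    have "\<delta> \<le> 1" "\<delta> \<le> t0 - (\<tau> - a)" unfolding \<delta>_def by auto
    then have "\<delta> * \<delta> \<le> \<delta> * 1" "\<delta> \<le> t0 - (\<tau> - a)" using d by (auto intro!: mult_left_mono)
    then show "\<delta>\<^sup>2 \<le> t0 - (\<tau> - a)" unfolding power2_eq_square by linarith
  qed
  let ?g = "(2 * N) *\<^sub>R (x0 - y)"
  have sq: "N * (norm (x0 + h - y))\<^sup>2 = N * (norm (x0 - y))\<^sup>2 + ?g \<bullet> h + N * (norm h)\<^sup>2" for h
  proof -
    have "(norm (x0 + h - y))\<^sup>2 = (norm (x0 - y))\<^sup>2 + 2 * ((x0 - y) \<bullet> h) + (norm h)\<^sup>2"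
      by (simp add: power2_norm_eq_inner algebra_simps inner_commute)
    then show ?thesis unfolding inner_scaleR_left by (simp add: distrib_left)
  qed
  have inS: "norm (x0 + h - y) \<le> a" if "norm h < \<delta>" for h
  proof -
    have "x0 + h - y = (x0 - y) + h" by simp
    then have "norm (x0 + h - y) \<le> norm (x0 - y) + norm h" by (simp only: norm_triangle_ineq)
    then show ?thesis using that \<delta> by simp
  qed
  have "touch (\<lambda>z. - u z) x0 t0 ?g N (\<lambda>t. - N * t) (\<lambda>t. - N) \<delta>"
    unfolding touch_def
  proof (intro conjI allI impI)
    have "(x0, t0) \<in> ?Q" using z(1) SQ z0 by blast
    then show "norm x0 < 1" "- 1 < t0" "t0 \<le> 0" by auto
    show "((\<lambda>t. - N * t) has_real_derivative - N) (at t)" for t by (auto intro!: derivative_eq_intros)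
    show "\<exists>\<delta>'>0. \<forall>x t. norm (x - x0) < \<delta>' \<and> t0 - \<delta>'\<^sup>2 < t \<and> t \<le> t0 \<longrightarrow> - u (x, t) \<le> test_fun (\<lambda>z. - u z) x0 t0 ?g N (\<lambda>t. - N * t) (x, t)"
    proof (intro exI[of _ \<delta>] conjI allI impI \<delta>)
      fix x t assume h: "norm (x - x0) < \<delta> \<and> t0 - \<delta>\<^sup>2 < t \<and> t \<le> t0"
      have "norm (x - y) \<le> a" using inS[of "x - x0"] h by simp
      moreover have "\<tau> - a \<le> t" "t \<le> \<tau>" using h \<delta>(3) x0 by auto
      ultimately have "- u (x, t) - N * (norm (x - y))\<^sup>2 - N * (\<tau> - t) \<le> - u (x0, t0) - N * (norm (x0 - y))\<^sup>2 - N * (\<tau> - t0)" by (rule max)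
      moreover have "N * (norm (x - y))\<^sup>2 = N * (norm (x0 - y))\<^sup>2 + ?g \<bullet> (x - x0) + N * (norm (x - x0))\<^sup>2" using sq[of "x - x0"] by simp
      moreover have "N * (\<tau> - t) - N * (\<tau> - t0) = - N * t - - N * t0" by (simp add: algebra_simps)
      ultimately show "- u (x, t) \<le> test_fun (\<lambda>z. - u z) x0 t0 ?g N (\<lambda>t. - N * t) (x, t)" unfolding test_fun_def by simp
    qed
    fix h :: "real ^ 'd" assume "norm h < \<delta>"
    from max[OF inS[OF this] x0(2,3)] show "- u (x0 + h, t0) \<le> - u (x0, t0) + ?g \<bullet> h + N * (norm h)\<^sup>2" unfolding sq by simp
  qed (use N \<delta> in auto)
  from visc_super_touch(1)[OF n C super this] neg[OF z(1)] show False unfolding z0 by simp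
qed

section \<open>Scaling\<close>

lemma nonloc_scale:
  assumes "0 < M"
  shows "nonloc p n w x \<delta> = M powr (p - 1) * nonloc p n (\<lambda>y. w y / M) x \<delta>"
proof -
  have "spow p (w x - w (x + h)) = M powr (p - 1) * spow p (w x / M - w (x + h) / M)" for h
    using spow_mult[OF assms, of p "w x / M - w (x + h) / M"] assms by (simp add: right_diff_distrib)
  then have "nonloc p n w x \<delta> = (LINT h|lebesgue. M powr (p - 1) * (indicator (- ball 0 \<delta>) h * (spow p (w x / M - w (x + h) / M) * norm h powr - n)))"
    unfolding nonloc_def by (simp only: mult_ac)
  then show ?thesis unfolding nonloc_def by simp
qed

lemma touch_scale:
  fixes u :: "(real ^ 'd) \<times> real \<Rightarrow> real"
  assumes M: "0 < M" and t: "touch (\<lambda>z. u z / M) x0 t0 g \<Lambda> \<beta> \<beta>' \<delta>"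
  shows "touch u x0 t0 (M *\<^sub>R g) (M * \<Lambda>) (\<lambda>t. M * \<beta> t) (\<lambda>t. M * \<beta>' t) \<delta>"
proof -
  have sc: "a \<le> M * b" if "a / M \<le> b" for a b using that M by (simp add: pos_divide_le_eq mult.commute)
  have tf: "test_fun u x0 t0 (M *\<^sub>R g) (M * \<Lambda>) (\<lambda>t. M * \<beta> t) z = M * test_fun (\<lambda>z. u z / M) x0 t0 g \<Lambda> \<beta> z" for z
    unfolding test_fun_def using M by (cases z) (simp add: algebra_simps)
  have sp: "u (x0, t0) + (M *\<^sub>R g) \<bullet> h + M * \<Lambda> * (norm h)\<^sup>2 = M * (u (x0, t0) / M + g \<bullet> h + \<Lambda> * (norm h)\<^sup>2)" for h
    using M by (simp add: algebra_simps)
  show ?thesis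
    using t unfolding touch_def tf sp
    by (auto intro!: sc DERIV_cmult continuous_intros mult_nonneg_nonneg simp: less_imp_le[OF M])
qed

text \<open>The nonlocal term and its error are homogeneous of degree \<open>p - 1\<close>, the time
  derivative of degree 1. Writing \<open>M\<close> as \<open>M powr (p - 1) * M powr (2 - p)\<close>
  leaves the new coefficient of the time derivative.\<close>

lemma qsub_scale:
  fixes u :: "(real ^ 'd) \<times> real \<Rightarrow> real"
  assumes M: "0 < M" and qs: "qsub p q n 1 C u Z"
  shows "qsub p q n (M powr (2 - p)) C (\<lambda>z. u z / M) Z"
  unfolding qsub_def
proof (intro allI impI)
  fix x0 t0 g \<Lambda> \<beta> \<beta>' \<delta> assume t: "touch (\<lambda>z. u z / M) x0 t0 g \<Lambda> \<beta> \<beta>' \<delta>"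
  let ?X = "\<Lambda> * (norm g + \<Lambda> * \<delta>) powr (p - 2) * \<delta> powr (p - q)"
  let ?N = "nonloc p n (\<lambda>x. u (x, t0) / M) x0 \<delta>"
  have MM: "M powr (p - 1) * M powr (2 - p) = M" "M * M powr (p - 2) = M powr (p - 1)"
    using M powr_mult_base[of M "p - 2"] by (simp_all add: powr_add[symmetric])
  have e1: "norm (M *\<^sub>R g) + M * \<Lambda> * \<delta> = M * (norm g + \<Lambda> * \<delta>)" using M by (simp add: algebra_simps)
  have "C * (M * \<Lambda> * (norm (M *\<^sub>R g) + M * \<Lambda> * \<delta>) powr (p - 2) * \<delta> powr (p - q)) = C * ((M * M powr (p - 2)) * ?X)"
    unfolding e1 powr_mult by (simp only: mult_ac)
  then have e: "C * (M * \<Lambda> * (norm (M *\<^sub>R g) + M * \<Lambda> * \<delta>) powr (p - 2) * \<delta> powr (p - q)) = M powr (p - 1) * (C * ?X)"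
    unfolding MM by (simp only: mult_ac)
  have "(x0, t0) \<in> Z \<or> 1 * (M * \<beta>' t0) + nonloc p n (\<lambda>x. u (x, t0)) x0 \<delta> \<le> C * (M * \<Lambda> * (norm (M *\<^sub>R g) + M * \<Lambda> * \<delta>) powr (p - 2) * \<delta> powr (p - q))"
    using qs[unfolded qsub_def, rule_format, OF touch_scale[OF M t]] .
  moreover have "1 * (M * \<beta>' t0) + nonloc p n (\<lambda>x. u (x, t0)) x0 \<delta> = M powr (p - 1) * (M powr (2 - p) * \<beta>' t0 + ?N)"
    unfolding nonloc_scale[OF M, of p n "\<lambda>x. u (x, t0)"] distrib_left mult.assoc[symmetric] MM by simp
  ultimately have "(x0, t0) \<in> Z \<or> M powr (p - 1) * (M powr (2 - p) * \<beta>' t0 + ?N) \<le> M powr (p - 1) * (C * ?X)"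
    unfolding e by simp
  then show "(x0, t0) \<in> Z \<or> M powr (2 - p) * \<beta>' t0 + ?N \<le> C * ?X" using M by (simp add: mult.assoc)
qed

lemma tail_int_scale:
  assumes "0 < M"
  shows "tail_int p n (\<lambda>z. w z / M) = tail_int p n w / M powr (p - 1)"
    and "tail_fun p n w \<Longrightarrow> tail_fun p n (\<lambda>z. w z / M)"
proof -
  have e: "\<bar>w z / M\<bar> powr (p - 1) / (1 + norm z powr n) = (\<bar>w z\<bar> powr (p - 1) / (1 + norm z powr n)) / M powr (p - 1)" for z
    using assms by (simp add: abs_divide powr_divide)
  show "tail_int p n (\<lambda>z. w z / M) = tail_int p n w / M powr (p - 1)"
    unfolding tail_int_def e by (rule Bochner_Integration.integral_divide_zero)
  show "tail_fun p n (\<lambda>z. w z / M)" if w: "tail_fun p n w"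
    unfolding tail_fun_def e
  proof
    show "(\<lambda>z. w z / M) \<in> borel_measurable lebesgue" using w by (auto simp: tail_fun_def)
    show "integrable lebesgue (\<lambda>z. (\<bar>w z\<bar> powr (p - 1) / (1 + norm z powr n)) / M powr (p - 1))"
      using w by (intro Bochner_Integration.integrable_divide_zero) (auto simp: tail_fun_def)
  qed
qed

lemma tail_int_nonneg: "0 \<le> tail_int p n w"
  unfolding tail_int_eq by (intro integral_nonneg_AE AE_I2 mult_nonneg_nonneg weight_nonneg) auto

text \<open>The essential supremum bounds \<open>u\<close> only almost everywhere. If some value
  exceeded it, continuity would give a relative neighbourhood with the same property, and this
  contains a ball, which has positive measure. Boundedness on the closed cylinder ensures that
  \<open>real_of_ereal\<close> acts on a finite value.\<close>

lemma Linf_norm_ge: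
  fixes u :: "(real ^ 'd) \<times> real \<Rightarrow> real"
  assumes uc: "continuous_on (ball 0 1 \<times> {-1<..0}) u"
  shows "0 \<le> Linf_norm (parab_cyl (3/4) 0 0) u"
    and "z \<in> parab_cyl (3/4) 0 0 \<Longrightarrow> \<bar>u z\<bar> \<le> Linf_norm (parab_cyl (3/4) 0 0) u"
proof -
  define S where "S = ball (0 :: real ^ 'd) (3/4) \<times> {- (9/16)<..0 :: real}"
  have Se: "parab_cyl (3/4) 0 0 = S" by (simp add: S_def parab_cyl_def power2_eq_square)
  let ?K = "cball (0 :: real ^ 'd) (3/4) \<times> {- (9/16)..0 :: real}"
  have Kc: "compact ?K" by (intro compact_Times compact_cball compact_Icc)
  have SK: "S \<subseteq> ?K" unfolding S_def by auto
  have KQ: "?K \<subseteq> ball 0 1 \<times> {-1<..0}" by auto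
  have "bounded (u ` ?K)" by (rule compact_imp_bounded[OF compact_continuous_image[OF continuous_on_subset[OF uc KQ] Kc]])
  then obtain U where U: "\<And>z. z \<in> ?K \<Longrightarrow> \<bar>u z\<bar> \<le> U" unfolding bounded_iff by auto
  have us: "continuous_on S u" using continuous_on_subset[OF uc] SK KQ by blast
  have Sb: "S \<in> sets borel"
  proof -
    have "S = (ball 0 (3/4) \<times> UNIV) \<inter> ({z. snd z \<le> 0} \<inter> {z. - (9/16) < snd z})" unfolding S_def by auto
    moreover have "open (ball (0 :: real ^ 'd) (3/4) \<times> (UNIV :: real set))" by (intro open_Times) auto
    moreover have "closed {z :: (real ^ 'd) \<times> real. snd z \<le> 0}" by (intro closed_Collect_le continuous_intros)
    moreover have "open {z :: (real ^ 'd) \<times> real. - (9/16) < snd z}" by (intro open_Collect_less continuous_intros)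
    ultimately show ?thesis by auto
  qed
  then have Sl: "S \<in> sets lebesgue" by simp
  have m: "(\<lambda>z. ereal \<bar>u z\<bar>) \<in> borel_measurable (lebesgue_on S)"
    using continuous_imp_measurable_on_sets_lebesgue[OF us Sl] by measurable
  let ?c = "esssup (lebesgue_on S) (\<lambda>z. ereal \<bar>u z\<bar>)"
  have cU: "?c \<le> ereal U"
    by (rule esssup_I[OF m]) (use U SK in \<open>auto intro!: AE_I2\<close>)
  have ae: "AE z in lebesgue. z \<in> S \<longrightarrow> ereal \<bar>u z\<bar> \<le> ?c"
    using esssup_AE[of "\<lambda>z. ereal \<bar>u z\<bar>" "lebesgue_on S"] AE_restrict_space_iff[of S lebesgue] Sl by simp
  have le: "ereal \<bar>u z\<bar> \<le> ?c" if z: "z \<in> S" for z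
  proof (rule ccontr)
    assume n: "\<not> ereal \<bar>u z\<bar> \<le> ?c"
    have "continuous_on S (\<lambda>z. ereal \<bar>u z\<bar>)" by (intro continuous_on_ereal continuous_intros us)
    then have "\<forall>\<^sub>F w in at z within S. ?c < ereal \<bar>u w\<bar>"
      using n z by (auto simp: continuous_on_def intro!: order_tendstoD(1))
    then obtain d where d: "0 < d" "\<And>w. w \<in> S \<Longrightarrow> dist w z < d \<Longrightarrow> ?c < ereal \<bar>u w\<bar>"
      using n unfolding eventually_at by (metis not_le)
    obtain x t where zt: "z = (x, t)" by (cases z)
    define V where "V = (ball (0 :: real ^ 'd) (3/4) \<times> {- (9/16)<..<0 :: real}) \<inter> ball z d"
    have Vo: "open V" unfolding V_def by (intro open_Int open_Times) auto
    have VS: "V \<subseteq> S" unfolding V_def S_def by auto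
    \<comment> \<open>The point may lie on the top \<open>t = 0\<close>, where \<open>S\<close> is
      not open; a shift down by \<open>\<epsilon>\<close> reaches the interior while staying within
      distance \<open>d\<close>.\<close>
    define \<epsilon> where "\<epsilon> = min (d / 2) ((t + 9/16) / 2)"
    have t: "norm x < 3/4" "- (9/16) < t" "t \<le> 0" using z unfolding zt S_def by auto
    have \<epsilon>1: "\<epsilon> \<le> d / 2" unfolding \<epsilon>_def by (rule min.cobounded1)
    have \<epsilon>2: "\<epsilon> \<le> (t + 9/16) / 2" unfolding \<epsilon>_def by (rule min.cobounded2)
    have "0 < \<epsilon>" using d(1) t unfolding \<epsilon>_def by simp
    moreover have "\<epsilon> < d" using \<epsilon>1 d(1) by simp
    moreover have "\<epsilon> < t + 9/16" using \<epsilon>2 t(2) by simp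
    ultimately have \<epsilon>: "0 < \<epsilon>" "\<epsilon> < d" "\<epsilon> < t + 9/16" by auto
    have "(x, t - \<epsilon>) \<in> V" unfolding V_def zt using t \<epsilon> by (auto simp: dist_Pair_Pair dist_real_def)
    then obtain \<rho> where \<rho>: "0 < \<rho>" "ball (x, t - \<epsilon>) \<rho> \<subseteq> V" using Vo open_contains_ball by metis
    have "AE w in lebesgue. w \<notin> ball (x, t - \<epsilon>) \<rho>"
      using ae
    proof eventually_elim
      case (elim w)
      show ?case
      proof
        assume "w \<in> ball (x, t - \<epsilon>) \<rho>"
        then have w: "w \<in> V" by (rule subsetD[OF \<rho>(2)])
        then have "w \<in> S" "dist w z < d" using VS unfolding V_def by (auto simp: dist_commute)
        then show False using d(2)[of w] elim by simp
      qed
    qed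
    then have "emeasure lebesgue (ball (x, t - \<epsilon>) \<rho>) = 0"
      by (subst (asm) AE_iff_measurable[of "ball (x, t - \<epsilon>) \<rho>"]) auto
    then have "measure lborel (ball (x, t - \<epsilon>) \<rho>) = 0" by (simp add: measure_def)
    then show False using content_ball_pos[OF \<rho>(1), of "(x, t - \<epsilon>)"] by simp
  qed
  have zS: "(0, 0) \<in> S" unfolding S_def by simp
  obtain c where c: "?c = ereal c"
    using cU le[OF zS] by (cases ?c) auto
  have L: "Linf_norm S u = c" unfolding Linf_norm_def c by simp
  show 1: "\<bar>u z\<bar> \<le> Linf_norm (parab_cyl (3/4) 0 0) u" if "z \<in> parab_cyl (3/4) 0 0" for z
    using le[of z] that unfolding Se L c by simp
  show "0 \<le> Linf_norm (parab_cyl (3/4) 0 0) u" using 1[of "(0, 0)"] zS unfolding Se by simp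
qed

lemma tail_norm_eq: "n = real CARD('d) + s * p \<Longrightarrow> tail_norm p s (w :: real ^ 'd \<Rightarrow> real) = tail_int p n w powr (1 / (p - 1))"
  by (simp add: tail_norm_def tail_int_def)

lemma tail_int_eq_norm:
  assumes "2 < p" "n = real CARD('d) + s * p"
  shows "tail_int p n (w :: real ^ 'd \<Rightarrow> real) = tail_norm p s w powr (p - 1)"
  unfolding tail_norm_eq[OF assms(2)] powr_powr using assms(1) tail_int_nonneg[of p n w] by simp

lemma tail_int_tendsto:
  fixes u :: "(real ^ 'd) \<times> real \<Rightarrow> real"
  assumes p: "2 < p" and n: "n = real CARD('d) + s * p" and u: "tail_continuous p s (- 1) 0 u" and t: "t \<in> {-1<..0}"
  shows "((\<lambda>\<tau>. tail_int p n (\<lambda>x. u (x, \<tau>) - u (x, t))) \<longlongrightarrow> 0) (at t within {-1<..0})"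
proof -
  have "((\<lambda>\<tau>. tail_norm p s (\<lambda>x. u (x, \<tau>) - u (x, t))) \<longlongrightarrow> 0) (at t within {-1<..0})"
    using u t unfolding tail_continuous_def by blast
  moreover have "0 \<le> tail_norm p s (\<lambda>x. u (x, \<tau>) - u (x, t))" for \<tau> unfolding tail_norm_eq[OF n] by simp
  ultimately show ?thesis
    unfolding tail_int_eq_norm[OF p n] using p by (intro tendsto_zero_powrI[where b = "p - 1"]) auto
qed

text \<open>A supremum of reals is an upper bound only for a bounded family; boundedness comes from
  compactness of \<open>{- (9/16)..0}\<close> inside \<open>{-1<..0}\<close>.\<close>

lemma tail_norm_le_sup:
  fixes u :: "(real ^ 'd) \<times> real \<Rightarrow> real"
  assumes p: "2 < p" and n: "n = real CARD('d) + s * p" and u: "tail_continuous p s (- 1) 0 u" and t: "- (9/16) < t" "t \<le> 0"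
  shows "tail_norm p s (\<lambda>x. u (x, t)) \<le> (SUP t\<in>{- (3/4)\<^sup>2 <.. 0}. tail_norm p s (\<lambda>x. u (x, t)))"
proof (rule cSUP_upper)
  show "t \<in> {- (3/4)\<^sup>2<..0}" using t by (simp add: power2_eq_square)
  have "\<exists>B. \<forall>t\<in>{- (9/16)..0}. tail_int p n (\<lambda>x. u (x, t)) \<le> B"
    by (rule tail_int_bounded[OF p, where I = "{-1<..0}" and w = "\<lambda>t x. u (x, t)"])
      (use tail_fun_tail_space[OF u _ _ n] tail_int_tendsto[OF p n u] in auto)
  then obtain B where B: "\<And>t. t \<in> {- (9/16)..0} \<Longrightarrow> tail_int p n (\<lambda>x. u (x, t)) \<le> B" by blast
  show "bdd_above ((\<lambda>t. tail_norm p s (\<lambda>x. u (x, t))) ` {- (3/4)\<^sup>2<..0})"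
  proof (rule bdd_aboveI2)
    fix t assume "t \<in> {- (3/4)\<^sup>2<..0 :: real}"
    then have "t \<in> {- (9/16)..0}" by (simp add: power2_eq_square)
    then show "tail_norm p s (\<lambda>x. u (x, t)) \<le> B powr (1 / (p - 1))"
      unfolding tail_norm_eq[OF n] using B p tail_int_nonneg[of p n "\<lambda>x. u (x, t)"] by (intro powr_mono2) auto
  qed
qed

lemma obstacle_continuous:
  fixes ob :: "(real ^ 'd) \<times> real \<Rightarrow> real"
  assumes \<alpha>: "0 < \<alpha>" and ob: "\<And>x t y \<tau>. norm x < 1 \<Longrightarrow> norm y < 1 \<Longrightarrow> - 1 < t \<Longrightarrow> t \<le> 0 \<Longrightarrow> - 1 < \<tau> \<Longrightarrow> \<tau> \<le> 0 \<Longrightarrow>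
     ob (x, t) - ob (y, \<tau>) \<le> Lx * norm (x - y) + Lt * \<bar>t - \<tau>\<bar> powr \<alpha>"
  shows "continuous_on (ball 0 1 \<times> {-1<..0}) ob"
  unfolding continuous_on_def
proof
  fix z assume z: "z \<in> ball (0 :: real ^ 'd) 1 \<times> {-1<..0 :: real}"
  let ?Q = "ball (0 :: real ^ 'd) 1 \<times> {-1<..0 :: real}"
  let ?m = "\<lambda>w. Lx * norm (fst w - fst z) + Lt * \<bar>snd w - snd z\<bar> powr \<alpha>"
  have "((\<lambda>w. \<bar>snd w - snd z\<bar> powr \<alpha>) \<longlongrightarrow> 0) (at z within ?Q)"
  proof (rule tendsto_zero_powrI[OF _ tendsto_const _ \<alpha>])
    have "((\<lambda>w. \<bar>snd w - snd z\<bar>) \<longlongrightarrow> \<bar>snd z - snd z\<bar>) (at z within ?Q)" by (intro tendsto_intros)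
    then show "((\<lambda>w. \<bar>snd w - snd z\<bar>) \<longlongrightarrow> 0) (at z within ?Q)" by simp
  qed simp
  moreover have "((\<lambda>w. norm (fst w - fst z)) \<longlongrightarrow> norm (fst z - fst z)) (at z within ?Q)" by (intro tendsto_intros)
  ultimately have "(?m \<longlongrightarrow> Lx * norm (fst z - fst z) + Lt * 0) (at z within ?Q)" by (intro tendsto_add tendsto_mult_left)
  then have m: "(?m \<longlongrightarrow> 0) (at z within ?Q)" by simp
  have "\<forall>\<^sub>F w in at z within ?Q. norm (ob w - ob z) \<le> ?m w"
    unfolding eventually_at_filter
  proof (rule always_eventually, intro allI impI)
    fix w assume "w \<noteq> z" and w: "w \<in> ?Q"
    obtain x t y \<tau> where e: "w = (x, t)" "z = (y, \<tau>)" by (cases w; cases z)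
    show "norm (ob w - ob z) \<le> ?m w"
      using ob[of x y t \<tau>] ob[of y x \<tau> t] w z unfolding e by (auto simp: abs_le_iff norm_minus_commute abs_minus_commute)
  qed
  then have "((\<lambda>w. ob w - ob z) \<longlongrightarrow> 0) (at z within ?Q)" by (rule Lim_null_comparison[OF _ m])
  then show "(ob \<longlongrightarrow> ob z) (at z within ?Q)" by (rule LIM_zero_cancel)
qed

text \<open>\<open>sol_size\<close> is chosen so that the values and the tail integrals of
  \<open>u / M\<close> are at most 1. As \<open>1 \<le> M\<close>, division does not enlarge the
  constants of the obstacle, and \<open>2 - p < 0\<close> makes the coefficient of the time
  derivative at most 1.\<close>

lemma nsol_normalised:
  fixes u :: "(real ^ 'd) \<times> real \<Rightarrow> real"
  assumes p: "2 < p" and n: "n = real CARD('d) + s * p" and C: "pv_bound TYPE('d) p (s * p) n C"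
    and \<alpha>: "0 < \<alpha>" and L: "0 \<le> Lx" "0 \<le> Lt"
    and ob: "\<And>x t y \<tau>. norm x < 1 \<Longrightarrow> norm y < 1 \<Longrightarrow> - 1 < t \<Longrightarrow> t \<le> 0 \<Longrightarrow> - 1 < \<tau> \<Longrightarrow> \<tau> \<le> 0 \<Longrightarrow>
     ob (x, t) - ob (y, \<tau>) \<le> Lx * norm (x - y) + Lt * \<bar>t - \<tau>\<bar> powr \<alpha>"
    and sol: "visc_solution p s ob (ball 0 1) (- 1) 0 u"
  defines "M \<equiv> sol_size p s u"
  shows "1 \<le> M" and "nsol p (s * p) C (M powr (2 - p)) Lx Lt \<alpha> n (\<lambda>z. u z / M) (\<lambda>z. ob z / M)"
proof -
  let ?Q = "ball (0 :: real ^ 'd) 1 \<times> {-1<..0 :: real}"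
  have sub: "visc_subsolution p s ob (ball 0 1) (- 1) 0 u" and super: "visc_supersolution p s ob (ball 0 1) (- 1) 0 u"
    using sol by (auto simp: visc_solution_def)
  have tc: "tail_continuous p s (- 1) 0 u" using sub by (simp add: visc_subsolution_def)
  have uc: "continuous_on ?Q u"
    using sub super by (intro usc_lsc_continuous) (auto simp: visc_subsolution_def visc_supersolution_def)
  have oc: "continuous_on ?Q ob" by (rule obstacle_continuous[OF \<alpha> ob])
  have tn0: "0 \<le> tail_norm p s w" for w :: "real ^ 'd \<Rightarrow> real" unfolding tail_norm_eq[OF n] by simp
  have sup0: "0 \<le> (SUP t\<in>{- (3/4)\<^sup>2 <.. 0}. tail_norm p s (\<lambda>x. u (x, t)))"
    using tail_norm_le_sup[OF p n tc, of 0] tn0[of "\<lambda>x. u (x, 0)"] by simp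
  show M1: "1 \<le> M" unfolding M_def sol_size_def using sup0 Linf_norm_ge(1)[OF uc] by linarith
  then have M0: "0 < M" by simp
  have uM: "\<bar>u z\<bar> \<le> M" if "z \<in> parab_cyl (3/4) 0 0" for z
    using Linf_norm_ge(2)[OF uc that] sup0 unfolding M_def sol_size_def by linarith
  have tM: "tail_norm p s (\<lambda>x. u (x, t)) \<le> M" if "- (9/16) < t" "t \<le> 0" for t
    using tail_norm_le_sup[OF p n tc that] Linf_norm_ge(1)[OF uc] unfolding M_def sol_size_def by linarith
  have tf: "tail_fun p n (\<lambda>x. u (x, t))" if "- 1 < t" "t \<le> 0" for t by (rule tail_fun_tail_space[OF tc that n])
  show "nsol p (s * p) C (M powr (2 - p)) Lx Lt \<alpha> n (\<lambda>z. u z / M) (\<lambda>z. ob z / M)"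
    unfolding nsol_def
  proof (intro conjI allI impI)
    show "0 < M powr (2 - p)" using M0 by simp
    show "M powr (2 - p) \<le> 1" using M1 p powr_mono[of "2 - p" 0 M] by simp
    show "continuous_on ?Q (\<lambda>z. u z / M)" using M0 by (intro continuous_intros uc) auto
    show "\<bar>u (x, t) / M\<bar> \<le> 1" if "norm x < 3/4 \<and> - (9/16) < t \<and> t \<le> 0" for x t
      using uM[of "(x, t)"] that M0 by (simp add: parab_cyl_def power2_eq_square abs_divide)
    fix t :: real assume t: "- (9/16) < t \<and> t \<le> 0"
    then show "tail_fun p n (\<lambda>x. u (x, t) / M)" by (intro tail_int_scale(2)[OF M0] tf) auto
    have "tail_int p n (\<lambda>x. u (x, t)) \<le> M powr (p - 1)"
      unfolding tail_int_eq_norm[OF p n] using tM t p tn0 by (intro powr_mono2) auto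
    then show "tail_int p n (\<lambda>x. u (x, t) / M) \<le> 1" unfolding tail_int_scale(1)[OF M0] using M0 by simp
    have e: "tail_int p n (\<lambda>x. u (x, \<tau>) / M - u (x, t) / M) = tail_int p n (\<lambda>x. u (x, \<tau>) - u (x, t)) / M powr (p - 1)" for \<tau>
      unfolding tail_int_scale(1)[OF M0, symmetric] by (simp add: diff_divide_distrib)
    have "((\<lambda>\<tau>. tail_int p n (\<lambda>x. u (x, \<tau>) - u (x, t)) / M powr (p - 1)) \<longlongrightarrow> 0 / M powr (p - 1)) (at t within {-1<..0})"
      using M0 t by (intro tendsto_divide tail_int_tendsto[OF p n tc] tendsto_const) auto
    then show "((\<lambda>\<tau>. tail_int p n (\<lambda>x. u (x, \<tau>) / M - u (x, t) / M)) \<longlongrightarrow> 0) (at t within {- (9/16)<..0})"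
      unfolding e by (intro tendsto_within_subset[where S = "{-1<..0}" and T = "{- (9/16)<..0}"]) auto
  next
    fix x :: "real ^ 'd" and t :: real assume "norm x < 1 \<and> - 1 < t \<and> t \<le> 0"
    then have "ob (x, t) \<le> u (x, t)" by (intro visc_super_ge_obstacle[OF n C super uc oc]) auto
    then show "ob (x, t) / M \<le> u (x, t) / M" using M0 by (intro divide_right_mono) auto
  next
    fix x y :: "real ^ 'd" and t \<tau> :: real assume a: "norm x < 1 \<and> norm y < 1 \<and> - 1 < t \<and> t \<le> 0 \<and> - 1 < \<tau> \<and> \<tau> \<le> 0"
    let ?X = "Lx * norm (x - y) + Lt * \<bar>t - \<tau>\<bar> powr \<alpha>"
    have X0: "0 \<le> ?X" using L by simp
    have "ob (x, t) / M - ob (y, \<tau>) / M = (ob (x, t) - ob (y, \<tau>)) / M" by (simp add: diff_divide_distrib)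
    also have "\<dots> \<le> ?X / M" using ob[of x y t \<tau>] a M0 by (intro divide_right_mono) auto
    also have "\<dots> \<le> ?X / 1" using X0 M1 by (intro divide_left_mono) auto
    finally show "ob (x, t) / M - ob (y, \<tau>) / M \<le> ?X" by simp
  next
    have "{z. u z / M \<le> ob z / M} = {z. u z \<le> ob z}" using M0 by (auto simp: divide_le_cancel)
    then show "qsub p (s * p) n (M powr (2 - p)) C (\<lambda>z. u z / M) {z. u z / M \<le> ob z / M}"
      using qsub_scale[OF M0 visc_sub_qsub[OF n C sub]] by simp
    have "qsub p (s * p) n 1 C (\<lambda>z. - u z) {}"
      unfolding qsub_def using visc_super_touch(2)[OF n C super] by simp
    from qsub_scale[OF M0 this] show "qsub p (s * p) n (M powr (2 - p)) C (\<lambda>z. - (u z / M)) {}" by simp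
  qed
qed

lemma regularity_estimate:
  assumes p: "2 < p" and s: "0 < s" "s < 1" and qc: "q_crit p s < 1"
    and \<alpha>: "0 < \<alpha>" "\<alpha> \<le> 1" "\<alpha> < 1 / (1 - q_crit p s)" and L: "0 \<le> Lx" "0 \<le> Lt"
  shows "\<exists>C>0. \<forall>(ob :: (real ^ 'd) \<times> real \<Rightarrow> real) u.
     (\<forall>x t y \<tau>. norm x < 1 \<and> norm y < 1 \<and> - 1 < t \<and> t \<le> 0 \<and> - 1 < \<tau> \<and> \<tau> \<le> 0 \<longrightarrow>
        ob (x, t) - ob (y, \<tau>) \<le> Lx * norm (x - y) + Lt * \<bar>t - \<tau>\<bar> powr \<alpha>) \<and>
     visc_solution p s ob (ball 0 1) (- 1) 0 u \<longrightarrow>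
     (\<forall>x t y \<tau>. (x, t) \<in> parab_cyl (1/2) 0 0 \<and> (y, \<tau>) \<in> parab_cyl (1/2) 0 0 \<longrightarrow>
        \<bar>u (x, t) - u (y, \<tau>)\<bar> \<le> C * sol_size p s u * (norm (x - y) + sol_size p s u powr ((p - 2) * \<alpha>) * \<bar>t - \<tau>\<bar> powr \<alpha>))"
proof -
  define q where "q = s * p"
  define n where "n = real CARD('d) + q"
  have q: "0 < q" "q < p" "p - 2 < q" using s p qc by (auto simp: q_def q_crit_def algebra_simps)
  have n': "n = real CARD('d) + s * p" by (simp add: n_def q_def)
  \<comment> \<open>\<open>p - 1 - q\<close> is \<open>q_crit p s\<close>, so the upper bound on
    \<open>\<alpha>\<close> is exactly the condition on \<open>Q\<close> in
    \<open>nonloc_lower\<close>.\<close>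
  have \<alpha>q: "1 - 1 / \<alpha> < p - 1 - q"
  proof -
    have "0 < 1 - q_crit p s" using qc by simp
    then have "1 - q_crit p s < 1 / \<alpha>" using \<alpha> by (simp add: field_simps)
    then show ?thesis by (simp add: q_crit_def q_def algebra_simps)
  qed
  obtain C where C: "0 < C" "pv_bound TYPE('d) p q n C" using pv_limit[OF p q(1,2) n_def] by blast
  from nsol_regularity[OF p q n_def less_imp_le[OF C(1)] \<alpha>(1,2) \<alpha>q L] obtain B where B: "0 < B"
    and reg: "\<And>\<kappa> (v :: (real ^ 'd) \<times> real \<Rightarrow> real) ob x y t \<tau>. nsol p q C \<kappa> Lx Lt \<alpha> n v ob \<and>
     norm x \<le> 1/2 \<and> norm y \<le> 1/2 \<and> - (1/4) \<le> t \<and> t \<le> 0 \<and> - (1/4) \<le> \<tau> \<and> \<tau> \<le> 0 \<Longrightarrow>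
     \<bar>v (x, t) - v (y, \<tau>)\<bar> \<le> B * (norm (x - y) + (\<bar>t - \<tau>\<bar> / \<kappa>) powr \<alpha>)" by blast
  { fix ob u :: "(real ^ 'd) \<times> real \<Rightarrow> real" and x y :: "real ^ 'd" and t \<tau> :: real
    assume ob: "\<forall>x t y \<tau>. norm x < 1 \<and> norm y < 1 \<and> - 1 < t \<and> t \<le> 0 \<and> - 1 < \<tau> \<and> \<tau> \<le> 0 \<longrightarrow>
        ob (x, t) - ob (y, \<tau>) \<le> Lx * norm (x - y) + Lt * \<bar>t - \<tau>\<bar> powr \<alpha>"
      and sol: "visc_solution p s ob (ball 0 1) (- 1) 0 u"
      and x: "(x, t) \<in> parab_cyl (1/2) 0 0" "(y, \<tau>) \<in> parab_cyl (1/2) 0 0"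
    let ?M = "sol_size p s u"
    have ob': "ob (x, t) - ob (y, \<tau>) \<le> Lx * norm (x - y) + Lt * \<bar>t - \<tau>\<bar> powr \<alpha>"
      if "norm x < 1" "norm y < 1" "- 1 < t" "t \<le> 0" "- 1 < \<tau>" "\<tau> \<le> 0" for x t y \<tau> using ob that by blast
    have M: "1 \<le> ?M" by (rule nsol_normalised(1)[OF p n' C(2)[unfolded q_def] \<alpha>(1) L ob' sol])
    have ns: "nsol p q C (?M powr (2 - p)) Lx Lt \<alpha> n (\<lambda>z. u z / ?M) (\<lambda>z. ob z / ?M)"
      unfolding q_def by (rule nsol_normalised(2)[OF p n' C(2)[unfolded q_def] \<alpha>(1) L ob' sol])
    have "\<bar>u (x, t) / ?M - u (y, \<tau>) / ?M\<bar> \<le> B * (norm (x - y) + (\<bar>t - \<tau>\<bar> / ?M powr (2 - p)) powr \<alpha>)"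
      by (rule reg) (use ns x in \<open>auto simp: parab_cyl_def power2_eq_square\<close>)
    \<comment> \<open>Undoing the normalisation: the coefficient \<open>\<kappa>\<close> is the
      source of the power of \<open>sol_size\<close> in front of the time difference.\<close>
    also have "(\<bar>t - \<tau>\<bar> / ?M powr (2 - p)) powr \<alpha> = ?M powr ((p - 2) * \<alpha>) * \<bar>t - \<tau>\<bar> powr \<alpha>"
    proof -
      have "\<bar>t - \<tau>\<bar> / ?M powr (2 - p) = ?M powr (p - 2) * \<bar>t - \<tau>\<bar>"
        using powr_minus_divide[of ?M "2 - p"] by simp
      then show ?thesis by (simp only: powr_mult powr_powr)
    qed
    finally have "?M * \<bar>u (x, t) / ?M - u (y, \<tau>) / ?M\<bar> \<le> ?M * (B * (norm (x - y) + ?M powr ((p - 2) * \<alpha>) * \<bar>t - \<tau>\<bar> powr \<alpha>))"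
      using M by (intro mult_left_mono) auto
    moreover have "?M * \<bar>u (x, t) / ?M - u (y, \<tau>) / ?M\<bar> = \<bar>u (x, t) - u (y, \<tau>)\<bar>"
    proof -
      have "u (x, t) / ?M - u (y, \<tau>) / ?M = (u (x, t) - u (y, \<tau>)) / ?M" by (simp add: diff_divide_distrib)
      then show ?thesis using M by (simp add: abs_divide)
    qed
    ultimately have "\<bar>u (x, t) - u (y, \<tau>)\<bar> \<le> B * ?M * (norm (x - y) + ?M powr ((p - 2) * \<alpha>) * \<bar>t - \<tau>\<bar> powr \<alpha>)"
      by (simp only: mult_ac) }
  then show ?thesis using B by (intro exI[of _ B]) blast
qed

text \<open>Change \<open>x\<close> first and \<open>t\<close> afterwards. Times in the unit
  cylinder differ by less than 1, so the exponent \<open>\<alpha>'\<close> may be lowered to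
  \<open>\<alpha>\<close>; \<open>max 0\<close> supplies the sign that the constants need.\<close>

lemma obstacle_modulus:
  fixes ob :: "(real ^ 'd) \<times> real \<Rightarrow> real"
  assumes ob: "ob \<in> C_lip_x (parab_cyl 1 0 0) \<inter> C_holder_t \<alpha>' (parab_cyl 1 0 0)" and \<alpha>: "0 < \<alpha>" "\<alpha> \<le> \<alpha>'"
    and x: "norm x < 1" "norm y < 1" "- 1 < t" "t \<le> 0" "- 1 < \<tau>" "\<tau> \<le> 0"
  shows "ob (x, t) - ob (y, \<tau>) \<le> max 0 (lip_x_seminorm (parab_cyl 1 0 0) ob) * norm (x - y)
    + max 0 (holder_t_seminorm \<alpha>' (parab_cyl 1 0 0) ob) * \<bar>t - \<tau>\<bar> powr \<alpha>"
proof -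
  let ?Q = "parab_cyl 1 0 0 :: ((real ^ 'd) \<times> real) set"
  let ?Lx = "max 0 (lip_x_seminorm ?Q ob)" and ?Lt = "max 0 (holder_t_seminorm \<alpha>' ?Q ob)"
  have Q: "(x, t) \<in> ?Q" "(y, t) \<in> ?Q" "(y, \<tau>) \<in> ?Q" using x by (auto simp: parab_cyl_def)
  have 1: "ob (x, t) - ob (y, t) \<le> ?Lx * norm (x - y)"
  proof (cases "x = y")
    case False
    have "\<bar>ob (x, t) - ob (y, t)\<bar> / norm (x - y) \<in> lip_x_quotients ?Q ob"
      unfolding lip_x_quotients_def using Q False by blast
    then have "\<bar>ob (x, t) - ob (y, t)\<bar> / norm (x - y) \<le> lip_x_seminorm ?Q ob"
      unfolding lip_x_seminorm_def using ob by (intro cSup_upper) (auto simp: C_lip_x_def)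
    then have "\<bar>ob (x, t) - ob (y, t)\<bar> \<le> lip_x_seminorm ?Q ob * norm (x - y)" using False by (simp add: pos_divide_le_eq)
    also have "\<dots> \<le> ?Lx * norm (x - y)" by (intro mult_right_mono) auto
    finally show ?thesis by simp
  qed simp
  have 2: "ob (y, t) - ob (y, \<tau>) \<le> ?Lt * \<bar>t - \<tau>\<bar> powr \<alpha>"
  proof (cases "t = \<tau>")
    case False
    have "\<bar>ob (y, t) - ob (y, \<tau>)\<bar> / \<bar>t - \<tau>\<bar> powr \<alpha>' \<in> holder_t_quotients \<alpha>' ?Q ob"
      unfolding holder_t_quotients_def using Q False by blast
    then have "\<bar>ob (y, t) - ob (y, \<tau>)\<bar> / \<bar>t - \<tau>\<bar> powr \<alpha>' \<le> holder_t_seminorm \<alpha>' ?Q ob"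
      unfolding holder_t_seminorm_def using ob by (intro cSup_upper) (auto simp: C_holder_t_def)
    then have "\<bar>ob (y, t) - ob (y, \<tau>)\<bar> \<le> holder_t_seminorm \<alpha>' ?Q ob * \<bar>t - \<tau>\<bar> powr \<alpha>'" using False by (simp add: pos_divide_le_eq)
    also have "\<dots> \<le> ?Lt * \<bar>t - \<tau>\<bar> powr \<alpha>"
      using x \<alpha> False by (intro mult_mono powr_mono') auto
    finally show ?thesis by simp
  qed simp
  show ?thesis using 1 2 by linarith
qed

theorem theorem1p1:
  fixes p s \<alpha> Lx Lt :: real
  assumes "p > 2" and "0 < s" and "s < 1" and "q_crit p s < 1"
  shows "(\<exists>C>0. \<forall>\<beta> \<alpha>\<^sub>\<phi> (\<phi> :: (real ^ 'd) \<times> real \<Rightarrow> real) u.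
            0 < \<beta> \<and> \<beta> < 1 / (1 - q_crit p s) \<and> 0 < \<alpha>\<^sub>\<phi> \<and> \<alpha>\<^sub>\<phi> \<le> 1 \<and> \<alpha> = min \<beta> \<alpha>\<^sub>\<phi> \<and>
            \<phi> \<in> C_lip_x (parab_cyl 1 0 0) \<inter> C_holder_t \<alpha>\<^sub>\<phi> (parab_cyl 1 0 0) \<and>
            lip_x_seminorm (parab_cyl 1 0 0) \<phi> = Lx \<and>
            holder_t_seminorm \<alpha>\<^sub>\<phi> (parab_cyl 1 0 0) \<phi> = Lt \<and>
            visc_solution p s \<phi> (ball 0 1) (- 1) 0 u \<and>
            tail_continuous p s (- 1) 0 u \<longrightarrow>
            (\<forall>x t y \<tau>. (x, t) \<in> parab_cyl (1/2) 0 0 \<and> (y, \<tau>) \<in> parab_cyl (1/2) 0 0 \<longrightarrow>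
               \<bar>u (x, t) - u (y, \<tau>)\<bar> \<le>
                 C * sol_size p s u *
                   (norm (x - y) + sol_size p s u powr ((p - 2) * \<alpha>) * \<bar>t - \<tau>\<bar> powr \<alpha>)))
       \<and> (q_crit p s > 0 \<longrightarrow>
          (\<exists>C>0. \<forall>(\<phi> :: (real ^ 'd) \<times> real \<Rightarrow> real) u.
            \<phi> \<in> C_lip_x (parab_cyl 1 0 0) \<inter> C_holder_t 1 (parab_cyl 1 0 0) \<and>
            lip_x_seminorm (parab_cyl 1 0 0) \<phi> = Lx \<and>
            holder_t_seminorm 1 (parab_cyl 1 0 0) \<phi> = Lt \<and>
            visc_solution p s \<phi> (ball 0 1) (- 1) 0 u \<and>
            tail_continuous p s (- 1) 0 u \<longrightarrow>
            (\<forall>x t y \<tau>. (x, t) \<in> parab_cyl (1/2) 0 0 \<and> (y, \<tau>) \<in> parab_cyl (1/2) 0 0 \<longrightarrow>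
               \<bar>u (x, t) - u (y, \<tau>)\<bar> \<le>
                 C * sol_size p s u *
                   (norm (x - y) + sol_size p s u powr (p - 2) * \<bar>t - \<tau>\<bar>))))"
proof -
  \<comment> \<open>\<open>Lx\<close> and \<open>Lt\<close> are arbitrary reals in the theorem,
    hence the truncation at 0.\<close>
  have L: "0 \<le> max 0 Lx" "0 \<le> max 0 Lt" by auto
  define obst where "obst a ob \<longleftrightarrow> (\<forall>x t y \<tau>. norm x < 1 \<and> norm y < 1 \<and> - 1 < t \<and> t \<le> 0 \<and> - 1 < \<tau> \<and> \<tau> \<le> 0 \<longrightarrow>
      ob (x, t) - ob (y, \<tau>) \<le> max 0 Lx * norm (x - y) + max 0 Lt * \<bar>t - \<tau>\<bar> powr a)"
    for a and ob :: "(real ^ 'd) \<times> real \<Rightarrow> real"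
  define est where "est a C u \<longleftrightarrow> (\<forall>x t y \<tau>. (x, t) \<in> parab_cyl (1/2) 0 0 \<and> (y, \<tau>) \<in> parab_cyl (1/2) 0 0 \<longrightarrow>
      \<bar>u (x, t) - u (y, \<tau>)\<bar> \<le> C * sol_size p s u * (norm (x - y) + sol_size p s u powr ((p - 2) * a) * \<bar>t - \<tau>\<bar> powr a))"
    for a C and u :: "(real ^ 'd) \<times> real \<Rightarrow> real"
  have reg: "\<exists>C>0. \<forall>ob u. obst a ob \<and> visc_solution p s ob (ball 0 1) (- 1) 0 u \<longrightarrow> est a C u"
    if "0 < a" "a \<le> 1" "a < 1 / (1 - q_crit p s)" for a
    unfolding obst_def est_def by (rule regularity_estimate[OF assms that L])
  have obstI: "obst a ob" if "ob \<in> C_lip_x (parab_cyl 1 0 0) \<inter> C_holder_t a' (parab_cyl 1 0 0)"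
    "lip_x_seminorm (parab_cyl 1 0 0) ob = Lx" "holder_t_seminorm a' (parab_cyl 1 0 0) ob = Lt" "0 < a" "a \<le> a'" for a a' ob
    using obstacle_modulus[OF that(1,4,5)] unfolding obst_def that(2,3) by blast
  show ?thesis
  proof (intro conjI impI, goal_cases)
    case 1
    show ?case
    proof (cases "0 < \<alpha> \<and> \<alpha> \<le> 1 \<and> \<alpha> < 1 / (1 - q_crit p s)")
      case True
      then obtain C where C: "0 < C" "\<And>ob u. obst \<alpha> ob \<and> visc_solution p s ob (ball 0 1) (- 1) 0 u \<Longrightarrow> est \<alpha> C u"
        using reg[of \<alpha>] by blast
      show ?thesis
      proof (rule exI[of _ C], rule conjI[OF C(1)], unfold est_def[symmetric], intro allI impI, elim conjE)
        fix \<beta> \<alpha>\<^sub>\<phi> and \<phi> u :: "(real ^ 'd) \<times> real \<Rightarrow> real"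
        assume a: "\<alpha> = min \<beta> \<alpha>\<^sub>\<phi>" "\<phi> \<in> C_lip_x (parab_cyl 1 0 0) \<inter> C_holder_t \<alpha>\<^sub>\<phi> (parab_cyl 1 0 0)"
          "lip_x_seminorm (parab_cyl 1 0 0) \<phi> = Lx" "holder_t_seminorm \<alpha>\<^sub>\<phi> (parab_cyl 1 0 0) \<phi> = Lt"
          "visc_solution p s \<phi> (ball 0 1) (- 1) 0 u"
        have "\<alpha> \<le> \<alpha>\<^sub>\<phi>" using a(1) by simp
        then show "est \<alpha> C u" using C(2)[of \<phi> u] obstI[OF a(2-4), of \<alpha>] True a(5) by blast
      qed
    next
      case False
      \<comment> \<open>Outside this range no \<open>\<beta>\<close> and
        \<open>\<alpha>\<^sub>\<phi>\<close> have \<open>\<alpha>\<close> as their minimum, so any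
        constant does.\<close>
      have vac: R if "0 < \<beta>" "\<beta> < 1 / (1 - q_crit p s)" "0 < \<alpha>\<^sub>\<phi>" "\<alpha>\<^sub>\<phi> \<le> 1" "\<alpha> = min \<beta> \<alpha>\<^sub>\<phi>" for \<beta> \<alpha>\<^sub>\<phi> R
        using False that by auto
      show ?thesis
        by (rule exI[of _ 1], rule conjI[OF zero_less_one], intro allI impI, elim conjE) (rule vac)
    qed
  next
    case 2
    \<comment> \<open>A positive \<open>q_crit p s\<close> makes the exponent 1 admissible.\<close>
    have "(1 :: real) < 1 / (1 - q_crit p s)" using 2 assms(4) by (simp add: less_divide_eq)
    then obtain C where C: "0 < C" "\<And>ob u. obst 1 ob \<and> visc_solution p s ob (ball 0 1) (- 1) 0 u \<Longrightarrow> est 1 C u"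
      using reg[of 1] by auto
    show ?case
    proof (rule exI[of _ C], rule conjI[OF C(1)], intro allI impI, elim conjE)
      fix \<phi> u :: "(real ^ 'd) \<times> real \<Rightarrow> real" and x y :: "real ^ 'd" and t \<tau>
      assume a: "\<phi> \<in> C_lip_x (parab_cyl 1 0 0) \<inter> C_holder_t 1 (parab_cyl 1 0 0)"
        "lip_x_seminorm (parab_cyl 1 0 0) \<phi> = Lx" "holder_t_seminorm 1 (parab_cyl 1 0 0) \<phi> = Lt"
        "visc_solution p s \<phi> (ball 0 1) (- 1) 0 u"
        and x: "(x, t) \<in> parab_cyl (1/2) 0 0" "(y, \<tau>) \<in> parab_cyl (1/2) 0 0"
      have "est 1 C u" using C(2)[of \<phi> u] obstI[OF a(1-3), of 1] a(4) by simp
      then have "\<bar>u (x, t) - u (y, \<tau>)\<bar> \<le> C * sol_size p s u * (norm (x - y) + sol_size p s u powr ((p - 2) * 1) * \<bar>t - \<tau>\<bar> powr 1)"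
        unfolding est_def using x by blast
      then show "\<bar>u (x, t) - u (y, \<tau>)\<bar> \<le> C * sol_size p s u * (norm (x - y) + sol_size p s u powr (p - 2) * \<bar>t - \<tau>\<bar>)"
        by simp
    qed
  qed
qed

end
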